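(* Let $\mathbb K$ be a unital commutative associative ring, let $M^-,M^+$ be finitely generated projective $\mathbb K$-modules of rank $6$, let $g:M^-\times M^+\to\mathbb K$ be a non-singular bilinear form, and let $e=(e^-,e^+)\in M^-\times M^+$ satisfy $g(e^-,e^+)=1$. Put $U^\sigma=\{v\in M^\sigma:g(v,e^{-\sigma})=0\}$, so $M^\sigma=\mathbb Ke^\sigma\oplus U^\sigma$, $\sigma=\pm$. Then $\mathcal E=\mathcal E(M^-,M^+,g)=\bigoplus_{(i_1,i_2)\in\mathbb Z^2}\mathcal E_{i_1,i_2}$ is a $\mathrm{BC}_2$-grading of the Lie algebra $\mathcal E$, where, for $\sigma=\pm$, $$\mathcal E_{\sigma1,0}=\textstyle\bigwedge_3(U^\sigma),\quad \mathcal E_{\sigma1,\sigma1}=\bigwedge_2(U^\sigma)e^\sigma,\quad \mathcal E_{\sigma2,\sigma1}=\bigwedge_6(M^\sigma),$$ $$\mathcal E_{0,0}=\mathcal E_0\cap\big(\iota^+(\mathrm{End}(\mathbb Ke^+)\oplus\mathrm{End}(U^+))+\mathbb Kh_0\big),$$ $$\mathcal E_{0,1}=\iota^+(\mathrm{Hom}(U^+,\mathbb Ke^+)),\quad \mathcal E_{0,-1}=\iota^+(\mathrm{Hom}(\mathbb Ke^+,U^+)),$$ and $\mathcal E_{i_1,i_2}=0$ for all other pairs $(i_1,i_2)\in\mathbb Z^2$. Moreover, the first component grading of this $\mathrm{BC}_2$-grading is the $5$-grading $\mathcal E=\bigoplus_{i=-2}^{2}\mathcal E_i$.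
   Context: All modules and algebras are over $\mathbb K$ ($\frac16\in\mathbb K$ is not assumed); $\sigma=\pm$ is also read as $\pm1$. A finitely generated projective module has rank $n$ if all its localizations at primes are free of rank $n$. $g$ is non-singular if it induces isomorphisms $M^-\to(M^+)^*$ and $M^+\to(M^-)^*$; write $g(v^+,v^-)=g(v^-,v^+)$. $(A^\sigma)^*\in\mathrm{End}(M^{-\sigma})$ is the adjoint of $A^\sigma\in\mathrm{End}(M^\sigma)$ relative to $g$. Using $M^+=\mathbb Ke^+\oplus U^+$, the modules $\mathrm{End}(\mathbb Ke^+)$, $\mathrm{End}(U^+)$, $\mathrm{Hom}(U^+,\mathbb Ke^+)$, $\mathrm{Hom}(\mathbb Ke^+,U^+)$ are regarded as the blocks of $\mathrm{End}(M^+)$. $\mathrm{BC}_2$-gradings. A $\mathrm{BC}_2$-grading of a Lie algebra $L$ is a $\mathbb Z^2$-grading with support contained in $\{0,\pm(1,0),\pm(0,1),\pm(1,1),\pm(2,0),\pm(2,1),\pm(2,2)\}$. Its first component grading is the $\mathbb Z$-grading with components $\bigoplus_jL_{i,j}$, $i\in\mathbb Z$. Exterior algebra notation. $\bigwedge(M^\sigma)=\bigoplus_k\bigwedge_k(M^\sigma)$ is the exterior algebra, product written $uv$. (1) For $v^{-\sigma}\in M^{-\sigma}$ let $\Delta_{v^{-\sigma}}$ be the unique anti-derivation of degree $-1$ of $\bigwedge(M^\sigma)$ (so $\Delta(xy)=\Delta(x)y+(-1)^kx\Delta(y)$ for $x\in\bigwedge_k$) with $\Delta_{v^{-\sigma}}(v^\sigma)=g(v^{-\sigma},v^\sigma)$.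 The map $v\mapsto\Delta_v$ extends to an associative algebra homomorphism $a\mapsto\Delta_a$ of $\bigwedge(M^{-\sigma})$ into $\mathrm{End}(\bigwedge(M^\sigma))$; write $a\cdot x=\Delta_a(x)$. (2) $\mathcal S=\{(A^-,A^+)\in\mathrm{End}(M^-)\oplus\mathrm{End}(M^+):g(A^-v^-,v^+)+g(v^-,A^+v^+)=0\}$, a Lie algebra; $\iota^+:\mathrm{End}(M^+)\to\mathcal S$, $\iota^+(A)=(-A^*,A)$. For $A=(A^-,A^+)\in\mathcal S$ and $x\in\bigwedge(M^\sigma)$, $A\circ x=D_{A^\sigma}(x)$, where $D_{A^\sigma}$ is the derivation of $\bigwedge(M^\sigma)$ extending $A^\sigma$. (3) For $x\in\bigwedge_k(M^\sigma)$, $a\in\bigwedge_k(M^{-\sigma})$, $k\ge1$: $E^\sigma(x,a)\in\mathrm{End}(M^\sigma)$, $E^\sigma(x,a)(v)=(v\cdot a)\cdot x$; and $E(x^-,x^+)=(E^-(x^-,x^+),-E^+(x^+,x^-))\in\mathcal S$. The Lie algebras. $\tilde{\mathcal S}=\mathcal S\oplus\mathbb Kh_0$ (direct sum of Lie algebras, $\mathbb Kh_0$ free of rank 1 with zero product); $h_0\circ p=\sigma kp$ for $p\in\bigwedge_{3k}(M^\sigma)$. $h_M=(-\mathrm{id}_{M^-},\mathrm{id}_{M^+})\in\mathcal S$. $\tilde{\mathcal E}=\bigoplus_{i=-2}^2\tilde{\mathcal E}_i$ with $\tilde{\mathcal E}_0=\tilde{\mathcal S}$, $\tilde{\mathcal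 E}_{\sigma k}=\bigwedge_{3k}(M^\sigma)$ for $k=1,2$, and with the skew-symmetric graded product extending that of $\tilde{\mathcal S}$ such that, for $A\in\tilde{\mathcal S}$ and $p_j,q_j\in\tilde{\mathcal E}_j$: $[A,p_i]=A\circ p_i$ ($i=\pm1,\pm2$); $[p_{-1},q_1]=E(p_{-1},q_1)+(p_{-1}\cdot q_1)h_0$; $[p_{-2},q_2]=-(p_{-2}\cdot q_2)(h_M-2h_0)$; $[p_i,q_i]=p_iq_i$ and $[p_i,q_{-2i}]=p_i\cdot q_{-2i}$ for $i=\pm1$. This is a $5$-graded Lie algebra. $\mathcal E=\bigoplus_i\mathcal E_i$ is the ideal with $\mathcal E_i=\tilde{\mathcal E}_i$ for $i\ne0$ and $\mathcal E_0=\{(A^-,A^+)+ah_0\in\tilde{\mathcal E}_0:\mathrm{tr}(A^+)+3a=0\}$. *)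

theory Defs
  imports "HOL-Library.Product_Plus" "HOL-Algebra.Module" "HOL-Algebra.QuotRing"
begin

text \<open>
  Throughout, \<open>K\<close> is a commutative ring (possibly zero).  The library record \<^type>\<open>module\<close>
  extends rings, so every module carries a multiplication and a unit; these fields are ignored for
  plain modules, hold the product of an associative algebra, and for Lie algebras the multiplication
  is the Lie bracket (the unit is again ignored).  Homomorphisms are extensional functions, so
  that equality of functions is equality of homomorphisms.
\<close>

section \<open>Modules\<close>

definition regular_module :: "('k, 'r) ring_scheme \<Rightarrow> ('k, 'k) module" where
  "regular_module K = \<lparr>carrier = carrier K, mult = mult K, one = \<one>\<^bsub>K\<^esub>, zero = \<zero>\<^bsub>K\<^esub>,
     add = add K, smult = mult K\<rparr>"

definition lin_maps ::
    "('k, 'r) ring_scheme \<Rightarrow> ('k, 'v, 's) module_scheme \<Rightarrow> ('k, 'w, 't) module_scheme \<Rightarrow> ('v \<Rightarrow> 'w) set" where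
  "lin_maps K V W = {f \<in> carrier V \<rightarrow>\<^sub>E carrier W.
     (\<forall>x\<in>carrier V. \<forall>y\<in>carrier V. f (x \<oplus>\<^bsub>V\<^esub> y) = f x \<oplus>\<^bsub>W\<^esub> f y) \<and>
     (\<forall>a\<in>carrier K. \<forall>x\<in>carrier V. f (a \<odot>\<^bsub>V\<^esub> x) = a \<odot>\<^bsub>W\<^esub> f x)}"

definition dual :: "('k, 'r) ring_scheme \<Rightarrow> ('k, 'v, 's) module_scheme \<Rightarrow> ('v \<Rightarrow> 'k) set" where
  "dual K V = lin_maps K V (regular_module K)"

definition End_alg ::
    "('k, 'r) ring_scheme \<Rightarrow> ('k, 'v, 's) module_scheme \<Rightarrow> ('k, 'v \<Rightarrow> 'v) module" where
  "End_alg K V = \<lparr>carrier = lin_maps K V V,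
     mult = (\<lambda>f h. \<lambda>x\<in>carrier V. f (h x)),
     one = (\<lambda>x\<in>carrier V. x),
     zero = (\<lambda>x\<in>carrier V. \<zero>\<^bsub>V\<^esub>),
     add = (\<lambda>f h. \<lambda>x\<in>carrier V. f x \<oplus>\<^bsub>V\<^esub> h x),
     smult = (\<lambda>a f. \<lambda>x\<in>carrier V. a \<odot>\<^bsub>V\<^esub> f x)\<rparr>"

definition alg_homs ::
    "('k, 'r) ring_scheme \<Rightarrow> ('k, 'v, 's) module_scheme \<Rightarrow> ('k, 'w, 't) module_scheme \<Rightarrow> ('v \<Rightarrow> 'w) set" where
  "alg_homs K A B = lin_maps K A B \<inter> ring_hom A B"

definition mspan ::
    "('k, 'r) ring_scheme \<Rightarrow> ('k, 'v, 's) module_scheme \<Rightarrow> 'v set \<Rightarrow> 'v set" where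
  "mspan K V S = \<Inter>{N. submodule N K V \<and> S \<subseteq> N}"

definition direct_sum2 ::
    "('k, 'r) ring_scheme \<Rightarrow> ('k, 'v, 's) module_scheme \<Rightarrow> 'v set \<Rightarrow> 'v set \<Rightarrow> bool" where
  "direct_sum2 K V N P \<longleftrightarrow> submodule N K V \<and> submodule P K V \<and>
     (\<forall>v\<in>carrier V. \<exists>!p. p \<in> N \<times> P \<and> v = fst p \<oplus>\<^bsub>V\<^esub> snd p)"

definition free_module :: "('k, 'r) ring_scheme \<Rightarrow> 'x set \<Rightarrow> ('k, 'x \<Rightarrow> 'k) module" where
  "free_module K X = \<lparr>carrier = {f. (\<forall>x. f x \<in> carrier K) \<and> finite {x. f x \<noteq> \<zero>\<^bsub>K\<^esub>} \<and>
       {x. f x \<noteq> \<zero>\<^bsub>K\<^esub>} \<subseteq> X},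
     mult = undefined, one = undefined,
     zero = (\<lambda>x. \<zero>\<^bsub>K\<^esub>),
     add = (\<lambda>f h x. f x \<oplus>\<^bsub>K\<^esub> h x),
     smult = (\<lambda>a f x. a \<otimes>\<^bsub>K\<^esub> f x)\<rparr>"

definition finitely_generated ::
    "('k, 'r) ring_scheme \<Rightarrow> ('k, 'v, 's) module_scheme \<Rightarrow> bool" where
  "finitely_generated K V \<longleftrightarrow> (\<exists>S. finite S \<and> S \<subseteq> carrier V \<and> mspan K V S = carrier V)"

text \<open>
  Projective: a direct summand of a free module.  A basis of type \<open>'v\<close> loses no generality,
  because if V is a summand of any free module, then it is a summand of the free module on the
  set \<open>carrier V\<close>.
\<close>

definition projective ::
    "('k, 'r) ring_scheme \<Rightarrow> ('k, 'v, 's) module_scheme \<Rightarrow> bool" where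
  "projective K V \<longleftrightarrow> (\<exists>X :: 'v set. \<exists>\<iota>\<in>lin_maps K V (free_module K X).
     \<exists>\<pi>\<in>lin_maps K (free_module K X) V. \<forall>v\<in>carrier V. \<pi> (\<iota> v) = v)"

text \<open>Localization at a prime \<open>P\<close>; \<open>frac K P V v s\<close> is the fraction \<open>v / s\<close> as the class of
  all pairs equivalent to \<open>(v, s)\<close>.\<close>

definition frac ::
    "('k, 'r) ring_scheme \<Rightarrow> 'k set \<Rightarrow> ('k, 'v, 's) module_scheme \<Rightarrow> 'v \<Rightarrow> 'k \<Rightarrow> ('v \<times> 'k) set" where
  "frac K P V v s = {(w, t). w \<in> carrier V \<and> t \<in> carrier K - P \<and>
     (\<exists>u\<in>carrier K - P. u \<odot>\<^bsub>V\<^esub> (t \<odot>\<^bsub>V\<^esub> v) = u \<odot>\<^bsub>V\<^esub> (s \<odot>\<^bsub>V\<^esub> w))}"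

definition loc_module ::
    "('k, 'r) ring_scheme \<Rightarrow> 'k set \<Rightarrow> ('k, 'v, 's) module_scheme
      \<Rightarrow> (('k \<times> 'k) set, ('v \<times> 'k) set) module" where
  "loc_module K P V = \<lparr>carrier = {frac K P V v s | v s. v \<in> carrier V \<and> s \<in> carrier K - P},
     mult = undefined, one = undefined,
     zero = frac K P V \<zero>\<^bsub>V\<^esub> \<one>\<^bsub>K\<^esub>,
     add = (\<lambda>X Y. \<Union>(v, s)\<in>X. \<Union>(w, t)\<in>Y. frac K P V (t \<odot>\<^bsub>V\<^esub> v \<oplus>\<^bsub>V\<^esub> s \<odot>\<^bsub>V\<^esub> w) (s \<otimes>\<^bsub>K\<^esub> t)),
     smult = (\<lambda>A X. \<Union>(a, s)\<in>A. \<Union>(v, t)\<in>X. frac K P V (a \<odot>\<^bsub>V\<^esub> v) (s \<otimes>\<^bsub>K\<^esub> t))\<rparr>"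

definition loc_ring ::
    "('k, 'r) ring_scheme \<Rightarrow> 'k set \<Rightarrow> ('k \<times> 'k) set ring" where
  "loc_ring K P = (let L = loc_module K P (regular_module K) in
     \<lparr>carrier = carrier L, mult = smult L, one = frac K P (regular_module K) \<one>\<^bsub>K\<^esub> \<one>\<^bsub>K\<^esub>,
      zero = zero L, add = add L\<rparr>)"

definition free_of_rank ::
    "('k, 'r) ring_scheme \<Rightarrow> ('k, 'v, 's) module_scheme \<Rightarrow> nat \<Rightarrow> bool" where
  "free_of_rank R V n \<longleftrightarrow> (\<exists>b\<in>{..<n} \<rightarrow> carrier V. \<forall>v\<in>carrier V.
     \<exists>!c. c \<in> {..<n} \<rightarrow>\<^sub>E carrier R \<and> v = (\<Oplus>\<^bsub>V\<^esub>i\<in>{..<n}. c i \<odot>\<^bsub>V\<^esub> b i))"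

definition fg_projective_of_rank ::
    "('k, 'r) ring_scheme \<Rightarrow> ('k, 'v, 's) module_scheme \<Rightarrow> nat \<Rightarrow> bool" where
  "fg_projective_of_rank K V n \<longleftrightarrow> module K V \<and> finitely_generated K V \<and> projective K V \<and>
     (\<forall>P. primeideal P K \<longrightarrow> free_of_rank (loc_ring K P) (loc_module K P V) n)"

text \<open>The trace is the contraction \<open>f \<otimes> v \<mapsto> f v\<close> transported along the isomorphism of \<open>V\<^sup>* \<otimes> V\<close>
  with the endomorphisms of the finitely generated projective module \<open>V\<close>.\<close>

definition mtrace ::
    "('k, 'r) ring_scheme \<Rightarrow> ('k, 'v, 's) module_scheme \<Rightarrow> ('v \<Rightarrow> 'v) \<Rightarrow> 'k" where
  "mtrace K V A = (THE t. \<exists>(n::nat) f v. f \<in> {..<n} \<rightarrow> dual K V \<and> v \<in> {..<n} \<rightarrow> carrier V \<and>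
     (\<forall>x\<in>carrier V. A x = (\<Oplus>\<^bsub>V\<^esub>i\<in>{..<n}. f i x \<odot>\<^bsub>V\<^esub> v i)) \<and>
     t = (\<Oplus>\<^bsub>K\<^esub>i\<in>{..<n}. f i (v i)))"

definition bilinear_form ::
    "('k, 'r) ring_scheme \<Rightarrow> ('k, 'v, 's) module_scheme \<Rightarrow> ('k, 'w, 't) module_scheme
      \<Rightarrow> ('v \<Rightarrow> 'w \<Rightarrow> 'k) \<Rightarrow> bool" where
  "bilinear_form K V W g \<longleftrightarrow>
     (\<forall>v\<in>carrier V. (\<lambda>w\<in>carrier W. g v w) \<in> dual K W) \<and>
     (\<forall>w\<in>carrier W. (\<lambda>v\<in>carrier V. g v w) \<in> dual K V)"

definition nonsingular ::
    "('k, 'r) ring_scheme \<Rightarrow> ('k, 'v, 's) module_scheme \<Rightarrow> ('k, 'w, 't) module_scheme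
      \<Rightarrow> ('v \<Rightarrow> 'w \<Rightarrow> 'k) \<Rightarrow> bool" where
  "nonsingular K V W g \<longleftrightarrow>
     bij_betw (\<lambda>v. \<lambda>w\<in>carrier W. g v w) (carrier V) (dual K W) \<and>
     bij_betw (\<lambda>w. \<lambda>v\<in>carrier V. g v w) (carrier W) (dual K V)"


section \<open>The exterior algebra\<close>

text \<open>
  The exterior algebra is the free associative algebra on the set \<open>carrier V\<close> (finitely supported
  functions on words) modulo the relations expressing that \<open>V\<close> is mapped linearly and that squares
  of vectors vanish, i.e. the tensor algebra modulo all \<open>v \<otimes> v\<close>.
\<close>

type_synonym ('k, 'v) ext = "('v list \<Rightarrow> 'k) set"

definition free_alg :: "('k, 'r) ring_scheme \<Rightarrow> 'x set \<Rightarrow> ('k, 'x list \<Rightarrow> 'k) module" where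
  "free_alg K X = (free_module K (lists X))
     \<lparr>mult := (\<lambda>f h w. \<Oplus>\<^bsub>K\<^esub>i\<in>{..length w}. f (take i w) \<otimes>\<^bsub>K\<^esub> h (drop i w)),
      one := (\<lambda>w. if w = [] then \<one>\<^bsub>K\<^esub> else \<zero>\<^bsub>K\<^esub>)\<rparr>"

definition word :: "('k, 'r) ring_scheme \<Rightarrow> 'x list \<Rightarrow> 'x list \<Rightarrow> 'k" where
  "word K u = (\<lambda>w. if w = u then \<one>\<^bsub>K\<^esub> else \<zero>\<^bsub>K\<^esub>)"

definition ext_ideal ::
    "('k, 'r) ring_scheme \<Rightarrow> ('k, 'v, 's) module_scheme \<Rightarrow> ('v list \<Rightarrow> 'k) set" where
  "ext_ideal K V = (let F = free_alg K (carrier V) in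
     Idl\<^bsub>F\<^esub> ({word K [u \<oplus>\<^bsub>V\<^esub> v] \<ominus>\<^bsub>F\<^esub> (word K [u] \<oplus>\<^bsub>F\<^esub> word K [v]) | u v.
                 u \<in> carrier V \<and> v \<in> carrier V} \<union>
             {word K [a \<odot>\<^bsub>V\<^esub> v] \<ominus>\<^bsub>F\<^esub> a \<odot>\<^bsub>F\<^esub> word K [v] | a v.
                 a \<in> carrier K \<and> v \<in> carrier V} \<union>
             {word K [v, v] | v. v \<in> carrier V}))"

definition ext_alg ::
    "('k, 'r) ring_scheme \<Rightarrow> ('k, 'v, 's) module_scheme \<Rightarrow> ('k, ('k, 'v) ext) module" where
  "ext_alg K V = (let F = free_alg K (carrier V); I = ext_ideal K V; Q = F Quot I in
     \<lparr>carrier = carrier Q, mult = mult Q, one = one Q, zero = zero Q, add = add Q,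
      smult = (\<lambda>a X. \<Union>x\<in>X. I +>\<^bsub>F\<^esub> (a \<odot>\<^bsub>F\<^esub> x))\<rparr>)"

definition ext_gen ::
    "('k, 'r) ring_scheme \<Rightarrow> ('k, 'v, 's) module_scheme \<Rightarrow> 'v \<Rightarrow> ('k, 'v) ext" where
  "ext_gen K V v = ext_ideal K V +>\<^bsub>free_alg K (carrier V)\<^esub> word K [v]"

definition ext_prod ::
    "('k, 'r) ring_scheme \<Rightarrow> ('k, 'v, 's) module_scheme \<Rightarrow> 'v list \<Rightarrow> ('k, 'v) ext" where
  "ext_prod K V vs = foldr (\<lambda>v x. ext_gen K V v \<otimes>\<^bsub>ext_alg K V\<^esub> x) vs \<one>\<^bsub>ext_alg K V\<^esub>"

text \<open>For a direct summand \<open>U\<close> of \<open>V\<close>, the exterior algebra of \<open>U\<close> embeds into that of \<open>V\<close>;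
  \<open>ext_pow_of K V U k\<close> is the image of its component of degree \<open>k\<close>.\<close>

definition ext_pow_of ::
    "('k, 'r) ring_scheme \<Rightarrow> ('k, 'v, 's) module_scheme \<Rightarrow> 'v set \<Rightarrow> nat \<Rightarrow> ('k, 'v) ext set" where
  "ext_pow_of K V U k = mspan K (ext_alg K V) {ext_prod K V vs | vs. set vs \<subseteq> U \<and> length vs = k}"

definition ext_pow ::
    "('k, 'r) ring_scheme \<Rightarrow> ('k, 'v, 's) module_scheme \<Rightarrow> nat \<Rightarrow> ('k, 'v) ext set" where
  "ext_pow K V k = ext_pow_of K V (carrier V) k"

text \<open>The identifications of degree 0 with \<open>K\<close> and of degree 1 with \<open>V\<close>.\<close>

definition ext_to_scalar ::
    "('k, 'r) ring_scheme \<Rightarrow> ('k, 'v, 's) module_scheme \<Rightarrow> ('k, 'v) ext \<Rightarrow> 'k" where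
  "ext_to_scalar K V x = (THE c. c \<in> carrier K \<and> c \<odot>\<^bsub>ext_alg K V\<^esub> \<one>\<^bsub>ext_alg K V\<^esub> = x)"

definition ext_to_vector ::
    "('k, 'r) ring_scheme \<Rightarrow> ('k, 'v, 's) module_scheme \<Rightarrow> ('k, 'v) ext \<Rightarrow> 'v" where
  "ext_to_vector K V x = (THE v. v \<in> carrier V \<and> ext_gen K V v = x)"

definition ext_antiderivation ::
    "('k, 'r) ring_scheme \<Rightarrow> ('k, 'v, 's) module_scheme \<Rightarrow> (('k, 'v) ext \<Rightarrow> ('k, 'v) ext) \<Rightarrow> bool" where
  "ext_antiderivation K V d \<longleftrightarrow> (let A = ext_alg K V in
     d \<in> lin_maps K A A \<and>
     (\<forall>x\<in>ext_pow K V 0. d x = \<zero>\<^bsub>A\<^esub>) \<and>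
     (\<forall>k. \<forall>x\<in>ext_pow K V (Suc k). d x \<in> ext_pow K V k) \<and>
     (\<forall>k. \<forall>x\<in>ext_pow K V k. \<forall>y\<in>carrier A.
        d (x \<otimes>\<^bsub>A\<^esub> y) = d x \<otimes>\<^bsub>A\<^esub> y \<oplus>\<^bsub>A\<^esub> (\<ominus>\<^bsub>A\<^esub> \<one>\<^bsub>A\<^esub>) [^]\<^bsub>A\<^esub> k \<otimes>\<^bsub>A\<^esub> (x \<otimes>\<^bsub>A\<^esub> d y)))"

text \<open>
  In the following, \<open>h\<close> pairs \<open>V\<close> with \<open>W\<close>, and elements of the exterior algebra of \<open>V\<close> act on
  that of \<open>W\<close>: \<open>contract K V W h a x\<close> is \<open>a \<cdot> x = \<Delta>\<^sub>a x\<close>.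
\<close>

definition contract1 ::
    "('k, 'r) ring_scheme \<Rightarrow> ('k, 'w, 't) module_scheme \<Rightarrow> ('v \<Rightarrow> 'w \<Rightarrow> 'k)
      \<Rightarrow> 'v \<Rightarrow> ('k, 'w) ext \<Rightarrow> ('k, 'w) ext" where
  "contract1 K W h v = (THE d. ext_antiderivation K W d \<and>
     (\<forall>w\<in>carrier W. d (ext_gen K W w) = h v w \<odot>\<^bsub>ext_alg K W\<^esub> \<one>\<^bsub>ext_alg K W\<^esub>))"

definition contract ::
    "('k, 'r) ring_scheme \<Rightarrow> ('k, 'v, 's) module_scheme \<Rightarrow> ('k, 'w, 't) module_scheme
      \<Rightarrow> ('v \<Rightarrow> 'w \<Rightarrow> 'k) \<Rightarrow> ('k, 'v) ext \<Rightarrow> ('k, 'w) ext \<Rightarrow> ('k, 'w) ext" where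
  "contract K V W h = (THE \<Delta>. \<Delta> \<in> alg_homs K (ext_alg K V) (End_alg K (ext_alg K W)) \<and>
     (\<forall>v\<in>carrier V. \<Delta> (ext_gen K V v) = contract1 K W h v))"

definition ext_deriv ::
    "('k, 'r) ring_scheme \<Rightarrow> ('k, 'v, 's) module_scheme \<Rightarrow> ('v \<Rightarrow> 'v)
      \<Rightarrow> ('k, 'v) ext \<Rightarrow> ('k, 'v) ext" where
  "ext_deriv K V T = (let A = ext_alg K V in
     THE d. d \<in> lin_maps K A A \<and>
       (\<forall>x\<in>carrier A. \<forall>y\<in>carrier A. d (x \<otimes>\<^bsub>A\<^esub> y) = d x \<otimes>\<^bsub>A\<^esub> y \<oplus>\<^bsub>A\<^esub> x \<otimes>\<^bsub>A\<^esub> d y) \<and>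
       (\<forall>v\<in>carrier V. d (ext_gen K V v) = ext_gen K V (T v)))"

text \<open>\<open>ext_E K V W h x a\<close> is the endomorphism \<open>w \<mapsto> (w \<cdot> a) \<cdot> x\<close> of \<open>W\<close>, for \<open>x\<close> and \<open>a\<close> of the
  same degree in the exterior algebras of \<open>W\<close> and \<open>V\<close>.\<close>

definition ext_E ::
    "('k, 'r) ring_scheme \<Rightarrow> ('k, 'v, 's) module_scheme \<Rightarrow> ('k, 'w, 't) module_scheme
      \<Rightarrow> ('v \<Rightarrow> 'w \<Rightarrow> 'k) \<Rightarrow> ('k, 'w) ext \<Rightarrow> ('k, 'v) ext \<Rightarrow> 'w \<Rightarrow> 'w" where
  "ext_E K V W h x a = (\<lambda>w\<in>carrier W.
     ext_to_vector K W (contract K V W h (contract1 K V (\<lambda>w v. h v w) w a) x))"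


section \<open>The Lie algebras\<close>

definition S_pairs ::
    "('k, 'r) ring_scheme \<Rightarrow> ('k, 'm, 's) module_scheme \<Rightarrow> ('k, 'n, 't) module_scheme
      \<Rightarrow> ('m \<Rightarrow> 'n \<Rightarrow> 'k) \<Rightarrow> (('m \<Rightarrow> 'm) \<times> ('n \<Rightarrow> 'n)) set" where
  "S_pairs K Mm Mp g = {(Am, Ap). Am \<in> lin_maps K Mm Mm \<and> Ap \<in> lin_maps K Mp Mp \<and>
     (\<forall>v\<in>carrier Mm. \<forall>w\<in>carrier Mp. g (Am v) w \<oplus>\<^bsub>K\<^esub> g v (Ap w) = \<zero>\<^bsub>K\<^esub>)}"

definition adjoint ::
    "('k, 'r) ring_scheme \<Rightarrow> ('k, 'm, 's) module_scheme \<Rightarrow> ('k, 'n, 't) module_scheme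
      \<Rightarrow> ('m \<Rightarrow> 'n \<Rightarrow> 'k) \<Rightarrow> ('n \<Rightarrow> 'n) \<Rightarrow> 'm \<Rightarrow> 'm" where
  "adjoint K Mm Mp g A = (THE B. B \<in> lin_maps K Mm Mm \<and>
     (\<forall>v\<in>carrier Mm. \<forall>w\<in>carrier Mp. g (B v) w = g v (A w)))"

definition iota_plus ::
    "('k, 'r) ring_scheme \<Rightarrow> ('k, 'm, 's) module_scheme \<Rightarrow> ('k, 'n, 't) module_scheme
      \<Rightarrow> ('m \<Rightarrow> 'n \<Rightarrow> 'k) \<Rightarrow> ('n \<Rightarrow> 'n) \<Rightarrow> ('m \<Rightarrow> 'm) \<times> ('n \<Rightarrow> 'n)" where
  "iota_plus K Mm Mp g A = (\<ominus>\<^bsub>End_alg K Mm\<^esub> adjoint K Mm Mp g A, A)"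

text \<open>
  An element of the 5-graded algebra, given by its components: degrees -2 and -1 in the exterior
  algebra of \<open>M\<^sup>-\<close>, the degree 0 component \<open>(A\<^sup>-, A\<^sup>+) + a h\<^sub>0\<close> as the three entries
  \<open>endm\<close>, \<open>endp\<close>, \<open>hcoef\<close>, and degrees 1 and 2 in the exterior algebra of \<open>M\<^sup>+\<close>.
\<close>

record ('k, 'm, 'n) lie_elem =
  neg2 :: "('k, 'm) ext"
  neg1 :: "('k, 'm) ext"
  endm :: "'m \<Rightarrow> 'm"
  endp :: "'n \<Rightarrow> 'n"
  hcoef :: 'k
  pos1 :: "('k, 'n) ext"
  pos2 :: "('k, 'n) ext"

definition tilde_zero ::
    "('k, 'r) ring_scheme \<Rightarrow> ('k, 'm, 's) module_scheme \<Rightarrow> ('k, 'n, 't) module_scheme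
      \<Rightarrow> ('k, 'm, 'n) lie_elem" where
  "tilde_zero K Mm Mp = \<lparr>neg2 = \<zero>\<^bsub>ext_alg K Mm\<^esub>, neg1 = \<zero>\<^bsub>ext_alg K Mm\<^esub>,
     endm = \<zero>\<^bsub>End_alg K Mm\<^esub>, endp = \<zero>\<^bsub>End_alg K Mp\<^esub>, hcoef = \<zero>\<^bsub>K\<^esub>,
     pos1 = \<zero>\<^bsub>ext_alg K Mp\<^esub>, pos2 = \<zero>\<^bsub>ext_alg K Mp\<^esub>\<rparr>"

definition tilde_add ::
    "('k, 'r) ring_scheme \<Rightarrow> ('k, 'm, 's) module_scheme \<Rightarrow> ('k, 'n, 't) module_scheme
      \<Rightarrow> ('k, 'm, 'n) lie_elem \<Rightarrow> ('k, 'm, 'n) lie_elem \<Rightarrow> ('k, 'm, 'n) lie_elem" where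
  "tilde_add K Mm Mp X Y =
    \<lparr>neg2 = neg2 X \<oplus>\<^bsub>ext_alg K Mm\<^esub> neg2 Y, neg1 = neg1 X \<oplus>\<^bsub>ext_alg K Mm\<^esub> neg1 Y,
     endm = endm X \<oplus>\<^bsub>End_alg K Mm\<^esub> endm Y, endp = endp X \<oplus>\<^bsub>End_alg K Mp\<^esub> endp Y,
     hcoef = hcoef X \<oplus>\<^bsub>K\<^esub> hcoef Y,
     pos1 = pos1 X \<oplus>\<^bsub>ext_alg K Mp\<^esub> pos1 Y, pos2 = pos2 X \<oplus>\<^bsub>ext_alg K Mp\<^esub> pos2 Y\<rparr>"

definition tilde_smult ::
    "('k, 'r) ring_scheme \<Rightarrow> ('k, 'm, 's) module_scheme \<Rightarrow> ('k, 'n, 't) module_scheme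
      \<Rightarrow> 'k \<Rightarrow> ('k, 'm, 'n) lie_elem \<Rightarrow> ('k, 'm, 'n) lie_elem" where
  "tilde_smult K Mm Mp a X =
    \<lparr>neg2 = a \<odot>\<^bsub>ext_alg K Mm\<^esub> neg2 X, neg1 = a \<odot>\<^bsub>ext_alg K Mm\<^esub> neg1 X,
     endm = a \<odot>\<^bsub>End_alg K Mm\<^esub> endm X, endp = a \<odot>\<^bsub>End_alg K Mp\<^esub> endp X,
     hcoef = a \<otimes>\<^bsub>K\<^esub> hcoef X,
     pos1 = a \<odot>\<^bsub>ext_alg K Mp\<^esub> pos1 X, pos2 = a \<odot>\<^bsub>ext_alg K Mp\<^esub> pos2 X\<rparr>"

text \<open>The action \<open>A \<circ> p\<close> of the degree 0 component \<open>A = (A\<^sup>-, A\<^sup>+) + a h\<^sub>0\<close> of \<open>X\<close> on elements \<open>p\<close> of degree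
  \<open>3 k\<close> in the exterior algebra of \<open>M\<^sup>-\<close> resp. \<open>M\<^sup>+\<close>, where \<open>h\<^sub>0\<close> acts as \<open>- k\<close> resp. \<open>k\<close>.\<close>

definition act_minus ::
    "('k, 'r) ring_scheme \<Rightarrow> ('k, 'm, 's) module_scheme
      \<Rightarrow> int \<Rightarrow> ('k, 'm, 'n) lie_elem \<Rightarrow> ('k, 'm) ext \<Rightarrow> ('k, 'm) ext" where
  "act_minus K Mm k X p =
     ext_deriv K Mm (endm X) p \<oplus>\<^bsub>ext_alg K Mm\<^esub> ([(- k)] \<cdot>\<^bsub>K\<^esub> hcoef X) \<odot>\<^bsub>ext_alg K Mm\<^esub> p"

definition act_plus ::
    "('k, 'r) ring_scheme \<Rightarrow> ('k, 'n, 't) module_scheme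
      \<Rightarrow> int \<Rightarrow> ('k, 'm, 'n) lie_elem \<Rightarrow> ('k, 'n) ext \<Rightarrow> ('k, 'n) ext" where
  "act_plus K Mp k X p =
     ext_deriv K Mp (endp X) p \<oplus>\<^bsub>ext_alg K Mp\<^esub> ([k] \<cdot>\<^bsub>K\<^esub> hcoef X) \<odot>\<^bsub>ext_alg K Mp\<^esub> p"

text \<open>
  The product is the sum of the products of homogeneous components, where those not listed
  explicitly in the comments below are obtained by skew-symmetry.  With \<open>h\<^sub>M = (- id, id)\<close>:
    \<open>[A, B]\<close> is the commutator and \<open>[A, p\<^sub>i] = A \<circ> p\<^sub>i\<close>;
    \<open>[p\<^sub>-\<^sub>1, q\<^sub>1] = (E\<^sup>-(p\<^sub>-\<^sub>1, q\<^sub>1), - E\<^sup>+(q\<^sub>1, p\<^sub>-\<^sub>1)) + (p\<^sub>-\<^sub>1 \<cdot> q\<^sub>1) h\<^sub>0\<close>;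
    \<open>[p\<^sub>-\<^sub>2, q\<^sub>2] = - (p\<^sub>-\<^sub>2 \<cdot> q\<^sub>2) (h\<^sub>M - 2 h\<^sub>0)\<close>;
    \<open>[p\<^sub>i, q\<^sub>i] = p\<^sub>i q\<^sub>i\<close> and \<open>[p\<^sub>i, q\<^sub>-\<^sub>2\<^sub>i] = p\<^sub>i \<cdot> q\<^sub>-\<^sub>2\<^sub>i\<close> for \<open>i = \<plusminus>1\<close>.
  The scalar \<open>c\<close> is \<open>p\<^sub>-\<^sub>2 \<cdot> q\<^sub>2 - q\<^sub>-\<^sub>2 \<cdot> p\<^sub>2\<close>.
\<close>

definition tilde_bracket ::
    "('k, 'r) ring_scheme \<Rightarrow> ('k, 'm, 's) module_scheme \<Rightarrow> ('k, 'n, 't) module_scheme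
      \<Rightarrow> ('m \<Rightarrow> 'n \<Rightarrow> 'k) \<Rightarrow> ('k, 'm, 'n) lie_elem \<Rightarrow> ('k, 'm, 'n) lie_elem \<Rightarrow> ('k, 'm, 'n) lie_elem" where
  "tilde_bracket K Mm Mp g X Y = (let
     Lm = ext_alg K Mm; Lp = ext_alg K Mp; Em = End_alg K Mm; Ep = End_alg K Mp;
     g' = (\<lambda>w v. g v w);
     on_plus = contract K Mm Mp g;
     on_minus = contract K Mp Mm g';
     E_minus = ext_E K Mp Mm g';
     E_plus = ext_E K Mm Mp g;
     c = ext_to_scalar K Mp (on_plus (neg2 X) (pos2 Y)) \<ominus>\<^bsub>K\<^esub>
         ext_to_scalar K Mp (on_plus (neg2 Y) (pos2 X))
   in
    \<lparr>neg2 = act_minus K Mm 2 X (neg2 Y) \<ominus>\<^bsub>Lm\<^esub> act_minus K Mm 2 Y (neg2 X)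
         \<oplus>\<^bsub>Lm\<^esub> neg1 X \<otimes>\<^bsub>Lm\<^esub> neg1 Y,
     neg1 = act_minus K Mm 1 X (neg1 Y) \<ominus>\<^bsub>Lm\<^esub> act_minus K Mm 1 Y (neg1 X)
         \<oplus>\<^bsub>Lm\<^esub> on_minus (pos1 X) (neg2 Y) \<ominus>\<^bsub>Lm\<^esub> on_minus (pos1 Y) (neg2 X),
     endm = endm X \<otimes>\<^bsub>Em\<^esub> endm Y \<ominus>\<^bsub>Em\<^esub> endm Y \<otimes>\<^bsub>Em\<^esub> endm X
         \<oplus>\<^bsub>Em\<^esub> E_minus (neg1 X) (pos1 Y) \<ominus>\<^bsub>Em\<^esub> E_minus (neg1 Y) (pos1 X)
         \<oplus>\<^bsub>Em\<^esub> c \<odot>\<^bsub>Em\<^esub> \<one>\<^bsub>Em\<^esub>,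
     endp = endp X \<otimes>\<^bsub>Ep\<^esub> endp Y \<ominus>\<^bsub>Ep\<^esub> endp Y \<otimes>\<^bsub>Ep\<^esub> endp X
         \<ominus>\<^bsub>Ep\<^esub> E_plus (pos1 Y) (neg1 X) \<oplus>\<^bsub>Ep\<^esub> E_plus (pos1 X) (neg1 Y)
         \<ominus>\<^bsub>Ep\<^esub> c \<odot>\<^bsub>Ep\<^esub> \<one>\<^bsub>Ep\<^esub>,
     hcoef = ext_to_scalar K Mp (on_plus (neg1 X) (pos1 Y))
         \<ominus>\<^bsub>K\<^esub> ext_to_scalar K Mp (on_plus (neg1 Y) (pos1 X))
         \<oplus>\<^bsub>K\<^esub> [(2::int)] \<cdot>\<^bsub>K\<^esub> c,
     pos1 = act_plus K Mp 1 X (pos1 Y) \<ominus>\<^bsub>Lp\<^esub> act_plus K Mp 1 Y (pos1 X)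
         \<oplus>\<^bsub>Lp\<^esub> on_plus (neg1 X) (pos2 Y) \<ominus>\<^bsub>Lp\<^esub> on_plus (neg1 Y) (pos2 X),
     pos2 = act_plus K Mp 2 X (pos2 Y) \<ominus>\<^bsub>Lp\<^esub> act_plus K Mp 2 Y (pos2 X)
         \<oplus>\<^bsub>Lp\<^esub> pos1 X \<otimes>\<^bsub>Lp\<^esub> pos1 Y\<rparr>)"

definition tilde_E ::
    "('k, 'r) ring_scheme \<Rightarrow> ('k, 'm, 's) module_scheme \<Rightarrow> ('k, 'n, 't) module_scheme
      \<Rightarrow> ('m \<Rightarrow> 'n \<Rightarrow> 'k) \<Rightarrow> ('k, ('k, 'm, 'n) lie_elem) module" where
  "tilde_E K Mm Mp g = \<lparr>carrier = {X.
       neg2 X \<in> ext_pow K Mm 6 \<and> neg1 X \<in> ext_pow K Mm 3 \<and>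
       (endm X, endp X) \<in> S_pairs K Mm Mp g \<and> hcoef X \<in> carrier K \<and>
       pos1 X \<in> ext_pow K Mp 3 \<and> pos2 X \<in> ext_pow K Mp 6},
     mult = tilde_bracket K Mm Mp g, one = undefined,
     zero = tilde_zero K Mm Mp, add = tilde_add K Mm Mp, smult = tilde_smult K Mm Mp\<rparr>"

definition lie_E ::
    "('k, 'r) ring_scheme \<Rightarrow> ('k, 'm, 's) module_scheme \<Rightarrow> ('k, 'n, 't) module_scheme
      \<Rightarrow> ('m \<Rightarrow> 'n \<Rightarrow> 'k) \<Rightarrow> ('k, ('k, 'm, 'n) lie_elem) module" where
  "lie_E K Mm Mp g = (tilde_E K Mm Mp g)\<lparr>carrier := {X \<in> carrier (tilde_E K Mm Mp g).
     mtrace K Mp (endp X) \<oplus>\<^bsub>K\<^esub> [(3::int)] \<cdot>\<^bsub>K\<^esub> hcoef X = \<zero>\<^bsub>K\<^esub>}\<rparr>"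

definition lie_E_component ::
    "('k, 'r) ring_scheme \<Rightarrow> ('k, 'm, 's) module_scheme \<Rightarrow> ('k, 'n, 't) module_scheme
      \<Rightarrow> ('m \<Rightarrow> 'n \<Rightarrow> 'k) \<Rightarrow> int \<Rightarrow> ('k, 'm, 'n) lie_elem set" where
  "lie_E_component K Mm Mp g i = (let Z = tilde_zero K Mm Mp in
     {X \<in> carrier (lie_E K Mm Mp g).
       (i \<noteq> -2 \<longrightarrow> neg2 X = neg2 Z) \<and> (i \<noteq> -1 \<longrightarrow> neg1 X = neg1 Z) \<and>
       (i \<noteq> 0 \<longrightarrow> endm X = endm Z \<and> endp X = endp Z \<and> hcoef X = hcoef Z) \<and>
       (i \<noteq> 1 \<longrightarrow> pos1 X = pos1 Z) \<and> (i \<noteq> 2 \<longrightarrow> pos2 X = pos2 Z)})"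


section \<open>Gradings of Lie algebras\<close>

definition lie_algebra ::
    "('k, 'r) ring_scheme \<Rightarrow> ('k, 'l, 's) module_scheme \<Rightarrow> bool" where
  "lie_algebra K L \<longleftrightarrow> module K L \<and>
     (\<forall>x\<in>carrier L. \<forall>y\<in>carrier L. x \<otimes>\<^bsub>L\<^esub> y \<in> carrier L) \<and>
     (\<forall>x\<in>carrier L. \<forall>y\<in>carrier L. \<forall>z\<in>carrier L.
        (x \<oplus>\<^bsub>L\<^esub> y) \<otimes>\<^bsub>L\<^esub> z = x \<otimes>\<^bsub>L\<^esub> z \<oplus>\<^bsub>L\<^esub> y \<otimes>\<^bsub>L\<^esub> z \<and>
        z \<otimes>\<^bsub>L\<^esub> (x \<oplus>\<^bsub>L\<^esub> y) = z \<otimes>\<^bsub>L\<^esub> x \<oplus>\<^bsub>L\<^esub> z \<otimes>\<^bsub>L\<^esub> y) \<and>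
     (\<forall>a\<in>carrier K. \<forall>x\<in>carrier L. \<forall>y\<in>carrier L.
        (a \<odot>\<^bsub>L\<^esub> x) \<otimes>\<^bsub>L\<^esub> y = a \<odot>\<^bsub>L\<^esub> (x \<otimes>\<^bsub>L\<^esub> y) \<and>
        x \<otimes>\<^bsub>L\<^esub> (a \<odot>\<^bsub>L\<^esub> y) = a \<odot>\<^bsub>L\<^esub> (x \<otimes>\<^bsub>L\<^esub> y)) \<and>
     (\<forall>x\<in>carrier L. x \<otimes>\<^bsub>L\<^esub> x = \<zero>\<^bsub>L\<^esub>) \<and>
     (\<forall>x\<in>carrier L. \<forall>y\<in>carrier L. \<forall>z\<in>carrier L.
        x \<otimes>\<^bsub>L\<^esub> (y \<otimes>\<^bsub>L\<^esub> z) \<oplus>\<^bsub>L\<^esub> y \<otimes>\<^bsub>L\<^esub> (z \<otimes>\<^bsub>L\<^esub> x) \<oplus>\<^bsub>L\<^esub> z \<otimes>\<^bsub>L\<^esub> (x \<otimes>\<^bsub>L\<^esub> y) = \<zero>\<^bsub>L\<^esub>)"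

definition lie_grading ::
    "('k, 'r) ring_scheme \<Rightarrow> ('k, 'l, 's) module_scheme \<Rightarrow> ('i::ab_group_add \<Rightarrow> 'l set) \<Rightarrow> bool" where
  "lie_grading K L C \<longleftrightarrow> lie_algebra K L \<and>
     (\<forall>i. submodule (C i) K L) \<and>
     (\<forall>x\<in>carrier L. \<exists>!f. (\<forall>i. f i \<in> C i) \<and> finite {i. f i \<noteq> \<zero>\<^bsub>L\<^esub>} \<and>
        x = (\<Oplus>\<^bsub>L\<^esub>i\<in>{i. f i \<noteq> \<zero>\<^bsub>L\<^esub>}. f i)) \<and>
     (\<forall>i j. \<forall>x\<in>C i. \<forall>y\<in>C j. x \<otimes>\<^bsub>L\<^esub> y \<in> C (i + j))"

definition BC2_grading ::
    "('k, 'r) ring_scheme \<Rightarrow> ('k, 'l, 's) module_scheme \<Rightarrow> (int \<times> int \<Rightarrow> 'l set) \<Rightarrow> bool" where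
  "BC2_grading K L C \<longleftrightarrow> lie_grading K L C \<and>
     {i. C i \<noteq> {\<zero>\<^bsub>L\<^esub>}} \<subseteq>
       {(0, 0), (1, 0), (-1, 0), (0, 1), (0, -1), (1, 1), (-1, -1),
        (2, 0), (-2, 0), (2, 1), (-2, -1), (2, 2), (-2, -2)}"

definition first_component ::
    "('k, 'r) ring_scheme \<Rightarrow> ('k, 'l, 's) module_scheme \<Rightarrow> (int \<times> int \<Rightarrow> 'l set) \<Rightarrow> int \<Rightarrow> 'l set" where
  "first_component K L C i = mspan K L (\<Union>j. C (i, j))"


section \<open>The components determined by a pair of vectors\<close>

definition line ::
    "('k, 'r) ring_scheme \<Rightarrow> ('k, 'v, 's) module_scheme \<Rightarrow> 'v \<Rightarrow> 'v set" where
  "line K V e = {a \<odot>\<^bsub>V\<^esub> e | a. a \<in> carrier K}"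

definition perp ::
    "('k, 'r) ring_scheme \<Rightarrow> ('k, 'w, 't) module_scheme \<Rightarrow> ('v \<Rightarrow> 'w \<Rightarrow> 'k) \<Rightarrow> 'v \<Rightarrow> 'w set" where
  "perp K W h v = {w \<in> carrier W. h v w = \<zero>\<^bsub>K\<^esub>}"

text \<open>Given \<open>V = N \<oplus> N'\<close>, the module \<open>Hom(N, P)\<close> as a block of the endomorphisms of \<open>V\<close>.\<close>

definition hom_block ::
    "('k, 'r) ring_scheme \<Rightarrow> ('k, 'v, 's) module_scheme \<Rightarrow> 'v set \<Rightarrow> 'v set \<Rightarrow> 'v set
      \<Rightarrow> ('v \<Rightarrow> 'v) set" where
  "hom_block K V N N' P = {A \<in> lin_maps K V V. (\<forall>x\<in>N. A x \<in> P) \<and> (\<forall>x\<in>N'. A x = \<zero>\<^bsub>V\<^esub>)}"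

definition ext_pow_times ::
    "('k, 'r) ring_scheme \<Rightarrow> ('k, 'v, 's) module_scheme \<Rightarrow> 'v set \<Rightarrow> nat \<Rightarrow> 'v \<Rightarrow> ('k, 'v) ext set" where
  "ext_pow_times K V U k e = {x \<otimes>\<^bsub>ext_alg K V\<^esub> ext_gen K V e | x. x \<in> ext_pow_of K V U k}"

definition iota_elem ::
    "('k, 'r) ring_scheme \<Rightarrow> ('k, 'm, 's) module_scheme \<Rightarrow> ('k, 'n, 't) module_scheme
      \<Rightarrow> ('m \<Rightarrow> 'n \<Rightarrow> 'k) \<Rightarrow> ('n \<Rightarrow> 'n) \<Rightarrow> 'k \<Rightarrow> ('k, 'm, 'n) lie_elem" where
  "iota_elem K Mm Mp g A a = (tilde_zero K Mm Mp)
     \<lparr>endm := fst (iota_plus K Mm Mp g A), endp := snd (iota_plus K Mm Mp g A), hcoef := a\<rparr>"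

definition E_bigraded ::
    "('k, 'r) ring_scheme \<Rightarrow> ('k, 'm, 's) module_scheme \<Rightarrow> ('k, 'n, 't) module_scheme
      \<Rightarrow> ('m \<Rightarrow> 'n \<Rightarrow> 'k) \<Rightarrow> 'm \<Rightarrow> 'n \<Rightarrow> int \<times> int \<Rightarrow> ('k, 'm, 'n) lie_elem set" where
  "E_bigraded K Mm Mp g em ep i = (let
     Z = tilde_zero K Mm Mp;
     Um = perp K Mm (\<lambda>w v. g v w) ep; Up = perp K Mp g em;
     Lp = line K Mp ep
   in
     if i = (1, 0) then {Z\<lparr>pos1 := x\<rparr> | x. x \<in> ext_pow_of K Mp Up 3}
     else if i = (-1, 0) then {Z\<lparr>neg1 := x\<rparr> | x. x \<in> ext_pow_of K Mm Um 3}
     else if i = (1, 1) then {Z\<lparr>pos1 := x\<rparr> | x. x \<in> ext_pow_times K Mp Up 2 ep}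
     else if i = (-1, -1) then {Z\<lparr>neg1 := x\<rparr> | x. x \<in> ext_pow_times K Mm Um 2 em}
     else if i = (2, 1) then {Z\<lparr>pos2 := x\<rparr> | x. x \<in> ext_pow K Mp 6}
     else if i = (-2, -1) then {Z\<lparr>neg2 := x\<rparr> | x. x \<in> ext_pow K Mm 6}
     else if i = (0, 0) then lie_E_component K Mm Mp g 0 \<inter>
       {iota_elem K Mm Mp g (A \<oplus>\<^bsub>End_alg K Mp\<^esub> B) a | A B a.
          A \<in> hom_block K Mp Lp Up Lp \<and> B \<in> hom_block K Mp Up Lp Up \<and> a \<in> carrier K}
     else if i = (0, 1) then {iota_elem K Mm Mp g A \<zero>\<^bsub>K\<^esub> | A. A \<in> hom_block K Mp Up Lp Lp}
     else if i = (0, -1) then {iota_elem K Mm Mp g A \<zero>\<^bsub>K\<^esub> | A. A \<in> hom_block K Mp Lp Up Up}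
     else {Z})"

end

theory Submission
 imports Defs
begin

text \<open>
 The Jacobi identity is trilinear, so it suffices to check it on homogeneous elements, where each case is an
 identity for contractions: contracting is a derivation under \<open>S\<close>, a vector of degree three contracts a
 product by \<open>a \<cdot> (p q) = (a \<cdot> p) q - E(p, a) \<circ> q - ((a \<cdot> q) p - E(q, a) \<circ> p)\<close>, and elements of top degree
 satisfy \<open>(p \<cdot> a) \<cdot> x = p (a \<cdot> x)\<close>. The remaining cases follow by interchanging the two modules.
 Top degree means degree six: locally at a prime the module has a basis of six elements, so the seventh exterior
 power vanishes, and the trace of the identity is six.

 The second grading counts the factors \<open>e\<close>. On the exterior algebra it is given by the idempotent derivation
 \<open>x \<mapsto> e (e\<^sup>- \<cdot> x)\<close> extending the projection \<open>P\<close> onto the line of \<open>e\<close>, and on endomorphisms by the Peirce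
 decomposition relative to \<open>P\<close>.
\<close>

section \<open>Modules, spans and linear maps\<close>

text \<open>Neither 2 nor 3 need be invertible and the modules need not have bases. Squares of odd
  elements are therefore shown to vanish on products of vectors, the two weights 0 and 1 are
  separated by annihilation conditions instead of eigenvalues, and computations use a finite dual
  basis in the sense of projective modules. The top exterior power need not have a generator; the
  exchange rule \<open>(u \<cdot> q) q' = (u \<cdot> q') q\<close> takes its place.

  The constants fit together as follows. The trace of \<open>E(p, a)\<close> is three times
  \<open>a \<cdot> p\<close>, and the trace of the identity is six, so both
  \<open>E(a, p) + (a \<cdot> p) h_0\<close> and \<open>- (h_M - 2 h_0)\<close> satisfy
  \<open>tr + 3 a = 0\<close>, and every bracket lands in the ideal. The same numbers give the
  action of \<open>- (h_M - 2 h_0)\<close>: it is \<open>- 3 + 2 = - 1\<close> on degree three and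
  \<open>- 6 + 4 = - 2\<close> on degree six.

  Contractions, derivations, traces and scalars are defined by descriptions, so each needs existence
  and uniqueness before anything can be computed. Existence of derivations and antiderivations comes
  from homomorphisms of the exterior algebra into triangular matrices over itself.\<close>

lemma (in module) mspan_least: "submodule N R M ==> S \<subseteq> N ==> mspan R M S \<subseteq> N"
 unfolding mspan_def by blast

lemma (in module) mspan_incl: "S \<subseteq> mspan R M S"
 unfolding mspan_def by blast

lemma (in module) mspan_closed: "S \<subseteq> carrier M ==> mspan R M S \<subseteq> carrier M"
 using mspan_least[OF carrier_is_submodule] .

lemma (in module) mspan_submodule:
 assumes "S \<subseteq> carrier M" shows "submodule (mspan R M S) R M"
proof (rule submoduleI)
 show "mspan R M S \<subseteq> carrier M" using assms by (rule mspan_closed)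
 show "\<zero>\<^bsub>M\<^esub> \<in> mspan R M S"
  unfolding mspan_def using submodule.axioms(1) subgroup.one_closed by fastforce
 show "\<ominus>\<^bsub>M\<^esub> a \<in> mspan R M S" if "a \<in> mspan R M S" for a
  using that unfolding mspan_def using submoduleE(3) by blast
 show "a \<oplus>\<^bsub>M\<^esub> b \<in> mspan R M S" if "a \<in> mspan R M S" "b \<in> mspan R M S" for a b
  using that unfolding mspan_def using submoduleE(5) by blast
 show "a \<odot>\<^bsub>M\<^esub> b \<in> mspan R M S" if "a \<in> carrier R" "b \<in> mspan R M S" for a b
  using that unfolding mspan_def using submoduleE(4) by blast
qed

lemma (in module) submodule_zero: "submodule N R M ==> \<zero>\<^bsub>M\<^esub> \<in> N"
 using submodule.axioms(1) subgroup.one_closed by fastforce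

lemma (in module) submodule_minus:
 "submodule N R M ==> x \<in> N ==> y \<in> N ==> x \<ominus>\<^bsub>M\<^esub> y \<in> N"
 unfolding a_minus_def using submoduleE(3,5) by blast

lemma (in module) submoduleI':
 assumes "N \<subseteq> carrier M" "\<zero>\<^bsub>M\<^esub> \<in> N" "!!x y. x \<in> N ==> y \<in> N ==> x \<oplus>\<^bsub>M\<^esub> y \<in> N"
  and sm: "!!a x. a \<in> carrier R ==> x \<in> N ==> a \<odot>\<^bsub>M\<^esub> x \<in> N"
 shows "submodule N R M"
proof (rule submoduleI)
 show "\<ominus>\<^bsub>M\<^esub> x \<in> N" if "x \<in> N" for x
  using sm[of "\<ominus> \<one>" x] that assms(1) by (auto simp: smult_l_minus subset_iff)
qed (use assms in auto)

text \<open>The elements of the span that satisfy \<open>P\<close> form a submodule containing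
  \<open>S\<close>. Membership in the span stays available in the closure steps because many later
  properties make sense only within a fixed exterior power.\<close>

lemma (in module) mspan_induct [consumes 2, case_names zero base add smult]:
 assumes "x \<in> mspan R M S" "S \<subseteq> carrier M" and "P \<zero>\<^bsub>M\<^esub>" "!!x. x \<in> S ==> P x"
  and "!!x y. x \<in> mspan R M S ==> y \<in> mspan R M S ==> x \<in> carrier M ==> y \<in> carrier M ==>
   P x ==> P y ==> P (x \<oplus>\<^bsub>M\<^esub> y)"
  and "!!a x. a \<in> carrier R ==> x \<in> mspan R M S ==> x \<in> carrier M ==> P x ==> P (a \<odot>\<^bsub>M\<^esub> x)"
 shows "P x"
proof -
 note sub = mspan_submodule[OF assms(2)] and cl = mspan_closed[OF assms(2)]
 have "submodule {x \<in> mspan R M S. P x} R M"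
  by (rule submoduleI')
   (use assms(3-) cl submodule_zero[OF sub] submoduleE(4,5)[OF sub] in \<open>auto simp: subset_iff simp del: in_lists_conv_set\<close>)
 from mspan_least[OF this, of S] assms(1,2,4) mspan_incl[of S] show ?thesis by blast
qed

lemma lin_mapsI:
 assumes "!!x. x \<in> carrier V ==> f x \<in> carrier W" "!!x. x \<notin> carrier V ==> f x = undefined"
  and "!!x y. x \<in> carrier V ==> y \<in> carrier V ==> f (x \<oplus>\<^bsub>V\<^esub> y) = f x \<oplus>\<^bsub>W\<^esub> f y"
  and "!!a x. a \<in> carrier K ==> x \<in> carrier V ==> f (a \<odot>\<^bsub>V\<^esub> x) = a \<odot>\<^bsub>W\<^esub> f x"
 shows "f \<in> lin_maps K V W"
 unfolding lin_maps_def using assms by (auto simp: PiE_def extensional_def)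

lemma lin_maps_restrictI:
 assumes "module K V" "!!x. x \<in> carrier V ==> f x \<in> carrier W"
  and "!!x y. x \<in> carrier V ==> y \<in> carrier V ==> f (x \<oplus>\<^bsub>V\<^esub> y) = f x \<oplus>\<^bsub>W\<^esub> f y"
  and "!!a x. a \<in> carrier K ==> x \<in> carrier V ==> f (a \<odot>\<^bsub>V\<^esub> x) = a \<odot>\<^bsub>W\<^esub> f x"
 shows "(\<lambda>x\<in>carrier V. f x) \<in> lin_maps K V W"
proof -
 interpret module K V by fact
 show ?thesis by (rule lin_mapsI) (use assms(2-) in auto)
qed

lemma lin_maps_closed: "f \<in> lin_maps K V W ==> x \<in> carrier V ==> f x \<in> carrier W"
 and lin_maps_undefined: "f \<in> lin_maps K V W ==> x \<notin> carrier V ==> f x = undefined"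
 and lin_maps_add: "f \<in> lin_maps K V W ==> x \<in> carrier V ==> y \<in> carrier V ==>
  f (x \<oplus>\<^bsub>V\<^esub> y) = f x \<oplus>\<^bsub>W\<^esub> f y"
 and lin_maps_smult: "f \<in> lin_maps K V W ==> a \<in> carrier K ==> x \<in> carrier V ==>
  f (a \<odot>\<^bsub>V\<^esub> x) = a \<odot>\<^bsub>W\<^esub> f x"
 unfolding lin_maps_def by auto

lemma lin_maps_eqI:
 "f \<in> lin_maps K V W ==> f' \<in> lin_maps K V W ==> (!!x. x \<in> carrier V ==> f x = f' x) ==> f = f'"
 unfolding lin_maps_def by (auto intro: PiE_ext)

lemma lin_maps_hom:
 assumes "abelian_group V" "abelian_group W" "f \<in> lin_maps K V W"
 shows lin_maps_zero: "f \<zero>\<^bsub>V\<^esub> = \<zero>\<^bsub>W\<^esub>"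
  and lin_maps_neg: "x \<in> carrier V ==> f (\<ominus>\<^bsub>V\<^esub> x) = \<ominus>\<^bsub>W\<^esub> f x"
  and lin_maps_minus: "x \<in> carrier V ==> y \<in> carrier V ==> f (x \<ominus>\<^bsub>V\<^esub> y) = f x \<ominus>\<^bsub>W\<^esub> f y"
proof -
 interpret V: abelian_group V by fact
 interpret W: abelian_group W by fact
 note cl = lin_maps_closed[OF assms(3)] and ad = lin_maps_add[OF assms(3)]
 show z: "f \<zero>\<^bsub>V\<^esub> = \<zero>\<^bsub>W\<^esub>"
  using ad[of "\<zero>\<^bsub>V\<^esub>" "\<zero>\<^bsub>V\<^esub>"] cl[of "\<zero>\<^bsub>V\<^esub>"] W.add.l_cancel_one by fastforce
 show n: "f (\<ominus>\<^bsub>V\<^esub> x) = \<ominus>\<^bsub>W\<^esub> f x" if "x \<in> carrier V" for x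
  using that ad[of "\<ominus>\<^bsub>V\<^esub> x" x] cl[of x] cl[of "\<ominus>\<^bsub>V\<^esub> x"] z V.l_neg W.minus_equality by force
 show "f (x \<ominus>\<^bsub>V\<^esub> y) = f x \<ominus>\<^bsub>W\<^esub> f y" if "x \<in> carrier V" "y \<in> carrier V"
  using that ad n cl by (simp add: V.minus_eq W.minus_eq)
qed

lemma lin_maps_finsum:
 assumes "abelian_group V" "abelian_group W" "f \<in> lin_maps K V W" "finite I" "u \<in> I \<rightarrow> carrier V"
 shows "f (\<Oplus>\<^bsub>V\<^esub>i\<in>I. u i) = (\<Oplus>\<^bsub>W\<^esub>i\<in>I. f (u i))"
proof -
 interpret V: abelian_group V by fact
 interpret W: abelian_group W by fact
 show ?thesis using assms(4,5)
 proof (induction I)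
  case empty then show ?case using lin_maps_zero[OF assms(1-3)] by simp
 next
  case (insert i I)
  then have "u \<in> I \<rightarrow> carrier V" "u i \<in> carrier V" by auto
  moreover have "(\<lambda>i. f (u i)) \<in> I \<rightarrow> carrier W"
   using insert.prems lin_maps_closed[OF assms(3)] by auto
  ultimately show ?case using insert lin_maps_add[OF assms(3)] lin_maps_closed[OF assms(3)] by simp
 qed
qed

lemma (in cring) regular_module_module: "module R (regular_module R)"
proof -
 have "abelian_group (regular_module R)"
 proof (rule abelian_groupI)
  fix x assume "x \<in> carrier (regular_module R)"
  then have "\<ominus> x \<in> carrier (regular_module R) \<and> \<ominus> x \<oplus> x = \<zero>" by (simp add: regular_module_def l_neg)
  then show "\<exists>y\<in>carrier (regular_module R). y \<oplus>\<^bsub>regular_module R\<^esub> x = \<zero>\<^bsub>regular_module R\<^esub>"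
   by (auto simp: regular_module_def)
 qed (auto simp: regular_module_def a_assoc intro: a_comm)
 then show ?thesis
  by (intro moduleI) (auto simp: regular_module_def is_cring l_distr r_distr m_assoc)
qed

section \<open>Free algebras\<close>

lemma (in cring) free_module_carrier:
 "f \<in> carrier (free_module R X) \<longleftrightarrow>
  (\<forall>x. f x \<in> carrier R) \<and> finite {x. f x \<noteq> \<zero>} \<and> {x. f x \<noteq> \<zero>} \<subseteq> X"
 by (simp add: free_module_def)

lemma (in cring) free_module_module: "module R (free_module R X)"
proof -
 have supp_add: "{x. f x \<oplus> h x \<noteq> \<zero>} \<subseteq> {x. f x \<noteq> \<zero>} \<union> {x. h x \<noteq> \<zero>}" for f h :: "'x => 'a"
  by auto
 have supp_smult: "{x. a \<otimes> f x \<noteq> \<zero>} \<subseteq> {x. f x \<noteq> \<zero>}" if "a \<in> carrier R" for f :: "'x => 'a" and a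
  using that by auto
 have "abelian_group (free_module R X)"
 proof (rule abelian_groupI)
  fix f h assume "f \<in> carrier (free_module R X)" "h \<in> carrier (free_module R X)"
  then show "f \<oplus>\<^bsub>free_module R X\<^esub> h \<in> carrier (free_module R X)"
   using supp_add[of f h] finite_subset[OF supp_add[of f h]] by (auto simp: free_module_def)
 next
  fix f assume f: "f \<in> carrier (free_module R X)"
  have "{x. \<ominus> f x \<noteq> \<zero>} = {x. f x \<noteq> \<zero>}"
   using f by (auto simp: free_module_def add.inv_eq_1_iff)
  then have "(\<lambda>x. \<ominus> f x) \<in> carrier (free_module R X)" using f by (simp add: free_module_def)
  moreover have "(\<lambda>x. \<ominus> f x) \<oplus>\<^bsub>free_module R X\<^esub> f = \<zero>\<^bsub>free_module R X\<^esub>"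
   using f by (auto simp: free_module_def l_neg)
  ultimately show "\<exists>h\<in>carrier (free_module R X). h \<oplus>\<^bsub>free_module R X\<^esub> f = \<zero>\<^bsub>free_module R X\<^esub>" by blast
 qed (auto simp: free_module_def a_assoc intro: a_comm)
 then show ?thesis
 proof (intro moduleI)
  fix a f assume a: "a \<in> carrier R" and "f \<in> carrier (free_module R X)"
  then show "a \<odot>\<^bsub>free_module R X\<^esub> f \<in> carrier (free_module R X)"
   using supp_smult[OF a, of f] finite_subset[OF supp_smult[OF a, of f]] by (auto simp: free_module_def)
 qed (auto simp: free_module_def is_cring l_distr r_distr m_assoc)
qed

text \<open>\<open>free_alg\<close> arises from \<open>free_module\<close> by a record update of
  product and unit, two fields about which the module laws say nothing.\<close>

lemma module_update_mult_one:
 assumes "module K M" shows "module K (M\<lparr>mult := m, one := e\<rparr>)"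
proof -
 interpret module K M by fact
 have "abelian_group (M\<lparr>mult := m, one := e\<rparr>)"
 proof (rule abelian_groupI)
  fix x assume "x \<in> carrier (M\<lparr>mult := m, one := e\<rparr>)"
  then show "\<exists>y\<in>carrier (M\<lparr>mult := m, one := e\<rparr>).
    y \<oplus>\<^bsub>M\<lparr>mult := m, one := e\<rparr>\<^esub> x = \<zero>\<^bsub>M\<lparr>mult := m, one := e\<rparr>\<^esub>"
   using M.l_neg[of x] M.a_inv_closed[of x] by auto
 qed (auto simp: M.a_assoc intro: M.a_comm)
 then show ?thesis
  by (intro moduleI) (auto simp: is_cring smult_l_distr smult_r_distr smult_assoc1)
qed

lemma (in cring) free_alg_module: "module R (free_alg R X)"
 unfolding free_alg_def using module_update_mult_one[OF free_module_module] .

text \<open>The library record carries ring and module operations side by side without relating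
  them; the two axioms make the product bilinear. Exterior algebras, endomorphism algebras, the ring
  of scalars and the triangular matrices below are all instances.\<close>

locale kalg = A: ring A + module K A for K (structure) and A +
 assumes smult_mult_l: "a \<in> carrier K ==> x \<in> carrier A ==> y \<in> carrier A ==>
   (a \<odot>\<^bsub>A\<^esub> x) \<otimes>\<^bsub>A\<^esub> y = a \<odot>\<^bsub>A\<^esub> (x \<otimes>\<^bsub>A\<^esub> y)"
  and smult_mult_r: "a \<in> carrier K ==> x \<in> carrier A ==> y \<in> carrier A ==>
   x \<otimes>\<^bsub>A\<^esub> (a \<odot>\<^bsub>A\<^esub> y) = a \<odot>\<^bsub>A\<^esub> (x \<otimes>\<^bsub>A\<^esub> y)"

text \<open>The product of the free algebra as a convolution over the ways to cut a word in two. It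
  applies to arbitrary coefficient functions, so a function shifted by a letter, as in the recursion
  over words, stays within its scope.\<close>

definition conv :: "('k, 'r) ring_scheme => ('x list => 'k) => ('x list => 'k) => 'x list => 'k" where
 "conv K f h w = (\<Oplus>\<^bsub>K\<^esub>i\<in>{..length w}. f (take i w) \<otimes>\<^bsub>K\<^esub> h (drop i w))"

context cring
begin

lemma conv_closed [simp]:
 "(!!w. f w \<in> carrier R) ==> (!!w. h w \<in> carrier R) ==> conv R f h w \<in> carrier R"
 unfolding conv_def by (auto intro!: finsum_closed)

lemma conv_Nil [simp]:
 "(!!w. f w \<in> carrier R) ==> (!!w. h w \<in> carrier R) ==> conv R f h [] = f [] \<otimes> h []"
 unfolding conv_def by (simp add: Pi_def)

text \<open>A cut either precedes the first letter, leaving the empty word on the left, or leaves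
  that letter to the left factor. This recursion turns the algebra laws into inductions over the
  word.\<close>

lemma conv_Cons [simp]:
 "(!!w. f w \<in> carrier R) ==> (!!w. h w \<in> carrier R) ==>
  conv R f h (a # w) = f [] \<otimes> h (a # w) \<oplus> conv R (\<lambda>u. f (a # u)) h w"
 unfolding conv_def length_Cons
 by (subst finsum_Suc2) (auto intro!: a_comm finsum_closed)

lemma conv_add_l: "(!!w. f w \<in> carrier R) ==> (!!w. f' w \<in> carrier R) ==> (!!w. h w \<in> carrier R) ==>
  conv R (\<lambda>w. f w \<oplus> f' w) h w = conv R f h w \<oplus> conv R f' h w"
 by (induction w arbitrary: f f') (simp_all add: l_distr a_ac)

lemma conv_add_r: "(!!w. f w \<in> carrier R) ==> (!!w. h w \<in> carrier R) ==> (!!w. h' w \<in> carrier R) ==>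
  conv R f (\<lambda>w. h w \<oplus> h' w) w = conv R f h w \<oplus> conv R f h' w"
 by (induction w arbitrary: f) (simp_all add: r_distr a_ac)

lemma conv_smult_l: "a \<in> carrier R ==> (!!w. f w \<in> carrier R) ==> (!!w. h w \<in> carrier R) ==>
  conv R (\<lambda>w. a \<otimes> f w) h w = a \<otimes> conv R f h w"
 by (induction w arbitrary: f) (simp_all add: r_distr m_assoc)

lemma conv_smult_r: "a \<in> carrier R ==> (!!w. f w \<in> carrier R) ==> (!!w. h w \<in> carrier R) ==>
  conv R f (\<lambda>w. a \<otimes> h w) w = a \<otimes> conv R f h w"
 by (induction w arbitrary: f) (simp_all add: r_distr m_lcomm)

text \<open>Shifting \<open>conv R f h\<close> by a letter gives a scalar multiple of the shifted
  \<open>h\<close> plus the convolution with the shifted \<open>f\<close>; hence the induction is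
  over the word with \<open>f\<close> arbitrary.\<close>

lemma conv_assoc: "(!!w. f w \<in> carrier R) ==> (!!w. h w \<in> carrier R) ==> (!!w. k w \<in> carrier R) ==>
  conv R (conv R f h) k w = conv R f (conv R h k) w"
proof (induction w arbitrary: f)
 case (Cons a w)
 have "(\<lambda>u. conv R f h (a # u)) = (\<lambda>u. f [] \<otimes> h (a # u) \<oplus> conv R (\<lambda>v. f (a # v)) h u)"
  using Cons.prems by simp
 with Cons show ?case
  by (simp add: conv_add_l conv_smult_l r_distr m_assoc a_assoc)
qed (simp add: m_assoc)

lemma conv_zero_l: "(!!w. h w \<in> carrier R) ==> conv R (\<lambda>w. \<zero>) h w = \<zero>"
 by (induction w) simp_all

lemma word_closed [simp]: "word R u w \<in> carrier R"
 by (simp add: word_def)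

lemma conv_one_l: "(!!w. h w \<in> carrier R) ==> conv R (word R []) h w = h w"
 by (cases w) (simp_all add: word_def conv_zero_l)

lemma conv_one_r: "(!!w. h w \<in> carrier R) ==> conv R h (word R []) w = h w"
proof (induction w arbitrary: h)
 case (Cons a w)
 have "word R [] (a # w) = \<zero>" by (simp add: word_def)
 with Cons show ?case by simp
qed (simp add: word_def)

lemma conv_word: "conv R (word R u) (word R v) w = word R (u @ v) w"
proof (induction u arbitrary: w)
 case Nil show ?case by (simp add: conv_one_l)
next
 case (Cons a u)
 have w: "word R (a # u) [] = \<zero>" by (simp add: word_def)
 show ?case
 proof (cases w)
  case (Cons b w')
  have "(\<lambda>x. word R (a # u) (b # x)) = (if a = b then word R u else (\<lambda>x. \<zero>))"
   by (auto simp: word_def)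
  then show ?thesis using Cons.IH[of w'] Cons w by (auto simp: conv_zero_l) (auto simp: word_def)
 qed (simp add: w, simp add: word_def)
qed

lemma conv_finite_support:
 assumes "!!w. f w \<in> carrier R" "!!w. h w \<in> carrier R" "finite {w. f w \<noteq> \<zero>}" "finite {w. h w \<noteq> \<zero>}"
  and "{w. f w \<noteq> \<zero>} \<subseteq> lists X" "{w. h w \<noteq> \<zero>} \<subseteq> lists X"
 shows "finite {w. conv R f h w \<noteq> \<zero>} \<and> {w. conv R f h w \<noteq> \<zero>} \<subseteq> lists X"
proof -
 have "\<exists>u v. w = u @ v \<and> f u \<noteq> \<zero> \<and> h v \<noteq> \<zero>" if "conv R f h w \<noteq> \<zero>" for w
 proof (rule ccontr)
  assume "\<not> ?thesis"
  then have "f (take i w) \<otimes> h (drop i w) = \<zero>" for i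
   by (metis append_take_drop_id assms(1,2) l_null r_null)
  then show False using that unfolding conv_def by simp
 qed
 then have "{w. conv R f h w \<noteq> \<zero>} \<subseteq> (\<lambda>(u, v). u @ v) ` ({w. f w \<noteq> \<zero>} \<times> {w. h w \<noteq> \<zero>})" (is "_ \<subseteq> ?S")
  by fastforce
 moreover have "finite ?S" using assms by blast
 moreover have "?S \<subseteq> lists X" using assms(5,6) by (fastforce simp: append_in_lists_conv simp del: in_lists_conv_set)
 ultimately show ?thesis using finite_subset by blast
qed

lemma free_alg_simps:
 "f \<otimes>\<^bsub>free_alg R X\<^esub> h = conv R f h" "\<one>\<^bsub>free_alg R X\<^esub> = word R []"
 "f \<oplus>\<^bsub>free_alg R X\<^esub> h = (\<lambda>w. f w \<oplus> h w)" "a \<odot>\<^bsub>free_alg R X\<^esub> f = (\<lambda>w. a \<otimes> f w)"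
 "\<zero>\<^bsub>free_alg R X\<^esub> = (\<lambda>w. \<zero>)"
 "f \<in> carrier (free_alg R X) \<longleftrightarrow> (\<forall>w. f w \<in> carrier R) \<and> finite {w. f w \<noteq> \<zero>} \<and> {w. f w \<noteq> \<zero>} \<subseteq> lists X"
 unfolding free_alg_def free_module_def conv_def word_def by (simp_all add: fun_eq_iff)

lemma word_in_free_alg: "u \<in> lists X ==> word R u \<in> carrier (free_alg R X)"
 by (auto simp: free_alg_simps word_def)

lemma free_alg_kalg: "kalg R (free_alg R X)"
proof -
 interpret F: module R "free_alg R X" by (rule free_alg_module)
 have "ring (free_alg R X)"
 proof (rule ringI)
  show "Group.monoid (free_alg R X)"
   by (rule monoidI) (use conv_finite_support[of _ _ X] word_in_free_alg[of "[]" X] in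
    \<open>auto simp: free_alg_simps fun_eq_iff conv_assoc conv_one_l conv_one_r\<close>)
 qed (auto simp: F.abelian_group_axioms free_alg_simps conv_add_l conv_add_r)
 then show ?thesis
  by (intro kalg.intro F.module_axioms kalg_axioms.intro)
   (auto simp: free_alg_simps conv_smult_l conv_smult_r)
qed

text \<open>Words are removed from the support one at a time. The induction runs over a finite
  superset of the support, so that a word with coefficient zero is simply dropped.\<close>

lemma free_alg_induct [consumes 1, case_names zero add]:
 assumes f: "f \<in> carrier (free_alg R X)" and P0: "P \<zero>\<^bsub>free_alg R X\<^esub>"
  and Pa: "!!c u f. c \<in> carrier R ==> u \<in> lists X ==> f \<in> carrier (free_alg R X) ==> P f ==>
   P (c \<odot>\<^bsub>free_alg R X\<^esub> word R u \<oplus>\<^bsub>free_alg R X\<^esub> f)"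
 shows "P f"
proof -
 have "finite S ==> f \<in> carrier (free_alg R X) ==> {w. f w \<noteq> \<zero>} \<subseteq> S ==> P f" for S f
 proof (induction S arbitrary: f rule: finite_induct)
  case empty
  then have "f = \<zero>\<^bsub>free_alg R X\<^esub>" by (auto simp: free_alg_simps)
  with P0 show ?case by simp
 next
  case (insert u S)
  show ?case
  proof (cases "f u = \<zero>")
   case True with insert show ?thesis by (intro insert.IH) auto
  next
   case False
   define f' where "f' = f(u := \<zero>)"
   have "{w. f' w \<noteq> \<zero>} = {w. f w \<noteq> \<zero>} - {u}" by (auto simp: f'_def)
   then have f': "f' \<in> carrier (free_alg R X)" and s: "{w. f' w \<noteq> \<zero>} \<subseteq> S"
    using insert.prems by (auto simp: free_alg_simps f'_def)
   have "f = f u \<odot>\<^bsub>free_alg R X\<^esub> word R u \<oplus>\<^bsub>free_alg R X\<^esub> f'"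
    using insert.prems(1) by (auto simp: free_alg_simps f'_def word_def)
   moreover have "f u \<in> carrier R" "u \<in> lists X" using insert.prems(1) False by (auto simp: free_alg_simps)
   ultimately show ?thesis using Pa[of "f u" u f'] insert.IH[OF f' s] f' by metis
  qed
 qed
 then show ?thesis using f by (auto simp: free_alg_simps)
qed

end

section \<open>Evaluation: the homomorphism from a free algebra given by images of the
  letters\<close>

definition eval_free :: "('k, 'r) ring_scheme => ('k, 'b, 's) module_scheme => ('x => 'b)
  => ('x list => 'k) => 'b" where
 "eval_free K B \<phi> f = (\<Oplus>\<^bsub>B\<^esub>w\<in>{w. f w \<noteq> \<zero>\<^bsub>K\<^esub>}. f w \<odot>\<^bsub>B\<^esub> foldr (\<lambda>v y. \<phi> v \<otimes>\<^bsub>B\<^esub> y) w \<one>\<^bsub>B\<^esub>)"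

locale free_eval = kalg K B for K (structure) and B +
 fixes X :: "'x set" and \<phi> :: "'x => 'b"
 assumes \<phi>_closed: "\<phi> \<in> X \<rightarrow> carrier B"
begin

abbreviation "F \<equiv> free_alg K X"
abbreviation "ev \<equiv> eval_free K B \<phi>"
abbreviation "pr w \<equiv> foldr (\<lambda>v y. \<phi> v \<otimes>\<^bsub>B\<^esub> y) w \<one>\<^bsub>B\<^esub>"

sublocale F: kalg K F by (rule free_alg_kalg)

lemma pr_closed: "w \<in> lists X ==> pr w \<in> carrier B"
 by (induction w) (use \<phi>_closed in auto)

lemma pr_append: "u \<in> lists X ==> w \<in> lists X ==> pr (u @ w) = pr u \<otimes>\<^bsub>B\<^esub> pr w"
 by (induction u) (use \<phi>_closed pr_closed in \<open>auto simp: A.m_assoc Pi_def\<close>)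

text \<open>Two elements can thus be evaluated over one common finite set of words, which is what
  additivity rests on.\<close>

lemma ev_superset:
 assumes "f \<in> carrier F" "finite S" "{w. f w \<noteq> \<zero>} \<subseteq> S" "S \<subseteq> lists X"
 shows "ev f = (\<Oplus>\<^bsub>B\<^esub>w\<in>S. f w \<odot>\<^bsub>B\<^esub> pr w)"
 unfolding eval_free_def
 by (rule A.add.finprod_mono_neutral_cong_left)
  (use assms pr_closed in \<open>auto simp: free_alg_simps subset_iff simp del: in_lists_conv_set\<close>)

lemma ev_closed: "f \<in> carrier F ==> ev f \<in> carrier B"
 unfolding eval_free_def by (rule A.finsum_closed) (use pr_closed in \<open>auto simp: free_alg_simps subset_iff simp del: in_lists_conv_set\<close>)

lemma ev_add:
 assumes "f \<in> carrier F" "h \<in> carrier F" shows "ev (f \<oplus>\<^bsub>F\<^esub> h) = ev f \<oplus>\<^bsub>B\<^esub> ev h"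
proof -
 define S where "S = {w. f w \<noteq> \<zero>} \<union> {w. h w \<noteq> \<zero>}"
 have S: "finite S" "S \<subseteq> lists X" using assms by (auto simp: S_def free_alg_simps)
 have "{w. (f \<oplus>\<^bsub>F\<^esub> h) w \<noteq> \<zero>} \<subseteq> S" by (auto simp: S_def free_alg_simps)
 then have "ev (f \<oplus>\<^bsub>F\<^esub> h) = (\<Oplus>\<^bsub>B\<^esub>w\<in>S. (f \<oplus>\<^bsub>F\<^esub> h) w \<odot>\<^bsub>B\<^esub> pr w)"
  using S assms by (intro ev_superset) auto
 also have "\<dots> = (\<Oplus>\<^bsub>B\<^esub>w\<in>S. f w \<odot>\<^bsub>B\<^esub> pr w \<oplus>\<^bsub>B\<^esub> h w \<odot>\<^bsub>B\<^esub> pr w)"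
  by (rule A.finsum_cong') (use S assms pr_closed in \<open>auto simp: free_alg_simps smult_l_distr subset_iff simp del: in_lists_conv_set\<close>)
 also have "\<dots> = (\<Oplus>\<^bsub>B\<^esub>w\<in>S. f w \<odot>\<^bsub>B\<^esub> pr w) \<oplus>\<^bsub>B\<^esub> (\<Oplus>\<^bsub>B\<^esub>w\<in>S. h w \<odot>\<^bsub>B\<^esub> pr w)"
  by (rule A.finsum_addf) (use S assms pr_closed in \<open>auto simp: free_alg_simps subset_iff simp del: in_lists_conv_set\<close>)
 also have "\<dots> = ev f \<oplus>\<^bsub>B\<^esub> ev h"
  using ev_superset[of f S] ev_superset[of h S] assms S by (simp add: S_def)
 finally show ?thesis .
qed

lemma ev_smult:
 assumes "f \<in> carrier F" "a \<in> carrier K" shows "ev (a \<odot>\<^bsub>F\<^esub> f) = a \<odot>\<^bsub>B\<^esub> ev f"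
proof -
 have S: "finite {w. f w \<noteq> \<zero>}" "{w. f w \<noteq> \<zero>} \<subseteq> lists X" "!!w. f w \<in> carrier K"
  using assms by (auto simp: free_alg_simps)
 have "ev (a \<odot>\<^bsub>F\<^esub> f) = (\<Oplus>\<^bsub>B\<^esub>w\<in>{w. f w \<noteq> \<zero>}. (a \<odot>\<^bsub>F\<^esub> f) w \<odot>\<^bsub>B\<^esub> pr w)"
  by (rule ev_superset[OF F.smult_closed]) (use S assms in \<open>auto simp: free_alg_simps simp del: in_lists_conv_set\<close>)
 also have "\<dots> = (\<Oplus>\<^bsub>B\<^esub>w\<in>{w. f w \<noteq> \<zero>}. a \<odot>\<^bsub>B\<^esub> (f w \<odot>\<^bsub>B\<^esub> pr w))"
  by (rule A.finsum_cong') (use S assms pr_closed in \<open>auto simp: free_alg_simps smult_assoc1 subset_iff simp del: in_lists_conv_set\<close>)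
 also have "\<dots> = a \<odot>\<^bsub>B\<^esub> ev f"
  unfolding eval_free_def
  by (rule finsum_smult_ldistr[symmetric]) (use S assms pr_closed in \<open>auto simp: subset_iff simp del: in_lists_conv_set\<close>)
 finally show ?thesis .
qed

lemma ev_word: "u \<in> lists X ==> ev (word K u) = pr u"
proof -
 assume u: "u \<in> lists X"
 have "{w. word K u w \<noteq> \<zero>} \<subseteq> {u}" "word K u u = \<one>" by (auto simp: word_def)
 then show ?thesis
  using ev_superset[of "word K u" "{u}"] u word_in_free_alg[of u X] pr_closed[of u]
  by (simp add: Pi_def del: in_lists_conv_set)
qed

lemma ev_zero: "ev \<zero>\<^bsub>F\<^esub> = \<zero>\<^bsub>B\<^esub>"
 by (simp add: eval_free_def free_alg_simps)

text \<open>Right multiplication by a single word is treated first, where concatenation becomes the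
  product of the values; linearity in the second factor does the rest.\<close>

lemma ev_mult:
 assumes "f \<in> carrier F" "h \<in> carrier F" shows "ev (f \<otimes>\<^bsub>F\<^esub> h) = ev f \<otimes>\<^bsub>B\<^esub> ev h"
proof -
 have *: "ev (f \<otimes>\<^bsub>F\<^esub> word K v) = ev f \<otimes>\<^bsub>B\<^esub> pr v" if "f \<in> carrier F" "v \<in> lists X" for f v
  using that(1)
 proof (induction rule: free_alg_induct)
  case zero then show ?case using that(2) word_in_free_alg[OF that(2)] pr_closed[OF that(2)] by (simp add: ev_zero)
 next
  case (add c u f)
  have "word K u \<otimes>\<^bsub>F\<^esub> word K v = word K (u @ v)" by (simp add: free_alg_simps conv_word fun_eq_iff)
  moreover have "word K u \<in> carrier F" "word K v \<in> carrier F" "word K (u @ v) \<in> carrier F"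
   "ev (word K u) = pr u" "ev (word K (u @ v)) = pr u \<otimes>\<^bsub>B\<^esub> pr v" "pr u \<in> carrier B" "pr v \<in> carrier B"
   using add(2) that(2) by (auto simp: word_in_free_alg ev_word pr_append pr_closed simp del: in_lists_conv_set foldr_append)
  moreover have "ev f \<in> carrier B" using add by (rule_tac ev_closed)
  ultimately show ?case using add(1,3,4)
   by (simp add: F.A.l_distr F.smult_mult_l ev_add ev_smult A.l_distr smult_mult_l)
 qed
 show ?thesis using assms(2)
 proof (induction rule: free_alg_induct)
  case zero then show ?case using assms ev_closed by (simp add: ev_zero)
 next
  case (add c u h)
  moreover have "word K u \<in> carrier F" "ev (word K u) = pr u" "pr u \<in> carrier B"
   "ev (f \<otimes>\<^bsub>F\<^esub> word K u) = ev f \<otimes>\<^bsub>B\<^esub> pr u"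
   using add(2) assms(1) * by (auto simp: word_in_free_alg ev_word pr_closed simp del: in_lists_conv_set)
  moreover have "ev h \<in> carrier B" "ev f \<in> carrier B" using add assms(1) by (auto intro: ev_closed)
  ultimately show ?case using add(1,3,4) assms(1)
   by (simp add: F.A.r_distr F.smult_mult_r ev_add ev_smult A.r_distr smult_mult_r)
 qed
qed

lemma ev_ring_hom: "ring_hom_ring F B ev"
 by (rule ring_hom_ringI2[OF F.A.ring_axioms A.ring_axioms])
  (auto simp: ring_hom_def ev_closed ev_mult ev_add ev_word free_alg_simps(2)[of X, symmetric],
  use ev_word[of "[]"] in \<open>simp add: free_alg_simps\<close>)

end

text \<open>Transport of structure along a surjection that respects all operations. It spares
  arguing with cosets directly, whose scalar multiplication is a union over representatives.\<close>

lemma kalg_hom_image: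
 fixes K (structure)
 assumes "kalg K F" and c: "carrier A = q ` carrier F"
  and ad: "!!f h. f \<in> carrier F ==> h \<in> carrier F ==> q f \<oplus>\<^bsub>A\<^esub> q h = q (f \<oplus>\<^bsub>F\<^esub> h)"
  and mu: "!!f h. f \<in> carrier F ==> h \<in> carrier F ==> q f \<otimes>\<^bsub>A\<^esub> q h = q (f \<otimes>\<^bsub>F\<^esub> h)"
  and sm: "!!a f. a \<in> carrier K ==> f \<in> carrier F ==> a \<odot>\<^bsub>A\<^esub> q f = q (a \<odot>\<^bsub>F\<^esub> f)"
  and z: "\<zero>\<^bsub>A\<^esub> = q \<zero>\<^bsub>F\<^esub>" and o: "\<one>\<^bsub>A\<^esub> = q \<one>\<^bsub>F\<^esub>"
 shows "kalg K A"
proof -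
 interpret F: kalg K F by fact
 have ab: "abelian_group A"
 proof (rule abelian_groupI)
  fix x assume "x \<in> carrier A"
  then obtain f where f: "f \<in> carrier F" "x = q f" using c by auto
  then have "q (\<ominus>\<^bsub>F\<^esub> f) \<oplus>\<^bsub>A\<^esub> x = \<zero>\<^bsub>A\<^esub>" by (simp add: ad z F.A.l_neg)
  then show "\<exists>y\<in>carrier A. y \<oplus>\<^bsub>A\<^esub> x = \<zero>\<^bsub>A\<^esub>" using f c by auto
 next
  fix x y assume "x \<in> carrier A" "y \<in> carrier A"
  then obtain f h where f: "f \<in> carrier F" "x = q f" "h \<in> carrier F" "y = q h" using c by auto
  then show "x \<oplus>\<^bsub>A\<^esub> y = y \<oplus>\<^bsub>A\<^esub> x" using F.A.a_comm[of f h] by (simp add: ad)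
 qed (auto simp: c ad z F.A.a_assoc)
 have "Group.monoid A"
  by (rule monoidI) (auto simp: c mu o F.A.m_assoc)
 with ab have "ring A"
  by (intro ringI) (auto simp: c ad mu F.A.l_distr F.A.r_distr)
 moreover have "module K A"
  by (rule moduleI[OF F.is_cring ab])
   (auto simp: c ad sm F.smult_l_distr F.smult_r_distr F.smult_assoc1)
 ultimately show ?thesis
  by (intro kalg.intro kalg_axioms.intro) (auto simp: c mu sm F.smult_mult_l F.smult_mult_r)
qed

definition ext_hom :: "('k, 'r) ring_scheme => ('k, 'v, 's) module_scheme => ('k, 'b, 't) module_scheme
  => ('v => 'b) => ('k, 'v) ext => 'b" where
 "ext_hom K V B \<phi> = (THE H. H \<in> alg_homs K (ext_alg K V) B \<and>
  (\<forall>v\<in>carrier V. H (ext_gen K V v) = \<phi> v))"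

section \<open>The exterior algebra\<close>

locale ext = module K V for K (structure) and V (structure)
begin

abbreviation "F \<equiv> free_alg K (carrier V)"
abbreviation "J \<equiv> ext_ideal K V"
abbreviation "A \<equiv> ext_alg K V"
abbreviation (input) plus_A (infixl "\<oplus>A" 65) where "x \<oplus>A y \<equiv> x \<oplus>\<^bsub>A\<^esub> y"
abbreviation (input) minus_A (infixl "\<ominus>A" 65) where "x \<ominus>A y \<equiv> x \<ominus>\<^bsub>A\<^esub> y"
abbreviation (input) times_A (infixl "\<otimes>A" 70) where "x \<otimes>A y \<equiv> x \<otimes>\<^bsub>A\<^esub> y"
abbreviation (input) scale_A (infixl "\<odot>A" 70) where "x \<odot>A y \<equiv> x \<odot>\<^bsub>A\<^esub> y"
abbreviation (input) neg_A ("\<ominus>A _" [81] 80) where "\<ominus>A x \<equiv> \<ominus>\<^bsub>A\<^esub> x"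
abbreviation (input) zero_A ("\<zero>A") where "\<zero>A \<equiv> \<zero>\<^bsub>A\<^esub>"
abbreviation (input) one_A ("\<one>A") where "\<one>A \<equiv> \<one>\<^bsub>A\<^esub>"
abbreviation (input) "CK \<equiv> carrier K"
abbreviation (input) "CV \<equiv> carrier V"
abbreviation (input) "CA \<equiv> carrier A"
abbreviation "\<gamma> \<equiv> ext_gen K V"
abbreviation "q f \<equiv> J +>\<^bsub>F\<^esub> f"

sublocale F: kalg K F by (rule free_alg_kalg)

abbreviation "rels \<equiv> {word K [u \<oplus>\<^bsub>V\<^esub> v] \<ominus>\<^bsub>F\<^esub> (word K [u] \<oplus>\<^bsub>F\<^esub> word K [v]) | u v.
        u : CV \<and> v : CV} \<union>
      {word K [a \<odot>\<^bsub>V\<^esub> v] \<ominus>\<^bsub>F\<^esub> a \<odot>\<^bsub>F\<^esub> word K [v] | a v.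
        a : CK \<and> v : CV} \<union>
      {word K [v, v] | v. v : CV}"

lemma rels_closed: "rels \<subseteq> carrier F"
 by (auto intro!: F.A.minus_closed F.A.a_closed F.smult_closed word_in_free_alg)

lemma J_def: "J = Idl\<^bsub>F\<^esub> rels"
 by (simp add: ext_ideal_def Let_def)

lemma J_ideal: "ideal J F"
 unfolding J_def by (rule F.A.genideal_ideal[OF rels_closed])

lemma rels_in_J: "rels \<subseteq> J"
 unfolding J_def by (rule F.A.genideal_self[OF rels_closed])

sublocale J: ideal J F by (rule J_ideal)

lemma q_eqI: "f \<in> carrier F ==> h \<in> carrier F ==> f \<ominus>\<^bsub>F\<^esub> h \<in> J ==> q f = q h"
 using F.A.quotient_eq_iff_same_a_r_cos[OF J_ideal] by blast

lemma ext_carrier: "CA = q ` carrier F"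
 unfolding ext_alg_def Let_def FactRing_def A_RCOSETS_def' by auto

lemma q_add: "f \<in> carrier F ==> h \<in> carrier F ==> q f \<oplus>A q h = q (f \<oplus>\<^bsub>F\<^esub> h)"
 unfolding ext_alg_def Let_def FactRing_def by (simp add: J.a_rcos_sum)

lemma q_mult: "f \<in> carrier F ==> h \<in> carrier F ==> q f \<otimes>A q h = q (f \<otimes>\<^bsub>F\<^esub> h)"
 unfolding ext_alg_def Let_def FactRing_def by (simp add: J.rcoset_mult_add)

lemma q_zero: "\<zero>A = q \<zero>\<^bsub>F\<^esub>"
 using F.A.a_rcos_zero[OF J_ideal J.zero_closed]
 unfolding ext_alg_def Let_def FactRing_def by simp

lemma q_one: "\<one>A = q \<one>\<^bsub>F\<^esub>"
 unfolding ext_alg_def Let_def FactRing_def by simp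

text \<open>A ring ideal absorbs scalars because the scalar \<open>a\<close> acts as multiplication
  by \<open>a\<close> times the unit of the free algebra.\<close>

lemma J_smult: "a : CK ==> j \<in> J ==> a \<odot>\<^bsub>F\<^esub> j \<in> J"
 using J.I_l_closed[of j "a \<odot>\<^bsub>F\<^esub> \<one>\<^bsub>F\<^esub>"] J.Icarr[of j] by (simp add: F.smult_mult_l)

text \<open>All representatives of a coset contribute the same coset to the union that defines the
  scalar multiple.\<close>

lemma q_smult:
 assumes "a : CK" "f \<in> carrier F" shows "a \<odot>A q f = q (a \<odot>\<^bsub>F\<^esub> f)"
proof -
 have "q (a \<odot>\<^bsub>F\<^esub> x) = q (a \<odot>\<^bsub>F\<^esub> f)" if "x \<in> q f" for x
 proof -
  obtain j where j: "j \<in> J" "x = j \<oplus>\<^bsub>F\<^esub> f" using \<open>x \<in> q f\<close> by (auto simp: a_r_coset_def')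
  then have jc: "j \<in> carrier F" "a \<odot>\<^bsub>F\<^esub> j \<in> carrier F" using J.Icarr assms by auto
  have "a \<odot>\<^bsub>F\<^esub> x \<ominus>\<^bsub>F\<^esub> a \<odot>\<^bsub>F\<^esub> f = a \<odot>\<^bsub>F\<^esub> j"
   using j jc assms by (simp add: F.smult_r_distr F.A.minus_eq F.A.a_assoc F.A.r_neg)
  then show ?thesis using j jc assms J_smult by (intro q_eqI) auto
 qed
 moreover have "f \<in> q f" using J.a_rcos_self assms by blast
 ultimately have "(\<Union>x\<in>q f. q (a \<odot>\<^bsub>F\<^esub> x)) = q (a \<odot>\<^bsub>F\<^esub> f)" by blast
 moreover have "a \<odot>A q f = (\<Union>x\<in>q f. q (a \<odot>\<^bsub>F\<^esub> x))"
  unfolding ext_alg_def Let_def by simp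
 ultimately show ?thesis by simp
qed

sublocale A: kalg K A
 by (rule kalg_hom_image[where q = "\<lambda>f. q f"])
  (simp_all add: F.kalg_axioms ext_carrier q_add q_mult q_smult q_zero q_one)

lemma word1: "v : CV ==> word K [v] \<in> carrier F"
 by (rule word_in_free_alg) simp

lemma word_in_F: "set u \<subseteq> CV ==> word K u \<in> carrier F"
 by (rule word_in_free_alg) auto

lemma gen_closed [simp, intro]: "v : CV ==> \<gamma> v : CA"
 unfolding ext_gen_def ext_carrier using word1 by blast

lemma word_mult: "word K u \<otimes>\<^bsub>F\<^esub> word K v = word K (u @ v)"
 by (simp add: free_alg_simps conv_word fun_eq_iff)

lemma gen_add: "u : CV ==> v : CV ==> \<gamma> (u \<oplus>\<^bsub>V\<^esub> v) = \<gamma> u \<oplus>A \<gamma> v"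
 unfolding ext_gen_def
 by (simp add: q_add word1) (intro q_eqI F.A.a_closed word1 rels_in_J[THEN subsetD]; blast)

lemma gen_smult: "a : CK ==> v : CV ==> \<gamma> (a \<odot>\<^bsub>V\<^esub> v) = a \<odot>A \<gamma> v"
 unfolding ext_gen_def
 by (simp add: q_smult word1) (intro q_eqI F.smult_closed word1 rels_in_J[THEN subsetD] smult_closed; blast)

lemma gen_square: "v : CV ==> \<gamma> v \<otimes>A \<gamma> v = \<zero>A"
proof -
 assume v: "v : CV"
 then have "word K [v, v] \<in> J" by (intro rels_in_J[THEN subsetD]) auto
 then have "q (word K [v, v]) = q \<zero>\<^bsub>F\<^esub>"
  using F.A.a_rcos_zero[OF J_ideal] J.zero_closed by simp
 with v show ?thesis by (simp add: ext_gen_def q_mult word1 word_mult q_zero)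
qed

lemma ext_prod_Nil [simp]: "ext_prod K V [] = \<one>A"
 and ext_prod_Cons [simp]: "ext_prod K V (v # vs) = \<gamma> v \<otimes>A ext_prod K V vs"
 by (simp_all add: ext_prod_def)

lemma ext_prod_word: "set vs \<subseteq> CV ==> ext_prod K V vs = q (word K vs)"
proof (induction vs)
 case Nil then show ?case by (simp add: q_one free_alg_simps)
next
 case (Cons v vs)
 then show ?case
  by (simp add: ext_gen_def q_mult word1 word_in_F word_mult)
qed

lemma ext_prod_closed: "set vs \<subseteq> CV ==> ext_prod K V vs : CA"
 by (induction vs) auto

text \<open>The exterior algebra is spanned by products of vectors, and these are built from the
  unit by left multiplication. Zero is reached as a scalar multiple of the unit.\<close>

lemma ext_induct [consumes 1, case_names one gen add smult]:
 assumes "x : CA" and P1: "P \<one>A"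
  and Pg: "!!v y. v : CV ==> y : CA ==> P y ==> P (\<gamma> v \<otimes>A y)"
  and Pa: "!!x y. x : CA ==> y : CA ==> P x ==> P y ==> P (x \<oplus>A y)"
  and Ps: "!!a x. a : CK ==> x : CA ==> P x ==> P (a \<odot>A x)"
 shows "P x"
proof -
 obtain f where f: "f \<in> carrier F" "x = q f" using assms(1) ext_carrier by auto
 have w: "set vs \<subseteq> CV ==> P (ext_prod K V vs)" for vs
  by (induction vs) (use P1 Pg ext_prod_closed in auto)
 have "P \<zero>A" using Ps[of \<zero> "\<one>A"] P1 by simp
 from f(1) have "P (q f)"
 proof (induction rule: free_alg_induct)
  case zero then show ?case using \<open>P \<zero>A\<close> by (simp add: q_zero)
 next
  case (add c u f)
  then have u: "set u \<subseteq> CV" "word K u \<in> carrier F" using word_in_F by auto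
  then have "q (c \<odot>\<^bsub>F\<^esub> word K u \<oplus>\<^bsub>F\<^esub> f) = c \<odot>A ext_prod K V u \<oplus>A q f"
   using add by (simp add: q_add q_smult ext_prod_word)
  moreover have "q f : CA" using add ext_carrier by auto
  ultimately show ?case using add u ext_prod_closed[of u] by (auto intro!: Pa Ps w)
 qed
 then show ?thesis using f by simp
qed

lemma ext_hom_unique:
 assumes "kalg K B" "H \<in> alg_homs K A B" "H' \<in> alg_homs K A B" "!!v. v : CV ==> H (\<gamma> v) = H' (\<gamma> v)"
 shows "H = H'"
proof (rule lin_maps_eqI)
 show l: "H \<in> lin_maps K A B" "H' \<in> lin_maps K A B" using assms by (auto simp: alg_homs_def)
 have r: "H \<in> ring_hom A B" "H' \<in> ring_hom A B" using assms by (auto simp: alg_homs_def)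
 show "H x = H' x" if "x : CA" for x
  using that by (induction rule: ext_induct)
   (use assms(4) in \<open>auto simp: ring_hom_one[OF r(1)] ring_hom_one[OF r(2)] ring_hom_mult[OF r(1)]
    ring_hom_mult[OF r(2)] lin_maps_add[OF l(1)] lin_maps_add[OF l(2)]
    lin_maps_smult[OF l(1)] lin_maps_smult[OF l(2)]\<close>)
qed

text \<open>Evaluation on the free algebra kills the three kinds of relations. Its kernel is an
  ideal, hence contains the ideal they generate, and evaluation descends to cosets.\<close>

lemma ext_universal:
 fixes \<phi> :: "'c => 'e"
 assumes "kalg K B" and cl: "!!v. v : CV ==> \<phi> v \<in> carrier B"
  and ad: "!!u v. u : CV ==> v : CV ==> \<phi> (u \<oplus>\<^bsub>V\<^esub> v) = \<phi> u \<oplus>\<^bsub>B\<^esub> \<phi> v"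
  and sm: "!!a v. a : CK ==> v : CV ==> \<phi> (a \<odot>\<^bsub>V\<^esub> v) = a \<odot>\<^bsub>B\<^esub> \<phi> v"
  and sq: "!!v. v : CV ==> \<phi> v \<otimes>\<^bsub>B\<^esub> \<phi> v = \<zero>\<^bsub>B\<^esub>"
 shows "\<exists>H. H \<in> alg_homs K A B \<and> (\<forall>v\<in>CV. H (\<gamma> v) = \<phi> v)"
proof -
 interpret B: kalg K B by fact
 interpret E: free_eval K B "CV" \<phi>
  by (intro free_eval.intro free_eval_axioms.intro) (use assms in auto)
 interpret ev: ring_hom_ring F B E.ev by (rule E.ev_ring_hom)
 have w: "word K [v] \<in> carrier F" "E.ev (word K [v]) = \<phi> v" if "v : CV" for v
  using that E.ev_word[of "[v]"] word1 cl by auto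
 have w2: "E.ev (word K [v, v]) = \<zero>\<^bsub>B\<^esub>" if "v : CV" for v
  using that E.ev_word[of "[v,v]"] cl sq by auto
 have mem: "word K [u \<oplus>\<^bsub>V\<^esub> v] \<in> carrier F" if "u : CV" "v : CV" for u v
  using that word1 by blast
 have ev0: "E.ev x = \<zero>\<^bsub>B\<^esub>" if "x \<in> rels" for x
  using that
 proof (elim UnE CollectE exE conjE)
  fix u v assume *: "x = word K [u \<oplus>\<^bsub>V\<^esub> v] \<ominus>\<^bsub>F\<^esub> (word K [u] \<oplus>\<^bsub>F\<^esub> word K [v])" "u : CV" "v : CV"
  then have "u \<oplus>\<^bsub>V\<^esub> v : CV" by simp
  with * w cl show ?thesis by (simp add: ad F.A.minus_eq B.A.r_neg)
 next
  fix a v assume *: "x = word K [a \<odot>\<^bsub>V\<^esub> v] \<ominus>\<^bsub>F\<^esub> a \<odot>\<^bsub>F\<^esub> word K [v]" "a : CK" "v : CV"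
  then have "a \<odot>\<^bsub>V\<^esub> v : CV" by simp
  with * w cl show ?thesis by (simp add: sm F.A.minus_eq B.A.r_neg E.ev_smult)
 next
  fix v assume "x = word K [v, v]" "v : CV"
  with w2 show ?thesis by simp
 qed
 have "rels \<subseteq> a_kernel F B E.ev"
 proof
  fix x assume x: "x \<in> rels"
  from ev0[OF x] subsetD[OF rels_closed x] show "x \<in> a_kernel F B E.ev"
   unfolding a_kernel_def' by blast
 qed
 then have JK: "J \<subseteq> a_kernel F B E.ev"
  unfolding J_def by (rule F.A.genideal_minimal[OF ev.kernel_is_ideal])
 have img: "E.ev ` q f = {E.ev f}" if f: "f \<in> carrier F" for f
 proof -
  have "E.ev x = E.ev f" if "x \<in> q f" for x
  proof -
   obtain j where j: "j \<in> J" "x = j \<oplus>\<^bsub>F\<^esub> f" using \<open>x \<in> q f\<close> by (auto simp: a_r_coset_def')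
   from JK j(1) have "j \<in> a_kernel F B E.ev" by blast
   then have "E.ev j = \<zero>\<^bsub>B\<^esub>" "j \<in> carrier F" unfolding a_kernel_def' by blast+
   then show ?thesis using j f by simp
  qed
  moreover have "f \<in> q f" using J.a_rcos_self f by blast
  ultimately show ?thesis by blast
 qed
 \<comment> \<open>Evaluation is constant on a coset, so the image of the coset is a singleton and
   \<open>the_elem\<close> reads off the value.\<close>
 define H where "H = (\<lambda>X\<in>CA. the_elem (E.ev ` X))"
 have H: "H (q f) = E.ev f" if "f \<in> carrier F" for f
  using imageI[OF that, of "\<lambda>f. q f"] img[OF that] by (simp add: H_def ext_carrier)
 have Aq: thesis if "x : CA" "!!f. f \<in> carrier F ==> x = q f ==> thesis" for x thesis
  using that(1) by (auto simp only: ext_carrier intro: that(2))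
 have "H \<in> alg_homs K A B"
  unfolding alg_homs_def
 proof
  show "H \<in> lin_maps K A B"
  proof (rule lin_mapsI)
   show "H x = undefined" if "x \<notin> CA" for x using that by (simp add: H_def)
   show "H x \<in> carrier B" if x: "x : CA" for x
    using x E.ev_closed H by (elim Aq) simp
   show "H (x \<oplus>A y) = H x \<oplus>\<^bsub>B\<^esub> H y" if "x : CA" "y : CA" for x y
    using that by (elim Aq) (simp add: q_add H E.ev_add)
   show "H (a \<odot>A x) = a \<odot>\<^bsub>B\<^esub> H x" if "a : CK" "x : CA" for a x
    using that by (elim Aq) (simp add: q_smult H E.ev_smult)
  qed
  show "H \<in> ring_hom A B"
  proof (rule ring_hom_memI)
   show "H x \<in> carrier B" if x: "x : CA" for x
    using x E.ev_closed H by (elim Aq) simp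
   show "H (x \<oplus>A y) = H x \<oplus>\<^bsub>B\<^esub> H y" if "x : CA" "y : CA" for x y
    using that by (elim Aq) (simp add: q_add H E.ev_add)
   show "H (x \<otimes>A y) = H x \<otimes>\<^bsub>B\<^esub> H y" if "x : CA" "y : CA" for x y
    using that by (elim Aq) (simp add: q_mult H E.ev_mult)
   show "H \<one>A = \<one>\<^bsub>B\<^esub>" by (simp add: q_one H)
  qed
 qed
 moreover have "H (\<gamma> v) = \<phi> v" if "v : CV" for v
  using w[OF that] H by (simp add: ext_gen_def)
 ultimately show ?thesis by blast
qed

lemma ext_hom:
 fixes \<phi> :: "'c => 'e"
 assumes "kalg K B" and "!!v. v : CV ==> \<phi> v \<in> carrier B"
  and "!!u v. u : CV ==> v : CV ==> \<phi> (u \<oplus>\<^bsub>V\<^esub> v) = \<phi> u \<oplus>\<^bsub>B\<^esub> \<phi> v"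
  and "!!a v. a : CK ==> v : CV ==> \<phi> (a \<odot>\<^bsub>V\<^esub> v) = a \<odot>\<^bsub>B\<^esub> \<phi> v"
  and "!!v. v : CV ==> \<phi> v \<otimes>\<^bsub>B\<^esub> \<phi> v = \<zero>\<^bsub>B\<^esub>"
 shows ext_hom_lin: "ext_hom K V B \<phi> \<in> lin_maps K A B"
  and ext_hom_ring: "ext_hom K V B \<phi> \<in> ring_hom A B"
  and ext_hom_gen: "v : CV ==> ext_hom K V B \<phi> (\<gamma> v) = \<phi> v"
proof -
 obtain H where H: "H \<in> alg_homs K A B \<and> (\<forall>v\<in>CV. H (\<gamma> v) = \<phi> v)"
  using ext_universal[of B \<phi>, OF assms] by blast
 have "\<exists>!H. H \<in> alg_homs K A B \<and> (\<forall>v\<in>CV. H (\<gamma> v) = \<phi> v)"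
  by (rule ex1I[of _ H]) (use H ext_hom_unique[OF assms(1)] in auto)
 from theI'[OF this] show "ext_hom K V B \<phi> \<in> lin_maps K A B"
  "ext_hom K V B \<phi> \<in> ring_hom A B" "v : CV ==> ext_hom K V B \<phi> (\<gamma> v) = \<phi> v"
  unfolding ext_hom_def alg_homs_def by auto
qed

text \<open>Polarization of \<open>gen_square\<close> at the sum of \<open>u\<close> and
  \<open>v\<close>.\<close>

lemma gen_anticomm:
 assumes "u : CV" "v : CV" shows "\<gamma> u \<otimes>A \<gamma> v = \<ominus>A (\<gamma> v \<otimes>A \<gamma> u)"
proof -
 have "(\<gamma> u \<oplus>A \<gamma> v) \<otimes>A (\<gamma> u \<oplus>A \<gamma> v) = \<zero>A"
  using gen_square[of "u \<oplus>\<^bsub>V\<^esub> v"] assms by (simp add: gen_add)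
 then have "\<gamma> u \<otimes>A \<gamma> v \<oplus>A \<gamma> v \<otimes>A \<gamma> u = \<zero>A"
  using assms by (simp add: A.A.l_distr A.A.r_distr gen_square A.A.a_ac)
 then show ?thesis using assms by (simp add: A.A.add.inv_unique' A.A.minus_equality)
qed

lemma gen_zero [simp]: "\<gamma> \<zero>\<^bsub>V\<^esub> = \<zero>A"
 using gen_smult[of \<zero> "\<zero>\<^bsub>V\<^esub>"] by simp

end

lemma (in module) mspan_mono: "S \<subseteq> S' ==> mspan R M S \<subseteq> mspan R M S'"
 unfolding mspan_def by blast

section \<open>Derivations and antiderivations\<close>

text \<open>Upper triangular two by two matrices over \<open>A\<close>: the triple
  \<open>(x, y, z)\<close> has diagonal \<open>x\<close>, \<open>z\<close> and corner
  \<open>y\<close>. A homomorphism into this algebra amounts to two homomorphisms into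
  \<open>A\<close> and a skew derivation relative to them.\<close>

definition tri_alg :: "('k, 'b, 's) module_scheme => ('k, 'b \<times> 'b \<times> 'b) module" where
 "tri_alg A = \<lparr>carrier = carrier A \<times> carrier A \<times> carrier A,
  mult = (\<lambda>(x, y, z) (x', y', z'). (x \<otimes>\<^bsub>A\<^esub> x', x \<otimes>\<^bsub>A\<^esub> y' \<oplus>\<^bsub>A\<^esub> y \<otimes>\<^bsub>A\<^esub> z', z \<otimes>\<^bsub>A\<^esub> z')),
  one = (\<one>\<^bsub>A\<^esub>, \<zero>\<^bsub>A\<^esub>, \<one>\<^bsub>A\<^esub>), zero = (\<zero>\<^bsub>A\<^esub>, \<zero>\<^bsub>A\<^esub>, \<zero>\<^bsub>A\<^esub>),
  add = (\<lambda>(x, y, z) (x', y', z'). (x \<oplus>\<^bsub>A\<^esub> x', y \<oplus>\<^bsub>A\<^esub> y', z \<oplus>\<^bsub>A\<^esub> z')),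
  smult = (\<lambda>a (x, y, z). (a \<odot>\<^bsub>A\<^esub> x, a \<odot>\<^bsub>A\<^esub> y, a \<odot>\<^bsub>A\<^esub> z))\<rparr>"

lemma (in kalg) tri_alg_kalg: "kalg K (tri_alg A)"
proof -
 have ab: "abelian_group (tri_alg A)"
 proof (rule abelian_groupI)
  fix x assume "x \<in> carrier (tri_alg A)"
  then obtain a b c where x: "x = (a, b, c)" "a \<in> carrier A" "b \<in> carrier A" "c \<in> carrier A"
   by (auto simp: tri_alg_def)
  then show "\<exists>y\<in>carrier (tri_alg A). y \<oplus>\<^bsub>tri_alg A\<^esub> x = \<zero>\<^bsub>tri_alg A\<^esub>"
   by (intro bexI[of _ "(\<ominus>\<^bsub>A\<^esub> a, \<ominus>\<^bsub>A\<^esub> b, \<ominus>\<^bsub>A\<^esub> c)"]) (simp_all add: tri_alg_def A.l_neg)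
 qed (auto simp: tri_alg_def A.a_assoc intro: A.a_comm)
 have "Group.monoid (tri_alg A)"
  by (rule monoidI) (auto simp: tri_alg_def A.m_assoc A.l_distr A.r_distr A.a_assoc)
 with ab have "ring (tri_alg A)"
  by (intro ringI) (auto simp: tri_alg_def A.l_distr A.r_distr A.a_ac)
 moreover have "module K (tri_alg A)"
  by (rule moduleI[OF is_cring ab])
   (auto simp: tri_alg_def smult_l_distr smult_r_distr smult_assoc1)
 ultimately show ?thesis
  by (intro kalg.intro kalg_axioms.intro)
   (auto simp: tri_alg_def smult_mult_l smult_mult_r smult_r_distr)
qed

lemma (in cring) regular_module_kalg: "kalg R (regular_module R)"
proof -
 interpret M: module R "regular_module R" by (rule regular_module_module)
 have "Group.monoid (regular_module R)"
  by (rule monoidI) (auto simp: regular_module_def m_assoc)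
 then have "ring (regular_module R)"
  by (intro ringI M.abelian_group_axioms) (auto simp: regular_module_def l_distr r_distr)
 then show ?thesis
  by (intro kalg.intro kalg_axioms.intro M.module_axioms) (auto simp: regular_module_def m_assoc m_lcomm)
qed

context ext
begin

text \<open>The grading involution, acting on degree \<open>k\<close> by the parity of
  \<open>k\<close>. With it the sign rules hold for all elements, not only for homogeneous
  ones.\<close>

definition alpha :: "('a, 'c) ext => ('a, 'c) ext" where
 "alpha = ext_hom K V A (\<lambda>v. \<ominus>A \<gamma> v)"

text \<open>The augmentation. It recovers the scalar from an element of degree 0 and vanishes on
  every multiple of a vector.\<close>

definition counit :: "('a, 'c) ext => 'a" where
 "counit = ext_hom K V (regular_module K) (\<lambda>v. \<zero>)"

lemma neg_gen_hom:
 assumes "v : CV"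
 shows "\<ominus>A \<gamma> v : CA" "\<ominus>A \<gamma> v \<otimes>A \<ominus>A \<gamma> v = \<zero>A"
  "u : CV ==> \<ominus>A \<gamma> (u \<oplus>\<^bsub>V\<^esub> v) = \<ominus>A \<gamma> u \<oplus>A \<ominus>A \<gamma> v"
  "a : CK ==> \<ominus>A \<gamma> (a \<odot>\<^bsub>V\<^esub> v) = a \<odot>A (\<ominus>A \<gamma> v)"
 using assms by (simp_all add: A.A.l_minus A.A.r_minus gen_square gen_add gen_smult A.A.minus_add
   A.smult_r_minus)

lemma alpha_hom:
 shows alpha_lin: "alpha \<in> lin_maps K A A" and alpha_ring: "alpha \<in> ring_hom A A"
  and alpha_gen: "v : CV ==> alpha (\<gamma> v) = \<ominus>A \<gamma> v"
 unfolding alpha_def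
 by (rule ext_hom[OF A.kalg_axioms]; simp add: neg_gen_hom)+

lemma counit_hom:
 shows counit_lin: "counit \<in> lin_maps K A (regular_module K)"
  and counit_ring: "counit \<in> ring_hom A (regular_module K)"
  and counit_gen: "v : CV ==> counit (\<gamma> v) = \<zero>"
 unfolding counit_def
 by (rule ext_hom[OF regular_module_kalg]; simp add: regular_module_def)+

lemma alpha_simps [simp]:
 shows "x : CA ==> alpha x : CA" "alpha \<one>A = \<one>A" "alpha \<zero>A = \<zero>A"
  "x : CA ==> y : CA ==> alpha (x \<oplus>A y) = alpha x \<oplus>A alpha y"
  "x : CA ==> y : CA ==> alpha (x \<otimes>A y) = alpha x \<otimes>A alpha y"
  "a : CK ==> x : CA ==> alpha (a \<odot>A x) = a \<odot>A alpha x"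
  "x : CA ==> alpha (\<ominus>A x) = \<ominus>A alpha x"
 using lin_maps_closed[OF alpha_lin] lin_maps_add[OF alpha_lin] lin_maps_smult[OF alpha_lin]
  ring_hom_mult[OF alpha_ring] ring_hom_one[OF alpha_ring]
  lin_maps_hom[OF A.A.is_abelian_group A.A.is_abelian_group alpha_lin] by auto

lemma counit_simps [simp]:
 shows "x : CA ==> counit x : CK" "counit \<one>A = \<one>" "counit \<zero>A = \<zero>"
  "x : CA ==> y : CA ==> counit (x \<oplus>A y) = counit x \<oplus> counit y"
  "x : CA ==> y : CA ==> counit (x \<otimes>A y) = counit x \<otimes> counit y"
  "a : CK ==> x : CA ==> counit (a \<odot>A x) = a \<otimes> counit x"
  "x : CA ==> counit (\<ominus>A x) = \<ominus> counit x"
  "v : CV ==> y : CA ==> counit (\<gamma> v \<otimes>A y) = \<zero>"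
proof -
 interpret Q: kalg K "regular_module K" by (rule regular_module_kalg)
 have m: "\<ominus>\<^bsub>regular_module K\<^esub> x = \<ominus> x" if "x : CK" for x
  by (rule Q.A.minus_equality) (use that in \<open>simp_all add: regular_module_def R.l_neg\<close>)
 show cl: "x : CA ==> counit x : CK" for x
  using lin_maps_closed[OF counit_lin, of x] by (simp add: regular_module_def)
 show "counit \<one>A = \<one>" "counit \<zero>A = \<zero>"
  "x : CA ==> y : CA ==> counit (x \<oplus>A y) = counit x \<oplus> counit y"
  "a : CK ==> x : CA ==> counit (a \<odot>A x) = a \<otimes> counit x"
  using lin_maps_add[OF counit_lin] lin_maps_smult[OF counit_lin] ring_hom_one[OF counit_ring]
  lin_maps_zero[OF A.A.is_abelian_group Q.A.is_abelian_group counit_lin]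
  by (auto simp: regular_module_def)
 show mu: "x : CA ==> y : CA ==> counit (x \<otimes>A y) = counit x \<otimes> counit y" for x y
  using ring_hom_mult[OF counit_ring] by (simp add: regular_module_def)
 show "x : CA ==> counit (\<ominus>A x) = \<ominus> counit x"
  using lin_maps_neg[OF A.A.is_abelian_group Q.A.is_abelian_group counit_lin, of x] m cl by simp
 show "v : CV ==> y : CA ==> counit (\<gamma> v \<otimes>A y) = \<zero>"
  using mu[of "\<gamma> v" y] counit_gen[of v] cl by simp
qed

subsection \<open>Exterior powers\<close>

lemma ext_pow_of_gens: "U \<subseteq> CV ==> {ext_prod K V vs |vs. set vs \<subseteq> U \<and> length vs = k} \<subseteq> CA"
 using ext_prod_closed by blast

lemma ext_pow_of_submodule: "U \<subseteq> CV ==> submodule (ext_pow_of K V U k) K A"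
 unfolding ext_pow_of_def by (rule A.mspan_submodule[OF ext_pow_of_gens])

lemma ext_pow_of_closed: "U \<subseteq> CV ==> x \<in> ext_pow_of K V U k ==> x : CA"
 using A.submoduleE(1)[OF ext_pow_of_submodule] by blast

lemma ext_pow_closed: "x \<in> ext_pow K V k ==> x : CA"
 unfolding ext_pow_def by (rule ext_pow_of_closed[OF subset_refl])

lemma ext_pow_of_ops:
 assumes "U \<subseteq> CV"
 shows "\<zero>A \<in> ext_pow_of K V U k"
  "x \<in> ext_pow_of K V U k ==> y \<in> ext_pow_of K V U k ==> x \<oplus>A y \<in> ext_pow_of K V U k"
  "x \<in> ext_pow_of K V U k ==> y \<in> ext_pow_of K V U k ==> x \<ominus>A y \<in> ext_pow_of K V U k"
  "x \<in> ext_pow_of K V U k ==> \<ominus>A x \<in> ext_pow_of K V U k"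
  "a : CK ==> x \<in> ext_pow_of K V U k ==> a \<odot>A x \<in> ext_pow_of K V U k"
 using A.submoduleE(3-5)[OF ext_pow_of_submodule[OF assms]] A.submodule_zero[OF ext_pow_of_submodule[OF assms]]
  A.submodule_minus[OF ext_pow_of_submodule[OF assms]] by auto

lemmas ext_pow_ops [simp, intro] = ext_pow_of_ops[OF subset_refl, folded ext_pow_def]

lemma ext_pow_of_mono: "U \<subseteq> U' ==> ext_pow_of K V U k \<subseteq> ext_pow_of K V U' k"
proof -
 assume "U \<subseteq> U'"
 then have "{ext_prod K V vs |vs. set vs \<subseteq> U \<and> length vs = k}
   \<subseteq> {ext_prod K V vs |vs. set vs \<subseteq> U' \<and> length vs = k}" by blast
 then show ?thesis unfolding ext_pow_of_def by (rule A.mspan_mono)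
qed

lemma ext_pow_of_sub: "U \<subseteq> CV ==> ext_pow_of K V U k \<subseteq> ext_pow K V k"
 unfolding ext_pow_def by (rule ext_pow_of_mono)

lemma ext_pow_of_induct [consumes 2, case_names zero prod add smult]:
 assumes "x \<in> ext_pow_of K V U k" "U \<subseteq> CV" and "P \<zero>A"
  and "!!vs. set vs \<subseteq> U ==> length vs = k ==> P (ext_prod K V vs)"
  and "!!x y. x \<in> ext_pow_of K V U k ==> y \<in> ext_pow_of K V U k ==> x : CA ==> y : CA ==>
   P x ==> P y ==> P (x \<oplus>A y)"
  and "!!a x. a : CK ==> x \<in> ext_pow_of K V U k ==> x : CA ==> P x ==> P (a \<odot>A x)"
 shows "P x"
 using assms(1)[unfolded ext_pow_of_def] ext_pow_of_gens[OF assms(2)]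
 by (induction rule: A.mspan_induct) (use assms(3-) in \<open>auto simp flip: ext_pow_of_def\<close>)

lemma ext_prod_in: "set vs \<subseteq> U ==> ext_prod K V vs \<in> ext_pow_of K V U (length vs)"
 unfolding ext_pow_of_def by (rule A.mspan_incl[THEN subsetD]) blast

lemma one_in_pow: "\<one>A \<in> ext_pow_of K V U 0"
 using ext_prod_in[of "[]"] by simp

lemma ext_pow_of_0:
 assumes "x \<in> ext_pow_of K V U 0" "U \<subseteq> CV"
 obtains c where "c : CK" "x = c \<odot>A \<one>A"
proof -
 from assms have "\<exists>c\<in>CK. x = c \<odot>A \<one>A"
 proof (induction rule: ext_pow_of_induct)
  case zero show ?case by (rule bexI[of _ \<zero>]) auto
 next
  case (prod vs) then show ?case by (intro bexI[of _ \<one>]) auto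
 next
  case (add x y)
  then obtain c d where "c : CK" "x = c \<odot>A \<one>A" "d : CK" "y = d \<odot>A \<one>A" by blast
  then show ?case by (intro bexI[of _ "c \<oplus> d"]) (auto simp: A.smult_l_distr)
 next
  case (smult a x)
  then obtain c where "c : CK" "x = c \<odot>A \<one>A" by blast
  with smult show ?case by (intro bexI[of _ "a \<otimes> c"]) (auto simp: A.smult_assoc1)
 qed
 with that show thesis by blast
qed

lemma ext_pow_0: "x \<in> ext_pow K V 0 ==> x = counit x \<odot>A \<one>A"
 unfolding ext_pow_def by (erule ext_pow_of_0) auto

text \<open>The augmentation is left inverse to \<open>c \<mapsto> c 1\<close>, so the scalars embed
  in the exterior algebra and the description has only one solution.\<close>

lemma ext_to_scalar_eq: "x \<in> ext_pow K V 0 ==> ext_to_scalar K V x = counit x"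
 unfolding ext_to_scalar_def
 by (rule the_equality) (use ext_pow_0 ext_pow_closed in force)+

lemma ext_pow_of_1:
 assumes "x \<in> ext_pow_of K V U 1" "submodule U K V"
 obtains u where "u \<in> U" "x = \<gamma> u"
proof -
 have U: "U \<subseteq> CV" using submoduleE(1)[OF assms(2)] .
 from assms(1) U have "\<exists>u\<in>U. x = \<gamma> u"
 proof (induction rule: ext_pow_of_induct)
  case zero show ?case by (rule bexI[of _ "\<zero>\<^bsub>V\<^esub>"]) (use submodule_zero[OF assms(2)] in auto)
 next
  case (prod vs)
  then obtain v where "vs = [v]" by (auto simp: length_Suc_conv)
  with prod U show ?case by (intro bexI[of _ v]) auto
 next
  case (add x y)
  then obtain u v where "u \<in> U" "x = \<gamma> u" "v \<in> U" "y = \<gamma> v" by blast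
  with U submoduleE(5)[OF assms(2)] show ?case by (intro bexI[of _ "u \<oplus>\<^bsub>V\<^esub> v"]) (auto simp: gen_add subset_iff)
 next
  case (smult a x)
  then obtain u where "u \<in> U" "x = \<gamma> u" by blast
  with smult U submoduleE(4)[OF assms(2)] show ?case by (intro bexI[of _ "a \<odot>\<^bsub>V\<^esub> u"]) (auto simp: gen_smult subset_iff)
 qed
 with that show thesis by blast
qed

lemma ext_pow_1:
 assumes "x \<in> ext_pow K V 1" obtains v where "v : CV" "x = \<gamma> v"
 using ext_pow_of_1[OF assms[unfolded ext_pow_def] carrier_is_submodule] .

lemma gen_in_pow_of: "u \<in> U ==> U \<subseteq> CV ==> \<gamma> u \<in> ext_pow_of K V U 1"
 using ext_prod_in[of "[u]" U] by (auto simp: subset_iff)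

lemma gen_in_pow [simp, intro]: "v : CV ==> \<gamma> v \<in> ext_pow K V 1"
 unfolding ext_pow_def by (rule gen_in_pow_of) auto

lemma gen_mult_pow_of:
 assumes "x \<in> ext_pow_of K V U k" "u \<in> U" "U \<subseteq> CV"
 shows "\<gamma> u \<otimes>A x \<in> ext_pow_of K V U (Suc k)"
proof -
 have u: "\<gamma> u : CA" using assms by auto
 from assms(1,3) show ?thesis
 proof (induction rule: ext_pow_of_induct)
  case (prod vs) then show ?case using ext_prod_in[of "u # vs" U] assms by auto
 qed (use u assms ext_pow_of_ops[OF assms(3)] in \<open>auto simp: A.A.r_distr A.smult_mult_r\<close>)
qed

lemma gen_mult_pow: "x \<in> ext_pow K V k ==> v : CV ==> \<gamma> v \<otimes>A x \<in> ext_pow K V (Suc k)"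
 unfolding ext_pow_def by (rule gen_mult_pow_of) auto

lemma pow_of_mult:
 assumes x: "x \<in> ext_pow_of K V U k" and y: "y \<in> ext_pow_of K V U l" and U: "U \<subseteq> CV"
 shows "x \<otimes>A y \<in> ext_pow_of K V U (k + l)"
proof -
 note yc = ext_pow_of_closed[OF U y]
 have *: "ext_prod K V vs \<otimes>A y \<in> ext_pow_of K V U (length vs + l)" if "set vs \<subseteq> U" for vs
  using that
 proof (induction vs)
  case (Cons v vs)
  then have "\<gamma> v \<otimes>A (ext_prod K V vs \<otimes>A y) \<in> ext_pow_of K V U (Suc (length vs + l))"
   using U by (intro gen_mult_pow_of) auto
  moreover have "v : CV" "ext_prod K V vs : CA" using Cons.prems U ext_prod_closed by auto
  ultimately show ?case using yc by (simp add: A.A.m_assoc)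
 qed (use y yc in simp)
 from x U show ?thesis
  by (induction rule: ext_pow_of_induct)
   (use * yc ext_pow_of_ops[OF U] in \<open>auto simp: A.A.l_distr A.smult_mult_l\<close>)
qed

lemma pow_mult: "x \<in> ext_pow K V k ==> y \<in> ext_pow K V l ==> x \<otimes>A y \<in> ext_pow K V (k + l)"
 unfolding ext_pow_def by (rule pow_of_mult) auto

text \<open>Peels off a leading vector, for statements in degree \<open>k + 1\<close> that rest on
  degree \<open>k\<close>.\<close>

lemma ext_pow_of_Suc_induct [consumes 2, case_names zero gen add smult]:
 assumes "x \<in> ext_pow_of K V U (Suc k)" "U \<subseteq> CV" and "P \<zero>A"
  and "!!u y. u \<in> U ==> y \<in> ext_pow_of K V U k ==> P (\<gamma> u \<otimes>A y)"
  and "!!x y. x \<in> ext_pow_of K V U (Suc k) ==> y \<in> ext_pow_of K V U (Suc k) ==> x : CA ==> y : CA ==>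
   P x ==> P y ==> P (x \<oplus>A y)"
  and "!!a x. a : CK ==> x \<in> ext_pow_of K V U (Suc k) ==> x : CA ==> P x ==> P (a \<odot>A x)"
 shows "P x"
 using assms(1,2)
proof (induction rule: ext_pow_of_induct)
 case (prod vs)
 then obtain v us where "vs = v # us" "length us = k" by (auto simp: length_Suc_conv)
 with prod assms(4) ext_prod_in[of us U] show ?case by auto
qed (use assms(3,5,6) in auto)

lemmas ext_pow_induct = ext_pow_of_induct[OF _ subset_refl, folded ext_pow_def, consumes 1, case_names zero prod add smult]
lemmas ext_pow_Suc_induct = ext_pow_of_Suc_induct[OF _ subset_refl, folded ext_pow_def, consumes 1, case_names zero gen add smult]

lemma alpha_pow: "x \<in> ext_pow K V k ==> alpha x = (if even k then x else \<ominus>A x)"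
proof (induction k arbitrary: x)
 case 0
 have "counit x : CK" using 0 ext_pow_closed by simp
 then have "alpha (counit x \<odot>A \<one>A) = counit x \<odot>A \<one>A" by simp
 with ext_pow_0[OF 0] show ?case by auto
next
 case (Suc k)
 from Suc.prems show ?case
 proof (induction rule: ext_pow_Suc_induct)
  case (gen u y)
  then show ?case using Suc.IH[OF gen(2)] ext_pow_closed[OF gen(2)]
   by (simp add: alpha_gen A.A.l_minus A.A.r_minus)
 qed (auto simp: A.A.minus_add A.smult_r_minus)
qed

text \<open>The sign depends on the degree of \<open>x\<close> and is absorbed into
  \<open>alpha\<close>, so \<open>x\<close> may be arbitrary.\<close>

lemma gen_commute: "x : CA ==> v : CV ==> \<gamma> v \<otimes>A x = alpha x \<otimes>A \<gamma> v"
proof (induction rule: ext_induct)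
 case (gen u y)
 have "\<gamma> v \<otimes>A (\<gamma> u \<otimes>A y) = \<ominus>A (\<gamma> u \<otimes>A (\<gamma> v \<otimes>A y))"
  using gen(1,2,4) gen_anticomm[of v u] by (simp flip: A.A.m_assoc add: A.A.l_minus)
 also have "\<dots> = \<ominus>A \<gamma> u \<otimes>A (alpha y \<otimes>A \<gamma> v)" using gen by (simp add: A.A.l_minus)
 also have "\<dots> = alpha (\<gamma> u \<otimes>A y) \<otimes>A \<gamma> v" using gen by (simp add: alpha_gen A.A.m_assoc)
 finally show ?case .
qed (auto simp: A.A.r_distr A.A.l_distr A.smult_mult_l A.smult_mult_r)

lemma pow_commute:
 assumes "x \<in> ext_pow K V k" "y \<in> ext_pow K V l"
 shows "x \<otimes>A y = (if even (k * l) then y \<otimes>A x else \<ominus>A (y \<otimes>A x))"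
 using assms(1)
proof (induction k arbitrary: x)
 case 0
 have "counit x : CK" "y : CA" using 0 assms(2) ext_pow_closed by simp_all
 then have "(counit x \<odot>A \<one>A) \<otimes>A y = y \<otimes>A (counit x \<odot>A \<one>A)"
  by (simp add: A.smult_mult_l A.smult_mult_r)
 with ext_pow_0[OF 0] show ?case by auto
next
 case (Suc k)
 have y: "y : CA" using assms(2) ext_pow_closed by simp
 from Suc.prems show ?case
 proof (induction rule: ext_pow_Suc_induct)
  case zero then show ?case using y by simp
 next
  case (gen u z)
  note z = ext_pow_closed[OF gen(2)]
  have "\<gamma> u \<otimes>A y = (if even l then y \<otimes>A \<gamma> u else \<ominus>A (y \<otimes>A \<gamma> u))"
   using gen_commute[of y u] alpha_pow[OF assms(2)] y gen by (auto simp: A.A.l_minus)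
  then show ?case using Suc.IH[OF gen(2)] z gen y
   by (auto simp: A.A.m_assoc A.A.r_minus) (simp_all flip: A.A.m_assoc add: A.A.l_minus A.A.r_minus)
 qed (use y in \<open>auto simp: A.A.r_distr A.A.l_distr A.A.minus_add A.smult_mult_l A.smult_mult_r A.smult_r_minus\<close>)
qed

text \<open>The second copy of the leading vector is moved next to the first one.\<close>

lemma prod_square: "set vs \<subseteq> CV ==> vs \<noteq> [] ==> ext_prod K V vs \<otimes>A ext_prod K V vs = \<zero>A"
proof (cases vs)
 case (Cons v us)
 assume "set vs \<subseteq> CV"
 with Cons have v: "v : CV" and x: "ext_prod K V us : CA" using ext_prod_closed by auto
 let ?x = "ext_prod K V us"
 have "(\<gamma> v \<otimes>A ?x) \<otimes>A (\<gamma> v \<otimes>A ?x) = (\<gamma> v \<otimes>A ?x \<otimes>A \<gamma> v) \<otimes>A ?x"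
  using v x by (simp add: A.A.m_assoc)
 also have "\<gamma> v \<otimes>A ?x \<otimes>A \<gamma> v = \<zero>A"
  using v x gen_commute[of ?x v] by (simp add: A.A.m_assoc gen_square)
 finally show ?thesis using Cons v x by simp
qed simp

text \<open>Graded commutativity alone yields only that twice the square vanishes. Squares of
  products of vectors vanish by a repeated factor, and in a sum the two mixed terms cancel.\<close>

lemma pow_odd_square: "x \<in> ext_pow K V k ==> odd k ==> x \<otimes>A x = \<zero>A"
proof (induction rule: ext_pow_induct)
 case (prod vs) then show ?case by (intro prod_square) auto
next
 case (add x y)
 then have "x \<otimes>A y = \<ominus>A (y \<otimes>A x)" using pow_commute[OF add(1,2)] by simp
 with add show ?case by (simp add: A.A.l_distr A.A.r_distr A.A.l_neg A.A.r_neg)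
qed (auto simp: A.smult_mult_l A.smult_mult_r)

subsection \<open>Derivations and antiderivations\<close>

text \<open>The matrix with diagonal \<open>s v\<close>, \<open>t v\<close> and corner
  \<open>\<phi> v\<close> depends linearly on \<open>v\<close>, and the three conditions on squares
  say that it squares to zero. The induced homomorphism has \<open>S\<close> and \<open>T\<close> on
  its diagonal by uniqueness, and its corner is the required map.\<close>

lemma skew_derivation_exists:
 fixes s \<phi> t :: "'c => ('a, 'c) ext"
 assumes cl: "!!v. v : CV ==> s v : CA" "!!v. v : CV ==> \<phi> v : CA" "!!v. v : CV ==> t v : CA"
  and ad: "!!u v. u : CV ==> v : CV ==> s (u \<oplus>\<^bsub>V\<^esub> v) = s u \<oplus>A s v"
   "!!u v. u : CV ==> v : CV ==> \<phi> (u \<oplus>\<^bsub>V\<^esub> v) = \<phi> u \<oplus>A \<phi> v"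
   "!!u v. u : CV ==> v : CV ==> t (u \<oplus>\<^bsub>V\<^esub> v) = t u \<oplus>A t v"
  and sm: "!!a v. a : CK ==> v : CV ==> s (a \<odot>\<^bsub>V\<^esub> v) = a \<odot>A s v"
   "!!a v. a : CK ==> v : CV ==> \<phi> (a \<odot>\<^bsub>V\<^esub> v) = a \<odot>A \<phi> v"
   "!!a v. a : CK ==> v : CV ==> t (a \<odot>\<^bsub>V\<^esub> v) = a \<odot>A t v"
  and sq: "!!v. v : CV ==> s v \<otimes>A s v = \<zero>A" "!!v. v : CV ==> t v \<otimes>A t v = \<zero>A"
   "!!v. v : CV ==> s v \<otimes>A \<phi> v \<oplus>A \<phi> v \<otimes>A t v = \<zero>A"
  and S: "S \<in> alg_homs K A A" "!!v. v : CV ==> S (\<gamma> v) = s v"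
  and T: "T \<in> alg_homs K A A" "!!v. v : CV ==> T (\<gamma> v) = t v"
 shows "\<exists>d\<in>lin_maps K A A. (\<forall>v\<in>CV. d (\<gamma> v) = \<phi> v) \<and>
  (\<forall>x\<in>CA. \<forall>y\<in>CA. d (x \<otimes>A y) = S x \<otimes>A d y \<oplus>A d x \<otimes>A T y)"
proof -
 let ?B = "tri_alg A"
 have "\<exists>H. H \<in> alg_homs K A ?B \<and> (\<forall>v\<in>CV. H (\<gamma> v) = (s v, \<phi> v, t v))"
  by (rule ext_universal[OF A.tri_alg_kalg])
   (use assms in \<open>simp_all add: tri_alg_def\<close>)
 then obtain H where H: "H \<in> lin_maps K A ?B" "H \<in> ring_hom A ?B"
   and Hg: "!!v. v : CV ==> H (\<gamma> v) = (s v, \<phi> v, t v)"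
  unfolding alg_homs_def by blast
 have cl: "fst (H x) : CA" "fst (snd (H x)) : CA" "snd (snd (H x)) : CA"
  if "x : CA" for x
  using lin_maps_closed[OF H(1) that] by (auto simp: tri_alg_def)
 have add: "H (x \<oplus>A y) = (fst (H x) \<oplus>A fst (H y), fst (snd (H x)) \<oplus>A fst (snd (H y)), snd (snd (H x)) \<oplus>A snd (snd (H y)))"
  if "x : CA" "y : CA" for x y
  using lin_maps_add[OF H(1) that] by (simp add: tri_alg_def split_beta)
 have smu: "H (a \<odot>A x) = (a \<odot>A fst (H x), a \<odot>A fst (snd (H x)), a \<odot>A snd (snd (H x)))"
  if "a : CK" "x : CA" for a x
  using lin_maps_smult[OF H(1) that] by (simp add: tri_alg_def split_beta)
 have mul: "H (x \<otimes>A y) = (fst (H x) \<otimes>A fst (H y),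
   fst (H x) \<otimes>A fst (snd (H y)) \<oplus>A fst (snd (H x)) \<otimes>A snd (snd (H y)), snd (snd (H x)) \<otimes>A snd (snd (H y)))"
  if "x : CA" "y : CA" for x y
  using ring_hom_mult[OF H(2) that] by (simp add: tri_alg_def split_beta)
 have one: "H \<one>A = (\<one>A, \<zero>A, \<one>A)"
  using ring_hom_one[OF H(2)] by (simp add: tri_alg_def)
 let ?r = "\<lambda>f. \<lambda>x\<in>CA. f (H x)"
 have fst_hom: "?r fst \<in> alg_homs K A A" and snd_hom: "?r (\<lambda>x. snd (snd x)) \<in> alg_homs K A A"
  unfolding alg_homs_def
  by (intro IntI lin_maps_restrictI ring_hom_memI; simp add: A.module_axioms cl add smu mul one)+
 have "?r fst = S" "?r (\<lambda>x. snd (snd x)) = T"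
  by (rule ext_hom_unique[OF A.kalg_axioms fst_hom S(1)], simp add: Hg S)
   (rule ext_hom_unique[OF A.kalg_axioms snd_hom T(1)], simp add: Hg T)
 then have ST: "fst (H x) = S x" "snd (snd (H x)) = T x" if "x : CA" for x
  using that by (metis (no_types, lifting) restrict_apply')+
 have "?r (\<lambda>x. fst (snd x)) \<in> lin_maps K A A"
  by (rule lin_maps_restrictI) (simp_all add: A.module_axioms cl add smu)
 then show ?thesis
  by (rule bexI[rotated]) (simp add: Hg mul ST)
qed

lemma id_alg_hom: "(\<lambda>x\<in>CA. x) \<in> alg_homs K A A"
 unfolding alg_homs_def by (intro IntI lin_maps_restrictI ring_hom_memI) (simp_all add: A.module_axioms)

text \<open>Both twists are the identity, and the condition on squares says that \<open>v\<close>
  and \<open>T v\<close> anticommute. A derivation kills the unit and is fixed by its values on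
  vectors, so the description in the definition denotes it.\<close>

lemma ext_deriv:
 assumes T: "T \<in> lin_maps K V V"
 shows ext_deriv_lin: "ext_deriv K V T \<in> lin_maps K A A"
  and ext_deriv_mult: "x : CA ==> y : CA ==>
   ext_deriv K V T (x \<otimes>A y) = ext_deriv K V T x \<otimes>A y \<oplus>A x \<otimes>A ext_deriv K V T y"
  and ext_deriv_gen: "v : CV ==> ext_deriv K V T (\<gamma> v) = \<gamma> (T v)"
proof -
 define Q where "Q d \<longleftrightarrow> d \<in> lin_maps K A A \<and>
   (\<forall>x\<in>CA. \<forall>y\<in>CA. d (x \<otimes>A y) = d x \<otimes>A y \<oplus>A x \<otimes>A d y) \<and>
   (\<forall>v\<in>CV. d (\<gamma> v) = \<gamma> (T v))" for d
 note Tc = lin_maps_closed[OF T]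
 have "\<exists>d\<in>lin_maps K A A. (\<forall>v\<in>CV. d (\<gamma> v) = \<gamma> (T v)) \<and>
  (\<forall>x\<in>CA. \<forall>y\<in>CA. d (x \<otimes>A y) = restrict (\<lambda>x. x) (CA) x \<otimes>A d y \<oplus>A d x \<otimes>A restrict (\<lambda>x. x) (CA) y)"
 proof (rule skew_derivation_exists[where s = \<gamma> and t = \<gamma> and \<phi> = "\<lambda>v. \<gamma> (T v)"
    and S = "\<lambda>x\<in>CA. x" and T = "\<lambda>x\<in>CA. x"])
  show "\<gamma> v \<otimes>A \<gamma> (T v) \<oplus>A \<gamma> (T v) \<otimes>A \<gamma> v = \<zero>A" if "v : CV" for v
   using that Tc gen_anticomm[of v "T v"] by (simp add: A.A.l_neg)
 qed (use Tc id_alg_hom in \<open>simp_all add: gen_add gen_smult gen_square lin_maps_add[OF T] lin_maps_smult[OF T]\<close>)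
 then obtain d where d: "d \<in> lin_maps K A A" "!!v. v : CV ==> d (\<gamma> v) = \<gamma> (T v)"
  "!!x y. x : CA ==> y : CA ==> d (x \<otimes>A y) = x \<otimes>A d y \<oplus>A d x \<otimes>A y" by auto
 have "Q d" unfolding Q_def using d lin_maps_closed[OF d(1)] by (simp add: A.A.a_comm)
 have un: "d' = d" if "Q d'" for d'
 proof (rule lin_maps_eqI)
  have d'1: "d' \<in> lin_maps K A A" "!!x y. x : CA ==> y : CA ==> d' (x \<otimes>A y) = d' x \<otimes>A y \<oplus>A x \<otimes>A d' y"
   "!!v. v : CV ==> d' (\<gamma> v) = \<gamma> (T v)"
   using that unfolding Q_def by blast+
  have d': "d' \<in> lin_maps K A A"  "!!v. v : CV ==> d' (\<gamma> v) = \<gamma> (T v)"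
   "!!x y. x : CA ==> y : CA ==> d' (x \<otimes>A y) = x \<otimes>A d' y \<oplus>A d' x \<otimes>A y"
   using d'1 lin_maps_closed[OF d'1(1)] by (simp_all add: A.A.a_comm)
  show "d' \<in> lin_maps K A A" "d \<in> lin_maps K A A" by (fact d'(1) d(1))+
  have d_one: "f \<one>A = \<zero>A" if f: "f \<in> lin_maps K A A"
   "!!x y. x : CA ==> y : CA ==> f (x \<otimes>A y) = x \<otimes>A f y \<oplus>A f x \<otimes>A y" for f
   using f(2)[of "\<one>A" "\<one>A"] lin_maps_closed[OF f(1), of "\<one>A"] by simp
  show "d' x = d x" if "x : CA" for x
   using that
  proof (induction rule: ext_induct)
   case one show ?case using d_one[OF d'(1,3)] d_one[OF d(1,3)] by simp
  next
   case (add x y)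
   then show ?case by (simp add: lin_maps_add[OF d(1)] lin_maps_add[OF d'(1)])
  next
   case (smult a x)
   then show ?case by (simp add: lin_maps_smult[OF d(1)] lin_maps_smult[OF d'(1)])
  qed (simp add: d d')
 qed
 have "Q (ext_deriv K V T)"
  unfolding ext_deriv_def Let_def Q_def[symmetric] by (rule theI[of Q, OF \<open>Q d\<close> un])
 then show "ext_deriv K V T \<in> lin_maps K A A"
  "x : CA ==> y : CA ==>
   ext_deriv K V T (x \<otimes>A y) = ext_deriv K V T x \<otimes>A y \<oplus>A x \<otimes>A ext_deriv K V T y"
  "v : CV ==> ext_deriv K V T (\<gamma> v) = \<gamma> (T v)"
  unfolding Q_def by auto
qed

lemma minus_one_pow:
 "x : CA ==> (\<ominus>A \<one>A) [^]\<^bsub>A\<^esub> (k::nat) \<otimes>A x = (if even k then x else \<ominus>A x)"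
 by (induction k) (auto simp: A.A.m_assoc A.A.l_minus A.A.r_minus)

text \<open>The left twist is \<open>alpha\<close>, the right one the identity; the condition on
  squares holds because scalars are central.\<close>

lemma contract1:
 assumes cl: "!!w. w : CV ==> h v w : CK"
  and ad: "!!w u. w : CV ==> u : CV ==> h v (w \<oplus>\<^bsub>V\<^esub> u) = h v w \<oplus> h v u"
  and sm: "!!a w. a : CK ==> w : CV ==> h v (a \<odot>\<^bsub>V\<^esub> w) = a \<otimes> h v w"
 shows contract1_lin: "contract1 K V h v \<in> lin_maps K A A"
  and contract1_mult: "x : CA ==> y : CA ==>
   contract1 K V h v (x \<otimes>A y) = contract1 K V h v x \<otimes>A y \<oplus>A alpha x \<otimes>A contract1 K V h v y"
  and contract1_gen: "w : CV ==> contract1 K V h v (\<gamma> w) = h v w \<odot>A \<one>A"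
  and contract1_pow0: "x \<in> ext_pow K V 0 ==> contract1 K V h v x = \<zero>A"
  and contract1_pow: "x \<in> ext_pow K V (Suc k) ==> contract1 K V h v x \<in> ext_pow K V k"
proof -
 define Q where "Q d \<longleftrightarrow> ext_antiderivation K V d \<and>
  (\<forall>w\<in>CV. d (ext_gen K V w) = h v w \<odot>\<^bsub>ext_alg K V\<^esub> \<one>\<^bsub>ext_alg K V\<^esub>)" for d
 have "\<exists>d\<in>lin_maps K A A. (\<forall>w\<in>CV. d (\<gamma> w) = h v w \<odot>A \<one>A) \<and>
  (\<forall>x\<in>CA. \<forall>y\<in>CA. d (x \<otimes>A y) = alpha x \<otimes>A d y \<oplus>A d x \<otimes>A restrict (\<lambda>x. x) (CA) y)"
 proof (rule skew_derivation_exists[where s = "\<lambda>v. \<ominus>A \<gamma> v" and t = \<gamma>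
    and T = "\<lambda>x\<in>CA. x"])
  show "\<ominus>A \<gamma> w \<otimes>A (h v w \<odot>A \<one>A) \<oplus>A h v w \<odot>A \<one>A \<otimes>A \<gamma> w = \<zero>A" if "w : CV" for w
   using that cl by (simp add: A.smult_mult_l A.smult_mult_r A.smult_r_minus A.A.l_neg A.A.l_minus)
  show "alpha \<in> alg_homs K A A" using alpha_lin alpha_ring by (simp add: alg_homs_def)
 qed (use cl id_alg_hom in \<open>simp_all add: neg_gen_hom alpha_gen gen_add gen_smult gen_square ad sm A.smult_l_distr A.smult_assoc1 A.A.minus_add A.smult_r_minus\<close>)
 then obtain d where d: "d \<in> lin_maps K A A" "!!w. w : CV ==> d (\<gamma> w) = h v w \<odot>A \<one>A"
  "!!x y. x : CA ==> y : CA ==> d (x \<otimes>A y) = alpha x \<otimes>A d y \<oplus>A d x \<otimes>A y" by auto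
 note dc = lin_maps_closed[OF d(1)]
 note dz = lin_maps_zero[OF A.A.is_abelian_group A.A.is_abelian_group d(1)]
 have dm: "d (x \<otimes>A y) = d x \<otimes>A y \<oplus>A alpha x \<otimes>A d y" if "x : CA" "y : CA" for x y
  using d(3)[OF that] that dc by (simp add: A.A.a_comm)
 have d1: "d \<one>A = \<zero>A" using dm[of "\<one>A" "\<one>A"] dc[of "\<one>A"] by simp
 have d0: "d x = \<zero>A" if "x \<in> ext_pow K V 0" for x
  using lin_maps_smult[OF d(1), of "counit x" "\<one>A"] ext_pow_0[OF that] ext_pow_closed[OF that] d1 by auto
 have dg: "d (\<gamma> w \<otimes>A y) = h v w \<odot>A y \<ominus>A \<gamma> w \<otimes>A d y" if "w : CV" "y : CA" for w y
  using that dm[of "\<gamma> w" y] d(2) cl dc by (simp add: A.smult_mult_l alpha_gen A.A.l_minus A.A.minus_eq)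
 have dp: "d x \<in> ext_pow K V k" if "x \<in> ext_pow K V (Suc k)" for x k
  using that
 proof (induction k arbitrary: x)
  case 0
  from 0 show ?case
   by (induction rule: ext_pow_Suc_induct)
   (use dz dg d0 cl lin_maps_add[OF d(1)] lin_maps_smult[OF d(1)] ext_pow_closed in \<open>auto simp: A.A.minus_eq\<close>)
 next
  case (Suc k)
  from Suc.prems show ?case
  proof (induction rule: ext_pow_Suc_induct)
   case (gen u y)
   then show ?case using dg[of u y] Suc.IH[of y] gen_mult_pow[of "d y" k u] cl ext_pow_closed[of y] by auto
  qed (use dz lin_maps_add[OF d(1)] lin_maps_smult[OF d(1)] in auto)
 qed
 have "ext_antiderivation K V d"
  unfolding ext_antiderivation_def Let_def
 proof (intro conjI ballI allI)
  fix k x y assume x: "x \<in> ext_pow K V k" "y : CA"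
  then have "x : CA" using ext_pow_closed by blast
  with x dc[of y] show "d (x \<otimes>A y) = d x \<otimes>A y \<oplus>A (\<ominus>A \<one>A) [^]\<^bsub>A\<^esub> k \<otimes>A (x \<otimes>A d y)"
   by (simp add: dm alpha_pow minus_one_pow A.A.l_minus)
 qed (use d d0 dp in auto)
 then have "Q d" using d by (auto simp: Q_def)
 have un: "d' = d" if "Q d'" for d'
 proof (rule lin_maps_eqI)
  have d': "d' \<in> lin_maps K A A" "!!w. w : CV ==> d' (\<gamma> w) = h v w \<odot>A \<one>A" "d' \<one>A = \<zero>A"
   using that one_in_pow[of "CV"] unfolding Q_def ext_antiderivation_def Let_def ext_pow_def by auto
  \<comment> \<open>For uniqueness the signed product rule is evaluated only for a left factor of
    degree 1.\<close>
  have g: "d' (\<gamma> w \<otimes>A y) = d' (\<gamma> w) \<otimes>A y \<oplus>A (\<ominus>A \<one>A) [^]\<^bsub>A\<^esub> (1::nat) \<otimes>A (\<gamma> w \<otimes>A d' y)" if "w : CV" "y : CA" for w y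
   using \<open>Q d'\<close> that gen_in_pow[of w] unfolding Q_def ext_antiderivation_def Let_def by blast
  show "d' \<in> lin_maps K A A" "d \<in> lin_maps K A A" by (fact d'(1) d(1))+
  show "d' x = d x" if "x : CA" for x
   using that
  proof (induction rule: ext_induct)
   case (gen w y)
   have "d y : CA" using dc gen by blast
   with gen g[of w y] minus_one_pow[of "\<gamma> w \<otimes>A d y" 1] show ?case
    by (simp add: dm d d' alpha_gen A.A.l_minus)
  next
   case (add x y)
   then show ?case by (simp add: lin_maps_add[OF d(1)] lin_maps_add[OF d'(1)])
  next
   case (smult a x)
   then show ?case by (simp add: lin_maps_smult[OF d(1)] lin_maps_smult[OF d'(1)])
  qed (simp add: d1 d')
 qed
 have "contract1 K V h v = d"
  unfolding contract1_def Q_def[symmetric] by (rule the_equality[of Q, OF \<open>Q d\<close> un])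
 then show "contract1 K V h v \<in> lin_maps K A A"
  "x : CA ==> y : CA ==>
   contract1 K V h v (x \<otimes>A y) = contract1 K V h v x \<otimes>A y \<oplus>A alpha x \<otimes>A contract1 K V h v y"
  "w : CV ==> contract1 K V h v (\<gamma> w) = h v w \<odot>A \<one>A"
  "x \<in> ext_pow K V 0 ==> contract1 K V h v x = \<zero>A"
  "x \<in> ext_pow K V (Suc k) ==> contract1 K V h v x \<in> ext_pow K V k"
  using d dm d0 dp by auto
qed

end

section \<open>Contractions\<close>

lemma (in module) End_alg_kalg: "kalg R (End_alg R M)"
proof -
 have lc: "f x \<in> carrier M" if "f \<in> lin_maps R M M" "x \<in> carrier M" for f x
  using lin_maps_closed that by metis
 note defs = End_alg_def lin_maps_add lin_maps_smult lc smult_r_distr M.a_ac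
 have neg: "(\<lambda>x\<in>carrier M. \<ominus>\<^bsub>M\<^esub> f x) \<in> lin_maps R M M" if "f \<in> lin_maps R M M" for f
  by (rule lin_maps_restrictI[OF module_axioms]) (use that in \<open>simp_all add: defs M.minus_add smult_r_minus\<close>)
 have ext: "f = f'" if "f \<in> lin_maps R M M" "f' \<in> lin_maps R M M" "!!x. x \<in> carrier M ==> f x = f' x" for f f'
  using that by (rule lin_maps_eqI)
 have add: "(\<lambda>x\<in>carrier M. f x \<oplus>\<^bsub>M\<^esub> k x) \<in> lin_maps R M M" if "f \<in> lin_maps R M M" "k \<in> lin_maps R M M" for f k
  by (rule lin_maps_restrictI[OF module_axioms]) (use that in \<open>simp_all add: defs\<close>)
 have zero: "(\<lambda>x\<in>carrier M. \<zero>\<^bsub>M\<^esub>) \<in> lin_maps R M M"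
  by (rule lin_maps_restrictI[OF module_axioms]) simp_all
 have one: "(\<lambda>x\<in>carrier M. x) \<in> lin_maps R M M"
  by (rule lin_maps_restrictI[OF module_axioms]) simp_all
 have mult: "(\<lambda>x\<in>carrier M. f (k x)) \<in> lin_maps R M M" if "f \<in> lin_maps R M M" "k \<in> lin_maps R M M" for f k
  by (rule lin_maps_restrictI[OF module_axioms]) (use that in \<open>simp_all add: defs\<close>)
 have smult: "(\<lambda>x\<in>carrier M. a \<odot>\<^bsub>M\<^esub> f x) \<in> lin_maps R M M" if "a \<in> carrier R" "f \<in> lin_maps R M M" for a f
  by (rule lin_maps_restrictI[OF module_axioms])
   (use that in \<open>simp_all add: defs R.m_comm flip: smult_assoc1\<close>)
 note closed = add zero one mult smult
 have ab: "abelian_group (End_alg R M)"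
 proof (rule abelian_groupI)
  fix f assume f: "f \<in> carrier (End_alg R M)"
  have "(\<lambda>x\<in>carrier M. \<ominus>\<^bsub>M\<^esub> f x) \<oplus>\<^bsub>End_alg R M\<^esub> f = \<zero>\<^bsub>End_alg R M\<^esub>"
   using f by (auto simp: End_alg_def lc M.l_neg intro!: restrict_ext)
  moreover have "(\<lambda>x\<in>carrier M. \<ominus>\<^bsub>M\<^esub> f x) \<in> carrier (End_alg R M)"
   using f neg by (simp add: End_alg_def)
  ultimately show "\<exists>y\<in>carrier (End_alg R M). y \<oplus>\<^bsub>End_alg R M\<^esub> f = \<zero>\<^bsub>End_alg R M\<^esub>"
   by blast
 next
  fix f assume "f \<in> carrier (End_alg R M)"
  then have f: "f \<in> lin_maps R M M" by (simp add: End_alg_def)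
  show "\<zero>\<^bsub>End_alg R M\<^esub> \<oplus>\<^bsub>End_alg R M\<^esub> f = f"
   using ext[OF add[OF zero f] f] by (simp add: End_alg_def lc[OF f])
 qed (auto simp: End_alg_def closed M.a_ac lc intro!: restrict_ext)
 have "Group.monoid (End_alg R M)"
 proof (rule monoidI)
  fix f assume "f \<in> carrier (End_alg R M)"
  then have f: "f \<in> lin_maps R M M" by (simp add: End_alg_def)
  show "\<one>\<^bsub>End_alg R M\<^esub> \<otimes>\<^bsub>End_alg R M\<^esub> f = f" "f \<otimes>\<^bsub>End_alg R M\<^esub> \<one>\<^bsub>End_alg R M\<^esub> = f"
   using ext[OF mult[OF one f] f] ext[OF mult[OF f one] f] by (simp_all add: End_alg_def lc[OF f])
 qed (auto simp: End_alg_def closed lc intro!: restrict_ext)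
 with ab have "ring (End_alg R M)"
  by (intro ringI) (auto simp: End_alg_def closed lc lin_maps_add intro!: restrict_ext)
 moreover have "module R (End_alg R M)"
 proof (rule moduleI[OF R.is_cring ab])
  fix f assume "f \<in> carrier (End_alg R M)"
  then have f: "f \<in> lin_maps R M M" by (simp add: End_alg_def)
  show "\<one> \<odot>\<^bsub>End_alg R M\<^esub> f = f"
   using ext[OF smult[OF R.one_closed f] f] by (simp add: End_alg_def lc[OF f])
 qed (auto simp: End_alg_def closed lc smult_l_distr smult_r_distr smult_assoc1 intro!: restrict_ext)
 ultimately show ?thesis
  by (intro kalg.intro kalg_axioms.intro) (auto simp: End_alg_def closed lc lin_maps_smult intro!: restrict_ext)
qed

text \<open>Contraction calculus for a bilinear pairing. By \<open>swap\<close> the situation is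
  symmetric: a statement about contractions on the exterior algebra of \<open>W\<close> is available
  for that of \<open>V\<close> as well, usually through an interpretation called
  \<open>s\<close>.\<close>

locale dpair = V: ext K V + W: ext K W for K (structure) and V and W +
 fixes h :: "'c => 'e => 'a"
 assumes h_closed [simp, intro]: "v \<in> carrier V ==> w \<in> carrier W ==> h v w \<in> carrier K"
  and h_add_l: "v \<in> carrier V ==> v' \<in> carrier V ==> w \<in> carrier W ==> h (v \<oplus>\<^bsub>V\<^esub> v') w = h v w \<oplus> h v' w"
  and h_add_r: "v \<in> carrier V ==> w \<in> carrier W ==> w' \<in> carrier W ==> h v (w \<oplus>\<^bsub>W\<^esub> w') = h v w \<oplus> h v w'"
  and h_smult_l: "a \<in> carrier K ==> v \<in> carrier V ==> w \<in> carrier W ==> h (a \<odot>\<^bsub>V\<^esub> v) w = a \<otimes> h v w"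
  and h_smult_r: "a \<in> carrier K ==> v \<in> carrier V ==> w \<in> carrier W ==> h v (a \<odot>\<^bsub>W\<^esub> w) = a \<otimes> h v w"
begin

abbreviation "AV \<equiv> ext_alg K V"
abbreviation (input) plus_AV (infixl "\<oplus>AV" 65) where "x \<oplus>AV y \<equiv> x \<oplus>\<^bsub>AV\<^esub> y"
abbreviation (input) minus_AV (infixl "\<ominus>AV" 65) where "x \<ominus>AV y \<equiv> x \<ominus>\<^bsub>AV\<^esub> y"
abbreviation (input) times_AV (infixl "\<otimes>AV" 70) where "x \<otimes>AV y \<equiv> x \<otimes>\<^bsub>AV\<^esub> y"
abbreviation (input) scale_AV (infixl "\<odot>AV" 70) where "x \<odot>AV y \<equiv> x \<odot>\<^bsub>AV\<^esub> y"
abbreviation (input) neg_AV ("\<ominus>AV _" [81] 80) where "\<ominus>AV x \<equiv> \<ominus>\<^bsub>AV\<^esub> x"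
abbreviation (input) zero_AV ("\<zero>AV") where "\<zero>AV \<equiv> \<zero>\<^bsub>AV\<^esub>"
abbreviation (input) one_AV ("\<one>AV") where "\<one>AV \<equiv> \<one>\<^bsub>AV\<^esub>"
abbreviation "AW \<equiv> ext_alg K W"
abbreviation (input) plus_AW (infixl "\<oplus>AW" 65) where "x \<oplus>AW y \<equiv> x \<oplus>\<^bsub>AW\<^esub> y"
abbreviation (input) minus_AW (infixl "\<ominus>AW" 65) where "x \<ominus>AW y \<equiv> x \<ominus>\<^bsub>AW\<^esub> y"
abbreviation (input) times_AW (infixl "\<otimes>AW" 70) where "x \<otimes>AW y \<equiv> x \<otimes>\<^bsub>AW\<^esub> y"
abbreviation (input) scale_AW (infixl "\<odot>AW" 70) where "x \<odot>AW y \<equiv> x \<odot>\<^bsub>AW\<^esub> y"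
abbreviation (input) neg_AW ("\<ominus>AW _" [81] 80) where "\<ominus>AW x \<equiv> \<ominus>\<^bsub>AW\<^esub> x"
abbreviation (input) zero_AW ("\<zero>AW") where "\<zero>AW \<equiv> \<zero>\<^bsub>AW\<^esub>"
abbreviation (input) one_AW ("\<one>AW") where "\<one>AW \<equiv> \<one>\<^bsub>AW\<^esub>"
abbreviation (input) "CK \<equiv> carrier K"
abbreviation (input) "CV \<equiv> carrier V"
abbreviation (input) "CW \<equiv> carrier W"
abbreviation (input) "XV \<equiv> carrier AV"
abbreviation (input) "XW \<equiv> carrier AW"
abbreviation (input) "LW \<equiv> lin_maps K W W"
abbreviation (input) "LV \<equiv> lin_maps K V V"
abbreviation (input) "pW \<equiv> ext_pow K W"
abbreviation (input) "pV \<equiv> ext_pow K V"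
abbreviation (input) plus_V (infixl "\<oplus>V" 65) where "x \<oplus>V y \<equiv> x \<oplus>\<^bsub>V\<^esub> y"
abbreviation (input) minus_V (infixl "\<ominus>V" 65) where "x \<ominus>V y \<equiv> x \<ominus>\<^bsub>V\<^esub> y"
abbreviation (input) scale_V (infixl "\<odot>V" 70) where "x \<odot>V y \<equiv> x \<odot>\<^bsub>V\<^esub> y"
abbreviation (input) neg_V ("\<ominus>V _" [81] 80) where "\<ominus>V x \<equiv> \<ominus>\<^bsub>V\<^esub> x"
abbreviation (input) zero_V ("\<zero>V") where "\<zero>V \<equiv> \<zero>\<^bsub>V\<^esub>"
abbreviation (input) plus_W (infixl "\<oplus>W" 65) where "x \<oplus>W y \<equiv> x \<oplus>\<^bsub>W\<^esub> y"
abbreviation (input) minus_W (infixl "\<ominus>W" 65) where "x \<ominus>W y \<equiv> x \<ominus>\<^bsub>W\<^esub> y"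
abbreviation (input) scale_W (infixl "\<odot>W" 70) where "x \<odot>W y \<equiv> x \<odot>\<^bsub>W\<^esub> y"
abbreviation (input) neg_W ("\<ominus>W _" [81] 80) where "\<ominus>W x \<equiv> \<ominus>\<^bsub>W\<^esub> x"
abbreviation (input) zero_W ("\<zero>W") where "\<zero>W \<equiv> \<zero>\<^bsub>W\<^esub>"
abbreviation "gV \<equiv> ext_gen K V"
abbreviation "gW \<equiv> ext_gen K W"
abbreviation "dW \<equiv> contract1 K W h"
abbreviation "dV \<equiv> contract1 K V (\<lambda>w v. h v w)"
abbreviation "cW \<equiv> contract K V W h"
abbreviation "cV \<equiv> contract K W V (\<lambda>w v. h v w)"

lemma swap: "dpair K W V (\<lambda>w v. h v w)"
 by (intro dpair.intro dpair_axioms.intro V.ext_axioms W.ext_axioms)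
  (simp_all add: h_add_l h_add_r h_smult_l h_smult_r)

lemma dW_props:
 assumes v: "v : CV"
 shows dW_lin: "dW v \<in> lin_maps K AW AW"
  and dW_mult: "x : XW ==> y : XW ==>
   dW v (x \<otimes>AW y) = dW v x \<otimes>AW y \<oplus>AW W.alpha x \<otimes>AW dW v y"
  and dW_gen: "w : CW ==> dW v (gW w) = h v w \<odot>AW \<one>AW"
  and dW_pow0: "x : pW 0 ==> dW v x = \<zero>AW"
  and dW_pow: "x : pW (Suc k) ==> dW v x : pW k"
 by (rule W.contract1[where h = h and v = v]; use v in \<open>simp add: h_add_r h_smult_r\<close>)+

lemma dW_closed [simp, intro]: "v : CV ==> x : XW ==> dW v x : XW"
 using lin_maps_closed[OF dW_lin] .

lemma dW_linear:
 assumes "v : CV"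
 shows dW_add: "x : XW ==> y : XW ==> dW v (x \<oplus>AW y) = dW v x \<oplus>AW dW v y"
  and dW_smult: "a : CK ==> x : XW ==> dW v (a \<odot>AW x) = a \<odot>AW dW v x"
  and dW_zero: "dW v \<zero>AW = \<zero>AW"
  and dW_neg: "x : XW ==> dW v (\<ominus>AW x) = \<ominus>AW dW v x"
  and dW_one: "dW v \<one>AW = \<zero>AW"
 using lin_maps_add[OF dW_lin[OF assms]] lin_maps_smult[OF dW_lin[OF assms]]
  lin_maps_hom[OF W.A.A.is_abelian_group W.A.A.is_abelian_group dW_lin[OF assms]]
  dW_pow0[OF assms, of "\<one>AW"] W.one_in_pow[of "CW"] by (auto simp: ext_pow_def)

lemma dW_gen_mult:
 "v : CV ==> w : CW ==> x : XW ==>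
  dW v (gW w \<otimes>AW x) = h v w \<odot>AW x \<ominus>AW gW w \<otimes>AW dW v x"
 by (simp add: dW_mult dW_gen W.A.smult_mult_l W.alpha_gen W.A.A.l_minus W.A.A.minus_eq)

text \<open>After a leading vector, the two terms containing its pairing with \<open>v\<close>
  cancel. This vanishing is what allows \<open>v \<mapsto> dW v\<close> to extend to the exterior
  algebra of \<open>V\<close>.\<close>

lemma dW_square: "x : XW ==> v : CV ==> dW v (dW v x) = \<zero>AW"
 by (induction rule: W.ext_induct)
  (simp_all add: dW_linear dW_gen_mult W.A.A.minus_eq W.A.A.minus_add W.A.A.r_neg)

lemma dW_add_l: "x : XW ==> v : CV ==> v' : CV ==>
  dW (v \<oplus>V v') x = dW v x \<oplus>AW dW v' x"
 by (induction rule: W.ext_induct)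
  (simp_all add: dW_linear dW_gen_mult W.A.A.minus_eq W.A.A.minus_add W.A.A.a_ac h_add_l
   W.A.smult_l_distr W.A.smult_r_distr W.A.A.r_distr)

lemma dW_smult_l: "x : XW ==> v : CV ==> a : CK ==>
  dW (a \<odot>V v) x = a \<odot>AW dW v x"
 by (induction rule: W.ext_induct)
  (simp_all add: dW_linear dW_gen_mult W.A.A.minus_eq h_smult_l W.A.smult_r_minus
   W.A.smult_assoc1 W.A.smult_r_distr W.A.smult_mult_r W.A.A.minus_add V.R.m_comm[of a] flip: W.A.smult_assoc1)

lemma End_AW: "kalg K (End_alg K AW)"
 by (rule W.A.End_alg_kalg)

text \<open>The universal property of the exterior algebra of \<open>V\<close>, with values in the
  endomorphisms of the exterior algebra of \<open>W\<close>; the homomorphism it provides is the one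
  that \<open>contract\<close> describes.\<close>

lemma contract_hom:
 shows cW_lin0: "cW \<in> lin_maps K AV (End_alg K AW)"
  and cW_ring: "cW \<in> ring_hom AV (End_alg K AW)"
  and cW_gen0: "v : CV ==> cW (gV v) = dW v"
proof -
 have "cW = ext_hom K V (End_alg K AW) dW"
  unfolding contract_def ext_hom_def ..
 moreover note * = V.ext_hom[where B = "End_alg K AW" and \<phi> = dW, OF End_AW]
 have lin_eq: "f = f'" if "f \<in> lin_maps K AW AW" "f' \<in> lin_maps K AW AW" "!!x. x : XW ==> f x = f' x" for f f'
  using that by (rule lin_maps_eqI)
 have E: "f \<oplus>\<^bsub>End_alg K AW\<^esub> f' = (\<lambda>x\<in>XW. f x \<oplus>AW f' x)"
  "f \<otimes>\<^bsub>End_alg K AW\<^esub> f' = (\<lambda>x\<in>XW. f (f' x))" "a \<odot>\<^bsub>End_alg K AW\<^esub> f = (\<lambda>x\<in>XW. a \<odot>AW f x)"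
  "\<zero>\<^bsub>End_alg K AW\<^esub> = (\<lambda>x\<in>XW. \<zero>AW)" for f f' a
  by (simp_all add: End_alg_def)
 have "dW (u \<oplus>V v) = dW u \<oplus>\<^bsub>End_alg K AW\<^esub> dW v" if "u : CV" "v : CV" for u v
  unfolding E by (rule lin_eq) (use that in \<open>auto intro!: lin_maps_restrictI W.A.module_axioms dW_lin
     simp: dW_add_l dW_linear W.A.smult_r_distr W.A.A.a_ac\<close>)
 moreover have "dW (a \<odot>V v) = a \<odot>\<^bsub>End_alg K AW\<^esub> dW v" if "a : CK" "v : CV" for a v
  unfolding E by (rule lin_eq) (use that in \<open>auto intro!: lin_maps_restrictI W.A.module_axioms dW_lin
     simp: dW_smult_l dW_linear W.A.smult_r_distr V.R.m_comm simp flip: W.A.smult_assoc1\<close>)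
 moreover have "dW v \<otimes>\<^bsub>End_alg K AW\<^esub> dW v = \<zero>\<^bsub>End_alg K AW\<^esub>" if "v : CV" for v
  unfolding E by (rule restrict_ext) (use that in \<open>simp add: dW_square\<close>)
 moreover have "dW v \<in> carrier (End_alg K AW)" if "v : CV" for v
  using dW_lin[OF that] by (simp add: End_alg_def)
 ultimately show "cW \<in> lin_maps K AV (End_alg K AW)" "cW \<in> ring_hom AV (End_alg K AW)"
  "v : CV ==> cW (gV v) = dW v" using * by metis+
qed

lemma cW_lin: "a : XV ==> cW a \<in> lin_maps K AW AW"
 using lin_maps_closed[OF cW_lin0] by (simp add: End_alg_def)

lemma cW_closed [simp, intro]: "a : XV ==> x : XW ==> cW a x : XW"
 using lin_maps_closed[OF cW_lin] .

lemma cW_linear_r: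
 assumes "a : XV"
 shows cW_add_r: "x : XW ==> y : XW ==> cW a (x \<oplus>AW y) = cW a x \<oplus>AW cW a y"
  and cW_smult_r: "k : CK ==> x : XW ==> cW a (k \<odot>AW x) = k \<odot>AW cW a x"
  and cW_zero_r: "cW a \<zero>AW = \<zero>AW"
  and cW_neg_r: "x : XW ==> cW a (\<ominus>AW x) = \<ominus>AW cW a x"
 using lin_maps_add[OF cW_lin[OF assms]] lin_maps_smult[OF cW_lin[OF assms]]
  lin_maps_hom[OF W.A.A.is_abelian_group W.A.A.is_abelian_group cW_lin[OF assms]] by auto

lemma cW_linear_l:
 assumes x: "x : XW"
 shows cW_add_l: "a : XV ==> b : XV ==> cW (a \<oplus>AV b) x = cW a x \<oplus>AW cW b x"
  and cW_smult_l: "k : CK ==> a : XV ==> cW (k \<odot>AV a) x = k \<odot>AW cW a x"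
  and cW_zero_l: "cW \<zero>AV x = \<zero>AW"
  and cW_neg_l: "a : XV ==> cW (\<ominus>AV a) x = \<ominus>AW cW a x"
  and cW_one: "cW \<one>AV x = x"
  and cW_mult: "a : XV ==> b : XV ==> cW (a \<otimes>AV b) x = cW a (cW b x)"
  and cW_gen: "v : CV ==> cW (gV v) x = dW v x"
  and cW_gen_mult: "v : CV ==> b : XV ==> cW (gV v \<otimes>AV b) x = dW v (cW b x)"
proof -
 show "a : XV ==> b : XV ==> cW (a \<oplus>AV b) x = cW a x \<oplus>AW cW b x"
  using x lin_maps_add[OF cW_lin0] by (simp add: End_alg_def)
 show sm: "k : CK ==> a : XV ==> cW (k \<odot>AV a) x = k \<odot>AW cW a x" for k a
  using x lin_maps_smult[OF cW_lin0] by (simp add: End_alg_def)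
 show "cW \<zero>AV x = \<zero>AW" using sm[of \<zero> "\<one>AV"] x by simp
 show "a : XV ==> cW (\<ominus>AV a) x = \<ominus>AW cW a x"
  using sm[of "\<ominus> \<one>" a] x by (simp add: V.A.smult_l_minus W.A.smult_l_minus)
 show "cW \<one>AV x = x" using x ring_hom_one[OF cW_ring] by (simp add: End_alg_def)
 show mu: "a : XV ==> b : XV ==> cW (a \<otimes>AV b) x = cW a (cW b x)" for a b
  using x ring_hom_mult[OF cW_ring] by (simp add: End_alg_def)
 show g: "v : CV ==> cW (gV v) x = dW v x" using cW_gen0 by simp
 show "v : CV ==> b : XV ==> cW (gV v \<otimes>AV b) x = dW v (cW b x)"
  using mu[of "gV v" b] cW_gen0 by simp
qed

lemma cW_pow:
 assumes "a : pV k" "x : pW (k + l)" shows "cW a x : pW l"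
 using assms
proof (induction k arbitrary: a l)
 case 0
 note x = W.ext_pow_closed[OF 0(2)]
 have c: "V.counit a : CK" using V.ext_pow_closed[OF 0(1)] by simp
 then have "cW (V.counit a \<odot>AV \<one>AV) x = V.counit a \<odot>AW x"
  using x by (simp add: cW_smult_l cW_one)
 with V.ext_pow_0[OF 0(1)] 0(2) c show ?case by auto
next
 case (Suc k)
 note x = W.ext_pow_closed[OF Suc.prems(2)]
 from Suc.prems(1) show ?case
 proof (induction rule: V.ext_pow_Suc_induct)
  case (gen v b)
  have "cW b x : pW (Suc l)" using Suc.IH[of b "Suc l"] gen Suc.prems by simp
  then show ?case using gen V.ext_pow_closed[OF gen(2)] x dW_pow by (simp add: cW_gen_mult)
 qed (use x in \<open>auto simp: cW_linear_l\<close>)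
qed

text \<open>Contraction by \<open>w \<cdot> a\<close> is a graded commutator of multiplication by
  \<open>w\<close> with contraction by \<open>a\<close>. For a vector \<open>a\<close> this is the
  antiderivation rule applied to \<open>w x\<close>, and multiplying \<open>a\<close> by one more
  vector on the left reproduces the formula.\<close>

lemma contract_contract1:
 assumes "a : XV" "w : CW" "x : XW"
 shows "cW (dV w a) x = gW w \<otimes>AW cW a x \<ominus>AW cW (V.alpha a) (gW w \<otimes>AW x)"
proof -
 interpret s: dpair K W V "\<lambda>w v. h v w" by (rule swap)
 show ?thesis using assms
 proof (induction rule: V.ext_induct)
  case one then show ?case by (simp add: s.dW_linear cW_linear_l W.A.A.minus_eq W.A.A.r_neg)
 next
  case (gen v a)
  have "cW (dV w (gV v \<otimes>AV a)) x = h v w \<odot>AW cW a x \<ominus>AW dW v (cW (dV w a) x)"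
   using gen by (simp add: s.dW_gen_mult cW_linear_l V.A.A.minus_eq W.A.A.minus_eq)
  also have "dW v (cW (dV w a) x) = h v w \<odot>AW cW a x \<ominus>AW gW w \<otimes>AW dW v (cW a x)
    \<ominus>AW dW v (cW (V.alpha a) (gW w \<otimes>AW x))"
   using gen by (simp add: dW_linear dW_gen_mult W.A.A.minus_eq)
  finally show ?case using gen
   by (simp add: cW_linear_l V.alpha_gen V.A.A.l_minus W.A.A.minus_eq W.A.A.minus_add W.A.A.a_assoc
     W.A.A.r_neg1 W.A.A.r_neg2)
 next
  case (add a b) then show ?case
   by (simp add: s.dW_linear cW_linear_l W.A.A.r_distr W.A.A.minus_eq W.A.A.minus_add W.A.A.a_ac)
 next
  case (smult k a) then show ?case
   by (simp add: s.dW_linear cW_linear_l W.A.smult_r_distr W.A.smult_mult_r W.A.smult_r_minus W.A.A.minus_eq)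
 qed
qed

text \<open>When all vectors annihilate \<open>x\<close>, only the first term of
  \<open>contract_contract1\<close> survives, and the factors of \<open>p\<close> can be moved out
  one at a time.\<close>

lemma contract_contract_top:
 assumes p: "p : XW" and a: "a : XV" and x: "x : XW"
  and top: "!!w. w : CW ==> gW w \<otimes>AW x = \<zero>AW"
 shows "cW (cV p a) x = p \<otimes>AW cW a x"
proof -
 interpret s: dpair K W V "\<lambda>w v. h v w" by (rule swap)
 from p show ?thesis
 proof (induction rule: W.ext_induct)
  case (gen w p)
  then have "cW (dV w (cV p a)) x = gW w \<otimes>AW cW (cV p a) x"
   using a x top by (simp add: contract_contract1 cW_linear_r W.A.A.minus_eq)
  with gen a x show ?case by (simp add: s.cW_linear_l W.A.A.m_assoc)
 qed (use a x in \<open>simp_all add: s.cW_linear_l cW_linear_l W.A.A.l_distr W.A.smult_mult_l\<close>)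
qed

text \<open>By \<open>contract_contract1\<close> the contraction of \<open>a\<close> by
  \<open>w\<close> is traded for multiplication of \<open>y\<close> by \<open>w\<close>, since the
  augmentation kills everything that begins with \<open>w\<close>. The minus sign of the formula,
  the parity of \<open>a\<close> and the parity from moving \<open>w\<close> past \<open>y\<close>
  multiply to one.\<close>

lemma pairing_sym:
 assumes "a : pV k" "x : pW k"
 shows "W.counit (cW a x) = V.counit (cV x a)"
proof -
 interpret s: dpair K W V "\<lambda>w v. h v w" by (rule swap)
 show ?thesis using assms
 proof (induction k arbitrary: a x)
  case 0
  have c: "V.counit a : CK" "W.counit x : CK"
   using 0 V.ext_pow_closed W.ext_pow_closed by simp_all
  then have "W.counit (cW (V.counit a \<odot>AV \<one>AV) (W.counit x \<odot>AW \<one>AW)) =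
    V.counit (cV (W.counit x \<odot>AW \<one>AW) (V.counit a \<odot>AV \<one>AV))"
   by (simp add: cW_linear_l s.cW_linear_l cW_linear_r s.cW_linear_r V.R.m_comm)
  with V.ext_pow_0[OF 0(1)] W.ext_pow_0[OF 0(2)] show ?case by metis
 next
  case (Suc k)
  note a = V.ext_pow_closed[OF Suc.prems(1)]
  from Suc.prems(2) show ?case
  proof (induction rule: W.ext_pow_Suc_induct)
   case (gen w y)
   note y = W.ext_pow_closed[OF gen(2)] and w = gen(1)
   have da: "dV w a : pV k" using s.dW_pow Suc.prems(1) w by simp
   note dac = V.ext_pow_closed[OF da]
   have "V.counit (cV (y \<otimes>AW gW w) a) = W.counit (cW (dV w a) y)"
    using Suc.IH[OF da gen(2)] a y w by (simp add: s.cW_linear_l)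
   also have "\<dots> = \<ominus> W.counit (cW (V.alpha a) (gW w \<otimes>AW y))"
    using a y w by (simp add: contract_contract1 W.A.A.minus_eq W.counit_gen)
   finally have *: "V.counit (cV (y \<otimes>AW gW w) a) = \<ominus> W.counit (cW (V.alpha a) (gW w \<otimes>AW y))" .
   have "W.counit (cW a (gW w \<otimes>AW y)) : CK" "V.counit (cV (y \<otimes>AW gW w) a) : CK"
    using a y w by auto
   then show ?case
    using * V.alpha_pow[OF Suc.prems(1)] W.gen_commute[OF y w] W.alpha_pow[OF gen(2)] a y w
    by (auto simp: W.A.A.l_minus cW_linear_l s.cW_linear_l split: if_splits)
  qed (use a in \<open>auto simp: cW_linear_r s.cW_linear_l cW_linear_l\<close>)
 qed
qed

end

section \<open>Dual bases, traces and the endomorphisms $E(x, a)$\<close>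

lemma (in comm_monoid) finprod_swap:
 assumes "finite A" "finite B" "!!i j. i \<in> A ==> j \<in> B ==> f i j \<in> carrier G"
 shows "(\<Otimes>\<^bsub>G\<^esub>i\<in>A. \<Otimes>\<^bsub>G\<^esub>j\<in>B. f i j) = (\<Otimes>\<^bsub>G\<^esub>j\<in>B. \<Otimes>\<^bsub>G\<^esub>i\<in>A. f i j)"
 using assms(1,3)
proof (induction A)
 case empty then show ?case by simp
next
 case (insert i A)
 then have "(\<Otimes>\<^bsub>G\<^esub>j\<in>B. \<Otimes>\<^bsub>G\<^esub>i\<in>insert i A. f i j) = (\<Otimes>\<^bsub>G\<^esub>j\<in>B. f i j \<otimes> (\<Otimes>\<^bsub>G\<^esub>i\<in>A. f i j))"
  by (intro finprod_cong') (auto simp: Pi_def)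
 also have "\<dots> = (\<Otimes>\<^bsub>G\<^esub>j\<in>B. f i j) \<otimes> (\<Otimes>\<^bsub>G\<^esub>j\<in>B. \<Otimes>\<^bsub>G\<^esub>i\<in>A. f i j)"
  using insert by (intro finprod_multf) auto
 finally show ?case using insert by (simp add: Pi_def)
qed

lemmas (in abelian_monoid) finsum_swap = add.finprod_swap

section \<open>Derivations of the exterior algebra induced by endomorphisms\<close>

context ext
begin

abbreviation "D \<equiv> ext_deriv K V"

lemma D_closed [simp, intro]: "T \<in> lin_maps K V V ==> x : CA ==> D T x : CA"
 using lin_maps_closed[OF ext_deriv_lin] .

lemma D_linear:
 assumes "T \<in> lin_maps K V V"
 shows D_add: "x : CA ==> y : CA ==> D T (x \<oplus>A y) = D T x \<oplus>A D T y"
  and D_smult: "a : CK ==> x : CA ==> D T (a \<odot>A x) = a \<odot>A D T x"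
  and D_zero: "D T \<zero>A = \<zero>A"
  and D_neg: "x : CA ==> D T (\<ominus>A x) = \<ominus>A D T x"
  and D_one: "D T \<one>A = \<zero>A"
proof -
 note l = ext_deriv_lin[OF assms]
 show "x : CA ==> y : CA ==> D T (x \<oplus>A y) = D T x \<oplus>A D T y"
  "a : CK ==> x : CA ==> D T (a \<odot>A x) = a \<odot>A D T x"
  "D T \<zero>A = \<zero>A" "x : CA ==> D T (\<ominus>A x) = \<ominus>A D T x"
  using lin_maps_add[OF l] lin_maps_smult[OF l] lin_maps_hom[OF A.A.is_abelian_group A.A.is_abelian_group l]
  by auto
 show "D T \<one>A = \<zero>A"
  using ext_deriv_mult[OF assms, of "\<one>A" "\<one>A"] D_closed[OF assms, of "\<one>A"] by simp
qed

lemma D_gen_mult: "T \<in> lin_maps K V V ==> v : CV ==> x : CA ==>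
  D T (\<gamma> v \<otimes>A x) = \<gamma> (T v) \<otimes>A x \<oplus>A \<gamma> v \<otimes>A D T x"
 by (simp add: ext_deriv_mult ext_deriv_gen)

lemma D_pow: "x \<in> ext_pow K V k ==> T \<in> lin_maps K V V ==> D T x \<in> ext_pow K V k"
proof (induction k arbitrary: x)
 case 0
 have "counit x : CK" using ext_pow_closed[OF 0(1)] by simp
 then have "D T (counit x \<odot>A \<one>A) = \<zero>A" using D_linear[OF 0(2)] by simp
 with ext_pow_0[OF 0(1)] show ?case by auto
next
 case (Suc k)
 from Suc.prems(1) show ?case
 proof (induction rule: ext_pow_Suc_induct)
  case (gen u y)
  then show ?case using Suc.IH[OF gen(2) Suc.prems(2)] ext_pow_closed[OF gen(2)] lin_maps_closed[OF Suc.prems(2)]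
   by (simp add: D_gen_mult[OF Suc.prems(2)] gen_mult_pow)
 qed (use Suc.prems(2) in \<open>auto simp: D_linear\<close>)
qed

lemma End_simps:
 "carrier (End_alg K V) = lin_maps K V V" "\<zero>\<^bsub>End_alg K V\<^esub> = (\<lambda>x\<in>CV. \<zero>\<^bsub>V\<^esub>)"
 "v : CV ==> (T \<oplus>\<^bsub>End_alg K V\<^esub> T') v = T v \<oplus>\<^bsub>V\<^esub> T' v"
 "v : CV ==> (T \<otimes>\<^bsub>End_alg K V\<^esub> T') v = T (T' v)"
 "v : CV ==> (a \<odot>\<^bsub>End_alg K V\<^esub> T) v = a \<odot>\<^bsub>V\<^esub> T v"
 "v : CV ==> \<one>\<^bsub>End_alg K V\<^esub> v = v"
 by (simp_all add: End_alg_def)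

sublocale End: kalg K "End_alg K V" by (rule End_alg_kalg)

lemma End_closed:
 "T \<in> lin_maps K V V ==> T' \<in> lin_maps K V V ==> T \<oplus>\<^bsub>End_alg K V\<^esub> T' \<in> lin_maps K V V"
 "T \<in> lin_maps K V V ==> T' \<in> lin_maps K V V ==> T \<otimes>\<^bsub>End_alg K V\<^esub> T' \<in> lin_maps K V V"
 "T \<in> lin_maps K V V ==> T' \<in> lin_maps K V V ==> T \<ominus>\<^bsub>End_alg K V\<^esub> T' \<in> lin_maps K V V"
 "T \<in> lin_maps K V V ==> \<ominus>\<^bsub>End_alg K V\<^esub> T \<in> lin_maps K V V"
 "a : CK ==> T \<in> lin_maps K V V ==> a \<odot>\<^bsub>End_alg K V\<^esub> T \<in> lin_maps K V V"
 "\<one>\<^bsub>End_alg K V\<^esub> \<in> lin_maps K V V" "\<zero>\<^bsub>End_alg K V\<^esub> \<in> lin_maps K V V"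
 using End.A.a_closed[of T T'] End.A.m_closed[of T T'] End.A.minus_closed[of T T'] End.A.a_inv_closed[of T]
  End.smult_closed[of a T] End.A.one_closed End.A.zero_closed
 by (simp_all add: End_simps)

lemma End_neg: "v : CV ==> T \<in> lin_maps K V V ==> (\<ominus>\<^bsub>End_alg K V\<^esub> T) v = \<ominus>\<^bsub>V\<^esub> T v"
 using End.smult_l_minus[of \<one> T] End_simps(5)[of v "\<ominus> \<one>" T] lin_maps_closed[of T K V V v]
 by (simp add: smult_l_minus End_simps(1))

lemma End_minus: "v : CV ==> T \<in> lin_maps K V V ==> T' \<in> lin_maps K V V ==>
  (T \<ominus>\<^bsub>End_alg K V\<^esub> T') v = T v \<ominus>\<^bsub>V\<^esub> T' v"
 by (simp add: End.A.minus_eq End_simps(3) End_neg M.minus_eq)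

lemma End_eqI: "T \<in> lin_maps K V V ==> T' \<in> lin_maps K V V ==> (!!v. v : CV ==> T v = T' v) ==> T = T'"
 by (rule lin_maps_eqI)

lemma gen_neg: "v : CV ==> \<gamma> (\<ominus>\<^bsub>V\<^esub> v) = \<ominus>A \<gamma> v"
 using gen_smult[of "\<ominus> \<one>" v] by (simp add: smult_l_minus A.smult_l_minus)

text \<open>The passage from endomorphisms to derivations is a homomorphism of Lie algebras. For the
  commutator both sides are derivations with the same values on vectors; the induction over products
  carries this out.\<close>

lemma D_End:
 assumes x: "x : CA" and T: "T \<in> lin_maps K V V" and T': "T' \<in> lin_maps K V V"
 shows D_End_add: "D (T \<oplus>\<^bsub>End_alg K V\<^esub> T') x = D T x \<oplus>A D T' x"
  and D_End_minus: "D (T \<ominus>\<^bsub>End_alg K V\<^esub> T') x = D T x \<ominus>A D T' x"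
  and D_End_neg: "D (\<ominus>\<^bsub>End_alg K V\<^esub> T) x = \<ominus>A D T x"
  and D_End_smult: "a : CK ==> D (a \<odot>\<^bsub>End_alg K V\<^esub> T) x = a \<odot>A D T x"
  and D_End_zero: "D \<zero>\<^bsub>End_alg K V\<^esub> x = \<zero>A"
  and D_End_comm: "D (T \<otimes>\<^bsub>End_alg K V\<^esub> T' \<ominus>\<^bsub>End_alg K V\<^esub> T' \<otimes>\<^bsub>End_alg K V\<^esub> T) x =
   D T (D T' x) \<ominus>A D T' (D T x)"
proof -
 note Tc = lin_maps_closed[OF T] lin_maps_closed[OF T']
 have add: "D (T \<oplus>\<^bsub>End_alg K V\<^esub> T') x = D T x \<oplus>A D T' x"
  if "T \<in> lin_maps K V V" "T' \<in> lin_maps K V V" for T T'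
  using x
  by (induction rule: ext_induct)
   (use that lin_maps_closed[OF that(1)] lin_maps_closed[OF that(2)] in \<open>simp_all add: End_closed D_linear D_gen_mult
    End_simps gen_add A.A.l_distr A.A.r_distr A.A.a_ac A.smult_r_distr\<close>)
 have smult: "D (a \<odot>\<^bsub>End_alg K V\<^esub> T) x = a \<odot>A D T x" if "a : CK" "T \<in> lin_maps K V V" for a T
  using x
  by (induction rule: ext_induct)
   (use that lin_maps_closed[OF that(2)] in \<open>simp_all add: End_closed D_linear D_gen_mult End_simps gen_smult
    A.smult_r_distr A.smult_mult_l A.smult_mult_r R.m_comm flip: A.smult_assoc1\<close>)
 have neg: "D (\<ominus>\<^bsub>End_alg K V\<^esub> T) x = \<ominus>A D T x" if "T \<in> lin_maps K V V" for T
  using smult[of "\<ominus> \<one>" T] that x by (simp add: End.smult_l_minus A.smult_l_minus End_simps(1))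
 show "D (T \<oplus>\<^bsub>End_alg K V\<^esub> T') x = D T x \<oplus>A D T' x" "D (\<ominus>\<^bsub>End_alg K V\<^esub> T) x = \<ominus>A D T x"
  "a : CK ==> D (a \<odot>\<^bsub>End_alg K V\<^esub> T) x = a \<odot>A D T x"
  using add[OF T T'] neg[OF T] smult[OF _ T] by auto
 show "D (T \<ominus>\<^bsub>End_alg K V\<^esub> T') x = D T x \<ominus>A D T' x"
  using T T' by (simp add: End.A.minus_eq A.A.minus_eq add End_closed neg)
 show "D \<zero>\<^bsub>End_alg K V\<^esub> x = \<zero>A"
  using smult[OF R.zero_closed T] T x by (simp add: End_simps(1))
 let ?C = "T \<otimes>\<^bsub>End_alg K V\<^esub> T' \<ominus>\<^bsub>End_alg K V\<^esub> T' \<otimes>\<^bsub>End_alg K V\<^esub> T"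
 have C: "?C \<in> lin_maps K V V" using T T' by (simp add: End_closed)
 have Cv: "\<gamma> (?C v) = \<gamma> (T (T' v)) \<ominus>A \<gamma> (T' (T v))" if "v : CV" for v
  using that T T' Tc by (simp add: End_minus End_closed End_simps gen_add gen_neg M.minus_eq A.A.minus_eq)
 show "D ?C x = D T (D T' x) \<ominus>A D T' (D T x)"
  using x
 proof (induction rule: ext_induct)
  case one show ?case using C T T' by (simp add: D_linear A.A.minus_eq A.A.r_neg)
 next
  case (gen v y)
  define p q r s where "p = \<gamma> (T (T' v))" and "q = \<gamma> (T' (T v))" and "r = \<gamma> (T v)" and "s = \<gamma> (T' v)"
  have cl: "p : CA" "q : CA" "r : CA" "s : CA" "\<gamma> v : CA" using gen Tc by (auto simp: p_def q_def r_def s_def)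
  have "D ?C (\<gamma> v \<otimes>A y) = (p \<ominus>A q) \<otimes>A y \<oplus>A \<gamma> v \<otimes>A (D T (D T' y) \<ominus>A D T' (D T y))"
   using gen C by (simp add: D_gen_mult Cv p_def q_def)
  moreover have "D T (D T' (\<gamma> v \<otimes>A y)) = p \<otimes>A y \<oplus>A s \<otimes>A D T y \<oplus>A (r \<otimes>A D T' y \<oplus>A \<gamma> v \<otimes>A D T (D T' y))"
   using gen T T' Tc by (simp add: D_gen_mult D_linear p_def r_def s_def)
  moreover have "D T' (D T (\<gamma> v \<otimes>A y)) = q \<otimes>A y \<oplus>A r \<otimes>A D T' y \<oplus>A (s \<otimes>A D T y \<oplus>A \<gamma> v \<otimes>A D T' (D T y))"
   using gen T T' Tc by (simp add: D_gen_mult D_linear q_def r_def s_def)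
  moreover have "y : CA" "D T y : CA" "D T' y : CA" "D T (D T' y) : CA" "D T' (D T y) : CA"
   using gen T T' by auto
  ultimately show ?case using cl by (simp only:) algebra
 next
  case (add x y)
  then have "D T x : CA" "D T' x : CA" "D T (D T' x) : CA" "D T' (D T x) : CA"
   "D T y : CA" "D T' y : CA" "D T (D T' y) : CA" "D T' (D T y) : CA" using T T' by auto
  with add C T T' show ?case by (simp add: D_linear A.A.minus_eq A.A.minus_add A.A.a_ac)
 qed (use C T T' in \<open>simp add: D_linear A.smult_r_distr A.smult_r_minus A.A.minus_eq\<close>)
qed

text \<open>Euler's identity: each of the \<open>k\<close> vectors in a product contributes
  once.\<close>

lemma D_one_End: "x \<in> ext_pow K V k ==> D \<one>\<^bsub>End_alg K V\<^esub> x = ([int k] \<cdot>\<^bsub>K\<^esub> \<one>) \<odot>A x"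
proof (induction k arbitrary: x)
 case 0
 have "counit x : CK" using ext_pow_closed[OF 0] by simp
 then have "D \<one>\<^bsub>End_alg K V\<^esub> (counit x \<odot>A \<one>A) = \<zero>A" using D_linear End_closed by simp
 with ext_pow_0[OF 0] ext_pow_closed[OF 0] show ?case by (auto simp: add_pow_def)
next
 case (Suc k)
 have k: "[(1 + int k)] \<cdot>\<^bsub>K\<^esub> \<one> = \<one> \<oplus> [int k] \<cdot>\<^bsub>K\<^esub> \<one>"
  using R.add.int_pow_mult[of \<one> 1 "int k"] R.add.int_pow_1[of \<one>] by (simp add: add_pow_def)
 have kc: "[int k] \<cdot>\<^bsub>K\<^esub> \<one> : CK"
  using R.add.int_pow_closed[of \<one> "int k"] by (simp add: add_pow_def)
 from Suc.prems show ?case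
 proof (induction rule: ext_pow_Suc_induct)
  case (gen u y)
  then show ?case using Suc.IH[OF gen(2)] ext_pow_closed[OF gen(2)] kc
   by (simp add: D_gen_mult End_closed End_simps k A.smult_l_distr A.smult_mult_r)
 qed (use kc in \<open>auto simp: D_linear End_closed k A.smult_r_distr A.smult_assoc1[symmetric] R.m_comm\<close>)
qed

end

context dpair
begin

abbreviation "EW \<equiv> End_alg K W"
abbreviation (input) plus_EW (infixl "\<oplus>EW" 65) where "x \<oplus>EW y \<equiv> x \<oplus>\<^bsub>EW\<^esub> y"
abbreviation (input) minus_EW (infixl "\<ominus>EW" 65) where "x \<ominus>EW y \<equiv> x \<ominus>\<^bsub>EW\<^esub> y"
abbreviation (input) times_EW (infixl "\<otimes>EW" 70) where "x \<otimes>EW y \<equiv> x \<otimes>\<^bsub>EW\<^esub> y"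
abbreviation (input) scale_EW (infixl "\<odot>EW" 70) where "x \<odot>EW y \<equiv> x \<odot>\<^bsub>EW\<^esub> y"
abbreviation (input) neg_EW ("\<ominus>EW _" [81] 80) where "\<ominus>EW x \<equiv> \<ominus>\<^bsub>EW\<^esub> x"
abbreviation (input) zero_EW ("\<zero>EW") where "\<zero>EW \<equiv> \<zero>\<^bsub>EW\<^esub>"
abbreviation (input) one_EW ("\<one>EW") where "\<one>EW \<equiv> \<one>\<^bsub>EW\<^esub>"
abbreviation (input) "YW \<equiv> carrier EW"

lemma gW_eq_counit: "v : CV ==> w : CW ==> h v w = W.counit (dW v (gW w))"
 by (simp add: dW_gen)

text \<open>The endomorphism of rank one given by the functional \<open>h v\<close> and the vector
  \<open>u\<close>. For a perfect pairing these maps generate all endomorphisms additively.\<close>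

definition rk :: "'c => 'e => 'e => 'e" where "rk v u = (\<lambda>w\<in>CW. h v w \<odot>W u)"

lemma rk_apply [simp]: "w : CW ==> rk v u w = h v w \<odot>W u"
 by (simp add: rk_def)

lemma rank1_lin: "v : CV ==> u : CW ==> rk v u : LW"
 unfolding rk_def by (rule lin_maps_restrictI[OF W.module_axioms])
  (simp_all add: h_add_r h_smult_r W.smult_l_distr W.smult_assoc1)

text \<open>Multiplication by \<open>u\<close> after contraction by \<open>v\<close> satisfies the
  Leibniz rule, because the sign of the antiderivation is undone when \<open>u\<close> is moved past
  a factor.\<close>

lemma D_rank1:
 assumes "x : XW" "v : CV" "u : CW"
 shows "W.D (rk v u) x = gW u \<otimes>AW dW v x"
 using assms
proof (induction rule: W.ext_induct)
 case (gen w y)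
 then show ?case using W.gen_anticomm[of u w]
  by (simp add: W.D_gen_mult rank1_lin dW_gen_mult W.gen_smult W.A.smult_mult_l W.A.smult_mult_r
    W.A.A.r_distr W.A.A.minus_eq W.A.A.l_minus W.A.A.r_minus flip: W.A.A.m_assoc)
qed (use rank1_lin in \<open>auto simp: W.D_linear dW_linear W.A.A.r_distr W.A.smult_mult_r\<close>)

lemma dW_anticomm:
 assumes "x : XW" "v : CV" "u : CV"
 shows "dW v (dW u x) = \<ominus>AW dW u (dW v x)"
 using V.gen_anticomm[of v u] cW_gen_mult[of x v "gV u"] cW_gen_mult[of x u "gV v"] assms
 by (simp add: cW_linear_l)

text \<open>The last hypothesis puts \<open>(T, T')\<close> into the Lie algebra S. It enters for a
  leading vector \<open>w\<close>: the terms with \<open>h (T v) w\<close> and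
  \<open>h v (T' w)\<close> cancel.\<close>

lemma deriv_dW:
 assumes "x : XW" and v: "v : CV" and T: "T : LV" and T': "T' : LW"
  and adj: "!!v w. v : CV ==> w : CW ==> h (T v) w \<oplus> h v (T' w) = \<zero>"
 shows "W.D T' (dW v x) = dW (T v) x \<oplus>AW dW v (W.D T' x)"
 using assms(1)
proof (induction rule: W.ext_induct)
 case one show ?case using T T' v lin_maps_closed[OF T v] by (simp add: W.D_linear dW_linear)
next
 case (gen w y)
 note c = lin_maps_closed[OF T v] lin_maps_closed[OF T' gen(1)]
 define a b where "a = h (T v) w" and "b = h v (T' w)"
 have ab: "a : CK" "b : CK" "b = \<ominus> a"
  using adj[OF v gen(1)] c v gen(1) V.R.sum_zero_eq_neg[of b a] V.R.a_comm by (auto simp: a_def b_def)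
 define x1 x2 x3 where "x1 = W.D T' y" and "x2 = dW (T v) y" and "x3 = dW v (W.D T' y)"
 define z where "z = gW (T' w) \<otimes>AW dW v y"
 have xc: "x1 : XW" "x2 : XW" "x3 : XW" "z : XW" "gW w : XW" "y : XW"
  "a \<odot>AW y : XW" "h v w \<odot>AW x1 : XW"
  using gen c v T' ab by (auto simp: x1_def x2_def x3_def z_def)
 have "W.D T' (dW v (gW w \<otimes>AW y)) = h v w \<odot>AW x1 \<ominus>AW (z \<oplus>AW gW w \<otimes>AW (x2 \<oplus>AW x3))"
  using gen c v T' by (simp add: dW_gen_mult W.A.A.minus_eq W.D_linear W.D_gen_mult x1_def x2_def x3_def z_def)
 moreover have "dW (T v) (gW w \<otimes>AW y) = a \<odot>AW y \<ominus>AW gW w \<otimes>AW x2"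
  using gen c v T' by (simp add: dW_gen_mult x2_def a_def)
 moreover have "dW v (W.D T' (gW w \<otimes>AW y)) = (\<ominus>AW (a \<odot>AW y) \<ominus>AW z) \<oplus>AW (h v w \<odot>AW x1 \<ominus>AW gW w \<otimes>AW x3)"
  using gen c v T' ab by (simp add: W.D_gen_mult dW_linear dW_gen_mult x3_def x1_def z_def b_def[symmetric] W.A.smult_l_minus)
 ultimately show ?case using xc by (simp only:) algebra
next
 case (add x y)
 then show ?case using lin_maps_closed[OF T v] v T' by (simp add: W.D_linear dW_linear W.A.A.a_ac)
next
 case (smult a x)
 then show ?case using lin_maps_closed[OF T v] v T' by (simp add: W.D_linear dW_linear W.A.smult_r_distr)
qed

text \<open>Induction on \<open>a\<close>, with \<open>deriv_dW\<close> for each additional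
  vector.\<close>

lemma deriv_contract:
 assumes "a : XV" and x: "x : XW" and T: "T : LV" and T': "T' : LW"
  and adj: "!!v w. v : CV ==> w : CW ==> h (T v) w \<oplus> h v (T' w) = \<zero>"
 shows "W.D T' (cW a x) = cW (V.D T a) x \<oplus>AW cW a (W.D T' x)"
 using assms(1)
proof (induction rule: V.ext_induct)
 case one show ?case using T T' x by (simp add: V.D_linear cW_linear_l)
next
 case (gen v b)
 then have c: "T v : CV" using lin_maps_closed[OF T] by blast
 have "W.D T' (dW v (cW b x)) = dW (T v) (cW b x) \<oplus>AW dW v (W.D T' (cW b x))"
  using gen x T T' adj by (intro deriv_dW) auto
 with gen c x T T' show ?case by (simp add: cW_linear_l V.D_gen_mult dW_linear W.A.A.a_assoc)
next
 case (add a b) with x T T' show ?case by (simp add: cW_linear_l V.D_linear W.D_linear W.A.A.a_ac)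
next
 case (smult k a) with x T T' show ?case by (simp add: cW_linear_l V.D_linear W.D_linear W.A.smult_r_distr)
qed

end

text \<open>The families \<open>b\<close> and \<open>c\<close> form a dual basis in the sense of
  projective modules: they generate but need not be independent, and \<open>n\<close> may exceed the
  rank.\<close>

locale perfect = dpair K V W h for K (structure) and V and W and h :: "'c => 'e => 'a" +
 fixes n :: nat and b :: "nat => 'e" and c :: "nat => 'c"
 assumes b_closed: "b \<in> {..<n} \<rightarrow> CW" and c_closed: "c \<in> {..<n} \<rightarrow> CV"
  and dual_W: "w : CW ==> w = (\<Oplus>\<^bsub>W\<^esub>i\<in>{..<n}. h (c i) w \<odot>W b i)"
  and dual_V: "v : CV ==> v = (\<Oplus>\<^bsub>V\<^esub>i\<in>{..<n}. h v (b i) \<odot>V c i)"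
begin

lemma perfect_swap: "perfect K W V (\<lambda>w v. h v w) n c b"
 by (intro perfect.intro swap perfect_axioms.intro) (use b_closed c_closed dual_W dual_V in auto)

lemma bc [simp]: "i < n ==> b i : CW" "i < n ==> c i : CV"
 using b_closed c_closed by auto

lemma nondeg:
 assumes "w : CW" "w' : CW" "!!v. v : CV ==> h v w = h v w'" shows "w = w'"
proof -
 have "(\<Oplus>\<^bsub>W\<^esub>i\<in>{..<n}. h (c i) w \<odot>W b i) = (\<Oplus>\<^bsub>W\<^esub>i\<in>{..<n}. h (c i) w' \<odot>W b i)"
  by (rule W.finsum_cong') (use assms in auto)
 then show ?thesis using dual_W[OF assms(1)] dual_W[OF assms(2)] by simp
qed

text \<open>A vector is recovered from its image by contracting with all \<open>v\<close>. Thus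
  degree 1 is a copy of the module, and \<open>ext_to_vector\<close> is meaningful.\<close>

lemma gen_inj:
 assumes "w : CW" "w' : CW" "gW w = gW w'" shows "w = w'"
 by (rule nondeg) (use assms in \<open>simp_all add: gW_eq_counit\<close>)

lemma ext_to_vector_gen: "w : CW ==> ext_to_vector K W (gW w) = w"
 unfolding ext_to_vector_def by (rule the_equality) (use gen_inj in auto)

lemma h_finsum_l:
 assumes "finite I" "u \<in> I \<rightarrow> CV" "w : CW"
 shows "h (\<Oplus>\<^bsub>V\<^esub>i\<in>I. u i) w = (\<Oplus>i\<in>I. h (u i) w)"
 using assms(1,2)
proof (induction I)
 case empty
 show ?case using h_smult_l[of \<zero> "\<zero>V" w] assms(3) by simp
next
 case (insert i I)
 then have "u \<in> I \<rightarrow> CV" "u i : CV" "(\<lambda>i. h (u i) w) \<in> I \<rightarrow> CK" "h (u i) w : CK"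
  using assms(3) by auto
 with insert assms(3) show ?case by (simp add: h_add_l)
qed

lemma h_finsum_r:
 assumes "finite I" "u \<in> I \<rightarrow> CW" "v : CV"
 shows "h v (\<Oplus>\<^bsub>W\<^esub>i\<in>I. u i) = (\<Oplus>i\<in>I. h v (u i))"
proof -
 interpret s: perfect K W V "\<lambda>w v. h v w" n c b by (rule perfect_swap)
 show ?thesis by (rule s.h_finsum_l) (use assms in auto)
qed

text \<open>Expanding the argument in the dual basis writes \<open>T\<close> as the sum of the rank
  one maps \<open>rk (c i) (T (b i))\<close>; the induction runs over its partial sums.\<close>

lemma End_W_induct [consumes 1, case_names zero rank1]:
 assumes T: "T : LW" and P0: "P \<zero>EW"
  and P1: "!!v u T'. v : CV ==> u : CW ==> T' : LW ==> P T' ==>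
   P (rk v u \<oplus>EW T')"
 shows "P T"
proof -
 note Tc = lin_maps_closed[OF T]
 define S where "S m = (\<lambda>w\<in>CW. \<Oplus>\<^bsub>W\<^esub>i\<in>{..<m}. h (c i) w \<odot>W T (b i))" for m
 have "m \<le> n ==> S m : LW \<and> P (S m)" for m
 proof (induction m)
  case 0
  have "S 0 = \<zero>EW" by (simp add: S_def End_alg_def)
  then show ?case using P0 W.End_closed(7) by simp
 next
  case (Suc m)
  then have IH: "S m : LW" "P (S m)" by auto
  have m: "m < n" using Suc by simp
  note r = rank1_lin[OF bc(2)[OF m] Tc[OF bc(1)[OF m]]]
  have "S (Suc m) w = (rk (c m) (T (b m)) \<oplus>EW S m) w" for w
  proof (cases "w : CW")
   case True
   have "(\<lambda>i. h (c i) w \<odot>W T (b i)) \<in> {..<m} \<rightarrow> CW" "h (c m) w \<odot>W T (b m) : CW"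
    using True m Tc by auto
   then show ?thesis using True by (simp add: S_def W.End_simps lessThan_Suc)
  qed (simp add: S_def End_alg_def)
  then have "S (Suc m) = rk (c m) (T (b m)) \<oplus>EW S m" by (rule ext)
  then show ?case using P1[OF bc(2)[OF m] Tc[OF bc(1)[OF m]] IH] W.End_closed(1)[OF r IH(1)] by simp
 qed
 then have "P (S n)" by simp
 moreover have "S n = T"
 proof (rule W.End_eqI[OF _ T])
  show "S n : LW" using \<open>!!m. m \<le> n ==> S m : LW \<and> P (S m)\<close> by simp
  fix w assume w: "w : CW"
  have "T w = T (\<Oplus>\<^bsub>W\<^esub>i\<in>{..<n}. h (c i) w \<odot>W b i)" using dual_W[OF w] by simp
  also have "\<dots> = (\<Oplus>\<^bsub>W\<^esub>i\<in>{..<n}. T (h (c i) w \<odot>W b i))"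
   by (rule lin_maps_finsum[OF W.abelian_group_axioms W.abelian_group_axioms T]) (use w in auto)
  also have "\<dots> = (\<Oplus>\<^bsub>W\<^esub>i\<in>{..<n}. h (c i) w \<odot>W T (b i))"
   by (rule W.finsum_cong') (use w Tc in \<open>auto simp: lin_maps_smult[OF T]\<close>)
  finally show "S n w = T w" using w by (simp add: S_def)
 qed
 ultimately show ?thesis by simp
qed

abbreviation "tr \<equiv> mtrace K W"

text \<open>The trace does not depend on the representation of \<open>T\<close>: expanding the
  images of the \<open>b j\<close> by the representation and the vectors \<open>v i\<close> by the
  dual basis leads to the same double sum.\<close>

lemma trace_rep:
 assumes T: "T : LW" and f: "f \<in> {..<m} \<rightarrow> dual K W" and v: "v \<in> {..<m} \<rightarrow> CW"
  and rep: "!!x. x : CW ==> T x = (\<Oplus>\<^bsub>W\<^esub>i\<in>{..<m}. f i x \<odot>W v i)"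
 shows "(\<Oplus>j\<in>{..<n}. h (c j) (T (b j))) = (\<Oplus>i\<in>{..<(m::nat)}. f i (v i))"
proof -
 have fl: "f i \<in> lin_maps K W (regular_module K)" if "i < m" for i using f that by (auto simp: dual_def)
 have fc [simp]: "f i x : CK" if "i < m" "x : CW" for i x
  using lin_maps_closed[OF fl that(2)] that(1) by (simp add: regular_module_def)
 have vc [simp]: "i < m ==> v i : CW" for i using v by auto
 interpret Q: module K "regular_module K" by (rule V.R.regular_module_module)
 have fsum: "finsum (regular_module K) u I = finsum K u I" for u :: "nat => 'a" and I
  by (simp add: finsum_def finprod_def regular_module_def)
 have "h (c j) (T (b j)) = (\<Oplus>i\<in>{..<m}. f i (b j) \<otimes> h (c j) (v i))" if j: "j < n" for j
 proof -
  have "h (c j) (T (b j)) = (\<Oplus>i\<in>{..<m}. h (c j) (f i (b j) \<odot>W v i))"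
   unfolding rep[OF bc(1)[OF j]] by (rule h_finsum_r) (use j in auto)
  also have "\<dots> = (\<Oplus>i\<in>{..<m}. f i (b j) \<otimes> h (c j) (v i))"
   by (rule V.R.finsum_cong') (use j in \<open>auto simp: h_smult_r\<close>)
  finally show ?thesis .
 qed
 then have "(\<Oplus>j\<in>{..<n}. h (c j) (T (b j))) = (\<Oplus>j\<in>{..<n}. \<Oplus>i\<in>{..<m}. f i (b j) \<otimes> h (c j) (v i))"
  by (intro V.R.finsum_cong') auto
 also have "\<dots> = (\<Oplus>i\<in>{..<m}. \<Oplus>j\<in>{..<n}. f i (b j) \<otimes> h (c j) (v i))"
  by (rule V.R.finsum_swap) auto
 also have "\<dots> = (\<Oplus>i\<in>{..<m}. f i (v i))"
 proof (intro V.R.finsum_cong')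
  fix i assume i: "i \<in> {..<m}"
  have "f i (v i) = f i (\<Oplus>\<^bsub>W\<^esub>j\<in>{..<n}. h (c j) (v i) \<odot>W b j)" using dual_W[of "v i"] i by simp
  also have "\<dots> = (\<Oplus>j\<in>{..<n}. f i (h (c j) (v i) \<odot>W b j))"
   using i by (subst lin_maps_finsum[OF W.abelian_group_axioms Q.abelian_group_axioms fl]) (auto simp: fsum)
  also have "\<dots> = (\<Oplus>j\<in>{..<n}. f i (b j) \<otimes> h (c j) (v i))"
   using i lin_maps_smult[OF fl, of i] by (intro V.R.finsum_cong') (auto simp: regular_module_def V.R.m_comm)
  finally show "(\<Oplus>j\<in>{..<n}. f i (b j) \<otimes> h (c j) (v i)) = f i (v i)" by simp
 qed auto
 finally show ?thesis .
qed

lemma trace_eq: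
 assumes T: "T : LW" shows "tr T = (\<Oplus>j\<in>{..<n}. h (c j) (T (b j)))"
 unfolding mtrace_def
proof (rule the_equality)
 let ?f = "\<lambda>i. \<lambda>w\<in>CW. h (c i) w"
 have 1: "?f i \<in> dual K W" if "i < n" for i
  unfolding dual_def by (rule lin_maps_restrictI[OF W.module_axioms])
   (use that in \<open>auto simp: regular_module_def h_add_r h_smult_r\<close>)
 have 2: "T x = (\<Oplus>\<^bsub>W\<^esub>i\<in>{..<n}. ?f i x \<odot>W T (b i))" if x: "x : CW" for x
 proof -
  have "T x = T (\<Oplus>\<^bsub>W\<^esub>i\<in>{..<n}. h (c i) x \<odot>W b i)" using dual_W[OF x] by simp
  also have "\<dots> = (\<Oplus>\<^bsub>W\<^esub>i\<in>{..<n}. T (h (c i) x \<odot>W b i))"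
   by (rule lin_maps_finsum[OF W.abelian_group_axioms W.abelian_group_axioms T]) (use x in auto)
  also have "\<dots> = (\<Oplus>\<^bsub>W\<^esub>i\<in>{..<n}. ?f i x \<odot>W T (b i))"
   by (rule W.finsum_cong') (use x lin_maps_closed[OF T] in \<open>auto simp: lin_maps_smult[OF T]\<close>)
  finally show ?thesis .
 qed
 have 3: "(\<Oplus>j\<in>{..<n}. h (c j) (T (b j))) = (\<Oplus>j\<in>{..<n}. ?f j (T (b j)))"
  by (rule V.R.finsum_cong') (use lin_maps_closed[OF T] in auto)
 show "\<exists>(m::nat) f v. f \<in> {..<m} \<rightarrow> dual K W \<and> v \<in> {..<m} \<rightarrow> CW \<and>
   (\<forall>x\<in>CW. T x = (\<Oplus>\<^bsub>W\<^esub>i\<in>{..<m}. f i x \<odot>W v i)) \<and>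
   (\<Oplus>j\<in>{..<n}. h (c j) (T (b j))) = (\<Oplus>i\<in>{..<m}. f i (v i))"
  by (rule exI[of _ n], rule exI[of _ ?f], rule exI[of _ "\<lambda>i. T (b i)"])
   (use 1 2 3 lin_maps_closed[OF T] in \<open>simp add: Pi_def\<close>)
next
 fix t assume "\<exists>m f v. f \<in> {..<m} \<rightarrow> dual K W \<and> v \<in> {..<m} \<rightarrow> CW \<and>
   (\<forall>x\<in>CW. T x = (\<Oplus>\<^bsub>W\<^esub>i\<in>{..<m}. f i x \<odot>W v i)) \<and> t = (\<Oplus>i\<in>{..<(m::nat)}. f i (v i))"
 then obtain m f v where m: "f \<in> {..<m::nat} \<rightarrow> dual K W" "v \<in> {..<m} \<rightarrow> CW"
   "\<forall>x\<in>CW. T x = (\<Oplus>\<^bsub>W\<^esub>i\<in>{..<m}. f i x \<odot>W v i)" "t = (\<Oplus>i\<in>{..<m}. f i (v i))" by blast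
 then show "t = (\<Oplus>j\<in>{..<n}. h (c j) (T (b j)))" using trace_rep[OF T m(1,2)] by simp
qed

lemma trace_closed [simp]: "T : LW ==> tr T : CK"
 by (simp add: trace_eq lin_maps_closed Pi_def)

lemma trace_add:
 assumes T: "T : LW" and T': "T' : LW"
 shows "tr (T \<oplus>EW T') = tr T \<oplus> tr T'"
proof -
 note cl = lin_maps_closed[OF T] lin_maps_closed[OF T']
 have "tr (T \<oplus>EW T') = (\<Oplus>j\<in>{..<n}. h (c j) (T (b j)) \<oplus> h (c j) (T' (b j)))"
  unfolding trace_eq[OF W.End_closed(1)[OF T T']]
  by (rule V.R.finsum_cong') (use cl in \<open>auto simp: W.End_simps h_add_r\<close>)
 also have "\<dots> = tr T \<oplus> tr T'"
  unfolding trace_eq[OF T] trace_eq[OF T'] by (rule V.R.finsum_addf) (use cl in auto)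
 finally show ?thesis .
qed

lemma trace_smult:
 assumes a: "a : CK" and T: "T : LW"
 shows "tr (a \<odot>EW T) = a \<otimes> tr T"
proof -
 note cl = lin_maps_closed[OF T]
 have "tr (a \<odot>EW T) = (\<Oplus>j\<in>{..<n}. a \<otimes> h (c j) (T (b j)))"
  unfolding trace_eq[OF W.End_closed(5)[OF a T]]
  by (rule V.R.finsum_cong') (use cl a in \<open>auto simp: W.End_simps h_smult_r\<close>)
 also have "\<dots> = a \<otimes> tr T"
  unfolding trace_eq[OF T] by (rule V.R.finsum_rdistr[symmetric]) (use cl a in auto)
 finally show ?thesis .
qed

lemma trace_neg: "T : LW ==> tr (\<ominus>EW T) = \<ominus> tr T"
 using trace_smult[of "\<ominus> \<one>" T]
 by (simp add: W.End.smult_l_minus V.R.l_minus W.End_simps(1))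

lemma trace_minus: "T : LW ==> T' : LW ==> tr (T \<ominus>EW T') = tr T \<ominus> tr T'"
 by (simp add: W.End.A.minus_eq trace_add trace_neg W.End_closed V.R.minus_eq)

lemma trace_zero: "tr \<zero>EW = \<zero>"
 using trace_smult[of \<zero> "\<zero>EW"] W.End_closed(7) by (simp add: W.End_simps(1))

lemma trace_rank1:
 assumes "v : CV" "u : CW" shows "tr (rk v u) = h v u"
proof -
 have "tr (rk v u) = (\<Oplus>j\<in>{..<n}. h (h v (b j) \<odot>V c j) u)"
  unfolding trace_eq[OF rank1_lin[OF assms]]
  by (rule V.R.finsum_cong') (use assms in \<open>auto simp: h_smult_l h_smult_r\<close>)
 also have "\<dots> = h (\<Oplus>\<^bsub>V\<^esub>j\<in>{..<n}. h v (b j) \<odot>V c j) u"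
  by (rule h_finsum_l[symmetric]) (use assms in auto)
 finally show ?thesis using dual_V[OF assms(1)] by simp
qed

text \<open>Expanding the inner image in the dual basis gives a double sum that is symmetric under
  exchanging the two maps together with the two indices.\<close>

lemma trace_comm:
 assumes T: "T : LW" and T': "T' : LW"
 shows "tr (T \<otimes>EW T') = tr (T' \<otimes>EW T)"
proof -
 have *: "tr (S \<otimes>EW S') = (\<Oplus>j\<in>{..<n}. \<Oplus>i\<in>{..<n}. h (c i) (S' (b j)) \<otimes> h (c j) (S (b i)))"
  if S: "S : LW" and S': "S' : LW" for S S'
 proof -
  have "h (c j) (S (S' (b j))) = (\<Oplus>i\<in>{..<n}. h (c i) (S' (b j)) \<otimes> h (c j) (S (b i)))" if j: "j < n" for j
  proof -
   have Sb: "S' (b j) : CW" using S' j lin_maps_closed by force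
   have "S (S' (b j)) = S (\<Oplus>\<^bsub>W\<^esub>i\<in>{..<n}. h (c i) (S' (b j)) \<odot>W b i)" using dual_W[OF Sb] by simp
   also have "\<dots> = (\<Oplus>\<^bsub>W\<^esub>i\<in>{..<n}. S (h (c i) (S' (b j)) \<odot>W b i))"
    by (rule lin_maps_finsum[OF W.abelian_group_axioms W.abelian_group_axioms S]) (use Sb in auto)
   also have "\<dots> = (\<Oplus>\<^bsub>W\<^esub>i\<in>{..<n}. h (c i) (S' (b j)) \<odot>W S (b i))"
    by (rule W.finsum_cong') (use Sb lin_maps_closed[OF S] in \<open>auto simp: lin_maps_smult[OF S]\<close>)
   also have "h (c j) \<dots> = (\<Oplus>i\<in>{..<n}. h (c j) (h (c i) (S' (b j)) \<odot>W S (b i)))"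
    by (rule h_finsum_r) (use j Sb lin_maps_closed[OF S] in auto)
   also have "\<dots> = (\<Oplus>i\<in>{..<n}. h (c i) (S' (b j)) \<otimes> h (c j) (S (b i)))"
    by (rule V.R.finsum_cong') (use j Sb lin_maps_closed[OF S] in \<open>auto simp: h_smult_r\<close>)
   finally show ?thesis .
  qed
  with S S' show ?thesis
   by (simp add: trace_eq W.End_closed) (rule V.R.finsum_cong', auto simp: W.End_simps lin_maps_closed)
 qed
 have "tr (T \<otimes>EW T') = (\<Oplus>i\<in>{..<n}. \<Oplus>j\<in>{..<n}. h (c i) (T' (b j)) \<otimes> h (c j) (T (b i)))"
  unfolding *[OF T T'] by (rule V.R.finsum_swap) (use lin_maps_closed[OF T] lin_maps_closed[OF T'] in auto)
 also have "\<dots> = tr (T' \<otimes>EW T)"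
  unfolding *[OF T' T]
  by (intro V.R.finsum_cong') (use lin_maps_closed[OF T] lin_maps_closed[OF T'] in \<open>auto simp: V.R.m_comm\<close>)
 finally show ?thesis .
qed

text \<open>The adjoint is written down with the dual basis, sending \<open>v\<close> to the sum of
  the \<open>h v (T (b i)) c i\<close>. Its linearity is then a consequence of the adjunction and
  non-degeneracy.\<close>

lemma adjoint_exists:
 assumes T: "T : LW"
 obtains B where "B : LV" "!!v w. v : CV ==> w : CW ==> h (B v) w = h v (T w)"
proof -
 note Tc = lin_maps_closed[OF T]
 define B where "B = (\<lambda>v\<in>CV. \<Oplus>\<^bsub>V\<^esub>i\<in>{..<n}. h v (T (b i)) \<odot>V c i)"
 have Bh: "h (B v) w = h v (T w)" if v: "v : CV" and w: "w : CW" for v w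
 proof -
  have "h (B v) w = (\<Oplus>i\<in>{..<n}. h (h v (T (b i)) \<odot>V c i) w)"
   unfolding B_def using v w Tc by (simp add: h_finsum_l Pi_def)
  also have "\<dots> = (\<Oplus>i\<in>{..<n}. h v (T (h (c i) w \<odot>W b i)))"
   by (rule V.R.finsum_cong') (use v w Tc in \<open>auto simp: h_smult_l h_smult_r V.R.m_comm lin_maps_smult[OF T]\<close>)
  also have "\<dots> = h v (\<Oplus>\<^bsub>W\<^esub>i\<in>{..<n}. T (h (c i) w \<odot>W b i))"
   by (rule h_finsum_r[symmetric]) (use v w Tc in auto)
  also have "(\<Oplus>\<^bsub>W\<^esub>i\<in>{..<n}. T (h (c i) w \<odot>W b i)) = T (\<Oplus>\<^bsub>W\<^esub>i\<in>{..<n}. h (c i) w \<odot>W b i)"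
   by (rule lin_maps_finsum[OF W.abelian_group_axioms W.abelian_group_axioms T, symmetric]) (use w in auto)
  finally show ?thesis using dual_W[OF w] by simp
 qed
 interpret s: perfect K W V "\<lambda>w v. h v w" n c b by (rule perfect_swap)
 have Bc: "B v : CV" if "v : CV" for v
  unfolding B_def using that Tc by (auto intro!: V.M.finsum_closed)
 have "B : LV"
 proof (rule lin_mapsI)
  show "B x = undefined" if "x \<notin> CV" for x using that by (simp add: B_def)
  show "B (x \<oplus>V y) = B x \<oplus>V B y" if "x : CV" "y : CV" for x y
   by (rule s.nondeg) (use that Tc in \<open>simp_all add: Bc Bh h_add_l\<close>)
  show "B (a \<odot>V x) = a \<odot>V B x" if "a : CK" "x : CV" for a x
   by (rule s.nondeg) (use that Tc in \<open>simp_all add: Bc Bh h_smult_l\<close>)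
 qed (rule Bc)
 with Bh that show thesis by blast
qed

end

lemma (in abelian_group) minus_zero_iff:
 "a \<in> carrier G ==> b \<in> carrier G ==> a \<ominus> b = \<zero> \<longleftrightarrow> a = b"
 by (metis a_minus_def add.inv_closed minus_equality minus_minus r_neg)

section \<open>The endomorphisms E(x, a): equivariance, adjoints, trace, and behaviour in top
  degree\<close>

context perfect
begin

abbreviation "E \<equiv> ext_E K V W h"

text \<open>Contracting \<open>a\<close> by a vector lowers its degree to \<open>k\<close>, so the
  contraction of \<open>x\<close> has degree 1 and \<open>ext_to_vector\<close> returns a genuine
  vector. \<open>E_gen\<close> is the form in which \<open>E\<close> is handled from here
  on.\<close>

lemma E_rep:
 assumes a: "a : pV (Suc k)" and x: "x : pW (Suc k)" and w: "w : CW"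
 shows E_closed: "E x a w : CW" and E_gen: "gW (E x a w) = cW (dV w a) x"
proof -
 interpret s: perfect K W V "\<lambda>w v. h v w" n c b by (rule perfect_swap)
 have "cW (dV w a) x : pW 1"
  using cW_pow[of "dV w a" k x 1] s.dW_pow[OF w a] x by simp
 then obtain u where u: "u : CW" "cW (dV w a) x = gW u" by (rule W.ext_pow_1)
 have "E x a w = ext_to_vector K W (gW u)" using w u by (simp add: ext_E_def)
 with u ext_to_vector_gen show "E x a w : CW" "gW (E x a w) = cW (dV w a) x" by auto
qed

lemma E_lin:
 assumes a: "a : pV (Suc k)" and x: "x : pW (Suc k)"
 shows "E x a : LW"
proof -
 interpret s: perfect K W V "\<lambda>w v. h v w" n c b by (rule perfect_swap)
 note cl = E_closed[OF a x] and g = E_gen[OF a x]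
 note ac = V.ext_pow_closed[OF a] and xc = W.ext_pow_closed[OF x]
 show ?thesis
 proof (rule lin_mapsI)
  show "E x a w = undefined" if "w \<notin> CW" for w using that by (simp add: ext_E_def)
  show "E x a (w \<oplus>W w') = E x a w \<oplus>W E x a w'" if "w : CW" "w' : CW" for w w'
   by (rule gen_inj) (use that cl ac xc in \<open>simp_all add: g W.gen_add s.dW_add_l cW_linear_l\<close>)
  show "E x a (k \<odot>W w) = k \<odot>W E x a w" if "k : CK" "w : CW" for k w
   by (rule gen_inj) (use that cl ac xc in \<open>simp_all add: g W.gen_smult s.dW_smult_l cW_linear_l\<close>)
 qed (rule cl)
qed

lemma E_linear_l:
 assumes a: "a : pV (Suc k)" and x: "x : pW (Suc k)"
 shows E_add_l: "y : pW (Suc k) ==> E (x \<oplus>AW y) a = E x a \<oplus>EW E y a"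
  and E_smult_l: "r : CK ==> E (r \<odot>AW x) a = r \<odot>EW E x a"
  and E_zero_l: "E \<zero>AW a = \<zero>EW"
proof -
 interpret s: perfect K W V "\<lambda>w v. h v w" n c b by (rule perfect_swap)
 note ac = V.ext_pow_closed[OF a] and xc = W.ext_pow_closed
 note lin = E_lin[OF a] and cl = E_closed[OF a] and g = E_gen[OF a]
 show "E (x \<oplus>AW y) a = E x a \<oplus>EW E y a" if y: "y : pW (Suc k)"
  using x y by (intro W.End_eqI W.End_closed lin W.ext_pow_ops; simp add: W.End_simps)
   (rule gen_inj, simp_all add: cl g W.gen_add cW_linear_r s.dW_closed ac xc)
 show sm: "E (r \<odot>AW x) a = r \<odot>EW E x a" if "r : CK" for r
  using x that by (intro W.End_eqI W.End_closed lin W.ext_pow_ops; simp add: W.End_simps)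
   (rule gen_inj, simp_all add: cl g W.gen_smult cW_linear_r s.dW_closed ac xc)
 show "E \<zero>AW a = \<zero>EW"
  using sm[of \<zero>] lin[OF x] xc[OF x] by (simp add: W.End_simps(1))
qed

lemma E_linear_r:
 assumes a: "a : pV (Suc k)" and x: "x : pW (Suc k)"
 shows E_add_r: "a' : pV (Suc k) ==> E x (a \<oplus>AV a') = E x a \<oplus>EW E x a'"
  and E_smult_r: "r : CK ==> E x (r \<odot>AV a) = r \<odot>EW E x a"
  and E_zero_r: "E x \<zero>AV = \<zero>EW"
proof -
 interpret s: perfect K W V "\<lambda>w v. h v w" n c b by (rule perfect_swap)
 note ac = V.ext_pow_closed and xc = W.ext_pow_closed[OF x]
 note lin = E_lin[OF _ x] and cl = E_closed[OF _ x] and g = E_gen[OF _ x]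
 show "E x (a \<oplus>AV a') = E x a \<oplus>EW E x a'" if a': "a' : pV (Suc k)"
  using a a' by (intro W.End_eqI W.End_closed lin V.ext_pow_ops; simp add: W.End_simps)
   (rule gen_inj, simp_all add: cl g W.gen_add cW_linear_l s.dW_linear s.dW_closed ac xc)
 show sm: "E x (r \<odot>AV a) = r \<odot>EW E x a" if "r : CK" for r
  using a that by (intro W.End_eqI W.End_closed lin V.ext_pow_ops; simp add: W.End_simps)
   (rule gen_inj, simp_all add: cl g W.gen_smult cW_linear_l s.dW_linear s.dW_closed ac xc)
 show "E x \<zero>AV = \<zero>EW"
  using sm[of \<zero>] lin[OF a] ac[OF a] by (simp add: W.End_simps(1))
qed

text \<open>\<open>deriv_contract\<close> is applied to the contraction that defines
  \<open>E\<close>, and \<open>deriv_dW\<close> for the interchanged modules to the inner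
  contraction by \<open>w\<close>. The term in which \<open>T'\<close> hits \<open>w\<close> is the
  second half of the commutator.\<close>

lemma E_equivariant:
 assumes a: "a : pV (Suc k)" and x: "x : pW (Suc k)"
  and T: "T : LV" and T': "T' : LW"
  and adj: "!!v w. v : CV ==> w : CW ==> h (T v) w \<oplus> h v (T' w) = \<zero>"
 shows "T' \<otimes>EW E x a \<ominus>EW E x a \<otimes>EW T' = E (W.D T' x) a \<oplus>EW E x (V.D T a)"
proof (rule W.End_eqI)
 interpret s: perfect K W V "\<lambda>w v. h v w" n c b by (rule perfect_swap)
 note Da = V.D_pow[OF a T] and Dx = W.D_pow[OF x T']
 note ac = V.ext_pow_closed[OF a] and xc = W.ext_pow_closed[OF x]
 note lin = E_lin[OF a x] E_lin[OF a Dx] E_lin[OF Da x]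
 show "T' \<otimes>EW E x a \<ominus>EW E x a \<otimes>EW T' : LW"
  "E (W.D T' x) a \<oplus>EW E x (V.D T a) : LW"
  using lin T' by (simp_all add: W.End_closed)
 fix w assume w: "w : CW"
 note T'w = lin_maps_closed[OF T' w]
 note cl = E_closed[OF a x] E_closed[OF a Dx w] E_closed[OF Da x w]
 have "gW (T' (E x a w)) = W.D T' (cW (dV w a) x)"
  using E_gen[OF a x w] cl(1)[OF w] T' by (simp flip: W.ext_deriv_gen)
 also have "\<dots> = cW (V.D T (dV w a)) x \<oplus>AW cW (dV w a) (W.D T' x)"
  using T T' adj w ac xc by (intro deriv_contract) auto
 also have "V.D T (dV w a) = dV (T' w) a \<oplus>AV dV w (V.D T a)"
  using T T' adj w ac by (intro s.deriv_dW) (auto simp: V.R.a_comm lin_maps_closed)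
 finally have "gW (T' (E x a w)) = gW (E x a (T' w)) \<oplus>AW gW (E x (V.D T a) w) \<oplus>AW gW (E (W.D T' x) a w)"
  using w T'w ac xc T T'
  by (simp add: E_gen[OF a x] E_gen[OF a Dx] E_gen[OF Da x] cW_linear_l)
 moreover have "gW (E x a (T' w)) : XW" "gW (E x (V.D T a) w) : XW" "gW (E (W.D T' x) a w) : XW"
  using cl(1)[OF T'w] cl(2,3) by auto
 ultimately have "gW (T' (E x a w)) \<ominus>AW gW (E x a (T' w)) = gW (E (W.D T' x) a w) \<oplus>AW gW (E x (V.D T a) w)"
  by (simp only:) algebra
 then have "gW (T' (E x a w) \<ominus>W E x a (T' w)) = gW (E (W.D T' x) a w \<oplus>W E x (V.D T a) w)"
  using cl(2,3) cl(1)[OF w] cl(1)[OF T'w] lin_maps_closed[OF T' cl(1)[OF w]]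
  by (simp add: W.M.minus_eq W.gen_add W.gen_neg W.A.A.minus_eq)
 then show "(T' \<otimes>EW E x a \<ominus>EW E x a \<otimes>EW T') w = (E (W.D T' x) a \<oplus>EW E x (V.D T a)) w"
  using cl(2,3) cl(1)[OF w] cl(1)[OF T'w] lin_maps_closed[OF T' cl(1)[OF w]] w T' lin
  by (simp add: W.End_minus W.End_closed W.End_simps gen_inj)
qed

lemma h_E:
 assumes a: "a : pV (Suc k)" and x: "x : pW (Suc k)" and w: "w : CW" and v: "v : CV"
 shows "h v (E x a w) = W.counit (dW v (cW (dV w a) x))"
 using E_gen[OF a x w] E_closed[OF a x w] v by (simp add: gW_eq_counit)

text \<open>Both sides are the pairing of \<open>v \<cdot> x\<close> with
  \<open>w \<cdot> a\<close>, up to sign. Moving \<open>w\<close> past the former and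
  \<open>v\<close> past the latter produces the same sign twice, as both have degree
  \<open>k\<close>.\<close>

lemma E_adjoint:
 assumes a: "a : pV (Suc k)" and x: "x : pW (Suc k)" and w: "w : CW" and v: "v : CV"
 shows "h (ext_E K W V (\<lambda>w v. h v w) a x v) w = h v (E x a w)"
proof -
 interpret s: perfect K W V "\<lambda>w v. h v w" n c b by (rule perfect_swap)
 note ac = V.ext_pow_closed[OF a] and xc = W.ext_pow_closed[OF x]
 note da = s.dW_pow[OF w a] and dx = dW_pow[OF v x]
 note dac = V.ext_pow_closed[OF da] and dxc = W.ext_pow_closed[OF dx]
 have "V.counit (dV w (cV (dW v x) a)) = V.counit (cV (gW w \<otimes>AW dW v x) a)"
  using ac dxc w by (simp add: s.cW_linear_l)
 also have "\<dots> = V.counit (cV (W.alpha (dW v x) \<otimes>AW gW w) a)" using dxc w by (simp add: W.gen_commute)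
 also have "\<dots> = V.counit (cV (W.alpha (dW v x)) (dV w a))" using dxc w ac by (simp add: s.cW_linear_l)
 also have "\<dots> = W.counit (cW (dV w a) (W.alpha (dW v x)))"
  using pairing_sym[OF da, of "W.alpha (dW v x)"] W.alpha_pow[OF dx] dx by simp
 also have "\<dots> = W.counit (cW (V.alpha (dV w a)) (dW v x))"
  using W.alpha_pow[OF dx] V.alpha_pow[OF da] dac dxc by (simp add: cW_linear_l cW_linear_r)
 also have "\<dots> = W.counit (cW (V.alpha (dV w a) \<otimes>AV gV v) x)" using dac v xc by (simp add: cW_linear_l)
 also have "\<dots> = W.counit (cW (gV v \<otimes>AV dV w a) x)" using dac v by (simp add: V.gen_commute)
 also have "\<dots> = W.counit (dW v (cW (dV w a) x))" using dac v xc by (simp add: cW_linear_l)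
 finally show ?thesis using s.h_E[OF x a v w] h_E[OF a x w v] by simp
qed

text \<open>Contracting \<open>v1 v2 v3\<close> by \<open>w\<close> gives three terms, so
  \<open>E\<close> is a sum of three rank one maps whose vectors are double contractions of
  \<open>x\<close>, the middle one with a sign. The trace of \<open>E\<close> and its derivation of
  the exterior algebra are both read off from this form.\<close>

lemma E_decomposable:
 assumes v: "v1 : CV" "v2 : CV" "v3 : CV" and x: "x : pW 3"
 obtains u1 u2 u3 where "u1 : CW" "u2 : CW" "u3 : CW"
  "gW u1 = dW v2 (dW v3 x)" "gW u2 = \<ominus>AW dW v1 (dW v3 x)" "gW u3 = dW v1 (dW v2 x)"
  "E x (ext_prod K V [v1, v2, v3]) = rk v1 u1 \<oplus>EW (rk v2 u2 \<oplus>EW rk v3 u3)"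
proof -
 interpret s: perfect K W V "\<lambda>w v. h v w" n c b by (rule perfect_swap)
 let ?a = "ext_prod K V [v1, v2, v3]"
 have x3: "x : pW (Suc (Suc (Suc 0)))" "x : pW (Suc (Suc 1))" using x by (simp_all add: numeral_3_eq_3)
 have a: "?a : pV (Suc (Suc (Suc 0)))"
  using V.ext_prod_in[of "[v1,v2,v3]" "CV"] v by (simp add: ext_pow_def)
 have "dW v2 (dW v3 x) : pW 1" "\<ominus>AW dW v1 (dW v3 x) : pW 1" "dW v1 (dW v2 x) : pW 1"
  using x3(2) v dW_pow by blast+
 then obtain u1 u2 u3 where u: "u1 : CW" "u2 : CW" "u3 : CW"
  and g: "dW v2 (dW v3 x) = gW u1" "\<ominus>AW dW v1 (dW v3 x) = gW u2" "dW v1 (dW v2 x) = gW u3"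
  by (metis W.ext_pow_1)
 note xc = W.ext_pow_closed[OF x]
 have g2: "dW v1 (dW v3 x) = \<ominus>AW gW u2" using g(2) xc v W.A.A.minus_minus by (metis dW_closed)
 have "E x ?a = rk v1 u1 \<oplus>EW (rk v2 u2 \<oplus>EW rk v3 u3)"
 proof (rule W.End_eqI[OF E_lin[OF a x3(1)]])
  show "rk v1 u1 \<oplus>EW (rk v2 u2 \<oplus>EW rk v3 u3) : LW"
   using u v by (simp add: W.End_closed rank1_lin)
  fix w assume w: "w : CW"
  have "dV w ?a = h v1 w \<odot>AV (gV v2 \<otimes>AV gV v3) \<ominus>AV
    (h v2 w \<odot>AV (gV v1 \<otimes>AV gV v3) \<ominus>AV h v3 w \<odot>AV (gV v1 \<otimes>AV gV v2))"
   using v w by (simp add: s.dW_gen_mult s.dW_gen s.dW_linear V.A.A.minus_eq V.A.A.r_distr V.A.A.r_minus V.A.smult_mult_r V.A.A.minus_add)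
  then have "gW (E x ?a w) = h v1 w \<odot>AW gW u1 \<ominus>AW (h v2 w \<odot>AW (\<ominus>AW gW u2) \<ominus>AW h v3 w \<odot>AW gW u3)"
   using E_gen[OF a x3(1) w] v w xc u by (simp add: cW_linear_l V.A.A.minus_eq W.A.A.minus_eq g g2)
  then have "gW (E x ?a w) = gW (h v1 w \<odot>W u1 \<oplus>W (h v2 w \<odot>W u2 \<oplus>W h v3 w \<odot>W u3))"
   using v w u by (simp add: W.gen_add W.gen_smult W.A.A.minus_eq W.A.A.minus_add W.A.smult_r_minus)
  then show "E x ?a w = (rk v1 u1 \<oplus>EW (rk v2 u2 \<oplus>EW rk v3 u3)) w"
   using gen_inj E_closed[OF a x3(1) w] v w u by (simp add: W.End_simps)
 qed
 with u g that show thesis by metis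
qed

text \<open>The factor 3 counts the rank one summands of \<open>E_decomposable\<close>: after
  reordering the contractions, each of them has trace \<open>a \<cdot> x\<close>.\<close>

lemma E_trace:
 assumes a: "a : pV 3" and x: "x : pW 3"
 shows "tr (E x a) = [(3::int)] \<cdot>\<^bsub>K\<^esub> W.counit (cW a x)"
proof -
 have x3: "x : pW (Suc 2)" using x by simp
 note xc = W.ext_pow_closed[OF x]
 have three: "[(3::int)] \<cdot>\<^bsub>K\<^esub> k = k \<oplus> (k \<oplus> k)" if "k : CK" for k
 proof -
  have "[(3::int)] \<cdot>\<^bsub>K\<^esub> k = [(3::nat)] \<cdot>\<^bsub>K\<^esub> k" by (simp add: add_pow_int_ge)
  then show ?thesis using that by (simp add: add_pow_def numeral_3_eq_3 V.R.a_assoc)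
 qed
 note ops = V.ext_pow_ops
 from a show ?thesis
 proof (induction rule: V.ext_pow_induct)
  case zero
  have z: "\<zero>AV \<in> pV (Suc 2)" by (rule V.ext_pow_ops)
  then show ?case using E_zero_r[OF z x3] by (simp add: trace_zero cW_linear_l xc three)
 next
  case (prod vs)
  then obtain v1 v2 v3 where vs: "vs = [v1, v2, v3]" "v1 : CV" "v2 : CV" "v3 : CV"
   by (auto simp: numeral_3_eq_3 length_Suc_conv)
  obtain u1 u2 u3 where u: "u1 : CW" "u2 : CW" "u3 : CW"
   and g: "gW u1 = dW v2 (dW v3 x)" "gW u2 = \<ominus>AW dW v1 (dW v3 x)" "gW u3 = dW v1 (dW v2 x)"
   and e: "E x (ext_prod K V [v1, v2, v3]) = rk v1 u1 \<oplus>EW (rk v2 u2 \<oplus>EW rk v3 u3)"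
   using E_decomposable[OF vs(2-4) x] by metis
  have "tr (E x (ext_prod K V vs)) = h v1 u1 \<oplus> (h v2 u2 \<oplus> h v3 u3)"
   unfolding vs(1) e using u vs(2-4) by (simp add: trace_add rank1_lin W.End_closed trace_rank1)
  also have "h v1 u1 = W.counit (cW (ext_prod K V vs) x)"
   using u vs xc by (simp add: gW_eq_counit g cW_linear_l)
  also have "h v2 u2 = W.counit (cW (ext_prod K V vs) x)"
   using u vs xc dW_anticomm[of "dW v3 x" v2 v1] by (simp add: gW_eq_counit g cW_linear_l dW_linear)
  also have "h v3 u3 = W.counit (cW (ext_prod K V vs) x)"
   using u vs xc dW_anticomm[of "dW v2 x" v3 v1] dW_anticomm[of x v3 v2] by (simp add: gW_eq_counit g cW_linear_l dW_linear)
  finally show ?case using vs xc by (simp add: three)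
 next
  case (add a b)
  then have "a : pV (Suc 2)" "b : pV (Suc 2)" by simp_all
  then show ?case using E_add_r[OF _ x3, of a b] E_lin[OF _ x3] add xc
   by (simp add: trace_add cW_linear_l three V.R.a_ac)
 next
  case (smult r a)
  then have "a : pV (Suc 2)" by simp
  then show ?case using E_smult_r[OF _ x3, of a r] E_lin[OF _ x3] smult xc
   by (simp add: trace_smult cW_linear_l three V.R.r_distr)
 qed
qed

text \<open>For \<open>a = v1 v2 v3\<close>, three applications of the antiderivation rule to
  \<open>p q\<close> give eight terms. Two of them have all contractions on the same factor and are
  the scalar multiples; of the six mixed terms, three make up the derivation of \<open>E p a\<close>
  on \<open>q\<close> and three that of \<open>E q a\<close> on \<open>p\<close>.\<close>

lemma contract3_mult:
 assumes a: "a : pV 3" and p: "p : pW 3" and q: "q : pW 3"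
 shows "cW a (p \<otimes>AW q) = (W.counit (cW a p) \<odot>AW q \<ominus>AW W.D (E p a) q)
  \<ominus>AW (W.counit (cW a q) \<odot>AW p \<ominus>AW W.D (E q a) p)"
proof -
 have p3: "p : pW (Suc 2)" and q3: "q : pW (Suc 2)" using p q by simp_all
 note pc = W.ext_pow_closed[OF p] and qc = W.ext_pow_closed[OF q]
 from a show ?thesis
 proof (induction rule: V.ext_pow_induct)
  case zero
  have z: "\<zero>AV \<in> pV (Suc 2)" by (rule V.ext_pow_ops)
  then show ?case using E_zero_r[OF z p3] E_zero_r[OF z q3] pc qc
   W.D_End_zero[OF _ W.End_closed(7) W.End_closed(7)]
   by (simp add: cW_linear_l W.A.A.minus_eq)
 next
  case (prod vs)
  then obtain v1 v2 v3 where vs: "vs = [v1, v2, v3]" and v: "v1 : CV" "v2 : CV" "v3 : CV"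
   by (auto simp: numeral_3_eq_3 length_Suc_conv)
  \<comment> \<open>\<open>P23\<close> is \<open>v2 \<cdot> (v3 \<cdot> p)\<close>: the rightmost
    index acts first. \<open>P\<close> and \<open>Q\<close> are the full contractions.\<close>
  define P1 P2 P3 P12 P13 P23 P where P: "P1 = dW v1 p" "P2 = dW v2 p" "P3 = dW v3 p"
   "P12 = dW v1 P2" "P13 = dW v1 P3" "P23 = dW v2 P3" "P = dW v1 P23"
  define Q1 Q2 Q3 Q12 Q13 Q23 Q where Q: "Q1 = dW v1 q" "Q2 = dW v2 q" "Q3 = dW v3 q"
   "Q12 = dW v1 Q2" "Q13 = dW v1 Q3" "Q23 = dW v2 Q3" "Q = dW v1 Q23"
  have pp: "p : pW (Suc (Suc (Suc 0)))" "q : pW (Suc (Suc (Suc 0)))"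
   using p q by (simp_all add: numeral_3_eq_3)
  have d: "P1 : pW (Suc (Suc 0))" "P2 : pW (Suc (Suc 0))" "P3 : pW (Suc (Suc 0))"
   "P12 : pW (Suc 0)" "P13 : pW (Suc 0)" "P23 : pW (Suc 0)" "P : pW 0"
   "Q1 : pW (Suc (Suc 0))" "Q2 : pW (Suc (Suc 0))" "Q3 : pW (Suc (Suc 0))"
   "Q12 : pW (Suc 0)" "Q13 : pW (Suc 0)" "Q23 : pW (Suc 0)" "Q : pW 0"
   unfolding P Q using pp v by (blast intro: dW_pow)+
  have cl: "P1 : XW" "P2 : XW" "P3 : XW" "P12 : XW" "P13 : XW"
   "P23 : XW" "P : XW" "Q1 : XW" "Q2 : XW" "Q3 : XW"
   "Q12 : XW" "Q13 : XW" "Q23 : XW" "Q : XW" "p : XW" "q : XW"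
   using d pc qc W.ext_pow_closed by auto
  have al: "W.alpha p = \<ominus>AW p" "W.alpha P1 = P1" "W.alpha P2 = P2" "W.alpha P3 = P3"
   "W.alpha P12 = \<ominus>AW P12" "W.alpha P13 = \<ominus>AW P13" "W.alpha P23 = \<ominus>AW P23"
   using W.alpha_pow[OF p] W.alpha_pow[OF d(1)] W.alpha_pow[OF d(2)] W.alpha_pow[OF d(3)]
    W.alpha_pow[OF d(4)] W.alpha_pow[OF d(5)] W.alpha_pow[OF d(6)] by simp_all
  have fin: "cW (ext_prod K V vs) p = P" "cW (ext_prod K V vs) q = Q"
   using v vs pc qc by (simp_all add: P Q cW_linear_l)
  have lhs: "cW (ext_prod K V vs) (p \<otimes>AW q) = dW v1 (dW v2 (dW v3 (p \<otimes>AW q)))"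
   using v vs pc qc by (simp add: cW_linear_l)
  have "dW v3 (p \<otimes>AW q) = P3 \<otimes>AW q \<ominus>AW p \<otimes>AW Q3"
   using v cl by (simp add: dW_mult al P(3) Q(3) W.A.A.minus_eq W.A.A.l_minus)
  then have "dW v2 (dW v3 (p \<otimes>AW q)) = (P23 \<otimes>AW q \<oplus>AW P3 \<otimes>AW Q2) \<ominus>AW (P2 \<otimes>AW Q3 \<ominus>AW p \<otimes>AW Q23)"
   using v cl by (simp add: dW_linear dW_mult al W.A.A.minus_eq W.A.A.l_minus flip: P Q)
  then have e1: "dW v1 (dW v2 (dW v3 (p \<otimes>AW q))) =
    ((P \<otimes>AW q \<ominus>AW P23 \<otimes>AW Q1) \<oplus>AW (P13 \<otimes>AW Q2 \<oplus>AW P3 \<otimes>AW Q12))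
    \<ominus>AW ((P12 \<otimes>AW Q3 \<oplus>AW P2 \<otimes>AW Q13) \<ominus>AW (P1 \<otimes>AW Q23 \<ominus>AW p \<otimes>AW Q))"
   using v cl by (simp add: dW_linear dW_mult al W.A.A.minus_eq W.A.A.l_minus flip: P Q)
  have De: "W.D (E x (ext_prod K V vs)) y = dW v2 (dW v3 x) \<otimes>AW dW v1 y \<oplus>AW
    (\<ominus>AW dW v1 (dW v3 x) \<otimes>AW dW v2 y \<oplus>AW dW v1 (dW v2 x) \<otimes>AW dW v3 y)"
   if x: "x : pW 3" and y: "y : XW" for x y
  proof -
   obtain u1 u2 u3 where u: "u1 : CW" "u2 : CW" "u3 : CW"
   and g: "gW u1 = dW v2 (dW v3 x)" "gW u2 = \<ominus>AW dW v1 (dW v3 x)" "gW u3 = dW v1 (dW v2 x)"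
   and e: "E x (ext_prod K V [v1, v2, v3]) = rk v1 u1 \<oplus>EW (rk v2 u2 \<oplus>EW rk v3 u3)"
    using E_decomposable[OF v x] by metis
   show ?thesis unfolding vs e
    using u v y by (simp add: W.D_End_add rank1_lin W.End_closed D_rank1 g)
  qed
  have Dp: "W.D (E p (ext_prod K V vs)) q = P23 \<otimes>AW Q1 \<oplus>AW (\<ominus>AW P13 \<otimes>AW Q2 \<oplus>AW P12 \<otimes>AW Q3)"
   using De[OF p qc] by (simp flip: P Q)
  \<comment> \<open>Here the contracted factors stand in the opposite order; one of degree 2
    commutes with one of degree 1.\<close>
  have Dq: "W.D (E q (ext_prod K V vs)) p = P1 \<otimes>AW Q23 \<oplus>AW (\<ominus>AW (P2 \<otimes>AW Q13) \<oplus>AW P3 \<otimes>AW Q12)"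
   using De[OF q pc] W.pow_commute[OF d(1) d(13)] W.pow_commute[OF d(2) d(12)] W.pow_commute[OF d(3) d(11)] cl
   by (simp add: W.A.A.l_minus flip: P Q)
  have c1: "W.counit P \<odot>AW q = P \<otimes>AW q"
  proof -
   have "(W.counit P \<odot>AW \<one>AW) \<otimes>AW q = W.counit P \<odot>AW q" using cl by (simp add: W.A.smult_mult_l)
   then show ?thesis using W.ext_pow_0[OF d(7)] by simp
  qed
  have c2: "W.counit Q \<odot>AW p = p \<otimes>AW Q"
  proof -
   have "p \<otimes>AW (W.counit Q \<odot>AW \<one>AW) = W.counit Q \<odot>AW p" using cl by (simp add: W.A.smult_mult_r)
   then show ?thesis using W.ext_pow_0[OF d(14)] by simp
  qed
  show ?case unfolding lhs fin Dp Dq c1 c2 e1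
   using cl by (simp add: W.A.A.minus_eq W.A.A.minus_add W.A.A.l_minus W.A.A.a_ac)
 next
  case (add a b)
  then have ab: "a : pV (Suc 2)" "b : pV (Suc 2)" by simp_all
  note lin = E_lin[OF ab(1) p3] E_lin[OF ab(1) q3] E_lin[OF ab(2) p3] E_lin[OF ab(2) q3]
  show ?case using E_add_r[OF ab(1) p3 ab(2)] E_add_r[OF ab(1) q3 ab(2)] lin add pc qc
   by (simp add: cW_linear_l W.D_End_add W.A.smult_l_distr W.A.A.minus_eq W.A.A.minus_add W.A.A.a_ac)
 next
  case (smult r a)
  then have a: "a : pV (Suc 2)" by simp_all
  note lin = E_lin[OF a p3] E_lin[OF a q3]
  show ?case using E_smult_r[OF a p3] E_smult_r[OF a q3] lin smult pc qc
   by (simp add: cW_linear_l W.D_End_smult W.A.smult_assoc1 W.A.smult_r_distr W.A.smult_r_minus W.A.A.minus_eq)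
 qed
qed

text \<open>Both sides are compared by pairing with an arbitrary \<open>v\<close>. Since
  \<open>v a = 0\<close>, the contraction formula rewrites each term on the left as the pairing of
  \<open>a\<close> with a product of degree six such as \<open>q (v \<cdot> (w p))\<close>. The
  relation needed between these products is the contraction by \<open>v\<close> of
  \<open>w p q = 0\<close>, an identity in degree seven.\<close>

lemma E_top:
 assumes a: "a : pV 6" and p: "p : pW 3" and q: "q : pW 3" and w: "w : CW"
  and topV: "!!v. v : CV ==> gV v \<otimes>AV a = \<zero>AV"
  and topW: "!!x. x : pW 7 ==> x = \<zero>AW"
 shows "E q (cV p a) w \<ominus>W E p (cV q a) w = \<ominus>W (W.counit (cW a (p \<otimes>AW q)) \<odot>W w)"
proof -
 interpret s: perfect K W V "\<lambda>w v. h v w" n c b by (rule perfect_swap)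
 note pc = W.ext_pow_closed[OF p] and qc = W.ext_pow_closed[OF q] and ac = V.ext_pow_closed[OF a]
 have p3: "p : pW (Suc 2)" and q3: "q : pW (Suc 2)" using p q by simp_all
 have ca: "cV x a : pV (Suc 2)" if "x : pW 3" for x
  using s.cW_pow[of x 3 a 3] a that by simp
 let ?k = "\<lambda>x. V.counit (cV x a)"
 have kc: "x : XW ==> ?k x : CK" for x using ac by simp
 have hE: "h v (E y (cV x a) w) = ?k (y \<otimes>AW dW v (gW w \<otimes>AW x))"
  if x: "x : pW 3" and y: "y : pW 3" and v: "v : CV" for x y v
 proof -
  note xc = W.ext_pow_closed[OF x] and yc = W.ext_pow_closed[OF y]
  let ?z = "gW w \<otimes>AW x"
  have z4: "?z : pW (Suc 3)" using W.gen_mult_pow[OF x w] .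
  have dz: "dW v ?z : pW 3" using dW_pow[OF v z4] .
  have cz: "cV (dW v ?z) a : pV 3" using s.cW_pow[OF dz, of a 3] a by simp
  have "h v (E y (cV x a) w) = W.counit (dW v (cW (dV w (cV x a)) y))"
   using h_E[OF ca[OF x] _ w v, of y] y by simp
  also have "\<dots> = W.counit (cW (gV v \<otimes>AV cV ?z a) y)"
   using xc yc w v ac by (simp add: cW_linear_l s.cW_linear_l)
  also have "gV v \<otimes>AV cV ?z a = cV (dW v ?z) a"
   using s.contract_contract1[of ?z v a] xc w v ac topV by (simp add: s.cW_linear_r V.A.A.minus_eq)
  also have "W.counit (cW (cV (dW v ?z) a) y) = V.counit (cV y (cV (dW v ?z) a))"
   by (rule pairing_sym[OF cz y])
  finally show ?thesis using yc xc w v ac by (simp add: s.cW_linear_l)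
 qed
 show ?thesis
 proof (rule nondeg)
  have El: "E q (cV p a) w : CW" "E p (cV q a) w : CW"
   using E_closed[OF ca[OF p] q3 w] E_closed[OF ca[OF q] p3 w] by auto
  then show "E q (cV p a) w \<ominus>W E p (cV q a) w : CW" by simp
  let ?c = "W.counit (cW a (p \<otimes>AW q))"
  show "\<ominus>W (?c \<odot>W w) : CW" using ac pc qc w by simp
  fix v assume v: "v : CV"
  define dp dq gw k where dp: "dp = dW v p" and dq: "dq = dW v q" and gw: "gw = gW w" and k: "k = h v w"
  have dpp: "dp : pW 2" "dq : pW 2" unfolding dp dq using dW_pow[OF v p3] dW_pow[OF v q3] by auto
  have cl: "dp : XW" "dq : XW" "gw : XW" "p : XW" "q : XW" "k : CK"
   "k \<odot>AW (p \<otimes>AW q) : XW"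
   using dp dq gw k pc qc v w by auto
  have "gw \<otimes>AW (p \<otimes>AW q) : pW 7"
   using W.gen_mult_pow[OF W.pow_mult[OF p q] w] by (simp add: gw)
  from topW[OF this] have "dW v (gw \<otimes>AW (p \<otimes>AW q)) = \<zero>AW" using v by (simp only: dW_linear)
  moreover have "dW v (gw \<otimes>AW (p \<otimes>AW q)) = k \<odot>AW (p \<otimes>AW q) \<ominus>AW gw \<otimes>AW (dp \<otimes>AW q \<ominus>AW p \<otimes>AW dq)"
   using v w pc qc W.alpha_pow[OF p]
   by (simp add: gw dW_mult dW_gen W.alpha_gen W.A.smult_mult_l k dp dq W.A.A.minus_eq W.A.A.l_minus)
  \<comment> \<open>The contraction of \<open>w p q = 0\<close> by \<open>v\<close>, solved for the
    term that contains \<open>h v w\<close>.\<close>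
  ultimately have e0: "k \<odot>AW (p \<otimes>AW q) = gw \<otimes>AW (dp \<otimes>AW q \<ominus>AW p \<otimes>AW dq)"
   using cl by (metis W.A.A.minus_zero_iff W.A.A.m_closed W.A.A.minus_closed)
  have gp: "gw \<otimes>AW dp : pW 3" "gw \<otimes>AW dq : pW 3"
   using W.gen_mult_pow[OF dpp(1) w] W.gen_mult_pow[OF dpp(2) w] by (simp_all add: gw)
  have com: "q \<otimes>AW (gw \<otimes>AW dp) = \<ominus>AW (gw \<otimes>AW dp \<otimes>AW q)" "q \<otimes>AW p = \<ominus>AW (p \<otimes>AW q)"
   "p \<otimes>AW (gw \<otimes>AW dq) = \<ominus>AW (gw \<otimes>AW dq \<otimes>AW p)" "p \<otimes>AW dq = dq \<otimes>AW p"
   using W.pow_commute[OF q gp(1)] W.pow_commute[OF p gp(2)] W.pow_commute[OF q p] W.pow_commute[OF p dpp(2)] by simp_all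
  have d4: "dW v (gw \<otimes>AW p) = k \<odot>AW p \<ominus>AW gw \<otimes>AW dp" "dW v (gw \<otimes>AW q) = k \<odot>AW q \<ominus>AW gw \<otimes>AW dq"
   using v w pc qc by (simp_all add: gw k dp dq dW_gen_mult)
  have z: "q \<otimes>AW dW v (gw \<otimes>AW p) \<ominus>AW p \<otimes>AW dW v (gw \<otimes>AW q) = \<ominus>AW (k \<odot>AW (p \<otimes>AW q))"
  proof -
   define X Y Z where X: "X = k \<odot>AW (p \<otimes>AW q)" and Y: "Y = gw \<otimes>AW dp \<otimes>AW q" and Z: "Z = gw \<otimes>AW dq \<otimes>AW p"
   have c: "X : XW" "Y : XW" "Z : XW" using cl X Y Z by auto
   have "q \<otimes>AW dW v (gw \<otimes>AW p) = \<ominus>AW X \<oplus>AW Y" "p \<otimes>AW dW v (gw \<otimes>AW q) = X \<oplus>AW Z"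
    using cl by (simp_all add: d4 com W.A.A.minus_eq W.A.A.r_distr W.A.smult_mult_r W.A.A.r_minus W.A.smult_r_minus X Y Z)
   moreover have "X = Y \<ominus>AW Z"
    using e0 cl by (simp add: X Y Z com W.A.A.minus_eq W.A.A.r_distr W.A.A.r_minus W.A.A.m_assoc)
   ultimately show ?thesis using c by (simp only: X[symmetric]) algebra
  qed
  have "h v (E q (cV p a) w \<ominus>W E p (cV q a) w) = h v (E q (cV p a) w) \<ominus> h v (E p (cV q a) w)"
   using El v h_smult_r[of "\<ominus> \<one>" v "E p (cV q a) w"] by (simp add: W.M.minus_eq h_add_r V.R.minus_eq W.smult_l_minus V.R.l_minus)
  also have "\<dots> = ?k (q \<otimes>AW dW v (gw \<otimes>AW p) \<ominus>AW p \<otimes>AW dW v (gw \<otimes>AW q))"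
   using hE[OF p q v] hE[OF q p v] v cl ac by (simp add: gw[symmetric] V.R.minus_eq W.A.A.minus_eq s.cW_linear_l)
  also have "\<dots> = \<ominus> (k \<otimes> ?k (p \<otimes>AW q))" unfolding z using cl ac by (simp add: s.cW_linear_l)
  also have "?k (p \<otimes>AW q) = ?c" using pairing_sym[of a 6 "p \<otimes>AW q"] a W.pow_mult[OF p q] by simp
  finally show "h v (E q (cV p a) w \<ominus>W E p (cV q a) w) = h v (\<ominus>W (?c \<odot>W w))"
   using v w pc qc ac h_smult_r[of "\<ominus> ?c" v w] by (simp add: W.smult_l_minus V.R.l_minus V.R.r_minus k V.R.m_comm)
 qed
qed

text \<open>By additivity \<open>T\<close> may be taken of rank one; contracting
  \<open>u q = 0\<close> by \<open>v\<close> then shows that \<open>u (v \<cdot> q)\<close> is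
  \<open>h v u\<close> times \<open>q\<close>.\<close>

lemma D_top:
 assumes T: "T : LW" and q: "q : XW" and top: "!!w. w : CW ==> gW w \<otimes>AW q = \<zero>AW"
 shows "W.D T q = tr T \<odot>AW q"
 using T
proof (induction rule: End_W_induct)
 case zero
 show ?case using W.D_End_zero[OF q W.End_closed(7) W.End_closed(7)] q by (simp add: trace_zero)
next
 case (rank1 v u T')
 have "h v u \<odot>AW q \<ominus>AW gW u \<otimes>AW dW v q = \<zero>AW"
  using dW_gen_mult[of v u q] top[of u] rank1 q by (simp add: dW_linear)
 then have "h v u \<odot>AW q = gW u \<otimes>AW dW v q" using rank1 q W.A.A.minus_zero_iff by simp
 with rank1 q show ?case
  by (simp add: W.D_End_add rank1_lin D_rank1 trace_add trace_rank1 W.A.smult_l_distr)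
qed

end

section \<open>Localization\<close>

text \<open>Zorn's lemma for the ideals that contain \<open>I\<close> but not 1; a maximal one among
  them is a maximal ideal, hence prime.\<close>

lemma (in cring) exists_primeideal:
 assumes I: "ideal I R" and one: "\<one> \<notin> I"
 obtains P where "primeideal P R" "I \<subseteq> P"
proof -
 let ?A = "{J. ideal J R \<and> I \<subseteq> J \<and> \<one> \<notin> J}"
 have "\<exists>M\<in>?A. \<forall>X\<in>?A. M \<subseteq> X \<longrightarrow> X = M"
 proof (rule subset_Zorn_nonempty)
  show "?A \<noteq> {}" using I one by blast
  fix C assume C: "C \<noteq> {}" "subset.chain ?A C"
  then have idl: "ideal J R" if "J \<in> C" for J using that unfolding subset.chain_def by blast
  have join: "\<exists>J\<in>C. x \<in> J \<and> y \<in> J" if "x \<in> \<Union>C" "y \<in> \<Union>C" for x y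
   using that C(2) unfolding subset.chain_def by blast
  have "ideal (\<Union>C) R"
  proof (rule idealI[OF ring_axioms])
   show "subgroup (\<Union>C) (add_monoid R)"
   proof (rule subgroup.intro)
    show "\<Union>C \<subseteq> carrier (add_monoid R)" using idl ideal.Icarr by fastforce
    show "\<one>\<^bsub>add_monoid R\<^esub> \<in> \<Union>C"
     using C(1) idl additive_subgroup.zero_closed[OF ideal.axioms(1)] by fastforce
    show "x \<otimes>\<^bsub>add_monoid R\<^esub> y \<in> \<Union>C" if "x \<in> \<Union>C" "y \<in> \<Union>C" for x y
    proof -
     obtain J where J: "J \<in> C" "x \<in> J" "y \<in> J" using join[OF \<open>x \<in> \<Union>C\<close> \<open>y \<in> \<Union>C\<close>] by blast
     then have "x \<oplus> y \<in> J" using additive_subgroup.a_closed[OF ideal.axioms(1)[OF idl]] by blast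
     with J show ?thesis by auto
    qed
    show "inv\<^bsub>add_monoid R\<^esub> x \<in> \<Union>C" if "x \<in> \<Union>C" for x
    proof -
     obtain J where J: "J \<in> C" "x \<in> J" using \<open>x \<in> \<Union>C\<close> by blast
     then have "\<ominus> x \<in> J" using additive_subgroup.a_inv_closed[OF ideal.axioms(1)[OF idl]] by blast
     with J show ?thesis unfolding a_inv_def by blast
    qed
   qed
   fix a x assume "a \<in> \<Union>C" and x: "x \<in> carrier R"
   then obtain J where J: "J \<in> C" "a \<in> J" by blast
   then show "x \<otimes> a \<in> \<Union>C" "a \<otimes> x \<in> \<Union>C"
    using ideal.I_l_closed[OF idl] ideal.I_r_closed[OF idl] x by blast+
  qed
  with C show "\<Union>C \<in> ?A" unfolding subset.chain_def by blast
 qed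
 then obtain M where M0: "M \<in> ?A" and max0: "\<forall>X\<in>?A. M \<subseteq> X \<longrightarrow> X = M" by (rule bexE)
 from M0 have M: "ideal M R" "I \<subseteq> M" "\<one> \<notin> M" by simp_all
 have max: "X = M" if "ideal X R" "\<one> \<notin> X" "M \<subseteq> X" for X
  using max0[THEN bspec, of X] that M(2) by simp
 have "maximalideal M R"
 proof (rule maximalidealI[OF M(1)])
  show "carrier R \<noteq> M" using M(3) by blast
  fix J assume J: "ideal J R" "M \<subseteq> J" "J \<subseteq> carrier R"
  show "J = M \<or> J = carrier R"
   using max[OF J(1) _ J(2)] ideal.one_imp_carrier[OF J(1)] by blast
 qed
 then show thesis using that M(2) maximalideal_prime by blast
qed

text \<open>The annihilator of a nonzero element is a proper ideal and lies in some prime ideal,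
  contrary to the local hypothesis. Local arguments are phrased with multipliers outside the prime,
  so that they remain inside the given module.\<close>

lemma (in module) zero_locally:
 assumes x: "x \<in> carrier M"
  and loc: "!!P. primeideal P R ==> \<exists>s\<in>carrier R - P. s \<odot>\<^bsub>M\<^esub> x = \<zero>\<^bsub>M\<^esub>"
 shows "x = \<zero>\<^bsub>M\<^esub>"
proof (rule ccontr)
 assume nz: "x \<noteq> \<zero>\<^bsub>M\<^esub>"
 let ?I = "{s \<in> carrier R. s \<odot>\<^bsub>M\<^esub> x = \<zero>\<^bsub>M\<^esub>}"
 have "ideal ?I R"
 proof (rule idealI[OF R.ring_axioms])
  show "subgroup ?I (add_monoid R)"
   by (rule subgroup.intro) (use x in \<open>auto simp: smult_l_distr smult_l_minus simp flip: a_inv_def\<close>)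
  show "!!a y. a \<in> ?I ==> y \<in> carrier R ==> y \<otimes> a \<in> ?I" "!!a y. a \<in> ?I ==> y \<in> carrier R ==> a \<otimes> y \<in> ?I"
   using x by (auto simp: smult_assoc1) (metis R.m_comm smult_assoc1 smult_r_null)
 qed
 moreover have "\<one> \<notin> ?I" using x nz by simp
 ultimately obtain P where P: "primeideal P R" "?I \<subseteq> P" using R.exists_primeideal by blast
 then obtain s where "s \<in> carrier R - P" "s \<odot>\<^bsub>M\<^esub> x = \<zero>\<^bsub>M\<^esub>" using loc by blast
 with P(2) show False by blast
qed

locale loc = module K V + P: primeideal P K for K (structure) and V (structure) and P
begin

abbreviation "S \<equiv> carrier K - P"

lemma S_one: "\<one> \<in> S"
 using P.one_imp_carrier P.I_notcarr by auto

lemma S_mult: "s \<in> S ==> t \<in> S ==> s \<otimes> t \<in> S"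
 using P.I_prime by auto

lemma S_closed: "s \<in> S ==> s \<in> carrier K" by simp

lemma frac_self: "v \<in> carrier V ==> s \<in> S ==> (v, s) \<in> frac K P V v s"
 using S_one by (auto simp: frac_def)

lemma frac_mem: "(w, t) \<in> frac K P V v s \<longleftrightarrow>
  w \<in> carrier V \<and> t \<in> S \<and> (\<exists>u\<in>S. u \<odot>\<^bsub>V\<^esub> (t \<odot>\<^bsub>V\<^esub> v) = u \<odot>\<^bsub>V\<^esub> (s \<odot>\<^bsub>V\<^esub> w))"
 by (simp add: frac_def)

text \<open>Transitivity of the equality of fractions. The witness for the conclusion is the product
  of the two given witnesses and the intermediate denominator \<open>s\<close>.\<close>

lemma frac_subset:
 assumes v: "v \<in> carrier V" "s \<in> S" and w: "w \<in> carrier V" "t \<in> S"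
  and u: "u \<in> S" "u \<odot>\<^bsub>V\<^esub> (t \<odot>\<^bsub>V\<^esub> v) = u \<odot>\<^bsub>V\<^esub> (s \<odot>\<^bsub>V\<^esub> w)"
 shows "frac K P V v s \<subseteq> frac K P V w t"
proof
 fix z assume "z \<in> frac K P V v s"
 then obtain x r p where z: "z = (x, r)" "x \<in> carrier V" "r \<in> S" "p \<in> S" "p \<odot>\<^bsub>V\<^esub> (r \<odot>\<^bsub>V\<^esub> v) = p \<odot>\<^bsub>V\<^esub> (s \<odot>\<^bsub>V\<^esub> x)"
  unfolding frac_def by blast
 note c = v w(1) z(2) S_closed[OF v(2)] S_closed[OF w(2)] S_closed[OF u(1)] S_closed[OF z(3)] S_closed[OF z(4)]
 have "(p \<otimes> u \<otimes> s) \<odot>\<^bsub>V\<^esub> (r \<odot>\<^bsub>V\<^esub> w) = (p \<otimes> r) \<odot>\<^bsub>V\<^esub> (u \<odot>\<^bsub>V\<^esub> (s \<odot>\<^bsub>V\<^esub> w))"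
  using c by (simp add: R.m_ac flip: smult_assoc1)
 also have "\<dots> = (p \<otimes> r) \<odot>\<^bsub>V\<^esub> (u \<odot>\<^bsub>V\<^esub> (t \<odot>\<^bsub>V\<^esub> v))" by (simp only: u(2))
 also have "\<dots> = (u \<otimes> t) \<odot>\<^bsub>V\<^esub> (p \<odot>\<^bsub>V\<^esub> (r \<odot>\<^bsub>V\<^esub> v))" using c by (simp add: R.m_ac flip: smult_assoc1)
 also have "\<dots> = (u \<otimes> t) \<odot>\<^bsub>V\<^esub> (p \<odot>\<^bsub>V\<^esub> (s \<odot>\<^bsub>V\<^esub> x))" by (simp only: z(5))
 also have "\<dots> = (p \<otimes> u \<otimes> s) \<odot>\<^bsub>V\<^esub> (t \<odot>\<^bsub>V\<^esub> x)" using c by (simp add: R.m_ac flip: smult_assoc1)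
 finally have "(p \<otimes> u \<otimes> s) \<odot>\<^bsub>V\<^esub> (r \<odot>\<^bsub>V\<^esub> w) = (p \<otimes> u \<otimes> s) \<odot>\<^bsub>V\<^esub> (t \<odot>\<^bsub>V\<^esub> x)" .
 moreover have "p \<otimes> u \<otimes> s \<in> S" using S_mult z u v by blast
 ultimately show "z \<in> frac K P V w t" unfolding frac_def using z by blast
qed

lemma frac_eqI:
 assumes "v \<in> carrier V" "s \<in> S" "w \<in> carrier V" "t \<in> S" "u \<in> S" "u \<odot>\<^bsub>V\<^esub> (t \<odot>\<^bsub>V\<^esub> v) = u \<odot>\<^bsub>V\<^esub> (s \<odot>\<^bsub>V\<^esub> w)"
 shows "frac K P V v s = frac K P V w t"
 using frac_subset[OF assms(1-5) assms(6)] frac_subset[OF assms(3,4,1,2,5) assms(6)[symmetric]] by blast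

lemma frac_eqD:
 assumes "frac K P V v s = frac K P V w t" "w \<in> carrier V" "t \<in> S"
 obtains u where "u \<in> S" "u \<odot>\<^bsub>V\<^esub> (t \<odot>\<^bsub>V\<^esub> v) = u \<odot>\<^bsub>V\<^esub> (s \<odot>\<^bsub>V\<^esub> w)"
 using frac_self[OF assms(2,3)] assms(1)[symmetric] unfolding frac_def by blast

abbreviation "L \<equiv> loc_module K P V"

lemma L_carrier: "carrier L = {frac K P V v s | v s. v \<in> carrier V \<and> s \<in> S}"
 by (simp add: loc_module_def)

lemma L_zero: "\<zero>\<^bsub>L\<^esub> = frac K P V \<zero>\<^bsub>V\<^esub> \<one>"
 by (simp add: loc_module_def)

text \<open>Sums in the localization are unions over all representatives, and every choice yields
  the same fraction.\<close>

lemma L_add: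
 assumes v: "v \<in> carrier V" "s \<in> S" and w: "w \<in> carrier V" "t \<in> S"
 shows "frac K P V v s \<oplus>\<^bsub>L\<^esub> frac K P V w t = frac K P V (t \<odot>\<^bsub>V\<^esub> v \<oplus>\<^bsub>V\<^esub> s \<odot>\<^bsub>V\<^esub> w) (s \<otimes> t)"
proof -
 have *: "frac K P V (t' \<odot>\<^bsub>V\<^esub> v' \<oplus>\<^bsub>V\<^esub> s' \<odot>\<^bsub>V\<^esub> w') (s' \<otimes> t') = frac K P V (t \<odot>\<^bsub>V\<^esub> v \<oplus>\<^bsub>V\<^esub> s \<odot>\<^bsub>V\<^esub> w) (s \<otimes> t)"
  if mem: "(v', s') \<in> frac K P V v s" "(w', t') \<in> frac K P V w t" for v' s' w' t'
 proof -
  obtain u p where u: "v' \<in> carrier V" "s' \<in> S" "u \<in> S" "u \<odot>\<^bsub>V\<^esub> (s' \<odot>\<^bsub>V\<^esub> v) = u \<odot>\<^bsub>V\<^esub> (s \<odot>\<^bsub>V\<^esub> v')"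
   and p: "w' \<in> carrier V" "t' \<in> S" "p \<in> S" "p \<odot>\<^bsub>V\<^esub> (t' \<odot>\<^bsub>V\<^esub> w) = p \<odot>\<^bsub>V\<^esub> (t \<odot>\<^bsub>V\<^esub> w')"
   using mem unfolding frac_mem by blast
  have c: "s \<in> carrier K" "t \<in> carrier K" "s' \<in> carrier K" "t' \<in> carrier K" "u \<in> carrier K" "p \<in> carrier K"
   using v w u p by auto
  have "(u \<otimes> p) \<odot>\<^bsub>V\<^esub> ((s \<otimes> t) \<odot>\<^bsub>V\<^esub> (t' \<odot>\<^bsub>V\<^esub> v' \<oplus>\<^bsub>V\<^esub> s' \<odot>\<^bsub>V\<^esub> w'))
    = (p \<otimes> t \<otimes> t') \<odot>\<^bsub>V\<^esub> (u \<odot>\<^bsub>V\<^esub> (s \<odot>\<^bsub>V\<^esub> v')) \<oplus>\<^bsub>V\<^esub> (u \<otimes> s \<otimes> s') \<odot>\<^bsub>V\<^esub> (p \<odot>\<^bsub>V\<^esub> (t \<odot>\<^bsub>V\<^esub> w'))"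
   using c u(1) p(1) by (simp add: smult_r_distr R.m_ac flip: smult_assoc1)
  also have "\<dots> = (p \<otimes> t \<otimes> t') \<odot>\<^bsub>V\<^esub> (u \<odot>\<^bsub>V\<^esub> (s' \<odot>\<^bsub>V\<^esub> v)) \<oplus>\<^bsub>V\<^esub> (u \<otimes> s \<otimes> s') \<odot>\<^bsub>V\<^esub> (p \<odot>\<^bsub>V\<^esub> (t' \<odot>\<^bsub>V\<^esub> w))"
   by (simp only: u(4) p(4))
  also have "\<dots> = (u \<otimes> p) \<odot>\<^bsub>V\<^esub> ((s' \<otimes> t') \<odot>\<^bsub>V\<^esub> (t \<odot>\<^bsub>V\<^esub> v \<oplus>\<^bsub>V\<^esub> s \<odot>\<^bsub>V\<^esub> w))"
   using c v(1) w(1) by (simp add: smult_r_distr R.m_ac flip: smult_assoc1)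
  finally show ?thesis
   using S_mult u p v w c by (intro frac_eqI[of _ _ _ _ "u \<otimes> p"]) auto
 qed
 have "frac K P V v s \<oplus>\<^bsub>L\<^esub> frac K P V w t = (\<Union>(v', s')\<in>frac K P V v s. \<Union>(w', t')\<in>frac K P V w t.
   frac K P V (t' \<odot>\<^bsub>V\<^esub> v' \<oplus>\<^bsub>V\<^esub> s' \<odot>\<^bsub>V\<^esub> w') (s' \<otimes> t'))"
  by (simp add: loc_module_def)
 also have "\<dots> = (\<Union>(v', s')\<in>frac K P V v s. \<Union>(w', t')\<in>frac K P V w t.
   frac K P V (t \<odot>\<^bsub>V\<^esub> v \<oplus>\<^bsub>V\<^esub> s \<odot>\<^bsub>V\<^esub> w) (s \<otimes> t))"
  using * by (intro SUP_cong refl) (auto split: prod.splits)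
 also have "\<dots> = frac K P V (t \<odot>\<^bsub>V\<^esub> v \<oplus>\<^bsub>V\<^esub> s \<odot>\<^bsub>V\<^esub> w) (s \<otimes> t)"
  using frac_self[OF v] frac_self[OF w] by blast
 finally show ?thesis .
qed

text \<open>Makes the finite sums in \<open>free_of_rank\<close> accessible to the library of sums
  over abelian monoids.\<close>

lemma L_comm_monoid: "abelian_monoid L"
proof (rule abelian_monoidI)
 have z: "\<zero>\<^bsub>L\<^esub> = frac K P V \<zero>\<^bsub>V\<^esub> \<one>" by (simp add: loc_module_def)
 show "\<zero>\<^bsub>L\<^esub> \<in> carrier L" using S_one by (auto simp: L_carrier z)
 fix x assume "x \<in> carrier L"
 then obtain v s where x: "x = frac K P V v s" "v \<in> carrier V" "s \<in> S" by (auto simp: L_carrier)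
 then show "\<zero>\<^bsub>L\<^esub> \<oplus>\<^bsub>L\<^esub> x = x" using S_one by (simp add: z L_add)
 fix y assume "y \<in> carrier L"
 then obtain w t where y: "y = frac K P V w t" "w \<in> carrier V" "t \<in> S" by (auto simp: L_carrier)
 have xy: "x \<oplus>\<^bsub>L\<^esub> y = frac K P V (t \<odot>\<^bsub>V\<^esub> v \<oplus>\<^bsub>V\<^esub> s \<odot>\<^bsub>V\<^esub> w) (s \<otimes> t)" using x y by (simp add: L_add)
 have c: "t \<odot>\<^bsub>V\<^esub> v \<oplus>\<^bsub>V\<^esub> s \<odot>\<^bsub>V\<^esub> w \<in> carrier V" "s \<otimes> t \<in> S" using x y S_mult by auto
 show "x \<oplus>\<^bsub>L\<^esub> y \<in> carrier L" using c unfolding xy L_carrier by blast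
 show "x \<oplus>\<^bsub>L\<^esub> y = y \<oplus>\<^bsub>L\<^esub> x"
  unfolding xy using x y by (simp add: L_add R.m_comm[of t s] M.a_comm)
 fix z assume "z \<in> carrier L"
 then obtain u r where z: "z = frac K P V u r" "u \<in> carrier V" "r \<in> S" by (auto simp: L_carrier)
 have c': "r \<odot>\<^bsub>V\<^esub> w \<oplus>\<^bsub>V\<^esub> t \<odot>\<^bsub>V\<^esub> u \<in> carrier V" "t \<otimes> r \<in> S" using z y S_mult by auto
 have "x \<oplus>\<^bsub>L\<^esub> y \<oplus>\<^bsub>L\<^esub> z = frac K P V (r \<odot>\<^bsub>V\<^esub> (t \<odot>\<^bsub>V\<^esub> v \<oplus>\<^bsub>V\<^esub> s \<odot>\<^bsub>V\<^esub> w) \<oplus>\<^bsub>V\<^esub> (s \<otimes> t) \<odot>\<^bsub>V\<^esub> u) ((s \<otimes> t) \<otimes> r)"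
  unfolding xy z using c z by (intro L_add)
 also have "\<dots> = frac K P V ((t \<otimes> r) \<odot>\<^bsub>V\<^esub> v \<oplus>\<^bsub>V\<^esub> s \<odot>\<^bsub>V\<^esub> (r \<odot>\<^bsub>V\<^esub> w \<oplus>\<^bsub>V\<^esub> t \<odot>\<^bsub>V\<^esub> u)) (s \<otimes> (t \<otimes> r))"
  using x y z by (simp add: smult_r_distr M.a_assoc R.m_ac flip: smult_assoc1)
 also have "\<dots> = x \<oplus>\<^bsub>L\<^esub> (y \<oplus>\<^bsub>L\<^esub> z)"
  unfolding x(1) y(1) z(1) L_add[OF y(2,3) z(2,3)] by (rule L_add[OF x(2,3) c', symmetric])
 finally show "x \<oplus>\<^bsub>L\<^esub> y \<oplus>\<^bsub>L\<^esub> z = x \<oplus>\<^bsub>L\<^esub> (y \<oplus>\<^bsub>L\<^esub> z)" .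
qed

abbreviation "fracK \<equiv> frac K P (regular_module K)"
abbreviation "LK \<equiv> loc_ring K P"

lemma LK_carrier: "carrier LK = {fracK a s | a s. a \<in> carrier K \<and> s \<in> S}"
 by (simp add: loc_ring_def Let_def loc_module_def regular_module_def)

lemma fracK_mem: "(b, t) \<in> fracK a s \<longleftrightarrow> b \<in> carrier K \<and> t \<in> S \<and> (\<exists>u\<in>S. u \<otimes> (t \<otimes> a) = u \<otimes> (s \<otimes> b))"
 by (simp add: frac_def regular_module_def)

lemma L_smult:
 assumes a: "a \<in> carrier K" "s \<in> S" and v: "v \<in> carrier V" "t \<in> S"
 shows "fracK a s \<odot>\<^bsub>L\<^esub> frac K P V v t = frac K P V (a \<odot>\<^bsub>V\<^esub> v) (s \<otimes> t)"
proof -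
 have *: "frac K P V (a' \<odot>\<^bsub>V\<^esub> v') (s' \<otimes> t') = frac K P V (a \<odot>\<^bsub>V\<^esub> v) (s \<otimes> t)"
  if mem: "(a', s') \<in> fracK a s" "(v', t') \<in> frac K P V v t" for a' s' v' t'
 proof -
  obtain u p where u: "a' \<in> carrier K" "s' \<in> S" "u \<in> S" "u \<otimes> (s' \<otimes> a) = u \<otimes> (s \<otimes> a')"
   and p: "v' \<in> carrier V" "t' \<in> S" "p \<in> S" "p \<odot>\<^bsub>V\<^esub> (t' \<odot>\<^bsub>V\<^esub> v) = p \<odot>\<^bsub>V\<^esub> (t \<odot>\<^bsub>V\<^esub> v')"
   using mem unfolding fracK_mem frac_mem by blast
  have c: "s \<in> carrier K" "t \<in> carrier K" "s' \<in> carrier K" "t' \<in> carrier K" "u \<in> carrier K" "p \<in> carrier K"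
   using a v u p by auto
  have "(u \<otimes> p) \<odot>\<^bsub>V\<^esub> ((s \<otimes> t) \<odot>\<^bsub>V\<^esub> (a' \<odot>\<^bsub>V\<^esub> v')) = (u \<otimes> (s \<otimes> a')) \<odot>\<^bsub>V\<^esub> (p \<odot>\<^bsub>V\<^esub> (t \<odot>\<^bsub>V\<^esub> v'))"
   using c u(1) p(1) by (simp add: R.m_ac flip: smult_assoc1)
  also have "\<dots> = (u \<otimes> (s' \<otimes> a)) \<odot>\<^bsub>V\<^esub> (p \<odot>\<^bsub>V\<^esub> (t' \<odot>\<^bsub>V\<^esub> v))" by (simp only: u(4) p(4))
  also have "\<dots> = (u \<otimes> p) \<odot>\<^bsub>V\<^esub> ((s' \<otimes> t') \<odot>\<^bsub>V\<^esub> (a \<odot>\<^bsub>V\<^esub> v))"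
   using c a(1) v(1) by (simp add: R.m_ac flip: smult_assoc1)
  finally show ?thesis
   using S_mult u p v a c by (intro frac_eqI[of _ _ _ _ "u \<otimes> p"]) auto
 qed
 have "(a, s) \<in> fracK a s" using a S_one by (auto simp: fracK_mem)
 have "fracK a s \<odot>\<^bsub>L\<^esub> frac K P V v t = (\<Union>(a', s')\<in>fracK a s. \<Union>(v', t')\<in>frac K P V v t.
   frac K P V (a' \<odot>\<^bsub>V\<^esub> v') (s' \<otimes> t'))"
  by (simp add: loc_module_def)
 also have "\<dots> = (\<Union>(a', s')\<in>fracK a s. \<Union>(v', t')\<in>frac K P V v t. frac K P V (a \<odot>\<^bsub>V\<^esub> v) (s \<otimes> t))"
  using * by (intro SUP_cong refl) (auto split: prod.splits)
 also have "\<dots> = frac K P V (a \<odot>\<^bsub>V\<^esub> v) (s \<otimes> t)"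
  using \<open>(a, s) \<in> fracK a s\<close> frac_self[OF v] by blast
 finally show ?thesis .
qed

lemma common_denominator:
 assumes "!!i. i < (n::nat) ==> \<exists>s\<in>S. Q i s" and "!!i s t. i < n ==> Q i s ==> s \<in> S ==> t \<in> S ==> Q i (t \<otimes> s)"
 shows "\<exists>s\<in>S. \<forall>i<n. Q i s"
 using assms
proof (induction n)
 case 0 then show ?case using S_one by auto
next
 case (Suc n)
 then obtain s where s: "s \<in> S" "\<forall>i<n. Q i s" by (metis less_Suc_eq)
 obtain t where t: "t \<in> S" "Q n t" using Suc.prems by blast
 show ?case
 proof (rule bexI[of _ "s \<otimes> t"])
  show "s \<otimes> t \<in> S" using S_mult s t by blast
  show "\<forall>i<Suc n. Q i (s \<otimes> t)"
  proof (intro allI impI)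
   fix i assume i: "i < Suc n"
   have st: "s \<otimes> t = t \<otimes> s" using s t R.m_comm by blast
   show "Q i (s \<otimes> t)"
   proof (cases "i = n")
    case True then show ?thesis using Suc.prems(2)[of n t s] s t by simp
   next
    case False then show ?thesis unfolding st using Suc.prems(2)[of i s t] s t i by simp
   qed
  qed
 qed
qed

text \<open>A local basis of fractions yields, after clearing denominators, a family of vectors that is
 a basis up to multiplication by elements outside the prime ideal.\<close>

lemma local_basis:
 assumes "free_of_rank LK L n"
 obtains \<beta> where "\<beta> \<in> {..<n} \<rightarrow> carrier V"
  "!!v. v \<in> carrier V ==> \<exists>s\<in>S. \<exists>k\<in>{..<n} \<rightarrow> carrier K. s \<odot>\<^bsub>V\<^esub> v = (\<Oplus>\<^bsub>V\<^esub>i\<in>{..<n}. k i \<odot>\<^bsub>V\<^esub> \<beta> i)"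
  "!!k. k \<in> {..<n} \<rightarrow> carrier K ==> (\<Oplus>\<^bsub>V\<^esub>i\<in>{..<n}. k i \<odot>\<^bsub>V\<^esub> \<beta> i) = \<zero>\<^bsub>V\<^esub> ==> \<exists>u\<in>S. \<forall>i<n. u \<otimes> k i = \<zero>"
proof -
 interpret L: abelian_monoid L by (rule L_comm_monoid)
 obtain B where B: "B \<in> {..<n} \<rightarrow> carrier L"
  and ex0: "\<forall>x\<in>carrier L. \<exists>!c. c \<in> {..<n} \<rightarrow>\<^sub>E carrier LK \<and> x = (\<Oplus>\<^bsub>L\<^esub>i\<in>{..<n}. c i \<odot>\<^bsub>L\<^esub> B i)"
  using assms unfolding free_of_rank_def by (rule bexE)
 note ex = bspec[OF ex0]
 have "\<exists>p. fst p \<in> carrier V \<and> snd p \<in> S \<and> B i = frac K P V (fst p) (snd p)" if i: "i < n" for i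
 proof -
  have "B i \<in> carrier L" by (rule funcset_mem[OF B]) (simp add: i)
  then obtain v s where "B i = frac K P V v s" "v \<in> carrier V" "s \<in> S" unfolding L_carrier by blast
  then show ?thesis by (intro exI[of _ "(v, s)"]) simp
 qed
 then obtain p where p: "!!i. i < n ==> fst (p i) \<in> carrier V \<and> snd (p i) \<in> S \<and> B i = frac K P V (fst (p i)) (snd (p i))"
  by metis
 define \<beta> \<tau> where "\<beta> = (\<lambda>i. fst (p i))" and "\<tau> = (\<lambda>i. snd (p i))"
 have \<beta>: "!!i. i < n ==> \<beta> i \<in> carrier V" "!!i. i < n ==> \<tau> i \<in> S"
  "!!i. i < n ==> B i = frac K P V (\<beta> i) (\<tau> i)" using p unfolding \<beta>_def \<tau>_def by blast+
 have LKc: "A \<odot>\<^bsub>L\<^esub> B i \<in> carrier L" if i: "i < n" and A: "A \<in> carrier LK" for A i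
 proof -
  obtain a s where "A = fracK a s" "a \<in> carrier K" "s \<in> S" using A unfolding LK_carrier by blast
  with \<beta>[OF i] show ?thesis
   using S_mult unfolding L_carrier by (auto simp: L_smult intro!: exI)
 qed
 have kbm: "(\<lambda>i. k i \<odot>\<^bsub>V\<^esub> \<beta> i) \<in> {..<m} \<rightarrow> carrier V" if "k \<in> {..<n} \<rightarrow> carrier K" "m \<le> n" for k m
  using that \<beta>(1) by (intro Pi_I smult_closed) (auto simp: Pi_iff)
 have Cbm: "(\<lambda>i. C i \<odot>\<^bsub>L\<^esub> B i) \<in> {..<m} \<rightarrow> carrier L" if "C \<in> {..<n} \<rightarrow>\<^sub>E carrier LK" "m \<le> n" for C m
  using that by (intro Pi_I LKc) (auto simp: PiE_iff)
 show thesis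
 proof (rule that[of \<beta>])
  show "\<beta> \<in> {..<n} \<rightarrow> carrier V" using \<beta> by auto
 next
  fix v assume v: "v \<in> carrier V"
  then have "frac K P V v \<one> \<in> carrier L" using S_one by (auto simp: L_carrier)
  from ex1_implies_ex[OF ex[OF this]]
  obtain C where C: "C \<in> {..<n} \<rightarrow>\<^sub>E carrier LK" "frac K P V v \<one> = (\<Oplus>\<^bsub>L\<^esub>i\<in>{..<n}. C i \<odot>\<^bsub>L\<^esub> B i)"
   by (elim exE conjE)
  \<comment> \<open>Partial sums are brought to a common denominator one summand at a time, the
    earlier coefficients being rescaled.\<close>
  have part: "m \<le> n ==> \<exists>s\<in>S. \<exists>k\<in>{..<n} \<rightarrow> carrier K.
    (\<Oplus>\<^bsub>L\<^esub>i\<in>{..<m}. C i \<odot>\<^bsub>L\<^esub> B i) = frac K P V (\<Oplus>\<^bsub>V\<^esub>i\<in>{..<m}. k i \<odot>\<^bsub>V\<^esub> \<beta> i) s" for m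
  proof (induction m)
   case 0
   show ?case by (rule bexI[OF _ S_one], rule bexI[of _ "\<lambda>_. \<zero>"]) (simp_all add: L_zero)
  next
   case (Suc m)
   then obtain s k where IH: "s \<in> S" "k \<in> {..<n} \<rightarrow> carrier K"
    "(\<Oplus>\<^bsub>L\<^esub>i\<in>{..<m}. C i \<odot>\<^bsub>L\<^esub> B i) = frac K P V (\<Oplus>\<^bsub>V\<^esub>i\<in>{..<m}. k i \<odot>\<^bsub>V\<^esub> \<beta> i) s" by auto
   have m: "m < n" using Suc by simp
   obtain a t where a: "C m = fracK a t" "a \<in> carrier K" "t \<in> S" using C(1) m unfolding LK_carrier by blast
   let ?X = "\<Oplus>\<^bsub>V\<^esub>i\<in>{..<m}. k i \<odot>\<^bsub>V\<^esub> \<beta> i"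
   let ?r = "t \<otimes> \<tau> m"
   have kb: "(\<lambda>i. k i \<odot>\<^bsub>V\<^esub> \<beta> i) \<in> {..<m} \<rightarrow> carrier V" using kbm[OF IH(2)] m by simp
   have X: "?X \<in> carrier V" using kb by (rule M.finsum_closed)
   have r: "?r \<in> S" "?r \<in> carrier K" using S_mult a \<beta> m by blast+
   define k' where "k' = (\<lambda>i. if i = m then s \<otimes> a else ?r \<otimes> k i)"
   have k': "k' \<in> {..<n} \<rightarrow> carrier K" using IH a r by (auto simp: k'_def Pi_iff)
   have cb: "(\<lambda>i. C i \<odot>\<^bsub>L\<^esub> B i) \<in> {..<m} \<rightarrow> carrier L" using Cbm[OF C(1)] m by simp
   have "(\<Oplus>\<^bsub>L\<^esub>i\<in>{..<Suc m}. C i \<odot>\<^bsub>L\<^esub> B i) = C m \<odot>\<^bsub>L\<^esub> B m \<oplus>\<^bsub>L\<^esub> (\<Oplus>\<^bsub>L\<^esub>i\<in>{..<m}. C i \<odot>\<^bsub>L\<^esub> B i)"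
    using cb LKc[OF m PiE_mem[OF C(1)]] m by (simp add: lessThan_Suc L.finsum_insert)
   also have "\<dots> = frac K P V (a \<odot>\<^bsub>V\<^esub> \<beta> m) ?r \<oplus>\<^bsub>L\<^esub> frac K P V ?X s"
    using a \<beta>[OF m] by (simp add: L_smult IH(3))
   also have "\<dots> = frac K P V (s \<odot>\<^bsub>V\<^esub> (a \<odot>\<^bsub>V\<^esub> \<beta> m) \<oplus>\<^bsub>V\<^esub> ?r \<odot>\<^bsub>V\<^esub> ?X) (?r \<otimes> s)"
    using a \<beta>[OF m] X r IH by (intro L_add) auto
   also have "?r \<odot>\<^bsub>V\<^esub> ?X = (\<Oplus>\<^bsub>V\<^esub>i\<in>{..<m}. ?r \<odot>\<^bsub>V\<^esub> (k i \<odot>\<^bsub>V\<^esub> \<beta> i))"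
    by (rule finsum_smult_ldistr[OF _ r(2) kb]) simp
   also have "\<dots> = (\<Oplus>\<^bsub>V\<^esub>i\<in>{..<m}. k' i \<odot>\<^bsub>V\<^esub> \<beta> i)"
    by (rule M.finsum_cong') (use m IH \<beta> r in \<open>auto simp: k'_def smult_assoc1 Pi_iff\<close>)
   also have "s \<odot>\<^bsub>V\<^esub> (a \<odot>\<^bsub>V\<^esub> \<beta> m) \<oplus>\<^bsub>V\<^esub> (\<Oplus>\<^bsub>V\<^esub>i\<in>{..<m}. k' i \<odot>\<^bsub>V\<^esub> \<beta> i) = (\<Oplus>\<^bsub>V\<^esub>i\<in>{..<Suc m}. k' i \<odot>\<^bsub>V\<^esub> \<beta> i)"
   proof -
    have "(\<lambda>i. k' i \<odot>\<^bsub>V\<^esub> \<beta> i) \<in> {..<m} \<rightarrow> carrier V" "k' m \<odot>\<^bsub>V\<^esub> \<beta> m \<in> carrier V"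
     using kbm[OF k', of m] funcset_mem[OF k', of m] \<beta> m by simp_all
    then show ?thesis using IH(1) a \<beta>[OF m] by (simp add: lessThan_Suc k'_def smult_assoc1)
   qed
   finally show ?case using S_mult[OF r(1) IH(1)] k' by blast
  qed
  obtain s k where k: "s \<in> S" "k \<in> {..<n} \<rightarrow> carrier K" "frac K P V v \<one> = frac K P V (\<Oplus>\<^bsub>V\<^esub>i\<in>{..<n}. k i \<odot>\<^bsub>V\<^esub> \<beta> i) s"
   using part[of n] C(2) by auto
  have kb: "(\<lambda>i. k i \<odot>\<^bsub>V\<^esub> \<beta> i) \<in> {..<n} \<rightarrow> carrier V" using kbm[OF k(2)] by simp
  have X: "(\<Oplus>\<^bsub>V\<^esub>i\<in>{..<n}. k i \<odot>\<^bsub>V\<^esub> \<beta> i) \<in> carrier V" using kb by (rule M.finsum_closed)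
  obtain u where u: "u \<in> S" "u \<odot>\<^bsub>V\<^esub> (s \<odot>\<^bsub>V\<^esub> v) = u \<odot>\<^bsub>V\<^esub> (\<one> \<odot>\<^bsub>V\<^esub> (\<Oplus>\<^bsub>V\<^esub>i\<in>{..<n}. k i \<odot>\<^bsub>V\<^esub> \<beta> i))"
   using frac_eqD[OF k(3) X k(1)] by blast
  have uc: "u \<in> carrier K" "s \<in> carrier K" using u k by auto
  have "(u \<otimes> s) \<odot>\<^bsub>V\<^esub> v = u \<odot>\<^bsub>V\<^esub> (\<Oplus>\<^bsub>V\<^esub>i\<in>{..<n}. k i \<odot>\<^bsub>V\<^esub> \<beta> i)" using u uc v X by (simp add: smult_assoc1)
  also have "\<dots> = (\<Oplus>\<^bsub>V\<^esub>i\<in>{..<n}. u \<odot>\<^bsub>V\<^esub> (k i \<odot>\<^bsub>V\<^esub> \<beta> i))" by (rule finsum_smult_ldistr[OF _ uc(1) kb]) simp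
  also have "\<dots> = (\<Oplus>\<^bsub>V\<^esub>i\<in>{..<n}. (u \<otimes> k i) \<odot>\<^bsub>V\<^esub> \<beta> i)"
   by (rule M.finsum_cong') (use uc k \<beta> in \<open>auto simp: smult_assoc1 Pi_iff\<close>)
  finally have "(u \<otimes> s) \<odot>\<^bsub>V\<^esub> v = (\<Oplus>\<^bsub>V\<^esub>i\<in>{..<n}. (u \<otimes> k i) \<odot>\<^bsub>V\<^esub> \<beta> i)" .
  moreover have "(\<lambda>i. u \<otimes> k i) \<in> {..<n} \<rightarrow> carrier K" using uc k by (auto simp: Pi_iff)
  ultimately show "\<exists>s\<in>S. \<exists>k\<in>{..<n} \<rightarrow> carrier K. s \<odot>\<^bsub>V\<^esub> v = (\<Oplus>\<^bsub>V\<^esub>i\<in>{..<n}. k i \<odot>\<^bsub>V\<^esub> \<beta> i)"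
   using S_mult[OF u(1) k(1)] by (intro bexI[of _ "u \<otimes> s"] bexI[of _ "\<lambda>i. u \<otimes> k i"])
 next
  fix k assume k: "k \<in> {..<n} \<rightarrow> carrier K" and z: "(\<Oplus>\<^bsub>V\<^esub>i\<in>{..<n}. k i \<odot>\<^bsub>V\<^esub> \<beta> i) = \<zero>\<^bsub>V\<^esub>"
  \<comment> \<open>As \<open>B i\<close> is the fraction of \<open>\<beta> i\<close> by
    \<open>\<tau> i\<close>, the coefficient needs the factor \<open>\<tau> i\<close> to produce
    \<open>k i\<close> times \<open>\<beta> i\<close> with denominator 1.\<close>
  define C where "C k = (\<lambda>i\<in>{..<n}. fracK (k i \<otimes> \<tau> i) \<one>)" for k
  have CE: "C k \<in> {..<n} \<rightarrow>\<^sub>E carrier LK" if "k \<in> {..<n} \<rightarrow> carrier K" for k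
   using that \<beta> S_one unfolding C_def LK_carrier by (auto simp: Pi_iff) blast
  have sum: "(\<Oplus>\<^bsub>L\<^esub>i\<in>{..<n}. C k i \<odot>\<^bsub>L\<^esub> B i) = frac K P V (\<Oplus>\<^bsub>V\<^esub>i\<in>{..<n}. k i \<odot>\<^bsub>V\<^esub> \<beta> i) \<one>"
   if k: "k \<in> {..<n} \<rightarrow> carrier K" for k
  proof -
   have "m \<le> n ==> (\<Oplus>\<^bsub>L\<^esub>i\<in>{..<m}. C k i \<odot>\<^bsub>L\<^esub> B i) = frac K P V (\<Oplus>\<^bsub>V\<^esub>i\<in>{..<m}. k i \<odot>\<^bsub>V\<^esub> \<beta> i) \<one>" for m
   proof (induction m)
    case 0 show ?case by (simp add: L_zero)
   next
    case (Suc m)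
    then have m: "m < n" by simp
    have km: "k m \<in> carrier K" "\<tau> m \<in> carrier K" using k m \<beta> by (auto simp: Pi_iff)
    have kb: "(\<lambda>i. k i \<odot>\<^bsub>V\<^esub> \<beta> i) \<in> {..<m} \<rightarrow> carrier V" "k m \<odot>\<^bsub>V\<^esub> \<beta> m \<in> carrier V"
     using kbm[OF k, of m] km \<beta> m by simp_all
    have t: "C k m \<odot>\<^bsub>L\<^esub> B m = frac K P V (k m \<odot>\<^bsub>V\<^esub> \<beta> m) \<one>"
    proof -
     have "C k m \<odot>\<^bsub>L\<^esub> B m = frac K P V ((k m \<otimes> \<tau> m) \<odot>\<^bsub>V\<^esub> \<beta> m) (\<one> \<otimes> \<tau> m)"
      using m km \<beta>[OF m] S_one by (simp add: C_def L_smult)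
     also have "\<dots> = frac K P V (k m \<odot>\<^bsub>V\<^esub> \<beta> m) \<one>"
      using m km \<beta>[OF m] S_one by (intro frac_eqI[of _ _ _ _ \<one>]) (auto simp: R.m_comm simp flip: smult_assoc1)
     finally show ?thesis .
    qed
    have "(\<lambda>i. C k i \<odot>\<^bsub>L\<^esub> B i) \<in> {..<m} \<rightarrow> carrier L" "C k m \<odot>\<^bsub>L\<^esub> B m \<in> carrier L"
     using Cbm[OF CE[OF k], of m] LKc[OF m, of "C k m"] PiE_mem[OF CE[OF k], of m] m by simp_all
    then have "(\<Oplus>\<^bsub>L\<^esub>i\<in>{..<Suc m}. C k i \<odot>\<^bsub>L\<^esub> B i) = C k m \<odot>\<^bsub>L\<^esub> B m \<oplus>\<^bsub>L\<^esub> (\<Oplus>\<^bsub>L\<^esub>i\<in>{..<m}. C k i \<odot>\<^bsub>L\<^esub> B i)"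
     by (simp add: lessThan_Suc)
    also have "\<dots> = frac K P V (k m \<odot>\<^bsub>V\<^esub> \<beta> m) \<one> \<oplus>\<^bsub>L\<^esub> frac K P V (\<Oplus>\<^bsub>V\<^esub>i\<in>{..<m}. k i \<odot>\<^bsub>V\<^esub> \<beta> i) \<one>"
     using Suc t by simp
    also have "\<dots> = frac K P V (k m \<odot>\<^bsub>V\<^esub> \<beta> m \<oplus>\<^bsub>V\<^esub> (\<Oplus>\<^bsub>V\<^esub>i\<in>{..<m}. k i \<odot>\<^bsub>V\<^esub> \<beta> i)) \<one>"
     using kb M.finsum_closed[OF kb(1)] S_one by (subst L_add) simp_all
    finally show ?case using kb by (simp add: lessThan_Suc)
   qed
   then show ?thesis by simp
  qed
  \<comment> \<open>Both families are coordinates of the zero of the localization, so uniqueness of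
    coordinates identifies them.\<close>
  have "C k = C (\<lambda>_. \<zero>)"
  proof -
   have "frac K P V \<zero>\<^bsub>V\<^esub> \<one> \<in> carrier L" using S_one by (auto simp: L_carrier)
   moreover have "(\<Oplus>\<^bsub>V\<^esub>i\<in>{..<n}. \<zero> \<odot>\<^bsub>V\<^esub> \<beta> i) = \<zero>\<^bsub>V\<^esub>" by (rule M.add.finprod_one_eqI) (use \<beta> in auto)
   moreover have "(\<lambda>_. \<zero>) \<in> {..<n} \<rightarrow> carrier K" by simp
   ultimately have eqs: "C k \<in> {..<n} \<rightarrow>\<^sub>E carrier LK \<and> frac K P V \<zero>\<^bsub>V\<^esub> \<one> = (\<Oplus>\<^bsub>L\<^esub>i\<in>{..<n}. C k i \<odot>\<^bsub>L\<^esub> B i)"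
    "C (\<lambda>_. \<zero>) \<in> {..<n} \<rightarrow>\<^sub>E carrier LK \<and> frac K P V \<zero>\<^bsub>V\<^esub> \<one> = (\<Oplus>\<^bsub>L\<^esub>i\<in>{..<n}. C (\<lambda>_. \<zero>) i \<odot>\<^bsub>L\<^esub> B i)"
    and mem: "frac K P V \<zero>\<^bsub>V\<^esub> \<one> \<in> carrier L"
    using CE[OF k] CE[of "\<lambda>_. \<zero>"] sum[OF k] sum[of "\<lambda>_. \<zero>"] z by simp_all
   obtain c0 where c0: "\<forall>c. c \<in> {..<n} \<rightarrow>\<^sub>E carrier LK \<and> frac K P V \<zero>\<^bsub>V\<^esub> \<one> = (\<Oplus>\<^bsub>L\<^esub>i\<in>{..<n}. c i \<odot>\<^bsub>L\<^esub> B i) \<longrightarrow> c = c0"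
    using ex[OF mem] by (elim ex1E) (rule that)
   from c0[rule_format, OF eqs(1)] c0[rule_format, OF eqs(2)] show ?thesis by simp
  qed
  have "\<exists>u\<in>S. u \<otimes> k i = \<zero>" if i: "i < n" for i
  proof -
   have c: "k i \<in> carrier K" "\<tau> i \<in> carrier K" using k \<beta> i by (auto simp: Pi_iff)
   have "fracK (k i \<otimes> \<tau> i) \<one> = fracK \<zero> \<one>"
    using fun_cong[OF \<open>C k = C (\<lambda>_. \<zero>)\<close>, of i] i c by (simp add: C_def)
   moreover have "(k i \<otimes> \<tau> i, \<one>) \<in> fracK (k i \<otimes> \<tau> i) \<one>" using c S_one by (auto simp: fracK_mem)
   ultimately have "(k i \<otimes> \<tau> i, \<one>) \<in> fracK \<zero> \<one>" by simp
   then obtain u where u: "u \<in> S" "u \<otimes> (\<one> \<otimes> \<zero>) = u \<otimes> (\<one> \<otimes> (k i \<otimes> \<tau> i))" unfolding fracK_mem by blast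
   then have "(u \<otimes> \<tau> i) \<otimes> k i = \<zero>" using c by (simp add: R.m_ac)
   then show ?thesis using S_mult[OF u(1) \<beta>(2)[OF i]] by blast
  qed
  then show "\<exists>u\<in>S. \<forall>i<n. u \<otimes> k i = \<zero>"
  proof (rule common_denominator)
   fix i s t assume "i < n" "s \<otimes> k i = \<zero>" "s \<in> S" "t \<in> S"
   moreover from \<open>i < n\<close> have "k i \<in> carrier K" using k by (auto simp: Pi_iff)
   ultimately show "t \<otimes> s \<otimes> k i = \<zero>" by (simp add: R.m_assoc)
  qed
 qed
qed

end

section \<open>Consequences of the rank\<close>

lemma (in cring) free_module_expand:
 assumes "finite T" "T \<subseteq> X" "f \<in> carrier (free_module R X)" "{x. f x \<noteq> \<zero>} \<subseteq> T"
  and V: "module R V" and \<pi>: "\<pi> \<in> lin_maps R (free_module R X) V"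
 shows "\<pi> f = (\<Oplus>\<^bsub>V\<^esub>x\<in>T. f x \<odot>\<^bsub>V\<^esub> \<pi> (\<lambda>y. if y = x then \<one> else \<zero>))"
 using assms(1-4)
proof (induction T arbitrary: f)
 case empty
 interpret V: module R V by (rule V)
 interpret F: module R "free_module R X" by (rule free_module_module)
 have "f = \<zero>\<^bsub>free_module R X\<^esub>" using empty by (auto simp: free_module_def)
 then show ?case using lin_maps_zero[OF F.abelian_group_axioms V.abelian_group_axioms \<pi>] by simp
next
 case (insert x T)
 interpret V: module R V by (rule V)
 let ?\<delta> = "\<lambda>x y. if y = x then \<one> else \<zero>"
 have \<delta>: "?\<delta> z \<in> carrier (free_module R X)" if "z \<in> X" for z
  using that by (auto simp: free_module_def)
 have \<pi>\<delta>: "\<pi> (?\<delta> z) \<in> carrier V" if "z \<in> X" for z using lin_maps_closed[OF \<pi> \<delta>[OF that]] .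
 have fc: "f z \<in> carrier R" for z using insert.prems by (simp add: free_module_def)
 define f' where "f' = f(x := \<zero>)"
 have s: "{y. f' y \<noteq> \<zero>} \<subseteq> T" using insert.prems by (auto simp: f'_def)
 have f': "f' \<in> carrier (free_module R X)"
  using finite_subset[OF s insert.hyps(1)] s insert.prems fc by (auto simp: free_module_def f'_def)
 have xs: "f x \<odot>\<^bsub>free_module R X\<^esub> ?\<delta> x \<in> carrier (free_module R X)"
  using module.smult_closed[OF free_module_module fc \<delta>] insert.prems by blast
 have "f = f x \<odot>\<^bsub>free_module R X\<^esub> ?\<delta> x \<oplus>\<^bsub>free_module R X\<^esub> f'"
  using fc by (auto simp: free_module_def f'_def)
 then have "\<pi> f = f x \<odot>\<^bsub>V\<^esub> \<pi> (?\<delta> x) \<oplus>\<^bsub>V\<^esub> \<pi> f'"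
  using lin_maps_add[OF \<pi> xs f'] lin_maps_smult[OF \<pi> fc \<delta>] insert.prems by (metis insert_subset)
 also have "\<pi> f' = (\<Oplus>\<^bsub>V\<^esub>y\<in>T. f' y \<odot>\<^bsub>V\<^esub> \<pi> (?\<delta> y))" using insert s f' by blast
 also have "\<dots> = (\<Oplus>\<^bsub>V\<^esub>y\<in>T. f y \<odot>\<^bsub>V\<^esub> \<pi> (?\<delta> y))"
  by (rule V.finsum_cong') (use insert fc \<pi>\<delta> in \<open>auto simp: f'_def\<close>)
 also have "f x \<odot>\<^bsub>V\<^esub> \<pi> (?\<delta> x) \<oplus>\<^bsub>V\<^esub> (\<Oplus>\<^bsub>V\<^esub>y\<in>T. f y \<odot>\<^bsub>V\<^esub> \<pi> (?\<delta> y)) = (\<Oplus>\<^bsub>V\<^esub>y\<in>insert x T. f y \<odot>\<^bsub>V\<^esub> \<pi> (?\<delta> y))"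
  by (rule V.finsum_insert[symmetric]) (use insert fc \<pi>\<delta> in auto)
 finally show ?case .
qed

text \<open>The dual basis lemma. Finite generation bounds the coordinates that occur: outside the
  union \<open>T\<close> of the supports of the generators every coordinate functional vanishes, so
  only finitely many basis elements of the free module are involved.\<close>

lemma (in module) dual_basis_exists:
 assumes "finitely_generated R M" "projective R M"
 obtains n f b where "f \<in> {..<n::nat} \<rightarrow> dual R M" "b \<in> {..<n} \<rightarrow> carrier M"
  "!!v. v \<in> carrier M ==> v = (\<Oplus>\<^bsub>M\<^esub>i\<in>{..<n}. f i v \<odot>\<^bsub>M\<^esub> b i)"
proof -
 obtain G where G: "finite G" "G \<subseteq> carrier M" "mspan R M G = carrier M"
  using assms(1) unfolding finitely_generated_def by blast
 obtain X :: "'c set" and \<iota> \<pi> where \<iota>: "\<iota> \<in> lin_maps R M (free_module R X)"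
  and \<pi>: "\<pi> \<in> lin_maps R (free_module R X) M" and \<pi>\<iota>: "\<forall>v\<in>carrier M. \<pi> (\<iota> v) = v"
  using assms(2) unfolding projective_def by (elim exE bexE)
 interpret F: module R "free_module R X" by (rule R.free_module_module)
 define T where "T = (\<Union>g\<in>G. {x. \<iota> g x \<noteq> \<zero>})"
 note \<iota>c = lin_maps_closed[OF \<iota>, unfolded R.free_module_carrier]
 have T: "finite T" "T \<subseteq> X" using G \<iota>c unfolding T_def by blast+
 have \<iota>v: "\<iota> v x \<in> carrier R" if "v \<in> carrier M" for v x using \<iota>c[OF that] by blast
 have \<iota>a: "\<iota> (v \<oplus>\<^bsub>M\<^esub> w) x = \<iota> v x \<oplus> \<iota> w x" if "v \<in> carrier M" "w \<in> carrier M" for v w x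
  using lin_maps_add[OF \<iota> that] by (simp add: free_module_def)
 have \<iota>s: "\<iota> (a \<odot>\<^bsub>M\<^esub> v) x = a \<otimes> \<iota> v x" if "a \<in> carrier R" "v \<in> carrier M" for a v x
  using lin_maps_smult[OF \<iota> that] by (simp add: free_module_def)
 have \<iota>0: "\<iota> \<zero>\<^bsub>M\<^esub> x = \<zero>" for x
  using lin_maps_zero[OF M.abelian_group_axioms F.abelian_group_axioms \<iota>] by (simp add: free_module_def)
 have supp: "\<iota> v x = \<zero>" if "v \<in> carrier M" "x \<notin> T" for v x
 proof -
  have "v \<in> mspan R M G" using G that by simp
  then show ?thesis using G(2)
   by (induction rule: mspan_induct) (use that in \<open>auto simp: \<iota>0 \<iota>a \<iota>s T_def\<close>)
 qed
 obtain e where e: "bij_betw e {0..<card T} T" using ex_bij_betw_nat_finite[OF T(1)] by blast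
 let ?n = "card T"
 let ?d = "\<lambda>x. \<pi> (\<lambda>y. if y = x then \<one> else \<zero>)"
 have e': "e ` {..<?n} = T" "inj_on e {..<?n}"
  using e by (simp_all add: bij_betw_def atLeast0LessThan)
 have eT: "e i \<in> T" if "i < ?n" for i using e'(1) that by blast
 have d: "?d x \<in> carrier M" if "x \<in> T" for x
  using that T by (intro lin_maps_closed[OF \<pi>]) (auto simp: free_module_def)
 show thesis
 proof (rule that[of "\<lambda>i. \<lambda>v\<in>carrier M. \<iota> v (e i)" ?n "\<lambda>i. ?d (e i)"])
  show "(\<lambda>i. \<lambda>v\<in>carrier M. \<iota> v (e i)) \<in> {..<?n} \<rightarrow> dual R M"
   unfolding dual_def
   by (intro Pi_I lin_maps_restrictI[OF module_axioms]) (simp_all add: regular_module_def \<iota>v \<iota>a \<iota>s)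
  show "(\<lambda>i. ?d (e i)) \<in> {..<?n} \<rightarrow> carrier M" using d e' by blast
  fix v assume v: "v \<in> carrier M"
  have "v = \<pi> (\<iota> v)" using \<pi>\<iota> v by simp
  also have "\<dots> = (\<Oplus>\<^bsub>M\<^esub>x\<in>T. \<iota> v x \<odot>\<^bsub>M\<^esub> ?d x)"
   using T lin_maps_closed[OF \<iota> v] supp[OF v] by (intro R.free_module_expand[OF _ _ _ _ module_axioms \<pi>]) auto
  also have "\<dots> = (\<Oplus>\<^bsub>M\<^esub>i\<in>{..<?n}. \<iota> v (e i) \<odot>\<^bsub>M\<^esub> ?d (e i))"
  proof -
   have "(\<lambda>x. \<iota> v x \<odot>\<^bsub>M\<^esub> ?d x) \<in> e ` {..<?n} \<rightarrow> carrier M" unfolding e'(1) using d v \<iota>v by auto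
   from M.finsum_reindex[OF this e'(2)] show ?thesis unfolding e'(1) .
  qed
  also have "\<dots> = (\<Oplus>\<^bsub>M\<^esub>i\<in>{..<?n}. (\<lambda>v\<in>carrier M. \<iota> v (e i)) v \<odot>\<^bsub>M\<^esub> ?d (e i))"
   by (rule M.finsum_cong') (use v d eT \<iota>v in auto)
  finally show "v = (\<Oplus>\<^bsub>M\<^esub>i\<in>{..<?n}. (\<lambda>v\<in>carrier M. \<iota> v (e i)) v \<odot>\<^bsub>M\<^esub> ?d (e i))" .
 qed
qed

section \<open>Vanishing of exterior powers above the rank, and the trace of the identity\<close>

context ext
begin

text \<open>Factors \<open>\<beta>\<close> can be moved to the right end, where a second one
  vanishes. For \<open>k = 0\<close> the truncated \<open>k - 1\<close> is 0, hence the explicit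
  clause on \<open>z\<close>. The splitting serves both for counting generators and, later, for
  separating the vector \<open>e\<close>.\<close>

lemma pow_of_insert:
 assumes x: "x \<in> ext_pow_of K V U' k" and U': "U' \<subseteq> CV" and U: "U \<subseteq> CV" and \<beta>: "\<beta> : CV"
  and dec: "!!v. v \<in> U' ==> \<exists>u\<in>U. \<exists>a\<in>CK. v = u \<oplus>\<^bsub>V\<^esub> a \<odot>\<^bsub>V\<^esub> \<beta>"
 shows "\<exists>y\<in>ext_pow_of K V U k. \<exists>z\<in>ext_pow_of K V U (k - 1). (k = 0 \<longrightarrow> z = \<zero>A) \<and> x = y \<oplus>A z \<otimes>A \<gamma> \<beta>"
 using x
proof (induction k arbitrary: x)
 case 0
 obtain a where a: "a : CK" "x = a \<odot>A \<one>A" using ext_pow_of_0[OF 0 U'] by blast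
 then have "x \<in> ext_pow_of K V U 0" using ext_pow_of_ops(5)[OF U] one_in_pow by blast
 with a \<beta> ext_pow_of_ops(1)[OF U] show ?case by (intro bexI[of _ x] bexI[of _ "\<zero>A"]) auto
next
 case (Suc k)
 note ops = ext_pow_of_ops[OF U] and cl = ext_pow_of_closed[OF U]
 have bb: "\<gamma> \<beta> : CA" using \<beta> by simp
 from Suc.prems U' show ?case
 proof (induction rule: ext_pow_of_Suc_induct)
  case zero then show ?case using ops(1) bb by (intro bexI[of _ "\<zero>A"]) auto
 next
  case (gen v x)
  obtain u a where u: "u \<in> U" "a : CK" "v = u \<oplus>\<^bsub>V\<^esub> a \<odot>\<^bsub>V\<^esub> \<beta>" using dec gen(1) by blast
  obtain y z where yz: "y \<in> ext_pow_of K V U k" "z \<in> ext_pow_of K V U (k - 1)" "k = 0 \<longrightarrow> z = \<zero>A"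
   "x = y \<oplus>A z \<otimes>A \<gamma> \<beta>" using Suc.IH[OF gen(2)] by blast
  note yc = cl[OF yz(1)] and zc = cl[OF yz(2)] and uc = subsetD[OF U u(1)]
  have uz: "\<gamma> u \<otimes>A z \<in> ext_pow_of K V U k"
   using gen_mult_pow_of[OF yz(2) u(1) U] yz(3) ops(1) uc by (cases k) auto
  have ay: "alpha y \<in> ext_pow_of K V U k"
   using alpha_pow[OF subsetD[OF ext_pow_of_sub[OF U] yz(1)]] yz(1) ops(4)[OF yz(1)] by simp
  have "\<gamma> \<beta> \<otimes>A (z \<otimes>A \<gamma> \<beta>) = \<zero>A"
   using gen_commute[OF zc \<beta>] bb zc \<beta> gen_square[OF \<beta>] by (simp add: A.A.m_assoc flip: A.A.m_assoc) (simp add: A.A.m_assoc gen_square)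
  then have "\<gamma> v \<otimes>A x = \<gamma> u \<otimes>A y \<oplus>A (\<gamma> u \<otimes>A z \<oplus>A a \<odot>A alpha y) \<otimes>A \<gamma> \<beta>"
   using u yz yc zc uc bb \<beta> gen_commute[OF yc \<beta>]
   by (simp add: gen_add gen_smult A.A.l_distr A.A.r_distr A.smult_mult_l A.A.m_assoc A.A.a_ac A.smult_r_distr)
  moreover have "\<gamma> u \<otimes>A y \<in> ext_pow_of K V U (Suc k)" using gen_mult_pow_of[OF yz(1) u(1) U] .
  moreover have "\<gamma> u \<otimes>A z \<oplus>A a \<odot>A alpha y \<in> ext_pow_of K V U (Suc k - 1)"
   using ops(2)[OF uz ops(5)[OF u(2) ay]] by simp
  ultimately show ?case by blast
 next
  case (add x x')
  then obtain y z y' z' where yz: "y \<in> ext_pow_of K V U (Suc k)" "z \<in> ext_pow_of K V U k" "x = y \<oplus>A z \<otimes>A \<gamma> \<beta>"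
   "y' \<in> ext_pow_of K V U (Suc k)" "z' \<in> ext_pow_of K V U k" "x' = y' \<oplus>A z' \<otimes>A \<gamma> \<beta>" by auto
  note c = cl[OF yz(1)] cl[OF yz(2)] cl[OF yz(4)] cl[OF yz(5)]
  have "x \<oplus>A x' = (y \<oplus>A y') \<oplus>A (z \<oplus>A z') \<otimes>A \<gamma> \<beta>" using yz c bb by (simp add: A.A.l_distr A.A.a_ac)
  with ops(2)[OF yz(1,4)] ops(2)[OF yz(2,5)] show ?case by auto
 next
  case (smult a x)
  then obtain y z where yz: "y \<in> ext_pow_of K V U (Suc k)" "z \<in> ext_pow_of K V U k" "x = y \<oplus>A z \<otimes>A \<gamma> \<beta>" by auto
  note c = cl[OF yz(1)] cl[OF yz(2)]
  have "a \<odot>A x = a \<odot>A y \<oplus>A (a \<odot>A z) \<otimes>A \<gamma> \<beta>" using yz c bb smult by (simp add: A.smult_r_distr A.smult_mult_l)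
  with ops(5)[OF smult(1) yz(1)] ops(5)[OF smult(1) yz(2)] show ?case by auto
 qed
qed

text \<open>The generators are removed one by one. In \<open>y + z \<beta>\<close> the part
  \<open>y\<close> keeps its degree while the number of generators drops, so the surplus
  \<open>j\<close> has to grow in the induction.\<close>

lemma ext_pow_span_zero:
 assumes \<beta>: "!!i. i < m ==> \<beta> i : CV"
  and x: "x \<in> ext_pow_of K V {\<Oplus>\<^bsub>V\<^esub>i\<in>{..<m::nat}. k i \<odot>\<^bsub>V\<^esub> \<beta> i | k. k \<in> {..<m} \<rightarrow> CK} (Suc (m + j))"
 shows "x = \<zero>A"
proof -
 define U where "U m = {\<Oplus>\<^bsub>V\<^esub>i\<in>{..<m}. k i \<odot>\<^bsub>V\<^esub> \<beta> i | k. k \<in> {..<m} \<rightarrow> CK}" for m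
 have kb: "(\<lambda>i. k i \<odot>\<^bsub>V\<^esub> \<beta> i) \<in> {..<l} \<rightarrow> CV" if "k \<in> {..<l} \<rightarrow> CK" "l \<le> m" for k l
  using that \<beta> by (intro Pi_I smult_closed) (auto simp: Pi_iff)
 have Uc: "U l \<subseteq> CV" if "l \<le> m" for l
  using M.finsum_closed[OF kb] that unfolding U_def by blast
 have "l \<le> m ==> x \<in> ext_pow_of K V (U l) (Suc (l + j)) ==> x = \<zero>A" for l x
 proof (induction l arbitrary: x j)
  case 0
  have U0: "U 0 \<subseteq> {\<zero>\<^bsub>V\<^esub>}" by (auto simp: U_def)
  from 0(2) Uc[OF 0(1)] show ?case
  proof (induction rule: ext_pow_of_Suc_induct)
   case (gen u y)
   then have "u = \<zero>\<^bsub>V\<^esub>" using U0 by blast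
   then show ?case using ext_pow_of_closed[OF Uc[OF 0(1)] gen(2)] by simp
  qed auto
 next
  case (Suc l)
  then have l: "l \<le> m" "l < m" by auto
  have dec: "\<exists>u\<in>U l. \<exists>a\<in>CK. v = u \<oplus>\<^bsub>V\<^esub> a \<odot>\<^bsub>V\<^esub> \<beta> l" if v: "v \<in> U (Suc l)" for v
  proof -
   obtain k where k: "k \<in> {..<Suc l} \<rightarrow> CK" "v = (\<Oplus>\<^bsub>V\<^esub>i\<in>{..<Suc l}. k i \<odot>\<^bsub>V\<^esub> \<beta> i)"
    using v unfolding U_def by blast
   have kl: "k \<in> {..<l} \<rightarrow> CK" "k l : CK" using k(1) by (auto simp: Pi_iff)
   have "v = k l \<odot>\<^bsub>V\<^esub> \<beta> l \<oplus>\<^bsub>V\<^esub> (\<Oplus>\<^bsub>V\<^esub>i\<in>{..<l}. k i \<odot>\<^bsub>V\<^esub> \<beta> i)"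
    unfolding k(2) using kb[OF kl(1) l(1)] kl(2) \<beta>[OF l(2)] by (simp add: lessThan_Suc)
   then have "v = (\<Oplus>\<^bsub>V\<^esub>i\<in>{..<l}. k i \<odot>\<^bsub>V\<^esub> \<beta> i) \<oplus>\<^bsub>V\<^esub> k l \<odot>\<^bsub>V\<^esub> \<beta> l"
    using kl \<beta>[OF l(2)] M.finsum_closed[OF kb[OF kl(1) l(1)]] by (simp add: M.a_comm)
   moreover have "(\<Oplus>\<^bsub>V\<^esub>i\<in>{..<l}. k i \<odot>\<^bsub>V\<^esub> \<beta> i) \<in> U l" unfolding U_def using kl(1) by blast
   ultimately show ?thesis using kl(2) by blast
  qed
  obtain y z where yz: "y \<in> ext_pow_of K V (U l) (Suc (l + Suc j))" "z \<in> ext_pow_of K V (U l) (Suc (l + j))" "x = y \<oplus>A z \<otimes>A \<gamma> (\<beta> l)"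
   using pow_of_insert[OF Suc.prems(2) Uc[OF Suc.prems(1)] Uc[OF l(1)] \<beta>[OF l(2)] dec] by auto
  have "y = \<zero>A" "z = \<zero>A" using Suc.IH[OF l(1)] yz by blast+
  then show ?case using yz \<beta>[OF l(2)] by simp
 qed
 from this[of m x] x show ?thesis unfolding U_def by simp
qed

text \<open>Locally at a prime, every vector has a multiple, by an element outside the prime, in the
  span of \<open>n\<close> vectors, and the exterior power of degree \<open>n + 1\<close> of this
  span is zero. For a product the multipliers of the factors are multiplied.\<close>

lemma ext_pow_above_rank:
 assumes rank: "!!P. primeideal P K ==> free_of_rank (loc_ring K P) (loc_module K P V) n"
  and x: "x \<in> ext_pow K V (Suc n)"
 shows "x = \<zero>A"
proof (rule A.zero_locally[OF ext_pow_closed[OF x]])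
 fix P assume "primeideal P K"
 then interpret loc K V P by (intro loc.intro module_axioms)
 show "\<exists>s\<in>S. s \<odot>A x = \<zero>A"
 proof (rule local_basis[OF rank[OF \<open>primeideal P K\<close>]])
 fix \<beta> assume \<beta>: "\<beta> \<in> {..<n} \<rightarrow> CV"
  and sp: "!!v. v : CV ==> \<exists>s\<in>S. \<exists>k\<in>{..<n} \<rightarrow> CK. s \<odot>\<^bsub>V\<^esub> v = (\<Oplus>\<^bsub>V\<^esub>i\<in>{..<n}. k i \<odot>\<^bsub>V\<^esub> \<beta> i)"
 define U where "U = {\<Oplus>\<^bsub>V\<^esub>i\<in>{..<n}. k i \<odot>\<^bsub>V\<^esub> \<beta> i | k. k \<in> {..<n} \<rightarrow> CK}"
 have kb: "(\<lambda>i. k i \<odot>\<^bsub>V\<^esub> \<beta> i) \<in> {..<n} \<rightarrow> CV" if "k \<in> {..<n} \<rightarrow> CK" for k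
  using that \<beta> by (intro Pi_I smult_closed) (auto simp: Pi_iff)
 have Uc: "U \<subseteq> CV" using M.finsum_closed[OF kb] unfolding U_def by blast
 have zero: "y = \<zero>A" if "y \<in> ext_pow_of K V U (Suc n)" for y
  using ext_pow_span_zero[of n \<beta> y 0] that \<beta> unfolding U_def by (simp add: Pi_iff)
 have word: "\<exists>s\<in>S. s \<odot>A ext_prod K V vs \<in> ext_pow_of K V U (length vs)" if "set vs \<subseteq> CV" for vs
  using that
 proof (induction vs)
  case Nil
  show ?case using S_one one_in_pow by (intro bexI[of _ \<one>]) simp_all
 next
  case (Cons v vs)
  then obtain s where s: "s \<in> S" "s \<odot>A ext_prod K V vs \<in> ext_pow_of K V U (length vs)" by auto
  have "v : CV" using Cons.prems by simp
  from sp[OF this] obtain t where t: "t \<in> S" "t \<odot>\<^bsub>V\<^esub> v \<in> U" unfolding U_def by blast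
  have c: "v : CV" "ext_prod K V vs : CA" "s : CK" "t : CK"
   using Cons.prems ext_prod_closed s t by auto
  have "\<gamma> (t \<odot>\<^bsub>V\<^esub> v) \<otimes>A (s \<odot>A ext_prod K V vs) = (t \<otimes> s) \<odot>A ext_prod K V (v # vs)"
   using c by (simp add: gen_smult A.smult_mult_l A.smult_mult_r R.m_comm[of s t] flip: A.smult_assoc1)
  then show ?case using gen_mult_pow_of[OF s(2) t(2) Uc] S_mult[OF t(1) s(1)]
   by (intro bexI[of _ "t \<otimes> s"]) simp_all
 qed
 from x show "\<exists>s\<in>S. s \<odot>A x = \<zero>A"
 proof (induction rule: ext_pow_induct)
  case zero then show ?case using S_one by (intro bexI[of _ \<one>]) auto
 next
  case (prod vs)
  then show ?case using word[of vs] zero by auto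
 next
  case (add x y)
  then obtain s t where "s \<in> S" "s \<odot>A x = \<zero>A" "t \<in> S" "t \<odot>A y = \<zero>A" by blast
  moreover then have "s : CK" "t : CK" by auto
  moreover have "(s \<otimes> t) \<odot>A x = t \<odot>A (s \<odot>A x)" "(s \<otimes> t) \<odot>A y = s \<odot>A (t \<odot>A y)"
   using add \<open>s \<in> CK\<close> \<open>t \<in> CK\<close> by (simp_all add: R.m_comm[of s t] flip: A.smult_assoc1)
  ultimately have "(s \<otimes> t) \<odot>A (x \<oplus>A y) = \<zero>A" using add by (simp add: A.smult_r_distr)
  then show ?case using S_mult \<open>s \<in> S\<close> \<open>t \<in> S\<close> by blast
 next
  case (smult a x)
  then obtain s where s: "s \<in> S" "s \<odot>A x = \<zero>A" by blast
  have "s \<odot>A (a \<odot>A x) = a \<odot>A (s \<odot>A x)"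
  proof -
   have "(s \<otimes> a) \<odot>A x = (a \<otimes> s) \<odot>A x" using smult s by (simp add: R.m_comm)
   then show ?thesis using smult s(1) by (simp add: A.smult_assoc1)
  qed
  then show ?case using s smult by auto
 qed
 qed
qed

end

text \<open>Locally, a common multiple \<open>s\<close> of the dual basis vectors \<open>b j\<close>
  consists of combinations of the local basis \<open>\<beta>\<close>. The resulting matrix
  \<open>M\<close> describes multiplication by \<open>s\<close> on \<open>\<beta>\<close> and has
  trace \<open>s t\<close>. Independence of \<open>\<beta>\<close> up to multipliers makes its
  diagonal entries equal to \<open>s\<close>, whence \<open>s t = s \<mu>\<close> up to a further
  multiplier.\<close>

lemma (in perfect) trace_id:
 assumes rank: "!!P. primeideal P K ==> free_of_rank (loc_ring K P) (loc_module K P W) m"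
 shows "tr \<one>\<^bsub>EW\<^esub> = [int m] \<cdot>\<^bsub>K\<^esub> \<one>"
proof -
 interpret Q: module K "regular_module K" by (rule V.R.regular_module_module)
 define t where "t = tr \<one>\<^bsub>EW\<^esub>"
 have t: "t \<in> carrier K" using W.End_closed(6) by (simp add: t_def)
 define \<mu> where "\<mu> = [m] \<cdot>\<^bsub>K\<^esub> \<one>"
 have \<mu>: "\<mu> \<in> carrier K" by (simp add: \<mu>_def)
 have "t \<ominus> \<mu> = \<zero>\<^bsub>regular_module K\<^esub>"
 proof (rule Q.zero_locally)
  show "t \<ominus> \<mu> \<in> carrier (regular_module K)" using t \<mu> by (simp add: regular_module_def)
  fix P assume P: "primeideal P K"
  then interpret loc K W P by (intro loc.intro W.module_axioms)
  show "\<exists>s\<in>S. s \<odot>\<^bsub>regular_module K\<^esub> (t \<ominus> \<mu>) = \<zero>\<^bsub>regular_module K\<^esub>"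
  proof (rule local_basis[OF rank[OF P]])
  fix \<beta> assume \<beta>: "\<beta> \<in> {..<m} \<rightarrow> carrier W"
   and sp: "!!v. v \<in> carrier W ==> \<exists>s\<in>S. \<exists>k\<in>{..<m} \<rightarrow> carrier K. s \<odot>\<^bsub>W\<^esub> v = (\<Oplus>\<^bsub>W\<^esub>i\<in>{..<m}. k i \<odot>\<^bsub>W\<^esub> \<beta> i)"
   and ind: "!!k. k \<in> {..<m} \<rightarrow> carrier K ==> (\<Oplus>\<^bsub>W\<^esub>i\<in>{..<m}. k i \<odot>\<^bsub>W\<^esub> \<beta> i) = \<zero>\<^bsub>W\<^esub> ==> \<exists>u\<in>S. \<forall>i<m. u \<otimes> k i = \<zero>"
  have \<beta>c [simp]: "i < m ==> \<beta> i \<in> carrier W" for i using \<beta> by auto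
  have kb: "(\<lambda>i. k i \<odot>\<^bsub>W\<^esub> \<beta> i) \<in> {..<m} \<rightarrow> carrier W" if "k \<in> {..<m} \<rightarrow> carrier K" for k
   using that by (intro Pi_I W.smult_closed) (auto simp: Pi_iff)
  have "\<exists>s\<in>S. \<forall>j<n. \<exists>k\<in>{..<m} \<rightarrow> carrier K. s \<odot>\<^bsub>W\<^esub> b j = (\<Oplus>\<^bsub>W\<^esub>i\<in>{..<m}. k i \<odot>\<^bsub>W\<^esub> \<beta> i)"
  proof (rule common_denominator)
   show "\<exists>s\<in>S. \<exists>k\<in>{..<m} \<rightarrow> carrier K. s \<odot>\<^bsub>W\<^esub> b j = (\<Oplus>\<^bsub>W\<^esub>i\<in>{..<m}. k i \<odot>\<^bsub>W\<^esub> \<beta> i)" if "j < n" for j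
    using sp that by simp
   fix j s r assume j: "j < n" and "\<exists>k\<in>{..<m} \<rightarrow> carrier K. s \<odot>\<^bsub>W\<^esub> b j = (\<Oplus>\<^bsub>W\<^esub>i\<in>{..<m}. k i \<odot>\<^bsub>W\<^esub> \<beta> i)"
    and s: "s \<in> S" and r: "r \<in> S"
   then obtain k where k: "k \<in> {..<m} \<rightarrow> carrier K" "s \<odot>\<^bsub>W\<^esub> b j = (\<Oplus>\<^bsub>W\<^esub>i\<in>{..<m}. k i \<odot>\<^bsub>W\<^esub> \<beta> i)" by blast
   have "(r \<otimes> s) \<odot>\<^bsub>W\<^esub> b j = r \<odot>\<^bsub>W\<^esub> (\<Oplus>\<^bsub>W\<^esub>i\<in>{..<m}. k i \<odot>\<^bsub>W\<^esub> \<beta> i)" using r s j k by (simp add: W.smult_assoc1)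
   also have "\<dots> = (\<Oplus>\<^bsub>W\<^esub>i\<in>{..<m}. r \<odot>\<^bsub>W\<^esub> (k i \<odot>\<^bsub>W\<^esub> \<beta> i))" by (rule W.finsum_smult_ldistr) (use r kb[OF k(1)] in auto)
   also have "\<dots> = (\<Oplus>\<^bsub>W\<^esub>i\<in>{..<m}. (r \<otimes> k i) \<odot>\<^bsub>W\<^esub> \<beta> i)"
    by (rule W.M.finsum_cong') (use r k in \<open>auto simp: W.smult_assoc1 Pi_iff\<close>)
   finally have "(r \<otimes> s) \<odot>\<^bsub>W\<^esub> b j = (\<Oplus>\<^bsub>W\<^esub>i\<in>{..<m}. (r \<otimes> k i) \<odot>\<^bsub>W\<^esub> \<beta> i)" .
   moreover have "(\<lambda>i. r \<otimes> k i) \<in> {..<m} \<rightarrow> carrier K" using r k by (auto simp: Pi_iff)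
   ultimately show "\<exists>k\<in>{..<m} \<rightarrow> carrier K. (r \<otimes> s) \<odot>\<^bsub>W\<^esub> b j = (\<Oplus>\<^bsub>W\<^esub>i\<in>{..<m}. k i \<odot>\<^bsub>W\<^esub> \<beta> i)"
    by (intro bexI[of _ "\<lambda>i. r \<otimes> k i"])
  qed
  then obtain s where s: "s \<in> S" and ex: "\<forall>j<n. \<exists>k\<in>{..<m} \<rightarrow> carrier K. s \<odot>\<^bsub>W\<^esub> b j = (\<Oplus>\<^bsub>W\<^esub>i\<in>{..<m}. k i \<odot>\<^bsub>W\<^esub> \<beta> i)"
   by (rule bexE)
  define \<kappa> where "\<kappa> j = (SOME k. k \<in> {..<m} \<rightarrow> carrier K \<and> s \<odot>\<^bsub>W\<^esub> b j = (\<Oplus>\<^bsub>W\<^esub>i\<in>{..<m}. k i \<odot>\<^bsub>W\<^esub> \<beta> i))" for j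
  have \<kappa>': "\<kappa> j \<in> {..<m} \<rightarrow> carrier K \<and> s \<odot>\<^bsub>W\<^esub> b j = (\<Oplus>\<^bsub>W\<^esub>i\<in>{..<m}. \<kappa> j i \<odot>\<^bsub>W\<^esub> \<beta> i)" if "j < n" for j
  proof -
   have "\<exists>k. k \<in> {..<m} \<rightarrow> carrier K \<and> s \<odot>\<^bsub>W\<^esub> b j = (\<Oplus>\<^bsub>W\<^esub>i\<in>{..<m}. k i \<odot>\<^bsub>W\<^esub> \<beta> i)"
    using ex[rule_format, OF that] by blast
   from someI_ex[OF this] show ?thesis unfolding \<kappa>_def .
  qed
  have \<kappa>: "!!j. j < n ==> \<kappa> j \<in> {..<m} \<rightarrow> carrier K"
   "!!j. j < n ==> s \<odot>\<^bsub>W\<^esub> b j = (\<Oplus>\<^bsub>W\<^esub>i\<in>{..<m}. \<kappa> j i \<odot>\<^bsub>W\<^esub> \<beta> i)" using \<kappa>' by simp_all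
  have sc: "s \<in> carrier K" using s by simp
  have \<kappa>c [simp]: "\<kappa> j i \<in> carrier K" if "j < n" "i < m" for j i using \<kappa>(1) that by (auto simp: Pi_iff)
  define M where "M l i = (\<Oplus>j\<in>{..<n}. h (c j) (\<beta> l) \<otimes> \<kappa> j i)" for l i
  have Mc [simp]: "M l i \<in> carrier K" if "l < m" "i < m" for l i
   unfolding M_def using that by (auto intro!: V.R.finsum_closed)
  have st: "s \<otimes> t = (\<Oplus>i\<in>{..<m}. M i i)"
  proof -
   have "s \<otimes> t = s \<otimes> (\<Oplus>j\<in>{..<n}. h (c j) (b j))"
    unfolding t_def trace_eq[OF W.End_closed(6)]
    by (rule arg_cong[where f = "\<lambda>x. s \<otimes> x"], rule V.R.finsum_cong') (auto simp: W.End_simps)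
   also have "\<dots> = (\<Oplus>j\<in>{..<n}. s \<otimes> h (c j) (b j))" by (rule V.R.finsum_rdistr) (use sc in auto)
   also have "\<dots> = (\<Oplus>j\<in>{..<n}. \<Oplus>i\<in>{..<m}. h (c j) (\<beta> i) \<otimes> \<kappa> j i)"
   proof (rule V.R.finsum_cong')
    fix j assume "j \<in> {..<n}"
    then have j: "j < n" by simp
    have "s \<otimes> h (c j) (b j) = h (c j) (s \<odot>\<^bsub>W\<^esub> b j)" using sc j by (simp add: h_smult_r)
    also have "\<dots> = (\<Oplus>i\<in>{..<m}. h (c j) (\<kappa> j i \<odot>\<^bsub>W\<^esub> \<beta> i))"
     unfolding \<kappa>(2)[OF j] by (rule h_finsum_r) (use kb[OF \<kappa>(1)[OF j]] j in auto)
    also have "\<dots> = (\<Oplus>i\<in>{..<m}. h (c j) (\<beta> i) \<otimes> \<kappa> j i)"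
     by (rule V.R.finsum_cong') (use j in \<open>auto simp: h_smult_r V.R.m_comm\<close>)
    finally show "s \<otimes> h (c j) (b j) = (\<Oplus>i\<in>{..<m}. h (c j) (\<beta> i) \<otimes> \<kappa> j i)" .
   qed (auto intro!: V.R.finsum_closed)
   also have "\<dots> = (\<Oplus>i\<in>{..<m}. M i i)" unfolding M_def by (rule V.R.finsum_swap) auto
   finally show ?thesis .
  qed
  have s\<beta>: "s \<odot>\<^bsub>W\<^esub> \<beta> l = (\<Oplus>\<^bsub>W\<^esub>i\<in>{..<m}. M l i \<odot>\<^bsub>W\<^esub> \<beta> i)" if l: "l < m" for l
  proof (rule nondeg)
   show "s \<odot>\<^bsub>W\<^esub> \<beta> l \<in> carrier W" using sc l by simp
   have Ml: "M l \<in> {..<m} \<rightarrow> carrier K" using l by auto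
   show "(\<Oplus>\<^bsub>W\<^esub>i\<in>{..<m}. M l i \<odot>\<^bsub>W\<^esub> \<beta> i) \<in> carrier W" by (rule W.M.finsum_closed[OF kb[OF Ml]])
   fix v assume v: "v \<in> carrier V"
   have "h v (s \<odot>\<^bsub>W\<^esub> \<beta> l) = s \<otimes> h v (\<Oplus>\<^bsub>W\<^esub>j\<in>{..<n}. h (c j) (\<beta> l) \<odot>\<^bsub>W\<^esub> b j)"
    using dual_W[of "\<beta> l"] l v sc by (simp add: h_smult_r)
   also have "h v (\<Oplus>\<^bsub>W\<^esub>j\<in>{..<n}. h (c j) (\<beta> l) \<odot>\<^bsub>W\<^esub> b j) = (\<Oplus>j\<in>{..<n}. h v (h (c j) (\<beta> l) \<odot>\<^bsub>W\<^esub> b j))"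
    by (rule h_finsum_r) (use l v in auto)
   also have "s \<otimes> \<dots> = (\<Oplus>j\<in>{..<n}. s \<otimes> h v (h (c j) (\<beta> l) \<odot>\<^bsub>W\<^esub> b j))"
    by (rule V.R.finsum_rdistr) (use l v sc in auto)
   also have "\<dots> = (\<Oplus>j\<in>{..<n}. \<Oplus>i\<in>{..<m}. (h (c j) (\<beta> l) \<otimes> \<kappa> j i) \<otimes> h v (\<beta> i))"
   proof (rule V.R.finsum_cong')
    fix j assume "j \<in> {..<n}"
    then have j: "j < n" by simp
    have "s \<otimes> h v (h (c j) (\<beta> l) \<odot>\<^bsub>W\<^esub> b j) = h (c j) (\<beta> l) \<otimes> h v (s \<odot>\<^bsub>W\<^esub> b j)"
     using sc j l v by (simp add: h_smult_r V.R.m_ac)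
    also have "h v (s \<odot>\<^bsub>W\<^esub> b j) = (\<Oplus>i\<in>{..<m}. h v (\<kappa> j i \<odot>\<^bsub>W\<^esub> \<beta> i))"
     unfolding \<kappa>(2)[OF j] by (rule h_finsum_r) (use kb[OF \<kappa>(1)[OF j]] v in auto)
    also have "h (c j) (\<beta> l) \<otimes> \<dots> = (\<Oplus>i\<in>{..<m}. h (c j) (\<beta> l) \<otimes> h v (\<kappa> j i \<odot>\<^bsub>W\<^esub> \<beta> i))"
     by (rule V.R.finsum_rdistr) (use j l v in auto)
    also have "\<dots> = (\<Oplus>i\<in>{..<m}. (h (c j) (\<beta> l) \<otimes> \<kappa> j i) \<otimes> h v (\<beta> i))"
     by (rule V.R.finsum_cong') (use j l v in \<open>auto simp: h_smult_r V.R.m_assoc\<close>)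
    finally show "s \<otimes> h v (h (c j) (\<beta> l) \<odot>\<^bsub>W\<^esub> b j) = (\<Oplus>i\<in>{..<m}. (h (c j) (\<beta> l) \<otimes> \<kappa> j i) \<otimes> h v (\<beta> i))" .
   qed (use l v in \<open>auto intro!: V.R.finsum_closed\<close>)
   also have "\<dots> = (\<Oplus>i\<in>{..<m}. \<Oplus>j\<in>{..<n}. (h (c j) (\<beta> l) \<otimes> \<kappa> j i) \<otimes> h v (\<beta> i))"
    by (rule V.R.finsum_swap) (use l v in auto)
   also have "\<dots> = (\<Oplus>i\<in>{..<m}. h v (M l i \<odot>\<^bsub>W\<^esub> \<beta> i))"
   proof (rule V.R.finsum_cong')
    fix i assume i: "i \<in> {..<m}"
    have "h v (M l i \<odot>\<^bsub>W\<^esub> \<beta> i) = M l i \<otimes> h v (\<beta> i)" using i l v by (simp add: h_smult_r)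
    also have "\<dots> = (\<Oplus>j\<in>{..<n}. (h (c j) (\<beta> l) \<otimes> \<kappa> j i) \<otimes> h v (\<beta> i))"
     unfolding M_def by (rule V.R.finsum_ldistr) (use i l v in auto)
    finally show "(\<Oplus>j\<in>{..<n}. (h (c j) (\<beta> l) \<otimes> \<kappa> j i) \<otimes> h v (\<beta> i)) = h v (M l i \<odot>\<^bsub>W\<^esub> \<beta> i)" by simp
   qed (use l v in auto)
   also have "\<dots> = h v (\<Oplus>\<^bsub>W\<^esub>i\<in>{..<m}. M l i \<odot>\<^bsub>W\<^esub> \<beta> i)"
    by (rule h_finsum_r[symmetric]) (use kb[OF Ml] v in auto)
   finally show "h v (s \<odot>\<^bsub>W\<^esub> \<beta> l) = h v (\<Oplus>\<^bsub>W\<^esub>i\<in>{..<m}. M l i \<odot>\<^bsub>W\<^esub> \<beta> i)" .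
  qed
  have "\<exists>u\<in>S. \<forall>l<m. u \<otimes> M l l = u \<otimes> s"
  proof (rule common_denominator)
   fix l assume l: "l < m"
   \<comment> \<open>Row \<open>l\<close> of \<open>M\<close> minus \<open>s\<close> times the unit
     matrix: a relation among the \<open>\<beta> i\<close>.\<close>
   define k where "k i = M l i \<oplus> (if i = l then \<ominus> s else \<zero>)" for i
   have kc: "k \<in> {..<m} \<rightarrow> carrier K" using l sc by (auto simp: k_def)
   have Ml: "M l \<in> {..<m} \<rightarrow> carrier K" using l by auto
   have dl: "(\<lambda>i. if i = l then \<ominus> s else \<zero>) \<in> {..<m} \<rightarrow> carrier K" using sc by auto
   have "(\<Oplus>\<^bsub>W\<^esub>i\<in>{..<m}. k i \<odot>\<^bsub>W\<^esub> \<beta> i) = (\<Oplus>\<^bsub>W\<^esub>i\<in>{..<m}. M l i \<odot>\<^bsub>W\<^esub> \<beta> i \<oplus>\<^bsub>W\<^esub> (if i = l then \<ominus> s else \<zero>) \<odot>\<^bsub>W\<^esub> \<beta> i)"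
    by (rule W.M.finsum_cong') (use l sc in \<open>auto simp: k_def W.smult_l_distr\<close>)
   also have "\<dots> = (\<Oplus>\<^bsub>W\<^esub>i\<in>{..<m}. M l i \<odot>\<^bsub>W\<^esub> \<beta> i) \<oplus>\<^bsub>W\<^esub> (\<Oplus>\<^bsub>W\<^esub>i\<in>{..<m}. (if i = l then \<ominus> s else \<zero>) \<odot>\<^bsub>W\<^esub> \<beta> i)"
    by (rule W.M.finsum_addf[OF kb[OF Ml] kb[OF dl]])
   also have "(\<Oplus>\<^bsub>W\<^esub>i\<in>{..<m}. (if i = l then \<ominus> s else \<zero>) \<odot>\<^bsub>W\<^esub> \<beta> i) = (\<Oplus>\<^bsub>W\<^esub>i\<in>{..<m}. if l = i then (\<ominus> s) \<odot>\<^bsub>W\<^esub> \<beta> i else \<zero>\<^bsub>W\<^esub>)"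
    by (rule W.M.finsum_cong') (use l sc in auto)
   also have "\<dots> = (\<ominus> s) \<odot>\<^bsub>W\<^esub> \<beta> l" by (rule W.M.finsum_singleton) (use l sc in auto)
   finally have "(\<Oplus>\<^bsub>W\<^esub>i\<in>{..<m}. k i \<odot>\<^bsub>W\<^esub> \<beta> i) = \<zero>\<^bsub>W\<^esub>"
    using s\<beta>[OF l] l sc by (simp add: W.smult_l_minus W.M.r_neg)
   then obtain u where u: "u \<in> S" "u \<otimes> k l = \<zero>" using ind[OF kc] l by blast
   have uc: "u \<in> carrier K" using u by simp
   have "u \<otimes> M l l \<ominus> u \<otimes> s = \<zero>"
    using u(2) l sc uc by (simp add: k_def V.R.r_distr V.R.r_minus V.R.minus_eq)
   then have "u \<otimes> M l l = u \<otimes> s" using l sc uc by (simp add: V.R.minus_zero_iff)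
   then show "\<exists>u\<in>S. u \<otimes> M l l = u \<otimes> s" using u by blast
  next
   fix l u r assume "l < m" "u \<otimes> M l l = u \<otimes> s" "u \<in> S" "r \<in> S"
   then show "r \<otimes> u \<otimes> M l l = r \<otimes> u \<otimes> s" using sc by (simp add: V.R.m_assoc)
  qed
  then obtain u where u: "u \<in> S" "!!l. l < m ==> u \<otimes> M l l = u \<otimes> s" by blast
  have uc: "u \<in> carrier K" using u by simp
  have "u \<otimes> (s \<otimes> t) = (\<Oplus>i\<in>{..<m}. u \<otimes> M i i)" unfolding st by (rule V.R.finsum_rdistr) (use uc in auto)
  also have "\<dots> = (\<Oplus>i\<in>{..<m}. u \<otimes> s)" by (rule V.R.finsum_cong') (use u uc sc in auto)
  also have "\<dots> = [m] \<cdot>\<^bsub>K\<^esub> (u \<otimes> s)" using V.R.add.finprod_const[of "u \<otimes> s" "{..<m}"] uc sc by simp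
  also have "\<dots> = (u \<otimes> s) \<otimes> \<mu>"
   using V.R.add_pow_rdistr[of "u \<otimes> s" \<one> m] uc sc by (simp add: \<mu>_def)
  finally have "(u \<otimes> s) \<otimes> (t \<ominus> \<mu>) = \<zero>"
   using uc sc t \<mu> by (simp add: V.R.minus_eq V.R.r_distr V.R.r_minus V.R.r_neg V.R.m_assoc)
  then show "\<exists>s\<in>S. s \<odot>\<^bsub>regular_module K\<^esub> (t \<ominus> \<mu>) = \<zero>\<^bsub>regular_module K\<^esub>"
   using S_mult[OF u(1) s] by (intro bexI[of _ "u \<otimes> s"]) (simp_all add: regular_module_def)
  qed
 qed
 then have "t \<ominus> \<mu> = \<zero>" by (simp add: regular_module_def)
 then have "t = \<mu>" using t \<mu> by (simp add: V.R.minus_zero_iff)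
 then show ?thesis by (simp add: t_def \<mu>_def add_pow_int_ge)
qed

text \<open>The coordinate functionals of a dual basis of \<open>W\<close> are represented by
  vectors \<open>c i\<close> of \<open>V\<close>. The expansion in \<open>V\<close> follows by
  pairing with \<open>w\<close>, because vectors of \<open>V\<close> are separated by
  \<open>W\<close>.\<close>

lemma perfect_exists:
 fixes K (structure)
 assumes K: "cring K" and V: "fg_projective_of_rank K V n" and W: "fg_projective_of_rank K W m"
  and bil: "bilinear_form K V W h" and ns: "nonsingular K V W h"
 obtains l b c where "perfect K V W h l b c"
proof -
 interpret V: module K V using V by (simp add: fg_projective_of_rank_def)
 interpret W: module K W using W by (simp add: fg_projective_of_rank_def)
 have hW: "(\<lambda>w\<in>carrier W. h v w) \<in> lin_maps K W (regular_module K)" if "v \<in> carrier V" for v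
  using bil that by (simp add: bilinear_form_def dual_def)
 have hV: "(\<lambda>v\<in>carrier V. h v w) \<in> lin_maps K V (regular_module K)" if "w \<in> carrier W" for w
  using bil that by (simp add: bilinear_form_def dual_def)
 have dp: "dpair K V W h"
 proof (intro dpair.intro ext.intro dpair_axioms.intro V.module_axioms W.module_axioms)
  fix v w assume v: "v \<in> carrier V" and w: "w \<in> carrier W"
  show "h v w \<in> carrier K" using lin_maps_closed[OF hW[OF v] w] w by (simp add: regular_module_def)
  show "h (v \<oplus>\<^bsub>V\<^esub> v') w = h v w \<oplus> h v' w" if "v' \<in> carrier V" for v'
   using lin_maps_add[OF hV[OF w] v that] v w that by (simp add: regular_module_def)
  show "h (a \<odot>\<^bsub>V\<^esub> v) w = a \<otimes> h v w" if "a \<in> carrier K" for a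
   using lin_maps_smult[OF hV[OF w] that v] v w that by (simp add: regular_module_def)
  show "h v (w \<oplus>\<^bsub>W\<^esub> w') = h v w \<oplus> h v w'" if "w' \<in> carrier W" for w'
   using lin_maps_add[OF hW[OF v] w that] v w that by (simp add: regular_module_def)
  show "h v (a \<odot>\<^bsub>W\<^esub> w) = a \<otimes> h v w" if "a \<in> carrier K" for a
   using lin_maps_smult[OF hW[OF v] that w] v w that by (simp add: regular_module_def)
 qed
 interpret dpair K V W h by (rule dp)
 obtain l f b where f: "f \<in> {..<l::nat} \<rightarrow> dual K W" and b: "b \<in> {..<l} \<rightarrow> carrier W"
  and rep: "!!w. w \<in> carrier W ==> w = (\<Oplus>\<^bsub>W\<^esub>i\<in>{..<l}. f i w \<odot>\<^bsub>W\<^esub> b i)"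
  by (rule W.dual_basis_exists) (use W in \<open>simp_all add: fg_projective_of_rank_def\<close>)
 have "\<exists>v. v \<in> carrier V \<and> f i = (\<lambda>w\<in>carrier W. h v w)" if "i < l" for i
  using ns f that unfolding nonsingular_def bij_betw_def by (auto simp: Pi_iff)
 then obtain c where c: "!!i. i < l ==> c i \<in> carrier V" "!!i. i < l ==> f i = (\<lambda>w\<in>carrier W. h (c i) w)" by metis
 have bc: "i < l ==> b i \<in> carrier W" for i using b by auto
 have dW: "w = (\<Oplus>\<^bsub>W\<^esub>i\<in>{..<l}. h (c i) w \<odot>\<^bsub>W\<^esub> b i)" if w: "w \<in> carrier W" for w
 proof -
  have "(\<Oplus>\<^bsub>W\<^esub>i\<in>{..<l}. h (c i) w \<odot>\<^bsub>W\<^esub> b i) = (\<Oplus>\<^bsub>W\<^esub>i\<in>{..<l}. f i w \<odot>\<^bsub>W\<^esub> b i)"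
   by (rule W.M.finsum_cong') (use w c bc in auto)
  with rep[OF w] show ?thesis by simp
 qed
 have fin_r: "finite I ==> u \<in> I \<rightarrow> carrier W ==> v \<in> carrier V ==> h v (\<Oplus>\<^bsub>W\<^esub>i\<in>I. u i) = (\<Oplus>i\<in>I. h v (u i))" for I :: "nat set" and u v
 proof (induction I rule: finite_induct)
  case empty show ?case using h_smult_r[of \<zero> v "\<zero>\<^bsub>W\<^esub>"] empty by simp
 next
  case (insert i I)
  then have "u \<in> I \<rightarrow> carrier W" "u i \<in> carrier W" "(\<lambda>i. h v (u i)) \<in> I \<rightarrow> carrier K" by auto
  with insert show ?case by (simp add: h_add_r)
 qed
 have fin_l: "finite I ==> u \<in> I \<rightarrow> carrier V ==> w \<in> carrier W ==> h (\<Oplus>\<^bsub>V\<^esub>i\<in>I. u i) w = (\<Oplus>i\<in>I. h (u i) w)" for I :: "nat set" and u w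
 proof (induction I rule: finite_induct)
  case empty show ?case using h_smult_l[of \<zero> "\<zero>\<^bsub>V\<^esub>" w] empty by simp
 next
  case (insert i I)
  then have "u \<in> I \<rightarrow> carrier V" "u i \<in> carrier V" "(\<lambda>i. h (u i) w) \<in> I \<rightarrow> carrier K" by auto
  with insert show ?case by (simp add: h_add_l)
 qed
 have inj: "v = v'" if "v \<in> carrier V" "v' \<in> carrier V" "!!w. w \<in> carrier W ==> h v w = h v' w" for v v'
 proof -
  have "(\<lambda>w\<in>carrier W. h v w) = (\<lambda>w\<in>carrier W. h v' w)" using that(3) by (intro restrict_ext)
  with ns that(1,2) show ?thesis unfolding nonsingular_def bij_betw_def inj_on_def by blast
 qed
 have dV: "v = (\<Oplus>\<^bsub>V\<^esub>i\<in>{..<l}. h v (b i) \<odot>\<^bsub>V\<^esub> c i)" if v: "v \<in> carrier V" for v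
 proof (rule inj[OF v])
  have cl: "(\<lambda>i. h v (b i) \<odot>\<^bsub>V\<^esub> c i) \<in> {..<l} \<rightarrow> carrier V" using v bc c by auto
  show "(\<Oplus>\<^bsub>V\<^esub>i\<in>{..<l}. h v (b i) \<odot>\<^bsub>V\<^esub> c i) \<in> carrier V" by (rule V.M.finsum_closed[OF cl])
  fix w assume w: "w \<in> carrier W"
  have "h v w = h v (\<Oplus>\<^bsub>W\<^esub>i\<in>{..<l}. h (c i) w \<odot>\<^bsub>W\<^esub> b i)" using dW[OF w] by simp
  also have "\<dots> = (\<Oplus>i\<in>{..<l}. h v (h (c i) w \<odot>\<^bsub>W\<^esub> b i))" by (rule fin_r) (use v w bc c in auto)
  also have "\<dots> = (\<Oplus>i\<in>{..<l}. h (h v (b i) \<odot>\<^bsub>V\<^esub> c i) w)"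
   by (rule V.R.finsum_cong') (use v w bc c in \<open>auto simp: h_smult_l h_smult_r V.R.m_comm\<close>)
  also have "\<dots> = h (\<Oplus>\<^bsub>V\<^esub>i\<in>{..<l}. h v (b i) \<odot>\<^bsub>V\<^esub> c i) w" by (rule fin_l[symmetric]) (use cl w in auto)
  finally show "h v w = h (\<Oplus>\<^bsub>V\<^esub>i\<in>{..<l}. h v (b i) \<odot>\<^bsub>V\<^esub> c i) w" .
 qed
 show thesis
  by (rule that[of l b c], intro perfect.intro dp perfect_axioms.intro) (use b c dW dV in auto)
qed

section \<open>The Lie algebra\<close>

context abelian_group
begin

text \<open>These rearrangements have the shapes of the components of the bracket: three summands in
  degrees 2 and -2 and for \<open>hcoef\<close>, four in degrees 1 and -1, and five, with two
  patterns of signs, for the endomorphisms.\<close>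

lemma regroup3:
 "p \<in> carrier G ==> p' \<in> carrier G ==> q \<in> carrier G ==> q' \<in> carrier G ==> r \<in> carrier G ==> r' \<in> carrier G ==>
  (p \<oplus> p') \<ominus> (q \<oplus> q') \<oplus> (r \<oplus> r') = (p \<ominus> q \<oplus> r) \<oplus> (p' \<ominus> q' \<oplus> r')"
 by (simp add: minus_eq minus_add a_ac)

lemma regroup4:
 "p \<in> carrier G ==> p' \<in> carrier G ==> q \<in> carrier G ==> q' \<in> carrier G ==> r \<in> carrier G ==> r' \<in> carrier G ==>
  s \<in> carrier G ==> s' \<in> carrier G ==>
  (p \<ominus> q \<oplus> r) \<oplus> (p' \<ominus> q' \<oplus> r') \<ominus> (s \<oplus> s') = (p \<ominus> q \<oplus> r \<ominus> s) \<oplus> (p' \<ominus> q' \<oplus> r' \<ominus> s')"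
 by (simp add: minus_eq minus_add a_ac)

lemma regroup5:
 "p \<in> carrier G ==> p' \<in> carrier G ==> q \<in> carrier G ==> q' \<in> carrier G ==> r \<in> carrier G ==> r' \<in> carrier G ==>
  s \<in> carrier G ==> s' \<in> carrier G ==> t \<in> carrier G ==> t' \<in> carrier G ==>
  (p \<oplus> p') \<ominus> (q \<oplus> q') \<oplus> (r \<oplus> r') \<ominus> (s \<oplus> s') \<oplus> (t \<oplus> t') = (p \<ominus> q \<oplus> r \<ominus> s \<oplus> t) \<oplus> (p' \<ominus> q' \<oplus> r' \<ominus> s' \<oplus> t')"
 "p \<in> carrier G ==> p' \<in> carrier G ==> q \<in> carrier G ==> q' \<in> carrier G ==> r \<in> carrier G ==> r' \<in> carrier G ==>
  s \<in> carrier G ==> s' \<in> carrier G ==> t \<in> carrier G ==> t' \<in> carrier G ==>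
  (p \<oplus> p') \<ominus> (q \<oplus> q') \<ominus> (r \<oplus> r') \<oplus> (s \<oplus> s') \<ominus> (t \<oplus> t') = (p \<ominus> q \<ominus> r \<oplus> s \<ominus> t) \<oplus> (p' \<ominus> q' \<ominus> r' \<oplus> s' \<ominus> t')"
 by (simp_all add: minus_eq minus_add a_ac)

end

text \<open>What the Lie algebra needs from rank six: nothing survives in degree seven, and
  identities have trace six. The four facts are symmetric, so the locale passes to the interchanged
  modules.\<close>

locale lie = perfect K V W h n b c for K (structure) and V and W and h :: "'c => 'e => 'a" and n b c +
 assumes top_V: "x : pV 7 ==> x = \<zero>\<^bsub>ext_alg K V\<^esub>"
  and top_W: "y : pW 7 ==> y = \<zero>\<^bsub>ext_alg K W\<^esub>"
  and tr_id_V: "mtrace K V \<one>\<^bsub>End_alg K V\<^esub> = [(6::int)] \<cdot>\<^bsub>K\<^esub> \<one>"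
  and tr_id_W: "mtrace K W \<one>\<^bsub>End_alg K W\<^esub> = [(6::int)] \<cdot>\<^bsub>K\<^esub> \<one>"
begin

lemma lie_swap: "lie K W V (\<lambda>w v. h v w) n c b"
 by (intro lie.intro perfect_swap lie_axioms.intro) (use top_V top_W tr_id_V tr_id_W in auto)

sublocale s: perfect K W V "\<lambda>w v. h v w" n c b
 by (rule perfect_swap)

abbreviation "EV \<equiv> End_alg K V"
abbreviation (input) plus_EV (infixl "\<oplus>EV" 65) where "x \<oplus>EV y \<equiv> x \<oplus>\<^bsub>EV\<^esub> y"
abbreviation (input) minus_EV (infixl "\<ominus>EV" 65) where "x \<ominus>EV y \<equiv> x \<ominus>\<^bsub>EV\<^esub> y"
abbreviation (input) times_EV (infixl "\<otimes>EV" 70) where "x \<otimes>EV y \<equiv> x \<otimes>\<^bsub>EV\<^esub> y"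
abbreviation (input) scale_EV (infixl "\<odot>EV" 70) where "x \<odot>EV y \<equiv> x \<odot>\<^bsub>EV\<^esub> y"
abbreviation (input) neg_EV ("\<ominus>EV _" [81] 80) where "\<ominus>EV x \<equiv> \<ominus>\<^bsub>EV\<^esub> x"
abbreviation (input) zero_EV ("\<zero>EV") where "\<zero>EV \<equiv> \<zero>\<^bsub>EV\<^esub>"
abbreviation (input) one_EV ("\<one>EV") where "\<one>EV \<equiv> \<one>\<^bsub>EV\<^esub>"
abbreviation (input) "YV \<equiv> carrier EV"
abbreviation "E' \<equiv> ext_E K W V (\<lambda>w v. h v w)"
abbreviation "L \<equiv> tilde_E K V W h"
abbreviation (input) plus_L (infixl "\<oplus>L" 65) where "x \<oplus>L y \<equiv> x \<oplus>\<^bsub>L\<^esub> y"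
abbreviation (input) minus_L (infixl "\<ominus>L" 65) where "x \<ominus>L y \<equiv> x \<ominus>\<^bsub>L\<^esub> y"
abbreviation (input) times_L (infixl "\<otimes>L" 70) where "x \<otimes>L y \<equiv> x \<otimes>\<^bsub>L\<^esub> y"
abbreviation (input) scale_L (infixl "\<odot>L" 70) where "x \<odot>L y \<equiv> x \<odot>\<^bsub>L\<^esub> y"
abbreviation (input) neg_L ("\<ominus>L _" [81] 80) where "\<ominus>L x \<equiv> \<ominus>\<^bsub>L\<^esub> x"
abbreviation (input) zero_L ("\<zero>L") where "\<zero>L \<equiv> \<zero>\<^bsub>L\<^esub>"
abbreviation (input) one_L ("\<one>L") where "\<one>L \<equiv> \<one>\<^bsub>L\<^esub>"
abbreviation (input) "CL \<equiv> carrier L"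
abbreviation "Z \<equiv> tilde_zero K V W"
abbreviation "br \<equiv> tilde_bracket K V W h"
abbreviation "SP \<equiv> S_pairs K V W h"
abbreviation "pr a x \<equiv> W.counit (cW a x)"

section \<open>The Lie algebra S of pairs of endomorphisms\<close>

lemma SP_iff: "(A, B) \<in> SP \<longleftrightarrow> A : LV \<and> B : LW \<and>
  (\<forall>v\<in>CV. \<forall>w\<in>CW. h (A v) w \<oplus> h v (B w) = \<zero>)"
 by (simp add: S_pairs_def)

lemma h_zero_l [simp]: "w : CW ==> h \<zero>V w = \<zero>"
 and h_zero_r [simp]: "v : CV ==> h v \<zero>W = \<zero>"
 using h_smult_l[of \<zero> "\<zero>V" w] h_smult_r[of \<zero> v "\<zero>W"] by simp_all

lemma h_neg_l: "v : CV ==> w : CW ==> h (\<ominus>V v) w = \<ominus> h v w"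
 and h_neg_r: "v : CV ==> w : CW ==> h v (\<ominus>W w) = \<ominus> h v w"
 using h_smult_l[of "\<ominus> \<one>" v w] h_smult_r[of "\<ominus> \<one>" v w]
 by (simp_all add: V.smult_l_minus W.smult_l_minus V.R.l_minus)

lemma SP_adj:
 assumes "(A, B) \<in> SP" and v: "v : CV" and w: "w : CW"
 shows "h v (B w) = \<ominus> h (A v) w"
proof -
 have c: "h (A v) w : CK" "h v (B w) : CK"
  using assms lin_maps_closed[of A K V V v] lin_maps_closed[of B K W W w] by (auto simp: SP_iff)
 have "h (A v) w \<oplus> h v (B w) = \<zero>" using assms by (simp add: SP_iff)
 then have "h v (B w) \<oplus> h (A v) w = \<zero>" using c by (simp add: V.R.a_comm)
 then show ?thesis by (rule V.R.sum_zero_eq_neg[OF c(2,1)])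
qed

lemma SPI: "A : LV ==> B : LW ==>
  (!!v w. v : CV ==> w : CW ==> h v (B w) = \<ominus> h (A v) w) ==> (A, B) \<in> SP"
 by (auto simp: SP_iff V.R.r_neg lin_maps_closed)

lemma SP_zero: "(\<zero>EV, \<zero>EW) \<in> SP"
 by (rule SPI[OF V.End_closed(7) W.End_closed(7)]) (simp add: V.End_simps W.End_simps)

lemma SP_lin: "(A, B) \<in> SP ==> A : LV" "(A, B) \<in> SP ==> B : LW"
 by (simp_all add: SP_iff)

lemma SP_add:
 assumes A: "(A, B) \<in> SP" and A': "(A', B') \<in> SP"
 shows "(A \<oplus>EV A', B \<oplus>EW B') \<in> SP"
 by (rule SPI) (use SP_lin[OF A] SP_lin[OF A'] SP_lin[OF A, THEN lin_maps_closed] SP_lin[OF A', THEN lin_maps_closed]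
   in \<open>simp_all add: V.End_closed W.End_closed V.End_simps W.End_simps h_add_l h_add_r V.R.minus_add
    SP_adj[OF A] SP_adj[OF A']\<close>)

lemma SP_neg:
 assumes A: "(A, B) \<in> SP" shows "(\<ominus>EV A, \<ominus>EW B) \<in> SP"
 by (rule SPI) (use SP_lin[OF A] SP_lin[OF A, THEN lin_maps_closed]
   in \<open>simp_all add: V.End_closed W.End_closed V.End_neg W.End_neg h_neg_l h_neg_r SP_adj[OF A]\<close>)

lemma SP_minus: "(A, B) \<in> SP ==> (A', B') \<in> SP ==> (A \<ominus>EV A', B \<ominus>EW B') \<in> SP"
 unfolding V.End.A.minus_eq W.End.A.minus_eq by (intro SP_add SP_neg)

lemma SP_smult:
 assumes a: "a : CK" and A: "(A, B) \<in> SP" shows "(a \<odot>EV A, a \<odot>EW B) \<in> SP"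
 by (rule SPI) (use a SP_lin[OF A] SP_lin[OF A, THEN lin_maps_closed]
   in \<open>simp_all add: V.End_closed W.End_closed V.End_simps W.End_simps h_smult_l h_smult_r V.R.r_minus SP_adj[OF A]\<close>)

text \<open>The pair is \<open>- a h_M\<close>, with the sign in which it arises from brackets of
  degrees -2 and 2.\<close>

lemma SP_one: "a : CK ==> (a \<odot>EV \<one>EV, \<ominus>EW (a \<odot>EW \<one>EW)) \<in> SP"
 by (rule SPI) (auto simp: V.End_closed W.End_closed V.End_simps W.End_simps W.End_neg h_smult_l h_smult_r h_neg_r)

lemma SP_comm:
 assumes "(A, B) \<in> SP" "(A', B') \<in> SP"
 shows "(A \<otimes>EV A' \<ominus>EV A' \<otimes>EV A, B \<otimes>EW B' \<ominus>EW B' \<otimes>EW B) \<in> SP"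
proof (rule SPI)
 have l: "A : LV" "A' : LV" "B : LW" "B' : LW"
  using assms by (auto simp: SP_iff)
 note cl = l[THEN lin_maps_closed]
 show "A \<otimes>EV A' \<ominus>EV A' \<otimes>EV A : LV" "B \<otimes>EW B' \<ominus>EW B' \<otimes>EW B : LW"
  using l by (simp_all add: V.End_closed W.End_closed)
 fix v w assume "v : CV" "w : CW"
 then show "h v ((B \<otimes>EW B' \<ominus>EW B' \<otimes>EW B) w) = \<ominus> h ((A \<otimes>EV A' \<ominus>EV A' \<otimes>EV A) v) w"
  using l cl by (simp add: V.End_minus W.End_minus V.End_closed W.End_closed V.End_simps W.End_simps
    V.M.minus_eq W.M.minus_eq h_add_l h_add_r h_neg_l h_neg_r SP_adj[OF assms(1)] SP_adj[OF assms(2)] V.R.minus_add V.R.a_comm)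
qed

lemma SP_E: "a : pV 3 ==> x : pW 3 ==> (E' a x, \<ominus>EW E x a) \<in> SP"
 using E_lin[of a 2 x] s.E_lin[of x 2 a] E_closed[of a 2 x] s.E_closed[of x 2 a] E_adjoint[of a 2 x]
 by (intro SPI) (simp_all add: W.End_closed W.End_neg h_neg_r)

text \<open>The first component is minus the adjoint of the second. Equations in degree 0 can
  therefore be verified on \<open>W\<close> alone.\<close>

lemma SP_unique:
 assumes "(A, B) \<in> SP" "(A', B) \<in> SP" shows "A = A'"
proof (rule V.End_eqI)
 show l: "A : LV" "A' : LV" using assms by (auto simp: SP_iff)
 fix v assume v: "v : CV"
 show "A v = A' v"
 proof (rule s.nondeg)
  show "A v : CV" "A' v : CV" using l v by (auto intro: lin_maps_closed)
  fix w assume w: "w : CW"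
  have "\<ominus> h (A v) w = \<ominus> h (A' v) w" using SP_adj[OF assms(1) v w] SP_adj[OF assms(2) v w] by simp
  then show "h (A v) w = h (A' v) w" using l v w lin_maps_closed by (metis V.R.minus_minus h_closed)
 qed
qed

section \<open>The 5-graded module and its bracket\<close>

lemma L_iff: "X : CL \<longleftrightarrow> neg2 X : pV 6 \<and> neg1 X : pV 3 \<and>
   (endm X, endp X) \<in> SP \<and> hcoef X : CK \<and>
   pos1 X : pW 3 \<and> pos2 X : pW 6"
 by (simp add: tilde_E_def)

lemma L_simps:
 "mult L = br" "zero L = Z" "add L = tilde_add K V W" "smult L = tilde_smult K V W"
 by (simp_all add: tilde_E_def)

lemma L_fields:
 assumes "X : CL"
 shows "neg2 X : pV 6" "neg1 X : pV 3" "endm X : LV" "endp X : LW"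
  "hcoef X : CK" "pos1 X : pW 3" "pos2 X : pW 6"
  "neg2 X : XV" "neg1 X : XV" "pos1 X : XW" "pos2 X : XW"
  "(endm X, endp X) \<in> SP" "endm X : YV" "endp X : YW"
 using assms V.ext_pow_closed W.ext_pow_closed by (auto simp: L_iff SP_iff V.End_simps W.End_simps)

lemma lie_elem_eqI:
 fixes X Y :: "('a, 'c, 'e) lie_elem"
 assumes "neg2 X = neg2 Y" "neg1 X = neg1 Y" "endm X = endm Y" "endp X = endp Y" "hcoef X = hcoef Y"
  "pos1 X = pos1 Y" "pos2 X = pos2 Y"
 shows "X = Y"
 using assms by simp

lemma add_fields:
 "neg2 (X \<oplus>L Y) = neg2 X \<oplus>AV neg2 Y" "neg1 (X \<oplus>L Y) = neg1 X \<oplus>AV neg1 Y"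
 "endm (X \<oplus>L Y) = endm X \<oplus>EV endm Y" "endp (X \<oplus>L Y) = endp X \<oplus>EW endp Y"
 "hcoef (X \<oplus>L Y) = hcoef X \<oplus> hcoef Y"
 "pos1 (X \<oplus>L Y) = pos1 X \<oplus>AW pos1 Y" "pos2 (X \<oplus>L Y) = pos2 X \<oplus>AW pos2 Y"
 by (simp_all add: L_simps tilde_add_def)

lemma smult_fields:
 "neg2 (a \<odot>L Y) = a \<odot>AV neg2 Y" "neg1 (a \<odot>L Y) = a \<odot>AV neg1 Y"
 "endm (a \<odot>L Y) = a \<odot>EV endm Y" "endp (a \<odot>L Y) = a \<odot>EW endp Y"
 "hcoef (a \<odot>L Y) = a \<otimes> hcoef Y"
 "pos1 (a \<odot>L Y) = a \<odot>AW pos1 Y" "pos2 (a \<odot>L Y) = a \<odot>AW pos2 Y"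
 by (simp_all add: L_simps tilde_smult_def)

lemma zero_fields:
 "neg2 Z = \<zero>AV" "neg1 Z = \<zero>AV" "endm Z = \<zero>EV" "endp Z = \<zero>EW" "hcoef Z = \<zero>"
 "pos1 Z = \<zero>AW" "pos2 Z = \<zero>AW"
 by (simp_all add: tilde_zero_def)

lemma L_module: "module K L"
proof (rule moduleI[OF V.R.is_cring])
 show "abelian_group L"
 proof (rule abelian_groupI)
  fix X assume X: "X : CL"
  let ?Y = "\<lparr>neg2 = \<ominus>AV neg2 X, neg1 = \<ominus>AV neg1 X, endm = \<ominus>EV endm X, endp = \<ominus>EW endp X,
   hcoef = \<ominus> hcoef X, pos1 = \<ominus>AW pos1 X, pos2 = \<ominus>AW pos2 X\<rparr>"
  have "?Y : CL" using L_fields[OF X] by (simp add: L_iff SP_neg)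
  moreover have "?Y \<oplus>L X = \<zero>L"
   using L_fields[OF X] by (intro lie_elem_eqI)
    (simp_all add: add_fields L_simps(2) zero_fields V.A.A.l_neg W.A.A.l_neg V.R.l_neg V.End.A.l_neg W.End.A.l_neg)
  ultimately show "\<exists>Y\<in>CL. Y \<oplus>L X = \<zero>L" by blast
 next
  fix X Y assume "X : CL" "Y : CL"
  note f = L_fields[OF this(1)] L_fields[OF this(2)]
  show "X \<oplus>L Y : CL" using f by (simp add: L_iff add_fields SP_add)
  show "X \<oplus>L Y = Y \<oplus>L X"
   by (rule lie_elem_eqI) (use f in \<open>simp_all add: add_fields V.A.A.a_comm W.A.A.a_comm V.End.A.a_comm W.End.A.a_comm V.R.a_comm\<close>)
  fix U assume "U : CL"
  note g = L_fields[OF this]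
  show "X \<oplus>L Y \<oplus>L U = X \<oplus>L (Y \<oplus>L U)"
   by (rule lie_elem_eqI) (use f g in \<open>simp_all add: add_fields V.A.A.a_assoc W.A.A.a_assoc V.End.A.a_assoc W.End.A.a_assoc V.R.a_assoc\<close>)
 next
  show "\<zero>L \<in> CL" by (simp add: L_iff L_simps(2) zero_fields SP_zero)
  fix X assume "X : CL"
  note f = L_fields[OF this]
  show "\<zero>L \<oplus>L X = X"
   by (rule lie_elem_eqI) (use f in \<open>simp_all add: add_fields L_simps(2) zero_fields\<close>)
 qed
 fix a X assume a: "a : CK" and "X : CL"
 note f = L_fields[OF this(2)]
 show "a \<odot>L X : CL" using f a by (simp add: L_iff smult_fields SP_smult)
 fix r assume r: "r : CK"
 show "(a \<oplus> r) \<odot>L X = a \<odot>L X \<oplus>L r \<odot>L X"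
  by (rule lie_elem_eqI) (use f a r in \<open>simp_all add: smult_fields add_fields V.A.smult_l_distr W.A.smult_l_distr
   V.End.smult_l_distr W.End.smult_l_distr V.R.l_distr\<close>)
 show "(a \<otimes> r) \<odot>L X = a \<odot>L (r \<odot>L X)"
  by (rule lie_elem_eqI) (use f a r in \<open>simp_all add: smult_fields add_fields V.A.smult_assoc1 W.A.smult_assoc1
   V.End.smult_assoc1 W.End.smult_assoc1 V.R.m_assoc\<close>)
next
 fix X assume "X : CL"
 note f = L_fields[OF this]
 show "\<one> \<odot>L X = X" by (rule lie_elem_eqI) (use f in \<open>simp_all add: smult_fields\<close>)
next
 fix a X Y assume a: "a : CK" and "X : CL" "Y : CL"
 note f = L_fields[OF this(2)] L_fields[OF this(3)]
 show "a \<odot>L (X \<oplus>L Y) = a \<odot>L X \<oplus>L a \<odot>L Y"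
  by (rule lie_elem_eqI) (use f a in \<open>simp_all add: smult_fields add_fields V.A.smult_r_distr W.A.smult_r_distr
   V.End.smult_r_distr W.End.smult_r_distr V.R.r_distr\<close>)
qed

sublocale L: module K L
 by (rule L_module)

lemma int_scale [simp]: "a : CK ==> [(k::int)] \<cdot>\<^bsub>K\<^esub> a : CK"
 using V.R.add.int_pow_closed[of a k] by (simp add: add_pow_def)

lemma int_scale_ops:
 assumes "a : CK" "r : CK"
 shows "[(k::int)] \<cdot>\<^bsub>K\<^esub> (a \<oplus> r) = [k] \<cdot>\<^bsub>K\<^esub> a \<oplus> [k] \<cdot>\<^bsub>K\<^esub> r" "[k] \<cdot>\<^bsub>K\<^esub> (r \<otimes> a) = r \<otimes> [k] \<cdot>\<^bsub>K\<^esub> a"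
  "[k] \<cdot>\<^bsub>K\<^esub> (\<ominus> a) = \<ominus> ([k] \<cdot>\<^bsub>K\<^esub> a)" "[(- k)] \<cdot>\<^bsub>K\<^esub> a = \<ominus> ([k] \<cdot>\<^bsub>K\<^esub> a)" "[k] \<cdot>\<^bsub>K\<^esub> \<zero> = \<zero>"
  "[(1::int)] \<cdot>\<^bsub>K\<^esub> a = a" "[(2::int)] \<cdot>\<^bsub>K\<^esub> a = a \<oplus> a" "[(3::int)] \<cdot>\<^bsub>K\<^esub> a = a \<oplus> (a \<oplus> a)"
proof -
 show k0: "[(k::int)] \<cdot>\<^bsub>K\<^esub> \<zero> = \<zero>" for k
  using V.R.add.int_pow_one by (simp add: add_pow_def)
 show di: "[(k::int)] \<cdot>\<^bsub>K\<^esub> (a \<oplus> r) = [k] \<cdot>\<^bsub>K\<^esub> a \<oplus> [k] \<cdot>\<^bsub>K\<^esub> r" for k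
  using V.R.add.int_pow_distrib[of a r k] assms by (simp add: add_pow_def)
 show "[k] \<cdot>\<^bsub>K\<^esub> (r \<otimes> a) = r \<otimes> [k] \<cdot>\<^bsub>K\<^esub> a"
  using V.R.add_pow_rdistr_int[of r a k] assms by simp
 show n: "[k] \<cdot>\<^bsub>K\<^esub> (\<ominus> a) = \<ominus> ([k] \<cdot>\<^bsub>K\<^esub> a)"
  using V.R.add.int_pow_inv[of a k] assms by (simp add: add_pow_def a_inv_def)
 show "[(- k)] \<cdot>\<^bsub>K\<^esub> a = \<ominus> ([k] \<cdot>\<^bsub>K\<^esub> a)"
  using V.R.add.int_pow_neg[of a k] assms by (simp add: add_pow_def a_inv_def)
 show one: "[(1::int)] \<cdot>\<^bsub>K\<^esub> a = a"
  using V.R.add.int_pow_1[of a] assms by (simp add: add_pow_def)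
 have "[(1 + 1::int)] \<cdot>\<^bsub>K\<^esub> a = a \<oplus> a" "[(1 + (1 + 1)::int)] \<cdot>\<^bsub>K\<^esub> a = a \<oplus> (a \<oplus> a)"
  using V.R.add.int_pow_mult[of a 1 1] V.R.add.int_pow_mult[of a 1 "1 + 1"] one assms by (simp_all add: add_pow_def)
 then show "[(2::int)] \<cdot>\<^bsub>K\<^esub> a = a \<oplus> a" "[(3::int)] \<cdot>\<^bsub>K\<^esub> a = a \<oplus> (a \<oplus> a)" by simp_all
qed

lemma pr_closed [simp]: "a : XV ==> x : XW ==> pr a x : CK"
 by simp

lemma scalar3: "a : pV 3 ==> x : pW 3 ==> ext_to_scalar K W (cW a x) = pr a x"
 and scalar6: "a : pV 6 ==> x : pW 6 ==> ext_to_scalar K W (cW a x) = pr a x"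
 using cW_pow[of a 3 x 0] cW_pow[of a 6 x 0] by (auto simp: W.ext_to_scalar_eq)

lemma cW36: "a : pV 3 ==> x : pW 6 ==> cW a x : pW 3"
 and cV36: "x : pW 3 ==> a : pV 6 ==> cV x a : pV 3"
 using cW_pow[of a 3 x 3] s.cW_pow[of x 3 a 3] by simp_all

lemma mult33: "x : pW 3 ==> y : pW 3 ==> x \<otimes>AW y : pW 6"
 and mult33': "x' : pV 3 ==> y' : pV 3 ==> x' \<otimes>AV y' : pV 6"
 using W.pow_mult[of x 3 y 3] V.pow_mult[of x' 3 y' 3] by simp_all

lemma E3:
 assumes "a : pV 3" "x : pW 3"
 shows "E x a : LW" "E' a x : LV" "E x a : YW" "E' a x : YV"
  "y : pW 3 ==> E (x \<oplus>AW y) a = E x a \<oplus>EW E y a"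
  "y : pW 3 ==> E' a (x \<oplus>AW y) = E' a x \<oplus>EV E' a y"
  "a' : pV 3 ==> E x (a \<oplus>AV a') = E x a \<oplus>EW E x a'"
  "a' : pV 3 ==> E' (a \<oplus>AV a') x = E' a x \<oplus>EV E' a' x"
  "r : CK ==> E (r \<odot>AW x) a = r \<odot>EW E x a" "r : CK ==> E x (r \<odot>AV a) = r \<odot>EW E x a"
  "r : CK ==> E' a (r \<odot>AW x) = r \<odot>EV E' a x" "r : CK ==> E' (r \<odot>AV a) x = r \<odot>EV E' a x"
 using assms E_lin[of a 2 x] s.E_lin[of x 2 a] E_linear_l[of a 2 x] E_linear_r[of a 2 x]
  s.E_linear_l[of x 2 a] s.E_linear_r[of x 2 a] by (simp_all add: V.End_simps W.End_simps)

lemma E3_zero: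
 shows "a : pV 3 ==> E \<zero>AW a = \<zero>EW" "x : pW 3 ==> E x \<zero>AV = \<zero>EW"
  "a : pV 3 ==> E' a \<zero>AW = \<zero>EV" "x : pW 3 ==> E' \<zero>AV x = \<zero>EV"
 using E_zero_l[of a 2 "\<zero>AW"] E_zero_r[of "\<zero>AV" 2 x] s.E_zero_l[of x 2 "\<zero>AV"] s.E_zero_r[of "\<zero>AW" 2 a] by simp_all

text \<open>Action of a degree 0 element in degree -1. In degree -2, where \<open>h_0\<close> acts
  with twice the weight, it is called with \<open>a \<oplus> a\<close>. The counterpart
  \<open>aP\<close> for positive degrees has the opposite sign at \<open>a\<close>.\<close>

definition aM :: "('c => 'c) => 'a => ('a, 'c) ext => ('a, 'c) ext" where
 "aM A a x = V.D A x \<ominus>AV a \<odot>AV x"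

definition aP :: "('e => 'e) => 'a => ('a, 'e) ext => ('a, 'e) ext" where
 "aP A a x = W.D A x \<oplus>AW a \<odot>AW x"

lemma aM_rules:
 assumes A: "A : LV" and a: "a : CK"
 shows "x : XV ==> aM A a x : XV" "x : pV k ==> aM A a x : pV k"
  "x : XV ==> y : XV ==> aM A a (x \<oplus>AV y) = aM A a x \<oplus>AV aM A a y"
  "x : XV ==> r : CK ==> aM A a (r \<odot>AV x) = r \<odot>AV aM A a x"
  "x : XV ==> A' : LV ==> a' : CK ==>
   aM (A \<oplus>EV A') (a \<oplus> a') x = aM A a x \<oplus>AV aM A' a' x"
  "x : XV ==> r : CK ==> aM (r \<odot>EV A) (r \<otimes> a) x = r \<odot>AV aM A a x"
  "aM A a \<zero>AV = \<zero>AV" "x : XV ==> aM \<zero>EV \<zero> x = \<zero>AV"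
  "x : XV ==> aM A a (\<ominus>AV x) = \<ominus>AV aM A a x"
 using A a unfolding aM_def
 by (auto simp: V.D_pow V.D_linear V.D_End_add V.D_End_smult V.A.A.minus_eq V.A.smult_r_distr V.A.smult_l_distr
   V.A.A.minus_add V.A.A.a_ac V.A.smult_r_minus V.D_End_zero[OF _ V.End_closed(7) V.End_closed(7)] V.A.smult_assoc1)
  (simp_all add: V.R.m_comm flip: V.A.smult_assoc1)

lemma aP_rules:
 assumes A: "A : LW" and a: "a : CK"
 shows "x : XW ==> aP A a x : XW" "x : pW k ==> aP A a x : pW k"
  "x : XW ==> y : XW ==> aP A a (x \<oplus>AW y) = aP A a x \<oplus>AW aP A a y"
  "x : XW ==> r : CK ==> aP A a (r \<odot>AW x) = r \<odot>AW aP A a x"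
  "x : XW ==> A' : LW ==> a' : CK ==>
   aP (A \<oplus>EW A') (a \<oplus> a') x = aP A a x \<oplus>AW aP A' a' x"
  "x : XW ==> r : CK ==> aP (r \<odot>EW A) (r \<otimes> a) x = r \<odot>AW aP A a x"
  "aP A a \<zero>AW = \<zero>AW" "x : XW ==> aP \<zero>EW \<zero> x = \<zero>AW"
  "x : XW ==> aP A a (\<ominus>AW x) = \<ominus>AW aP A a x"
 using A a unfolding aP_def
 by (auto simp: W.D_pow W.D_linear W.D_End_add W.D_End_smult W.A.smult_r_distr W.A.smult_l_distr
   W.A.A.minus_add W.A.A.a_ac W.A.smult_r_minus W.D_End_zero[OF _ W.End_closed(7) W.End_closed(7)] W.A.smult_assoc1)
  (simp_all add: V.R.m_comm flip: W.A.smult_assoc1)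

text \<open>The bracket with integer multiples written as sums and scalars extracted by the
  augmentation. Computations with the bracket start from these formulas.\<close>

lemma br_fields:
 assumes "X : CL" "Y : CL"
 defines "cc \<equiv> pr (neg2 X) (pos2 Y) \<ominus> pr (neg2 Y) (pos2 X)"
 shows "neg2 (br X Y) = aM (endm X) (hcoef X \<oplus> hcoef X) (neg2 Y)
   \<ominus>AV aM (endm Y) (hcoef Y \<oplus> hcoef Y) (neg2 X) \<oplus>AV neg1 X \<otimes>AV neg1 Y"
  "neg1 (br X Y) = aM (endm X) (hcoef X) (neg1 Y) \<ominus>AV aM (endm Y) (hcoef Y) (neg1 X) \<oplus>AV cV (pos1 X) (neg2 Y) \<ominus>AV cV (pos1 Y) (neg2 X)"
  "endm (br X Y) = endm X \<otimes>EV endm Y \<ominus>EV endm Y \<otimes>EV endm X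
   \<oplus>EV E' (neg1 X) (pos1 Y) \<ominus>EV E' (neg1 Y) (pos1 X) \<oplus>EV cc \<odot>EV \<one>EV"
  "endp (br X Y) = endp X \<otimes>EW endp Y \<ominus>EW endp Y \<otimes>EW endp X
   \<ominus>EW E (pos1 Y) (neg1 X) \<oplus>EW E (pos1 X) (neg1 Y) \<ominus>EW cc \<odot>EW \<one>EW"
  "hcoef (br X Y) = pr (neg1 X) (pos1 Y) \<ominus> pr (neg1 Y) (pos1 X) \<oplus> (cc \<oplus> cc)"
  "pos1 (br X Y) = aP (endp X) (hcoef X) (pos1 Y) \<ominus>AW aP (endp Y) (hcoef Y) (pos1 X) \<oplus>AW cW (neg1 X) (pos2 Y) \<ominus>AW cW (neg1 Y) (pos2 X)"
  "pos2 (br X Y) = aP (endp X) (hcoef X \<oplus> hcoef X) (pos2 Y)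
   \<ominus>AW aP (endp Y) (hcoef Y \<oplus> hcoef Y) (pos2 X) \<oplus>AW pos1 X \<otimes>AW pos1 Y"
proof -
 note f = L_fields[OF assms(1)] L_fields[OF assms(2)]
 have cc: "cc : CK" using f by (simp add: cc_def)
 have cc2: "[(2::int)] \<cdot>\<^bsub>K\<^esub> cc = cc \<oplus> cc" by (rule int_scale_ops(7)[OF cc cc])
 note sc = scalar6[OF f(1) f(21)] scalar6[OF f(15) f(7)] scalar3[OF f(2) f(20)] scalar3[OF f(16) f(6)]
 have h: "[(- 2::int)] \<cdot>\<^bsub>K\<^esub> r = \<ominus> (r \<oplus> r)" "[(- 1::int)] \<cdot>\<^bsub>K\<^esub> r = \<ominus> r" "[(2::int)] \<cdot>\<^bsub>K\<^esub> r = r \<oplus> r" "[(1::int)] \<cdot>\<^bsub>K\<^esub> r = r"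
  if "r : CK" for r using int_scale_ops[OF that that] int_scale_ops(4)[OF that that, of 2] int_scale_ops(4)[OF that that, of 1] by simp_all
 note hx = h[OF f(5)] h[OF f(19)]
 show "neg2 (br X Y) = aM (endm X) (hcoef X \<oplus> hcoef X) (neg2 Y)
   \<ominus>AV aM (endm Y) (hcoef Y \<oplus> hcoef Y) (neg2 X) \<oplus>AV neg1 X \<otimes>AV neg1 Y"
  "neg1 (br X Y) = aM (endm X) (hcoef X) (neg1 Y) \<ominus>AV aM (endm Y) (hcoef Y) (neg1 X) \<oplus>AV cV (pos1 X) (neg2 Y) \<ominus>AV cV (pos1 Y) (neg2 X)"
  using f by (simp_all add: tilde_bracket_def Let_def act_minus_def aM_def hx V.A.smult_l_minus V.A.A.minus_eq)
 show "pos1 (br X Y) = aP (endp X) (hcoef X) (pos1 Y) \<ominus>AW aP (endp Y) (hcoef Y) (pos1 X) \<oplus>AW cW (neg1 X) (pos2 Y) \<ominus>AW cW (neg1 Y) (pos2 X)"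
  "pos2 (br X Y) = aP (endp X) (hcoef X \<oplus> hcoef X) (pos2 Y)
   \<ominus>AW aP (endp Y) (hcoef Y \<oplus> hcoef Y) (pos2 X) \<oplus>AW pos1 X \<otimes>AW pos1 Y"
  by (simp_all add: tilde_bracket_def Let_def act_plus_def aP_def hx)
 show "endm (br X Y) = endm X \<otimes>EV endm Y \<ominus>EV endm Y \<otimes>EV endm X
   \<oplus>EV E' (neg1 X) (pos1 Y) \<ominus>EV E' (neg1 Y) (pos1 X) \<oplus>EV cc \<odot>EV \<one>EV"
  "endp (br X Y) = endp X \<otimes>EW endp Y \<ominus>EW endp Y \<otimes>EW endp X
   \<ominus>EW E (pos1 Y) (neg1 X) \<oplus>EW E (pos1 X) (neg1 Y) \<ominus>EW cc \<odot>EW \<one>EW"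
  "hcoef (br X Y) = pr (neg1 X) (pos1 Y) \<ominus> pr (neg1 Y) (pos1 X) \<oplus> (cc \<oplus> cc)"
  unfolding cc2[symmetric] by (simp_all add: tilde_bracket_def Let_def sc cc_def)
qed

lemma br_closed:
 assumes "X : CL" "Y : CL" shows "br X Y : CL"
proof -
 note f = L_fields[OF assms(1)] L_fields[OF assms(2)]
 let ?c = "pr (neg2 X) (pos2 Y) \<ominus> pr (neg2 Y) (pos2 X)"
 have c: "?c : CK" using f by simp
 have "(endm X \<otimes>EV endm Y \<ominus>EV endm Y \<otimes>EV endm X
   \<oplus>EV E' (neg1 X) (pos1 Y) \<ominus>EV E' (neg1 Y) (pos1 X) \<oplus>EV ?c \<odot>EV \<one>EV,
  endp X \<otimes>EW endp Y \<ominus>EW endp Y \<otimes>EW endp X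
   \<oplus>EW (\<ominus>EW E (pos1 Y) (neg1 X)) \<ominus>EW (\<ominus>EW E (pos1 X) (neg1 Y)) \<oplus>EW (\<ominus>EW (?c \<odot>EW \<one>EW))) \<in> SP"
  using f c by (intro SP_add SP_minus SP_one SP_comm SP_E) auto
 then have "(endm (br X Y), endp (br X Y)) \<in> SP"
  unfolding br_fields[OF assms] using f E3[OF f(16) f(6)] by (simp add: W.End.A.minus_eq)
 with f c show ?thesis
  unfolding L_iff br_fields[OF assms]
  by (simp add: aM_rules aP_rules mult33 mult33' cW36 cV36)
qed

lemma br_add_l:
 assumes "X : CL" "X' : CL" "Y : CL"
 shows "br (X \<oplus>L X') Y = br X Y \<oplus>L br X' Y"
proof -
 note f = L_fields[OF assms(1)] L_fields[OF assms(2)] L_fields[OF assms(3)]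
 have XX: "X \<oplus>L X' : CL" using assms by simp
 note e = E3[OF f(2) f(34)] E3[OF f(16) f(34)] E3[OF f(30) f(6)] E3[OF f(30) f(20)]
 define H H' HY where "H = hcoef X \<oplus> hcoef X" and "H' = hcoef X' \<oplus> hcoef X'" and "HY = hcoef Y \<oplus> hcoef Y"
 have Hc: "H : CK" "H' : CK" "HY : CK" using f by (simp_all add: H_def H'_def HY_def)
 have "(hcoef X \<oplus> hcoef X') \<oplus> (hcoef X \<oplus> hcoef X') = H \<oplus> H'"
  using f by (simp add: V.R.a_ac H_def H'_def)
 note hh = this H_def[symmetric] H'_def[symmetric] HY_def[symmetric]
 have cc: "pr (neg2 X \<oplus>AV neg2 X') (pos2 Y) \<ominus> pr (neg2 Y) (pos2 X \<oplus>AW pos2 X') =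
   (pr (neg2 X) (pos2 Y) \<ominus> pr (neg2 Y) (pos2 X)) \<oplus> (pr (neg2 X') (pos2 Y) \<ominus> pr (neg2 Y) (pos2 X'))"
  using f by (simp add: cW_linear_l cW_linear_r V.R.minus_eq V.R.minus_add V.R.a_ac)
 define c c' where "c = pr (neg2 X) (pos2 Y) \<ominus> pr (neg2 Y) (pos2 X)"
  and "c' = pr (neg2 X') (pos2 Y) \<ominus> pr (neg2 Y) (pos2 X')"
 have cK: "c : CK" "c' : CK" "c \<odot>EV \<one>EV \<in> YV" "c' \<odot>EV \<one>EV \<in> YV"
  "c \<odot>EW \<one>EW \<in> YW" "c' \<odot>EW \<one>EW \<in> YW" using f by (simp_all add: c_def c'_def)
 have c2: "(c \<oplus> c') \<oplus> (c \<oplus> c') = (c \<oplus> c) \<oplus> (c' \<oplus> c')" using cK by (simp add: V.R.a_ac)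
 note cs = cc c_def[symmetric] c'_def[symmetric] c2
 show ?thesis
  by (rule lie_elem_eqI; unfold add_fields br_fields[OF XX assms(3)] br_fields[OF assms(1,3)] br_fields[OF assms(2,3)] hh cs)
   (use f e cK Hc in \<open>simp_all add: aM_rules aP_rules V.A.A.l_distr W.A.A.l_distr V.A.A.r_distr W.A.A.r_distr
    cW_linear_l cW_linear_r s.cW_linear_l s.cW_linear_r V.End.A.l_distr V.End.A.r_distr W.End.A.l_distr W.End.A.r_distr
    V.End.smult_l_distr W.End.smult_l_distr V.A.A.regroup3 W.A.A.regroup3 V.A.A.regroup4 W.A.A.regroup4
    V.End.A.regroup5 W.End.A.regroup5 V.R.regroup3\<close>)
qed

lemma br_smult_l:
 assumes a: "a : CK" and "X : CL" "Y : CL"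
 shows "br (a \<odot>L X) Y = a \<odot>L br X Y"
proof -
 note f = L_fields[OF assms(2)] L_fields[OF assms(3)]
 have XX: "a \<odot>L X : CL" using assms by simp
 note e = E3[OF f(2) f(20)] E3[OF f(16) f(6)]
 define H HY where "H = hcoef X \<oplus> hcoef X" and "HY = hcoef Y \<oplus> hcoef Y"
 have Hc: "H : CK" "HY : CK" using f by (simp_all add: H_def HY_def)
 have "(a \<otimes> hcoef X) \<oplus> (a \<otimes> hcoef X) = a \<otimes> H"
  using f a by (simp add: V.R.r_distr H_def)
 note hh = this H_def[symmetric] HY_def[symmetric]
 have cc: "pr (a \<odot>AV neg2 X) (pos2 Y) \<ominus> pr (neg2 Y) (a \<odot>AW pos2 X) = a \<otimes> (pr (neg2 X) (pos2 Y) \<ominus> pr (neg2 Y) (pos2 X))"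
  using f a by (simp add: cW_linear_l cW_linear_r V.R.minus_eq V.R.r_distr V.R.r_minus)
 define c where "c = pr (neg2 X) (pos2 Y) \<ominus> pr (neg2 Y) (pos2 X)"
 have cK: "c : CK" "c \<odot>EV \<one>EV \<in> YV" "c \<odot>EW \<one>EW \<in> YW" using f by (simp_all add: c_def)
 note cs = cc c_def[symmetric]
 show ?thesis
  by (rule lie_elem_eqI; unfold smult_fields br_fields[OF XX assms(3)] br_fields[OF assms(2,3)] hh cs)
   (use f e a cK Hc in \<open>simp_all add: aM_rules aP_rules V.A.smult_mult_l W.A.smult_mult_l cW_linear_l cW_linear_r
    s.cW_linear_l s.cW_linear_r V.End.smult_mult_l W.End.smult_mult_l V.End.smult_mult_r W.End.smult_mult_r
    V.A.A.minus_eq W.A.A.minus_eq V.End.A.minus_eq W.End.A.minus_eq V.R.minus_eq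
    V.A.smult_r_distr W.A.smult_r_distr V.End.smult_r_distr W.End.smult_r_distr V.R.r_distr
    V.A.smult_r_minus W.A.smult_r_minus V.End.smult_r_minus W.End.smult_r_minus V.R.r_minus
    V.End.smult_assoc1 W.End.smult_assoc1\<close>)
qed

text \<open>Skew-symmetry would not give this when 2 is a zero divisor. The products of
  \<open>neg1 X\<close> and of \<open>pos1 X\<close> with themselves vanish because 3 is
  odd.\<close>

lemma br_alternating:
 assumes "X : CL" shows "br X X = Z"
proof -
 note f = L_fields[OF assms]
 note e = E3[OF f(2) f(6)]
 show ?thesis
  by (rule lie_elem_eqI; unfold zero_fields br_fields[OF assms assms])
   (use f e V.pow_odd_square[OF f(2)] W.pow_odd_square[OF f(6)] in \<open>simp_all add: aM_rules aP_rules V.A.A.minus_eq W.A.A.minus_eq V.A.A.r_neg W.A.A.r_neg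
    V.End.A.minus_eq W.End.A.minus_eq V.End.A.r_neg W.End.A.r_neg W.End.A.l_neg V.R.minus_eq V.R.r_neg\<close>)
qed

end

context abelian_group
begin

lemma neg_regroup:
 "p \<in> carrier G ==> q \<in> carrier G ==> r \<in> carrier G ==> \<ominus> (p \<ominus> q \<oplus> r) = q \<ominus> p \<oplus> (\<ominus> r)"
 "p \<in> carrier G ==> q \<in> carrier G ==> r \<in> carrier G ==> s \<in> carrier G ==>
  \<ominus> (p \<ominus> q \<oplus> r \<ominus> s) = q \<ominus> p \<oplus> s \<ominus> r"
 "p \<in> carrier G ==> q \<in> carrier G ==> r \<in> carrier G ==> s \<in> carrier G ==> t \<in> carrier G ==>
  \<ominus> (p \<ominus> q \<oplus> r \<ominus> s \<oplus> t) = q \<ominus> p \<oplus> s \<ominus> r \<oplus> (\<ominus> t)"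
 "p \<in> carrier G ==> q \<in> carrier G ==> r \<in> carrier G ==> s \<in> carrier G ==> t \<in> carrier G ==>
  \<ominus> (p \<ominus> q \<ominus> r \<oplus> s \<ominus> t) = q \<ominus> p \<ominus> s \<oplus> r \<ominus> (\<ominus> t)"
 by (simp_all add: minus_eq minus_add a_ac)

end

context lie
begin

lemma neg_fields:
 assumes "X : CL"
 shows "neg2 (\<ominus>L X) = \<ominus>AV neg2 X" "neg1 (\<ominus>L X) = \<ominus>AV neg1 X"
 "endm (\<ominus>L X) = \<ominus>EV endm X" "endp (\<ominus>L X) = \<ominus>EW endp X" "hcoef (\<ominus>L X) = \<ominus> hcoef X"
 "pos1 (\<ominus>L X) = \<ominus>AW pos1 X" "pos2 (\<ominus>L X) = \<ominus>AW pos2 X"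
proof -
 note f = L_fields[OF assms]
 have m: "\<ominus>L X = (\<ominus> \<one>) \<odot>L X" using assms by (simp add: L.smult_l_minus)
 show "neg2 (\<ominus>L X) = \<ominus>AV neg2 X" "neg1 (\<ominus>L X) = \<ominus>AV neg1 X"
 "endm (\<ominus>L X) = \<ominus>EV endm X" "endp (\<ominus>L X) = \<ominus>EW endp X" "hcoef (\<ominus>L X) = \<ominus> hcoef X"
 "pos1 (\<ominus>L X) = \<ominus>AW pos1 X" "pos2 (\<ominus>L X) = \<ominus>AW pos2 X"
  unfolding m smult_fields using f
  by (simp_all add: V.A.smult_l_minus W.A.smult_l_minus V.End.smult_l_minus W.End.smult_l_minus V.R.l_minus)
qed

text \<open>Linearity in the second argument and the permutations of arguments in the Jacobi
  identity are both derived from this.\<close>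

lemma br_skew:
 assumes "X : CL" "Y : CL"
 shows "br Y X = \<ominus>L br X Y"
proof -
 note f = L_fields[OF assms(1)] L_fields[OF assms(2)]
 note e = E3[OF f(2) f(20)] E3[OF f(16) f(6)]
 have r: "neg1 Y \<otimes>AV neg1 X = \<ominus>AV (neg1 X \<otimes>AV neg1 Y)" "pos1 Y \<otimes>AW pos1 X = \<ominus>AW (pos1 X \<otimes>AW pos1 Y)"
  using V.pow_commute[OF f(16) f(2)] W.pow_commute[OF f(20) f(6)] by simp_all
 define c where "c = pr (neg2 X) (pos2 Y) \<ominus> pr (neg2 Y) (pos2 X)"
 have c: "pr (neg2 Y) (pos2 X) \<ominus> pr (neg2 X) (pos2 Y) = \<ominus> c" and cc: "c : CK"
  using f by (simp_all add: c_def V.R.minus_eq V.R.minus_add V.R.a_ac)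
 have c2: "\<ominus> c \<oplus> \<ominus> c = \<ominus> (c \<oplus> c)" using cc by (simp add: V.R.minus_add)
 define H HY where "H = hcoef X \<oplus> hcoef X" and "HY = hcoef Y \<oplus> hcoef Y"
 have Hc: "H : CK" "HY : CK" using f by (simp_all add: H_def HY_def)
 show ?thesis
  by (rule lie_elem_eqI; unfold neg_fields[OF br_closed[OF assms]] br_fields[OF assms(2,1)] br_fields[OF assms] r c c_def[symmetric] c2
    H_def[symmetric] HY_def[symmetric])
   (use f e cc Hc in \<open>simp_all add: aM_rules aP_rules V.A.A.neg_regroup(1,2) W.A.A.neg_regroup(1,2) V.End.A.neg_regroup(3)
    W.End.A.neg_regroup(4) V.R.neg_regroup(1) V.End.smult_l_minus W.End.smult_l_minus\<close>)
qed

lemma br_add_r: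
 assumes "X : CL" "X' : CL" "Y : CL"
 shows "br Y (X \<oplus>L X') = br Y X \<oplus>L br Y X'"
 using assms by (simp add: br_skew[of _ Y] br_add_l br_closed L.minus_add)

lemma br_smult_r:
 assumes "a : CK" "X : CL" "Y : CL"
 shows "br Y (a \<odot>L X) = a \<odot>L br Y X"
 using assms by (simp add: br_skew[of _ Y] br_smult_l br_closed L.smult_r_minus)

section \<open>Homogeneous elements and their multiplication table\<close>

abbreviation "N2 x \<equiv> Z\<lparr>neg2 := x\<rparr>"
abbreviation "N1 x \<equiv> Z\<lparr>neg1 := x\<rparr>"
abbreviation "Z0 A B a \<equiv> Z\<lparr>endm := A, endp := B, hcoef := a\<rparr>"
abbreviation "P1 x \<equiv> Z\<lparr>pos1 := x\<rparr>"
abbreviation "P2 x \<equiv> Z\<lparr>pos2 := x\<rparr>"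

lemma hom_closed:
 "x : pV 6 ==> N2 x : CL" "x : pV 3 ==> N1 x : CL"
 "(A, B) \<in> SP ==> a : CK ==> Z0 A B a : CL"
 "y : pW 3 ==> P1 y : CL" "y : pW 6 ==> P2 y : CL"
 by (simp_all add: L_iff zero_fields SP_zero)

lemma hom_decomp:
 assumes "X : CL"
 shows "X = N2 (neg2 X) \<oplus>L (N1 (neg1 X) \<oplus>L (Z0 (endm X) (endp X) (hcoef X) \<oplus>L (P1 (pos1 X) \<oplus>L P2 (pos2 X))))"
 by (rule lie_elem_eqI) (use L_fields[OF assms] in \<open>simp_all add: add_fields zero_fields\<close>)

lemma hom_add:
 "x : pV 6 ==> x' : pV 6 ==> N2 x \<oplus>L N2 x' = N2 (x \<oplus>AV x')"
 "x : pV 3 ==> x' : pV 3 ==> N1 x \<oplus>L N1 x' = N1 (x \<oplus>AV x')"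
 "Z0 A B a \<oplus>L Z0 A' B' a' = Z0 (A \<oplus>EV A') (B \<oplus>EW B') (a \<oplus> a')"
 "y : pW 3 ==> y' : pW 3 ==> P1 y \<oplus>L P1 y' = P1 (y \<oplus>AW y')"
 "y : pW 6 ==> y' : pW 6 ==> P2 y \<oplus>L P2 y' = P2 (y \<oplus>AW y')"
 by (rule lie_elem_eqI; simp add: add_fields zero_fields W.ext_pow_closed V.ext_pow_closed)+

lemmas SP_fields = SP_lin V.End_simps(1) W.End_simps(1)

lemma br_hom:
 assumes u: "u : pV 6" "u' : pV 6" and m: "m : pV 3" "m' : pV 3"
  and S: "(A, B) \<in> SP" "a : CK" "(A', B') \<in> SP" "a' : CK"
  and p: "p : pW 3" "p' : pW 3" and q: "q : pW 6" "q' : pW 6"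
 shows "br (N2 u) (N2 u') = Z" "br (N2 u) (N1 m) = Z" "br (N1 m) (N2 u) = Z"
  "br (N1 m) (N1 m') = N2 (m \<otimes>AV m')"
  "br (P2 q) (P2 q') = Z" "br (P2 q) (P1 p) = Z" "br (P1 p) (P2 q) = Z"
  "br (P1 p) (P1 p') = P2 (p \<otimes>AW p')"
  "br (Z0 A B a) (N2 u) = N2 (aM A (a \<oplus> a) u)" "br (N2 u) (Z0 A B a) = N2 (\<ominus>AV aM A (a \<oplus> a) u)"
  "br (Z0 A B a) (N1 m) = N1 (aM A a m)" "br (N1 m) (Z0 A B a) = N1 (\<ominus>AV aM A a m)"
  "br (Z0 A B a) (P2 q) = P2 (aP B (a \<oplus> a) q)" "br (P2 q) (Z0 A B a) = P2 (\<ominus>AW aP B (a \<oplus> a) q)"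
  "br (Z0 A B a) (P1 p) = P1 (aP B a p)" "br (P1 p) (Z0 A B a) = P1 (\<ominus>AW aP B a p)"
  "br (Z0 A B a) (Z0 A' B' a') = Z0 (A \<otimes>EV A' \<ominus>EV A' \<otimes>EV A) (B \<otimes>EW B' \<ominus>EW B' \<otimes>EW B) \<zero>"
  "br (N1 m) (P1 p) = Z0 (E' m p) (\<ominus>EW E p m) (pr m p)"
  "br (P1 p) (N1 m) = Z0 (\<ominus>EV E' m p) (E p m) (\<ominus> pr m p)"
  "br (N1 m) (P2 q) = P1 (cW m q)" "br (P2 q) (N1 m) = P1 (\<ominus>AW cW m q)"
  "br (P1 p) (N2 u) = N1 (cV p u)" "br (N2 u) (P1 p) = N1 (\<ominus>AV cV p u)"
  "br (N2 u) (P2 q) = Z0 (pr u q \<odot>EV \<one>EV) (\<ominus>EW (pr u q \<odot>EW \<one>EW)) (pr u q \<oplus> pr u q)"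
  "br (P2 q) (N2 u) = Z0 (\<ominus>EV (pr u q \<odot>EV \<one>EV)) (pr u q \<odot>EW \<one>EW) (\<ominus> (pr u q \<oplus> pr u q))"
proof -
 note cl = hom_closed(1)[OF u(1)] hom_closed(1)[OF u(2)] hom_closed(2)[OF m(1)] hom_closed(2)[OF m(2)]
  hom_closed(3)[OF S(1,2)] hom_closed(3)[OF S(3,4)] hom_closed(4)[OF p(1)] hom_closed(4)[OF p(2)]
  hom_closed(5)[OF q(1)] hom_closed(5)[OF q(2)]
 note c = V.ext_pow_closed[OF u(1)] V.ext_pow_closed[OF u(2)] V.ext_pow_closed[OF m(1)] V.ext_pow_closed[OF m(2)]
  W.ext_pow_closed[OF p(1)] W.ext_pow_closed[OF p(2)] W.ext_pow_closed[OF q(1)] W.ext_pow_closed[OF q(2)]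
  SP_lin[OF S(1)] SP_lin[OF S(3)] V.End_closed(7) W.End_closed(7) V.End.A.zero_closed W.End.A.zero_closed
 have c': "A : YV" "B : YW" "A' : YV" "B' : YW"
  using c by (simp_all add: V.End_simps W.End_simps)
 note e = E3(3,4)[OF m(1) p(1)]
 note z0 = V.ext_pow_ops(1)[of 3] W.ext_pow_ops(1)[of 3]
 note sims = zero_fields aM_rules aP_rules cW_linear_l(3) cW_linear_r(3) s.cW_linear_l(3) s.cW_linear_r(3)
  E3_zero V.A.A.minus_eq W.A.A.minus_eq V.End.A.minus_eq W.End.A.minus_eq V.R.minus_eq V.R.minus_add
  V.End.smult_l_minus W.End.smult_l_minus
 have lm: "aM A b x : XV" "aM A' b x : XV" if "x : XV" "b : CK" for b x
  using that c by (simp_all add: aM_rules)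
 show "br (N2 u) (N2 u') = Z" "br (N2 u) (N1 m) = Z" "br (N1 m) (N2 u) = Z"
  "br (N1 m) (N1 m') = N2 (m \<otimes>AV m')"
  "br (P2 q) (P2 q') = Z" "br (P2 q) (P1 p) = Z" "br (P1 p) (P2 q) = Z"
  "br (P1 p) (P1 p') = P2 (p \<otimes>AW p')"
  by (rule lie_elem_eqI; simp only: br_fields cl; use S m u p q c c' z0 in \<open>simp add: sims\<close>)+
 show "br (Z0 A B a) (N2 u) = N2 (aM A (a \<oplus> a) u)" "br (N2 u) (Z0 A B a) = N2 (\<ominus>AV aM A (a \<oplus> a) u)"
  "br (Z0 A B a) (N1 m) = N1 (aM A a m)" "br (N1 m) (Z0 A B a) = N1 (\<ominus>AV aM A a m)"
  "br (Z0 A B a) (P2 q) = P2 (aP B (a \<oplus> a) q)" "br (P2 q) (Z0 A B a) = P2 (\<ominus>AW aP B (a \<oplus> a) q)"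
  "br (Z0 A B a) (P1 p) = P1 (aP B a p)" "br (P1 p) (Z0 A B a) = P1 (\<ominus>AW aP B a p)"
  "br (Z0 A B a) (Z0 A' B' a') = Z0 (A \<otimes>EV A' \<ominus>EV A' \<otimes>EV A) (B \<otimes>EW B' \<ominus>EW B' \<otimes>EW B) \<zero>"
  by (rule lie_elem_eqI; simp only: br_fields cl; use S m u p q c c' z0 in \<open>simp add: sims\<close>)+
 show "br (N1 m) (P1 p) = Z0 (E' m p) (\<ominus>EW E p m) (pr m p)"
  "br (P1 p) (N1 m) = Z0 (\<ominus>EV E' m p) (E p m) (\<ominus> pr m p)"
  "br (N1 m) (P2 q) = P1 (cW m q)" "br (P2 q) (N1 m) = P1 (\<ominus>AW cW m q)"
  "br (P1 p) (N2 u) = N1 (cV p u)" "br (N2 u) (P1 p) = N1 (\<ominus>AV cV p u)"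
  "br (N2 u) (P2 q) = Z0 (pr u q \<odot>EV \<one>EV) (\<ominus>EW (pr u q \<odot>EW \<one>EW)) (pr u q \<oplus> pr u q)"
  "br (P2 q) (N2 u) = Z0 (\<ominus>EV (pr u q \<odot>EV \<one>EV)) (pr u q \<odot>EW \<one>EW) (\<ominus> (pr u q \<oplus> pr u q))"
  by (rule lie_elem_eqI; simp only: br_fields cl; use S m u p q c c' e z0 in \<open>simp add: sims\<close>)+
qed

end

context abelian_group
begin

lemma minus_plus_cancel:
 "p \<in> carrier G ==> q \<in> carrier G ==> r \<in> carrier G ==> (p \<ominus> q) \<oplus> (q \<oplus> r) = p \<oplus> r"
 by (simp add: minus_eq a_assoc r_neg1)

end

section \<open>Identities that carry the individual cases of the Jacobi identity\<close>

context lie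
begin

lemma top_gen_W: "q : pW 6 ==> w : CW ==> gW w \<otimes>AW q = \<zero>AW"
 and top_gen_V: "u : pV 6 ==> v : CV ==> gV v \<otimes>AV u = \<zero>AV"
 using W.gen_mult_pow[of q 6 w] V.gen_mult_pow[of u 6 v] top_W top_V by simp_all

lemma aP_comm:
 assumes l: "B : LW" "B' : LW" "a : CK" "a' : CK" and x: "x : XW"
 shows "aP B a (aP B' a' x) = aP (B \<otimes>EW B' \<ominus>EW B' \<otimes>EW B) \<zero> x \<oplus>AW aP B' a' (aP B a x)"
proof -
 let ?P = "W.D B (W.D B' x)" and ?Q = "W.D B' (W.D B x)" and ?R = "a' \<odot>AW W.D B x \<oplus>AW (a \<odot>AW W.D B' x \<oplus>AW (a \<otimes> a') \<odot>AW x)"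
 have c: "?P : XW" "?Q : XW" "?R : XW" using l x by simp_all
 have 1: "aP B a (aP B' a' x) = ?P \<oplus>AW ?R"
  using l x by (simp add: aP_def W.D_linear W.A.smult_r_distr W.A.smult_assoc1 W.A.A.a_ac)
 have "a' \<odot>AW (a \<odot>AW x) = (a \<otimes> a') \<odot>AW x" using l x by (simp add: V.R.m_comm flip: W.A.smult_assoc1)
 then have 2: "aP B' a' (aP B a x) = ?Q \<oplus>AW ?R"
  using l x by (simp add: aP_def W.D_linear W.A.smult_r_distr W.A.A.a_ac)
 have 3: "aP (B \<otimes>EW B' \<ominus>EW B' \<otimes>EW B) \<zero> x = ?P \<ominus>AW ?Q"
  using l x by (simp add: aP_def W.D_End_comm)
 show ?thesis unfolding 1 2 3 using c by (simp add: W.A.A.minus_plus_cancel)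
qed

text \<open>Each factor of degree 3 contributes \<open>a\<close>, which is why the product is acted
  on with \<open>a \<oplus> a\<close>.\<close>

lemma aP_mult:
 assumes l: "B : LW" "a : CK" and x: "x : XW" "y : XW"
 shows "aP B (a \<oplus> a) (x \<otimes>AW y) = aP B a x \<otimes>AW y \<oplus>AW x \<otimes>AW aP B a y"
 using assms by (simp add: aP_def W.ext_deriv_mult W.A.smult_l_distr W.A.A.l_distr W.A.A.r_distr W.A.smult_mult_l W.A.smult_mult_r W.A.A.a_ac)

lemma SP_adj0: "(A, B) \<in> SP ==> v : CV ==> w : CW ==> h (A v) w \<oplus> h v (B w) = \<zero>"
 by (simp add: SP_iff)

text \<open>For degrees 1, -1 and 2 the multiples of \<open>a\<close> balance as
  \<open>1 = - 1 + 2\<close>.\<close>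

lemma aP_contract:
 assumes S: "(A, B) \<in> SP" "a : CK" and x: "x : XW" "y : XV"
 shows "aP B a (cW y x) = cW (aM A a y) x \<oplus>AW cW y (aP B (a \<oplus> a) x)"
proof -
 note l = SP_lin[OF S(1)]
 have "W.D B (cW y x) = cW (V.D A y) x \<oplus>AW cW y (W.D B x)"
  using deriv_contract[OF x(2,1) l] SP_adj0[OF S(1)] by simp
 then show ?thesis using l S x
  by (simp add: aP_def aM_def cW_linear_l cW_linear_r W.A.smult_l_distr V.A.A.minus_eq W.A.A.a_ac W.A.A.r_neg1 W.A.A.r_neg2 W.A.A.r_neg)
qed

text \<open>A derivation kills degree 0, so the pairing is invariant under S; the two contributions
  of \<open>a\<close> cancel.\<close>

lemma pr_act:
 assumes S: "(A, B) \<in> SP" "a : CK" and x: "x : pW k" "y : pV k"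
 shows "pr (aM A a y) x \<oplus> pr y (aP B a x) = \<zero>"
proof -
 note l = SP_lin[OF S(1)] and xy = W.ext_pow_closed[OF x(1)] V.ext_pow_closed[OF x(2)]
 have c: "cW y x : pW 0" using cW_pow[of y k x 0] x by simp
 have "W.D B (cW y x) = cW (V.D A y) x \<oplus>AW cW y (W.D B x)"
  using deriv_contract[OF xy(2,1) l] SP_adj0[OF S(1)] by simp
 moreover have "W.D B (cW y x) = \<zero>AW"
 proof -
  obtain t where "t : CK" "cW y x = t \<odot>AW \<one>AW"
   using W.ext_pow_0[OF c] xy cW_closed W.counit_simps(1) by blast
  then show ?thesis using W.D_linear[OF l(2)] by simp
 qed
 ultimately have "pr (V.D A y) x \<oplus> pr y (W.D B x) = \<zero>"
  using l xy W.counit_simps by (metis W.D_closed V.D_closed cW_closed)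
 moreover have "pr (aM A a y) x \<oplus> pr y (aP B a x) = pr (V.D A y) x \<ominus> a \<otimes> pr y x \<oplus> (a \<otimes> pr y x \<oplus> pr y (W.D B x))"
  using l S xy by (simp add: aP_def aM_def cW_linear_l cW_linear_r V.A.A.minus_eq V.R.minus_eq V.R.a_comm)
 ultimately show ?thesis using l S xy by (simp add: V.R.minus_plus_cancel)
qed

lemma E_act:
 assumes S: "(A, B) \<in> SP" "a : CK" and x: "x : pW 3" "y : pV 3"
 shows "B \<otimes>EW E x y \<ominus>EW E x y \<otimes>EW B = E (aP B a x) y \<oplus>EW E x (aM A a y)"
proof -
 note l = SP_lin[OF S(1)] and e = E3[OF x(2,1)]
 have dx: "W.D B x : pW 3" "V.D A y : pV 3" using W.D_pow[OF x(1) l(2)] V.D_pow[OF x(2) l(1)] .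
 note e2 = E3(3)[OF x(2) dx(1)] E3(3)[OF dx(2) x(1)]
 have 1: "aM A a y = V.D A y \<oplus>AV (\<ominus> a) \<odot>AV y" using S V.ext_pow_closed[OF x(2)]
  by (simp add: aM_def V.A.A.minus_eq V.A.smult_l_minus)
 have "B \<otimes>EW E x y \<ominus>EW E x y \<otimes>EW B = E (W.D B x) y \<oplus>EW E x (V.D A y)"
  using E_equivariant[of y 2 x A B] x l SP_adj0[OF S(1)] by simp
 then show ?thesis unfolding 1 aP_def using S x e e2 E3(7)[OF dx(2) x(1)] E3(5)[OF x(2) dx(1)] dx
  by (simp add: W.End.smult_l_minus W.End.A.a_ac W.End.A.r_neg1 W.End.A.r_neg2 W.End.A.r_neg)
qed

lemma six: "r : CK ==> [(6::int)] \<cdot>\<^bsub>K\<^esub> r = (r \<oplus> r) \<oplus> ((r \<oplus> r) \<oplus> (r \<oplus> r))"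
 using V.R.add.int_pow_mult[of r 2 2] V.R.add.int_pow_mult[of r 2 "2 + 2"] int_scale_ops(7)[of r r]
 by (simp add: add_pow_def)

text \<open>The element \<open>- r (h_M - 2 h_0)\<close> acts on degree three by
  \<open>- 3 r + 2 r\<close> and on degree six by \<open>- 6 r + 4 r\<close>.\<close>

lemma h_scale:
 assumes r: "r : CK"
 shows "x : pW 3 ==> aP (\<ominus>EW (r \<odot>EW \<one>EW)) (r \<oplus> r) x = \<ominus>AW (r \<odot>AW x)"
  "x : pW 6 ==> aP (\<ominus>EW (r \<odot>EW \<one>EW)) ((r \<oplus> r) \<oplus> (r \<oplus> r)) x = \<ominus>AW ((r \<oplus> r) \<odot>AW x)"
proof -
 have l: "\<one>EW \<in> LW" "r \<odot>EW \<one>EW \<in> LW" using r by (simp_all add: W.End_closed)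
 have *: "\<ominus> (d \<oplus> (d \<oplus> d)) \<oplus> (d \<oplus> d) = \<ominus> d" if "d : CK" for d
  using that by (simp add: V.R.minus_add V.R.a_assoc V.R.r_neg1 V.R.l_neg)
 \<comment> \<open>Both claims at once: \<open>d\<close> is \<open>r\<close> for
   \<open>k = 3\<close> and \<open>r \<oplus> r\<close> for \<open>k = 6\<close>; in either case
   minus three plus two times \<open>d\<close> remains.\<close>
 have main: "aP (\<ominus>EW (r \<odot>EW \<one>EW)) (d \<oplus> d) x = \<ominus>AW (d \<odot>AW x)"
  if x: "x : pW k" and d: "d : CK" "[int k] \<cdot>\<^bsub>K\<^esub> r = d \<oplus> (d \<oplus> d)" for d x k
 proof -
  note xc = W.ext_pow_closed[OF x]
  have "W.D (r \<odot>EW \<one>EW) x = r \<odot>AW (([int k] \<cdot>\<^bsub>K\<^esub> \<one>) \<odot>AW x)"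
   using W.D_End_smult[OF xc l(1) l(1) r] W.D_one_End[OF x] by simp
  also have "\<dots> = (r \<otimes> [int k] \<cdot>\<^bsub>K\<^esub> \<one>) \<odot>AW x" by (rule W.A.smult_assoc1[symmetric]) (use r xc in simp_all)
  also have "r \<otimes> [int k] \<cdot>\<^bsub>K\<^esub> \<one> = d \<oplus> (d \<oplus> d)" using int_scale_ops(2)[of \<one> r "int k"] r d by simp
  finally have "aP (\<ominus>EW (r \<odot>EW \<one>EW)) (d \<oplus> d) x = (\<ominus> (d \<oplus> (d \<oplus> d)) \<oplus> (d \<oplus> d)) \<odot>AW x"
   unfolding aP_def using W.D_End_neg[OF xc l(2) l(2)] xc d by (simp only: W.A.smult_l_distr W.A.smult_l_minus V.R.a_closed V.R.a_inv_closed)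
  then show ?thesis using d xc * by (simp add: W.A.smult_l_minus)
 qed
 show "aP (\<ominus>EW (r \<odot>EW \<one>EW)) (r \<oplus> r) x = \<ominus>AW (r \<odot>AW x)" if "x : pW 3"
  using main[OF that r] int_scale_ops(8)[OF r r] by simp
 show "aP (\<ominus>EW (r \<odot>EW \<one>EW)) ((r \<oplus> r) \<oplus> (r \<oplus> r)) x = \<ominus>AW ((r \<oplus> r) \<odot>AW x)" if "x : pW 6"
  using main[OF that V.R.a_closed[OF r r]] six[OF r] by simp
qed

lemma contract_top:
 assumes p: "p : XW" and u: "u : pV 6" and q: "q : pW 6"
 shows "cW (cV p u) q = pr u q \<odot>AW p"
proof -
 have "cW u q : pW 0" using cW_pow[of u 6 q 0] u q by simp
 then have "p \<otimes>AW cW u q = p \<otimes>AW (pr u q \<odot>AW \<one>AW)" by (rule W.ext_pow_0[THEN arg_cong])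
 also have "\<dots> = pr u q \<odot>AW p" using u q p
  by (subst W.A.smult_mult_r) (simp_all add: V.ext_pow_closed W.ext_pow_closed)
 finally show ?thesis
  using contract_contract_top[OF p V.ext_pow_closed[OF u] W.ext_pow_closed[OF q] top_gen_W[OF q]] by simp
qed

text \<open>Both sides are the contraction of \<open>q\<close> by \<open>q' \<cdot> u\<close>,
  evaluated once by \<open>contract_top\<close> and once using that \<open>q' \<cdot> u\<close> is a
  scalar. The top exterior power thus behaves like a module of rank one without a chosen
  generator.\<close>

lemma top_exchange:
 assumes u: "u : pV 6" and q: "q : pW 6" "q' : pW 6"
 shows "pr u q \<odot>AW q' = pr u q' \<odot>AW q"
proof -
 note c = V.ext_pow_closed[OF u] q[THEN W.ext_pow_closed]
 have "V.counit (cV q' u) = pr u q'" using pairing_sym[OF u q(2)] by simp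
 moreover have "cV q' u : pV 0" using s.cW_pow[of q' 6 u 0] u q by simp
 ultimately have "cV q' u = pr u q' \<odot>AV \<one>AV" using V.ext_pow_0 c by fastforce
 then show ?thesis using contract_top[OF c(3) u q(1)] c by (simp add: cW_linear_l)
qed

text \<open>Put \<open>r = m \<cdot> p\<close>. By \<open>D_top\<close> and \<open>E_trace\<close>
  the endomorphism contributes \<open>- 3 r q\<close>, the coefficient of \<open>h_0\<close>
  contributes \<open>2 r q\<close>, and the product is
  \<open>p (m \<cdot> q) = (p \<cdot> m) \<cdot> q = r q\<close>.\<close>

lemma m_p_q:
 assumes m: "m : pV 3" and p: "p : pW 3" and q: "q : pW 6"
 shows "aP (\<ominus>EW E p m) (pr m p \<oplus> pr m p) q \<oplus>AW p \<otimes>AW cW m q = \<zero>AW"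
proof -
 note c = V.ext_pow_closed[OF m] p[THEN W.ext_pow_closed] q[THEN W.ext_pow_closed] and e = E3(1)[OF m p]
 have r: "pr m p : CK" using c by simp
 have pm: "cV p m : pV 0" using s.cW_pow[of p 3 m 0] m p by simp
 moreover have "V.counit (cV p m) = pr m p" using pairing_sym[OF m p] by simp
 ultimately have "cV p m = pr m p \<odot>AV \<one>AV" using V.ext_pow_0 c by fastforce
 then have 1: "p \<otimes>AW cW m q = pr m p \<odot>AW q"
  using contract_contract_top[OF c(2,1,3) top_gen_W[OF q]] c by (simp add: cW_linear_l)
 have "W.D (E p m) q = ([(3::int)] \<cdot>\<^bsub>K\<^esub> pr m p) \<odot>AW q"
  using D_top[OF e c(3) top_gen_W[OF q]] E_trace[OF m p] by simp
 then show ?thesis unfolding 1 using c r W.D_End_neg[OF c(3) e e] int_scale_ops(8)[OF r r]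
  by (simp add: aP_def W.A.smult_l_distr W.A.A.minus_add W.A.A.a_ac W.A.A.r_neg1 W.A.A.r_neg2 W.A.A.r_neg W.A.A.l_neg)
qed

lemma E_top':
 assumes u: "u : pV 6" and p: "p : pW 3" "q : pW 3"
 shows "\<ominus>EW (pr u (p \<otimes>AW q) \<odot>EW \<one>EW) = E q (cV p u) \<ominus>EW E p (cV q u)"
proof (rule W.End_eqI)
 note c = V.ext_pow_closed[OF u] p[THEN W.ext_pow_closed]
 note e = E3(1)[OF cV36[OF p(1) u] p(2)] E3(1)[OF cV36[OF p(2) u] p(1)]
 note o = W.End_closed(6) W.End_closed(5)[OF pr_closed W.End_closed(6)]
 have r: "pr u (p \<otimes>AW q) : CK" using c by simp
 show "\<ominus>EW (pr u (p \<otimes>AW q) \<odot>EW \<one>EW) : LW" "E q (cV p u) \<ominus>EW E p (cV q u) : LW"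
  using e r by (simp_all add: W.End_closed)
 fix w assume w: "w : CW"
 show "(\<ominus>EW (pr u (p \<otimes>AW q) \<odot>EW \<one>EW)) w = (E q (cV p u) \<ominus>EW E p (cV q u)) w"
  using E_top[OF u p w top_gen_V[OF u] top_W] w e r
  by (simp add: W.End_neg W.End_closed W.End_minus W.End_simps)
qed

text \<open>Contracting by \<open>p\<close> and then by \<open>q\<close> is contracting by
  \<open>q p\<close>, and exchanging two elements of degree 3 changes the sign.\<close>

lemma pr_top:
 assumes u: "u : pV 6" and p: "p : pW 3" "q : pW 3"
 shows "pr (cV p u) q = \<ominus> pr u (p \<otimes>AW q)"
proof -
 note c = V.ext_pow_closed[OF u] p[THEN W.ext_pow_closed]
 have "pr (cV p u) q = V.counit (cV q (cV p u))" using pairing_sym[OF cV36[OF p(1) u] p(2)] .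
 also have "\<dots> = V.counit (cV (q \<otimes>AW p) u)" using c by (simp add: s.cW_linear_l)
 also have "\<dots> = pr u (q \<otimes>AW p)" using pairing_sym[OF u mult33[OF p(2,1)]] by simp
 also have "q \<otimes>AW p = \<ominus>AW (p \<otimes>AW q)" using W.pow_commute[OF p(2,1)] by simp
 finally show ?thesis using c by (simp add: cW_linear_r)
qed

end

context abelian_group
begin

lemma flip_regroup:
 assumes "p \<in> carrier G" "q \<in> carrier G" "r \<in> carrier G" "s \<in> carrier G"
 shows "p \<ominus> q \<oplus> r \<ominus> s = p \<oplus> r \<ominus> q \<oplus> (\<ominus> s)" "p \<oplus> q \<ominus> r \<oplus> s = p \<ominus> r \<oplus> q \<ominus> (\<ominus> s)" "\<ominus> (p \<ominus> q \<oplus> (r \<oplus> r)) = q \<ominus> p \<oplus> (\<ominus> r \<oplus> \<ominus> r)"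
 using assms by (simp_all add: minus_eq minus_add a_ac)

end

context ring
begin

text \<open>The Jacobi identity of the commutator in an associative ring, in derivation
  form.\<close>

lemma commutator_derivation:
 assumes [simp]: "x \<in> carrier R" "y \<in> carrier R" "z \<in> carrier R"
 shows "x \<otimes> (y \<otimes> z \<ominus> z \<otimes> y) \<ominus> (y \<otimes> z \<ominus> z \<otimes> y) \<otimes> x =
  ((x \<otimes> y \<ominus> y \<otimes> x) \<otimes> z \<ominus> z \<otimes> (x \<otimes> y \<ominus> y \<otimes> x)) \<oplus> (y \<otimes> (x \<otimes> z \<ominus> z \<otimes> x) \<ominus> (x \<otimes> z \<ominus> z \<otimes> x) \<otimes> y)"
proof -
 have *: "(p \<ominus> t) \<ominus> (r \<ominus> q) = ((p \<ominus> u) \<ominus> (v \<ominus> q)) \<oplus> ((u \<ominus> r) \<ominus> (t \<ominus> v))"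
  if "p \<in> carrier R" "q \<in> carrier R" "r \<in> carrier R" "t \<in> carrier R" "u \<in> carrier R" "v \<in> carrier R" for p q r t u v
 proof -
  have "((p \<ominus> u) \<ominus> (v \<ominus> q)) \<oplus> ((u \<ominus> r) \<ominus> (t \<ominus> v)) = (p \<ominus> u) \<oplus> (u \<oplus> ((q \<ominus> v) \<oplus> (v \<oplus> (\<ominus> r \<ominus> t))))"
   using that by (simp add: minus_eq minus_add a_ac)
  also have "\<dots> = (p \<ominus> t) \<ominus> (r \<ominus> q)"
   using that by (simp add: minus_plus_cancel) (simp add: minus_eq minus_add a_ac)
  finally show ?thesis by simp
 qed
 have d: "a \<otimes> (b \<ominus> c) = a \<otimes> b \<ominus> a \<otimes> c" "(b \<ominus> c) \<otimes> a = b \<otimes> a \<ominus> c \<otimes> a"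
  if "a \<in> carrier R" "b \<in> carrier R" "c \<in> carrier R" for a b c
  using that by (simp_all add: minus_eq l_distr r_distr l_minus r_minus)
 show ?thesis
  by (simp add: d m_assoc) (rule *; simp)
qed

end

section \<open>The Jacobi identity on homogeneous elements\<close>

context lie
begin

lemmas zero_mem = V.ext_pow_ops(1)[of 6] V.ext_pow_ops(1)[of 3] W.ext_pow_ops(1)[of 6] W.ext_pow_ops(1)[of 3] SP_zero V.R.zero_closed

text \<open>The table of \<open>br_hom\<close> with every entry depending on its own arguments only;
  the slots that an entry does not mention are filled with zeros.\<close>

lemma br_simps:
 "u : pV 6 ==> u' : pV 6 ==> br (N2 u) (N2 u') = Z"
 "u : pV 6 ==> m : pV 3 ==> br (N2 u) (N1 m) = Z"
 "u : pV 6 ==> m : pV 3 ==> br (N1 m) (N2 u) = Z"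
 "m : pV 3 ==> m' : pV 3 ==> br (N1 m) (N1 m') = N2 (m \<otimes>AV m')"
 "q : pW 6 ==> q' : pW 6 ==> br (P2 q) (P2 q') = Z"
 "q : pW 6 ==> p : pW 3 ==> br (P2 q) (P1 p) = Z"
 "q : pW 6 ==> p : pW 3 ==> br (P1 p) (P2 q) = Z"
 "p : pW 3 ==> p' : pW 3 ==> br (P1 p) (P1 p') = P2 (p \<otimes>AW p')"
 "(A, B) \<in> SP ==> a : CK ==> u : pV 6 ==> br (Z0 A B a) (N2 u) = N2 (aM A (a \<oplus> a) u)"
 "(A, B) \<in> SP ==> a : CK ==> u : pV 6 ==> br (N2 u) (Z0 A B a) = N2 (\<ominus>AV aM A (a \<oplus> a) u)"
 "(A, B) \<in> SP ==> a : CK ==> m : pV 3 ==> br (Z0 A B a) (N1 m) = N1 (aM A a m)"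
 "(A, B) \<in> SP ==> a : CK ==> m : pV 3 ==> br (N1 m) (Z0 A B a) = N1 (\<ominus>AV aM A a m)"
 "(A, B) \<in> SP ==> a : CK ==> q : pW 6 ==> br (Z0 A B a) (P2 q) = P2 (aP B (a \<oplus> a) q)"
 "(A, B) \<in> SP ==> a : CK ==> q : pW 6 ==> br (P2 q) (Z0 A B a) = P2 (\<ominus>AW aP B (a \<oplus> a) q)"
 "(A, B) \<in> SP ==> a : CK ==> p : pW 3 ==> br (Z0 A B a) (P1 p) = P1 (aP B a p)"
 "(A, B) \<in> SP ==> a : CK ==> p : pW 3 ==> br (P1 p) (Z0 A B a) = P1 (\<ominus>AW aP B a p)"
 "(A, B) \<in> SP ==> a : CK ==> (A', B') \<in> SP ==> a' : CK ==>
  br (Z0 A B a) (Z0 A' B' a') = Z0 (A \<otimes>EV A' \<ominus>EV A' \<otimes>EV A) (B \<otimes>EW B' \<ominus>EW B' \<otimes>EW B) \<zero>"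
 "m : pV 3 ==> p : pW 3 ==> br (N1 m) (P1 p) = Z0 (E' m p) (\<ominus>EW E p m) (pr m p)"
 "m : pV 3 ==> p : pW 3 ==> br (P1 p) (N1 m) = Z0 (\<ominus>EV E' m p) (E p m) (\<ominus> pr m p)"
 "m : pV 3 ==> q : pW 6 ==> br (N1 m) (P2 q) = P1 (cW m q)"
 "m : pV 3 ==> q : pW 6 ==> br (P2 q) (N1 m) = P1 (\<ominus>AW cW m q)"
 "u : pV 6 ==> p : pW 3 ==> br (P1 p) (N2 u) = N1 (cV p u)"
 "u : pV 6 ==> p : pW 3 ==> br (N2 u) (P1 p) = N1 (\<ominus>AV cV p u)"
 "u : pV 6 ==> q : pW 6 ==>
  br (N2 u) (P2 q) = Z0 (pr u q \<odot>EV \<one>EV) (\<ominus>EW (pr u q \<odot>EW \<one>EW)) (pr u q \<oplus> pr u q)"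
 "u : pV 6 ==> q : pW 6 ==>
  br (P2 q) (N2 u) = Z0 (\<ominus>EV (pr u q \<odot>EV \<one>EV)) (pr u q \<odot>EW \<one>EW) (\<ominus> (pr u q \<oplus> pr u q))"
 by (rule br_hom; (assumption | rule zero_mem))+

text \<open>The Jacobi identity as the statement that bracketing with \<open>X\<close> is a
  derivation. By skew-symmetry it is invariant under permuting the arguments, and it is additive in
  the first one.\<close>

definition jac :: "('a, 'c, 'e) lie_elem => ('a, 'c, 'e) lie_elem => ('a, 'c, 'e) lie_elem => bool" where
 "jac X Y U \<longleftrightarrow> br X (br Y U) = br (br X Y) U \<oplus>L br Y (br X U)"

lemma jac_swap12:
 assumes "X : CL" "Y : CL" "U : CL" "jac X Y U" shows "jac Y X U"
proof -
 have "br (br Y X) U = \<ominus>L br (br X Y) U"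
  using assms br_smult_l[of "\<ominus> \<one>" "br X Y" U] by (simp add: br_skew[of X Y] br_closed L.smult_l_minus)
 then show ?thesis using assms unfolding jac_def by (simp add: br_closed L.r_neg1)
qed

lemma br_neg_r: "X : CL ==> Y : CL ==> br X (\<ominus>L Y) = \<ominus>L br X Y"
 using br_smult_r[of "\<ominus> \<one>" Y X] by (simp add: br_closed L.smult_l_minus)

lemma jac_swap23:
 assumes c: "X : CL" "Y : CL" "U : CL" and "jac X Y U" shows "jac X U Y"
proof -
 have "br X (br U Y) = \<ominus>L br X (br Y U)" using c by (simp add: br_skew[of Y U] br_neg_r br_closed)
 moreover have "br (br X U) Y = \<ominus>L br Y (br X U)" "br U (br X Y) = \<ominus>L br (br X Y) U"
  using c by (simp_all add: br_skew[of Y "br X U"] br_skew[of "br X Y" U] br_closed)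
 ultimately show ?thesis using assms unfolding jac_def by (simp add: br_closed L.minus_add L.a_comm)
qed

lemma jac_add:
 assumes "X : CL" "X' : CL" "Y : CL" "U : CL" "jac X Y U" "jac X' Y U"
 shows "jac (X \<oplus>L X') Y U"
 using assms unfolding jac_def by (simp add: br_closed br_add_l br_add_r L.a_ac)

lemma Z0_eqI:
 "(A, B) \<in> SP ==> (A', B') \<in> SP ==> B = B' ==> a = a' ==> Z0 A B a = Z0 A' B' a'"
 using SP_unique by blast

lemma jac_SSS:
 assumes S: "(A, B) \<in> SP" "a : CK" "(A', B') \<in> SP" "a' : CK" "(A'', B'') \<in> SP" "a'' : CK"
 shows "jac (Z0 A B a) (Z0 A' B' a') (Z0 A'' B'' a'')"
proof -
 have l: "A : YV" "B : YW" "A' : YV" "B' : YW" "A'' : YV" "B'' : YW"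
  using S SP_lin by (auto simp: V.End_simps(1) W.End_simps(1))
 show ?thesis unfolding jac_def
  using S by (simp add: br_simps SP_comm hom_add V.End.A.commutator_derivation[OF l(1,3,5)] W.End.A.commutator_derivation[OF l(2,4,6)])
qed

text \<open>These cases say that commutators act as commutators and that the degree 0 part acts by
  derivations on products and contractions.\<close>

lemma jac_S_act:
 assumes S: "(A, B) \<in> SP" "a : CK" "(A', B') \<in> SP" "a' : CK"
 shows "p : pW 3 ==> jac (Z0 A B a) (Z0 A' B' a') (P1 p)"
  "q : pW 6 ==> jac (Z0 A B a) (Z0 A' B' a') (P2 q)"
  "p : pW 3 ==> p' : pW 3 ==> jac (Z0 A B a) (P1 p) (P1 p')"
  "m : pV 3 ==> q : pW 6 ==> jac (Z0 A B a) (N1 m) (P2 q)"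
proof -
 note l = SP_lin[OF S(1)] SP_lin[OF S(3)] and cc = SP_comm[OF S(1,3)]
 note s = S l cc aP_rules(2)[OF l(2)] aP_rules(2)[OF l(4)] aM_rules(2)[OF l(1)] aP_rules(2)[OF SP_lin(2)[OF cc]]
 show "jac (Z0 A B a) (Z0 A' B' a') (P1 p)" if "p : pW 3"
  using that s aP_comm[OF l(2,4) S(2,4) W.ext_pow_closed[OF that]] by (simp add: jac_def br_simps hom_add)
 show "jac (Z0 A B a) (Z0 A' B' a') (P2 q)" if "q : pW 6"
  using that s aP_comm[OF l(2,4) _ _ W.ext_pow_closed[OF that], of "a \<oplus> a" "a' \<oplus> a'"] by (simp add: jac_def br_simps hom_add)
 show "jac (Z0 A B a) (P1 p) (P1 p')" if "p : pW 3" "p' : pW 3"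
  using that s aP_mult[OF l(2) S(2) that[THEN W.ext_pow_closed]] by (simp add: jac_def br_simps hom_add mult33)
 show "jac (Z0 A B a) (N1 m) (P2 q)" if "m : pV 3" "q : pW 6"
  using that s aP_contract[OF S(1,2) W.ext_pow_closed[OF that(2)] V.ext_pow_closed[OF that(1)]] by (simp add: jac_def br_simps hom_add cW36)
qed

text \<open>The endomorphism part is the equivariance of \<open>E\<close>, and the coefficient of
  \<open>h_0\<close> is the invariance of the pairing.\<close>

lemma jac_S_m_p:
 assumes S: "(A, B) \<in> SP" "a : CK" and m: "m : pV 3" and p: "p : pW 3"
 shows "jac (Z0 A B a) (N1 m) (P1 p)"
proof -
 note l = SP_lin[OF S(1)]
 have m': "aM A a m : pV 3" and p': "aP B a p : pW 3" using l S m p by (simp_all add: aM_rules(2) aP_rules(2))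
 note cl = V.ext_pow_closed[OF m] W.ext_pow_closed[OF p] V.ext_pow_closed[OF m'] W.ext_pow_closed[OF p']
 have c: "B : YW" "E p m : YW" "E (aP B a p) m : YW" "E p (aM A a m) : YW"
  using l E3(3)[OF m p] E3(3)[OF m p'] E3(3)[OF m' p] by (simp_all add: W.End_simps(1))
 have "\<ominus>EW (B \<otimes>EW E p m \<ominus>EW E p m \<otimes>EW B) = \<ominus>EW (E (aP B a p) m \<oplus>EW E p (aM A a m))"
  unfolding E_act[OF S p m] ..
 then have 1: "B \<otimes>EW (\<ominus>EW E p m) \<ominus>EW (\<ominus>EW E p m) \<otimes>EW B = \<ominus>EW E p (aM A a m) \<oplus>EW (\<ominus>EW E (aP B a p) m)"
  using c by (simp add: W.End.A.minus_eq W.End.A.minus_add W.End.A.r_minus W.End.A.l_minus W.End.A.a_comm)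
 have 2: "pr (aM A a m) p \<oplus> pr m (aP B a p) = \<zero>" using pr_act[OF S p m] .
 show ?thesis unfolding jac_def using S m p m' p' SP_E cl
  by (simp add: br_simps hom_add) (intro Z0_eqI SP_comm SP_add; simp add: SP_E 1 2)
qed

text \<open>Scalar endomorphisms are central, so the left side is zero; on the right the scalars
  \<open>r\<close> and \<open>r'\<close> cancel by invariance of the pairing.\<close>

lemma jac_S_u_q:
 assumes S: "(A, B) \<in> SP" "a : CK" and u: "u : pV 6" and q: "q : pW 6"
 shows "jac (Z0 A B a) (N2 u) (P2 q)"
proof -
 note l = SP_lin[OF S(1)] and a2 = V.R.a_closed[OF S(2,2)]
 have u': "aM A (a \<oplus> a) u : pV 6" and q': "aP B (a \<oplus> a) q : pW 6" using l S u q by (simp_all add: aM_rules(2) aP_rules(2))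
 note cl = V.ext_pow_closed[OF u] W.ext_pow_closed[OF q] V.ext_pow_closed[OF u'] W.ext_pow_closed[OF q']
 define r r' where "r = pr (aM A (a \<oplus> a) u) q" and "r' = pr u (aP B (a \<oplus> a) q)"
 have rc: "r : CK" "r' : CK" "B : YW" using cl l by (simp_all add: r_def r'_def W.End_simps(1))
 have z: "r \<oplus> r' = \<zero>" using pr_act[OF S(1) a2 q u] by (simp add: r_def r'_def)
 then have zz: "r \<oplus> r \<oplus> (r' \<oplus> r') = \<zero>" using rc by (simp add: V.R.a_ac V.R.a_lcomm[of r r'])
 have 1: "\<ominus>EW (r \<odot>EW \<one>EW) \<oplus>EW (\<ominus>EW (r' \<odot>EW \<one>EW)) = \<zero>EW"
  using rc z by (simp flip: W.End.A.minus_add W.End.smult_l_distr)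
 have 2: "B \<otimes>EW (\<ominus>EW (pr u q \<odot>EW \<one>EW)) \<ominus>EW (\<ominus>EW (pr u q \<odot>EW \<one>EW)) \<otimes>EW B = \<zero>EW"
  using rc cl by (simp add: W.End.A.minus_eq W.End.A.r_minus W.End.A.l_minus W.End.smult_mult_l W.End.smult_mult_r W.End.A.l_neg)
 show ?thesis unfolding jac_def using S u q u' q' cl rc
  by (simp add: br_simps hom_add SP_one r_def[symmetric] r'_def[symmetric]) (intro Z0_eqI SP_comm SP_add; simp add: SP_one 1 2 zz)
qed

lemma zero_hom: "N2 \<zero>AV = Z" "N1 \<zero>AV = Z" "P1 \<zero>AW = Z" "P2 \<zero>AW = Z"
 by (rule lie_elem_eqI; simp add: zero_fields)+

lemmas zero_P2 = zero_hom(4) and zero_P1 = zero_hom(3)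

lemma Z_closed: "Z : CL" and L_add_Z: "X : CL ==> X \<oplus>L Z = X" "X : CL ==> Z \<oplus>L X = X"
 using L.zero_closed L.r_zero[of X] L.l_zero[of X] by (simp_all only: L_simps(2))

lemma br_Z: "X : CL ==> br X Z = Z" "X : CL ==> br Z X = Z"
proof -
 have *: "\<zero> \<odot>L Y = Z" if "Y : CL" for Y using that L_simps(2) by (metis L.smult_l_null)
 show "br X Z = Z" "br Z X = Z" if X: "X : CL"
  using br_smult_r[OF V.R.zero_closed Z_closed X] br_smult_l[OF V.R.zero_closed Z_closed X] X *
  by (simp_all add: Z_closed br_closed)
qed

lemmas br_hom_zero = br_Z L_add_Z Z_closed

lemma SP_swap: "(B, A) \<in> S_pairs K W V (\<lambda>w v. h v w) \<longleftrightarrow> (A, B) \<in> SP"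
proof -
 have "h (A v) w \<oplus> h v (B w) = h v (B w) \<oplus> h (A v) w"
  if "A : LV" "B : LW" "v : CV" "w : CW" for v w
  using that by (intro V.R.a_comm) (simp_all add: lin_maps_closed)
 then show ?thesis by (auto simp: S_pairs_def)
qed

text \<open>This is the expansion \<open>contract3_mult\<close> of
  \<open>m \<cdot> (p p')\<close>.\<close>

lemma jac_m_p_p:
 assumes m: "m : pV 3" and p: "p : pW 3" "p' : pW 3"
 shows "jac (N1 m) (P1 p) (P1 p')"
proof -
 note c = p[THEN W.ext_pow_closed] V.ext_pow_closed[OF m] and e = E3(1)[OF m p(1)] E3(1)[OF m p(2)]
 have D: "W.D (\<ominus>EW E p m) p' = \<ominus>AW W.D (E p m) p'" "W.D (\<ominus>EW E p' m) p = \<ominus>AW W.D (E p' m) p"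
  using W.D_End_neg[OF c(2) e(1) e(1)] W.D_End_neg[OF c(1) e(2) e(2)] by simp_all
 have "cW m (p \<otimes>AW p') = aP (\<ominus>EW E p m) (pr m p) p' \<oplus>AW (\<ominus>AW aP (\<ominus>EW E p' m) (pr m p') p)"
  unfolding contract3_mult[OF m p] using c e by (simp add: aP_def D W.A.A.minus_eq W.A.A.a_comm)
 then show ?thesis using m p SP_E e
  by (simp add: jac_def br_simps hom_add mult33 cW36 c aP_rules(2) W.End_closed)
qed

text \<open>\<open>E_top'\<close> is the endomorphism part. By \<open>pr_top\<close> the two terms
  on the right have the same coefficient of \<open>h_0\<close>, in accordance with the factor 2 at
  \<open>h_0\<close> on the left.\<close>

lemma jac_u_p_p:
 assumes u: "u : pV 6" and p: "p : pW 3" "q : pW 3"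
 shows "jac (N2 u) (P1 p) (P1 q)"
proof -
 note c = p[THEN W.ext_pow_closed] V.ext_pow_closed[OF u] and pu = cV36[OF p(1) u] cV36[OF p(2) u]
 note pc = pu[THEN V.ext_pow_closed] and nu = V.ext_pow_ops(4)[OF pu(1)] V.ext_pow_ops(4)[OF pu(2)] and pq = mult33[OF p]
 note e = E3[OF pu(1) p(2)] E3[OF pu(2) p(1)]
 define r where "r = pr u (p \<otimes>AW q)"
 have rc: "r : CK" using c by (simp add: r_def)
 have "q \<otimes>AW p = \<ominus>AW (p \<otimes>AW q)" using W.pow_commute[OF p(2,1)] by simp
 then have h: "pr (cV p u) q = \<ominus> r" "pr (cV q u) p = r" using c pr_top[OF u p] pr_top[OF u p(2,1)] by (simp_all add: cW_linear_r r_def)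
 have n: "E q (\<ominus>AV cV p u) = \<ominus>EW E q (cV p u)" "E p (\<ominus>AV cV q u) = \<ominus>EW E p (cV q u)"
  using e(10)[of "\<ominus> \<one>"] e(22)[of "\<ominus> \<one>"] pc e by (simp_all add: V.A.smult_l_minus W.End.smult_l_minus)
 have 1: "\<ominus>EW (r \<odot>EW \<one>EW) = \<ominus>EW E q (\<ominus>AV cV p u) \<oplus>EW E p (\<ominus>AV cV q u)"
  unfolding r_def E_top'[OF u p] n using e by (simp add: W.End.A.minus_eq)
 have S: "(\<ominus>EV E' m p', E p' m) \<in> SP" if "m : pV 3" "p' : pW 3" for m p'
  using SP_neg[OF SP_E[OF that]] E3(3)[OF that] by simp
 show ?thesis unfolding jac_def using u p c pu nu pq pc rc
  by (simp add: br_simps hom_add r_def[symmetric]) (intro Z0_eqI SP_one SP_add SP_E S; simp add: 1 cW_linear_l h)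
qed

text \<open>Mirror image of the previous case, again of total degree 0. For the interchanged modules
  \<open>E_top'\<close> computes the component on \<open>V\<close>; equality is decided there and
  determines the component on \<open>W\<close>.\<close>

lemma jac_q_m_m:
 assumes q: "q : pW 6" and m: "m : pV 3" "m' : pV 3"
 shows "jac (P2 q) (N1 m) (N1 m')"
proof -
 interpret t: lie K W V "\<lambda>w v. h v w" n c b by (rule lie_swap)
 note cl = m[THEN V.ext_pow_closed] W.ext_pow_closed[OF q] and mq = cW36[OF m(1) q] cW36[OF m(2) q]
 note mc = mq[THEN W.ext_pow_closed] and nq = W.ext_pow_ops(4)[OF mq(1)] W.ext_pow_ops(4)[OF mq(2)] and mm = mult33'[OF m]
 note e = E3[OF m(2) mq(1)] E3[OF m(1) mq(2)]
 define r where "r = pr (m \<otimes>AV m') q"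
 have rc: "r : CK" using cl by (simp add: r_def)
 have rr: "V.counit (cV q (m \<otimes>AV m')) = r" using pairing_sym[OF mm q] by (simp add: r_def)
 have "m' \<otimes>AV m = \<ominus>AV (m \<otimes>AV m')" using V.pow_commute[OF m(2,1)] by simp
 then have h: "pr m' (cW m q) = \<ominus> r" "pr m (cW m' q) = r" using cl by (simp_all add: cW_linear_l r_def flip: cW_linear_l(6))
 have n: "E' m' (\<ominus>AW cW m q) = \<ominus>EV E' m' (cW m q)" "E' m (\<ominus>AW cW m' q) = \<ominus>EV E' m (cW m' q)"
  using e(11)[of "\<ominus> \<one>"] e(23)[of "\<ominus> \<one>"] mc e by (simp_all add: W.A.smult_l_minus V.End.smult_l_minus)
 have 1: "\<ominus>EV (r \<odot>EV \<one>EV) = \<ominus>EV E' m' (\<ominus>AW cW m q) \<oplus>EV E' m (\<ominus>AW cW m' q)"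
  using t.E_top'[OF q m] unfolding n rr using e by (simp add: V.End.A.minus_eq)
 have S: "(\<ominus>EV E' m p', E p' m) \<in> SP" if "m : pV 3" "p' : pW 3" for m p'
  using SP_neg[OF SP_E[OF that]] E3(3)[OF that] by simp
 have S1: "(\<ominus>EV (r \<odot>EV \<one>EV), r \<odot>EW \<one>EW) \<in> SP" using SP_neg[OF SP_one[OF rc]] rc by simp
 have eq: "Z0 A B a = Z0 A' B' a'" if "(A, B) \<in> SP" "(A', B') \<in> SP" "A = A'" "a = a'" for A B a A' B' a'
 proof -
  have "(B, A) \<in> S_pairs K W V (\<lambda>w v. h v w)" "(B', A) \<in> S_pairs K W V (\<lambda>w v. h v w)" using that SP_swap by simp_all
  then have "B = B'" by (rule t.SP_unique)
  with that show ?thesis by simp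
 qed
 show ?thesis unfolding jac_def using q m cl mq nq mm mc rc
  by (simp add: br_simps hom_add r_def[symmetric]) (intro eq S1 SP_add SP_E S; simp add: 1 cW_linear_r h V.R.minus_add)
qed

text \<open>The bracket of \<open>p\<close> and \<open>q\<close> is zero, and \<open>m_p_q\<close>
  says that the other two terms cancel.\<close>

lemma jac_m_p_q:
 assumes m: "m : pV 3" and p: "p : pW 3" and q: "q : pW 6"
 shows "jac (N1 m) (P1 p) (P2 q)"
proof -
 note c = V.ext_pow_closed[OF m] W.ext_pow_closed[OF p] W.ext_pow_closed[OF q] and e = E3(1)[OF m p]
 show ?thesis using m p q c SP_E e m_p_q[OF m p q]
  by (simp add: jac_def br_simps hom_add mult33 cW36 aP_rules(2) W.End_closed hom_closed br_hom_zero zero_P2)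
qed

text \<open>The bracket of \<open>p\<close> and \<open>q\<close> is zero. By
  \<open>contract_top\<close> the contraction of \<open>q\<close> by \<open>p \<cdot> u\<close> is
  \<open>u \<cdot> q\<close> times \<open>p\<close>, which cancels the action of
  \<open>[u, q]\<close> on \<open>p\<close> given by \<open>h_scale\<close>.\<close>

lemma jac_u_p_q:
 assumes u: "u : pV 6" and p: "p : pW 3" and q: "q : pW 6"
 shows "jac (N2 u) (P1 p) (P2 q)"
proof -
 note cl = V.ext_pow_closed[OF u] W.ext_pow_closed[OF p] W.ext_pow_closed[OF q]
 note pu = cV36[OF p u] note nu = V.ext_pow_ops(4)[OF pu] and pc = V.ext_pow_closed[OF pu]
 have rc: "pr u q : CK" using cl by simp
 have x: "aP (\<ominus>EW (pr u q \<odot>EW \<one>EW)) (pr u q \<oplus> pr u q) p : pW 3"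
  using rc p by (intro aP_rules(2)) (simp_all add: W.End_closed)
 have "cW (\<ominus>AV cV p u) q : pW 3" by (rule cW36[OF nu q])
 then show ?thesis using u p q nu pu pc cl rc SP_one contract_top[OF cl(2) u q] x h_scale(1)[OF rc p]
  by (simp add: jac_def br_simps hom_add br_hom_zero zero_P1 hom_closed cW_linear_l W.A.A.l_neg W.A.A.r_neg)
qed

text \<open>Both remaining terms are evaluated by \<open>h_scale\<close> in degree six, and
  \<open>top_exchange\<close> makes them cancel.\<close>

lemma jac_u_q_q:
 assumes u: "u : pV 6" and q: "q : pW 6" "q' : pW 6"
 shows "jac (N2 u) (P2 q) (P2 q')"
proof -
 note cl = V.ext_pow_closed[OF u] q[THEN W.ext_pow_closed]
 define r r' where "r = pr u q" and "r' = pr u q'"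
 have rc: "r : CK" "r' : CK" using cl by (simp_all add: r_def r'_def)
 have x: "aP (\<ominus>EW (r \<odot>EW \<one>EW)) ((r \<oplus> r) \<oplus> (r \<oplus> r)) q' : pW 6" "aP (\<ominus>EW (r' \<odot>EW \<one>EW)) ((r' \<oplus> r') \<oplus> (r' \<oplus> r')) q : pW 6"
  using rc q by (auto intro!: aP_rules(2) simp: W.End_closed)
 have "r \<odot>AW q' = r' \<odot>AW q" using top_exchange[OF u q] by (simp add: r_def r'_def)
 then have "aP (\<ominus>EW (r \<odot>EW \<one>EW)) ((r \<oplus> r) \<oplus> (r \<oplus> r)) q' \<oplus>AW (\<ominus>AW aP (\<ominus>EW (r' \<odot>EW \<one>EW)) ((r' \<oplus> r') \<oplus> (r' \<oplus> r')) q) = \<zero>AW"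
  using h_scale(2)[OF rc(1) q(2)] h_scale(2)[OF rc(2) q(1)] rc cl by (simp add: W.A.smult_l_distr W.A.A.l_neg W.A.A.r_neg)
 then show ?thesis using u q rc cl x SP_one
  by (simp add: jac_def br_simps hom_add br_hom_zero zero_P2 hom_closed r_def[symmetric] r'_def[symmetric])
qed

text \<open>Interchanging the modules reverses degrees. Since \<open>h_0\<close> acts with the sign
  of the degree, its coefficient changes sign. Through this map negative total degrees are reduced
  to positive ones.\<close>

definition flip_elem :: "('a, 'e, 'c) lie_elem => ('a, 'c, 'e) lie_elem" where
 "flip_elem X = \<lparr>neg2 = pos2 X, neg1 = pos1 X, endm = endp X, endp = endm X, hcoef = \<ominus> hcoef X,
  pos1 = neg1 X, pos2 = neg2 X\<rparr>"

lemma flip_closed: "X \<in> carrier (tilde_E K W V (\<lambda>w v. h v w)) ==> flip_elem X : CL"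
 by (simp add: tilde_E_def flip_elem_def SP_swap)

lemma flip_add:
 assumes "X \<in> carrier (tilde_E K W V (\<lambda>w v. h v w))" "Y \<in> carrier (tilde_E K W V (\<lambda>w v. h v w))"
 shows "flip_elem (X \<oplus>\<^bsub>tilde_E K W V (\<lambda>w v. h v w)\<^esub> Y) = flip_elem X \<oplus>L flip_elem Y"
 using assms by (intro lie_elem_eqI) (simp_all add: tilde_E_def flip_elem_def tilde_add_def V.R.minus_add)

text \<open>Pairings agree by \<open>pairing_sym\<close>. The scalar attached to degrees -2 and 2
  changes its sign along with the coefficient of \<open>h_0\<close>, since the two top degrees trade
  places.\<close>

lemma flip_br:
 assumes X: "X \<in> carrier (tilde_E K W V (\<lambda>w v. h v w))" and Y: "Y \<in> carrier (tilde_E K W V (\<lambda>w v. h v w))"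
 shows "flip_elem (tilde_bracket K W V (\<lambda>w v. h v w) X Y) = br (flip_elem X) (flip_elem Y)"
proof -
 interpret t: lie K W V "\<lambda>w v. h v w" n c b by (rule lie_swap)
 note f = t.L_fields[OF X] t.L_fields[OF Y]
 note cl = flip_closed[OF X] flip_closed[OF Y]
 have aM: "aM B (\<ominus> a) x = t.aP B a x" if "a : CK" "x : XV" for B a x
  using that by (simp add: aM_def t.aP_def V.A.A.minus_eq V.A.smult_l_minus)
 have aP: "aP B (\<ominus> a) x = t.aM B a x" if "a : CK" "x : XW" for B a x
  using that by (simp add: aP_def t.aM_def W.A.A.minus_eq W.A.smult_l_minus)
 have h2: "\<ominus> a \<oplus> \<ominus> a = \<ominus> (a \<oplus> a)" if "a : CK" for a using that by (simp add: V.R.minus_add)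
 have pr: "pr (pos1 X) (neg1 Y) = t.pr (neg1 Y) (pos1 X)" "pr (pos1 Y) (neg1 X) = t.pr (neg1 X) (pos1 Y)"
  "pr (pos2 X) (neg2 Y) = t.pr (neg2 Y) (pos2 X)" "pr (pos2 Y) (neg2 X) = t.pr (neg2 X) (pos2 Y)"
  using f by (auto intro!: pairing_sym)
 note e = E3[OF f(6) f(16)] E3[OF f(20) f(2)]
 define r where "r = t.pr (neg2 X) (pos2 Y) \<ominus> t.pr (neg2 Y) (pos2 X)"
 have rc: "r : CK" "t.pr (neg2 Y) (pos2 X) \<ominus> t.pr (neg2 X) (pos2 Y) = \<ominus> r"
  using f by (simp_all add: r_def V.R.minus_eq V.R.minus_add V.R.a_comm)
 have fl: "neg2 (flip_elem X) = pos2 X" "neg1 (flip_elem X) = pos1 X" "endm (flip_elem X) = endp X" "endp (flip_elem X) = endm X"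
  "hcoef (flip_elem X) = \<ominus> hcoef X" "pos1 (flip_elem X) = neg1 X" "pos2 (flip_elem X) = neg2 X" for X
  by (simp_all add: flip_elem_def)
 show ?thesis
 proof (rule lie_elem_eqI; simp only: fl br_fields[OF cl] t.br_fields[OF X Y] pr rc(2) r_def[symmetric])
  show "t.aP (endp X) (hcoef X \<oplus> hcoef X) (pos2 Y) \<ominus>AV t.aP (endp Y) (hcoef Y \<oplus> hcoef Y) (pos2 X) \<oplus>AV pos1 X \<otimes>AV pos1 Y =
   aM (endp X) (\<ominus> hcoef X \<oplus> \<ominus> hcoef X) (pos2 Y) \<ominus>AV aM (endp Y) (\<ominus> hcoef Y \<oplus> \<ominus> hcoef Y) (pos2 X) \<oplus>AV pos1 X \<otimes>AV pos1 Y"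
   "t.aM (endm X) (hcoef X \<oplus> hcoef X) (neg2 Y) \<ominus>AW t.aM (endm Y) (hcoef Y \<oplus> hcoef Y) (neg2 X) \<oplus>AW neg1 X \<otimes>AW neg1 Y =
   aP (endm X) (\<ominus> hcoef X \<oplus> \<ominus> hcoef X) (neg2 Y) \<ominus>AW aP (endm Y) (\<ominus> hcoef Y \<oplus> \<ominus> hcoef Y) (neg2 X) \<oplus>AW neg1 X \<otimes>AW neg1 Y"
   unfolding h2[OF f(5)] h2[OF f(19)] by (simp_all only: aM aP f V.R.a_closed)
  show "t.aP (endp X) (hcoef X) (pos1 Y) \<ominus>AV t.aP (endp Y) (hcoef Y) (pos1 X) \<oplus>AV cV (neg1 X) (pos2 Y) \<ominus>AV cV (neg1 Y) (pos2 X) =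
   aM (endp X) (\<ominus> hcoef X) (pos1 Y) \<ominus>AV aM (endp Y) (\<ominus> hcoef Y) (pos1 X) \<oplus>AV cV (neg1 X) (pos2 Y) \<ominus>AV cV (neg1 Y) (pos2 X)"
   "t.aM (endm X) (hcoef X) (neg1 Y) \<ominus>AW t.aM (endm Y) (hcoef Y) (neg1 X) \<oplus>AW cW (pos1 X) (neg2 Y) \<ominus>AW cW (pos1 Y) (neg2 X) =
   aP (endm X) (\<ominus> hcoef X) (neg1 Y) \<ominus>AW aP (endm Y) (\<ominus> hcoef Y) (neg1 X) \<oplus>AW cW (pos1 X) (neg2 Y) \<ominus>AW cW (pos1 Y) (neg2 X)"
   by (simp_all only: aM aP f)
 qed (use f e rc in \<open>simp_all add: V.End.smult_l_minus W.End.smult_l_minus V.End.A.flip_regroup(1) W.End.A.flip_regroup(2) V.R.flip_regroup(3)\<close>)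
qed

lemma flip_jac:
 assumes "X \<in> carrier (tilde_E K W V (\<lambda>w v. h v w))" "Y \<in> carrier (tilde_E K W V (\<lambda>w v. h v w))"
  "U \<in> carrier (tilde_E K W V (\<lambda>w v. h v w))" "lie.jac K W V (\<lambda>w v. h v w) X Y U"
 shows "jac (flip_elem X) (flip_elem Y) (flip_elem U)"
proof -
 interpret t: lie K W V "\<lambda>w v. h v w" n c b by (rule lie_swap)
 have "flip_elem (t.br X (t.br Y U)) = flip_elem (t.br (t.br X Y) U \<oplus>\<^bsub>t.L\<^esub> t.br Y (t.br X U))"
  using assms(4) by (simp add: t.jac_def)
 then show ?thesis using assms(1-3) by (simp add: jac_def flip_add flip_br t.br_closed)
qed

section \<open>From homogeneous triples in sorted order to arbitrary elements\<close>

inductive homog :: "int => ('a, 'c, 'e) lie_elem => bool" where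
 "u : pV 6 ==> homog (-2) (N2 u)"
| "m : pV 3 ==> homog (-1) (N1 m)"
| "(A, B) \<in> SP ==> A : LV ==> B : LW ==> a : CK ==> homog 0 (Z0 A B a)"
| "p : pW 3 ==> homog 1 (P1 p)"
| "q : pW 6 ==> homog 2 (P2 q)"

definition hom_set :: "int => ('a, 'c, 'e) lie_elem set" where
 "hom_set d = {X. homog d X}"

lemma hom_setI:
 "u : pV 6 ==> N2 u \<in> hom_set (-2)" "m : pV 3 ==> N1 m \<in> hom_set (-1)"
 "(A, B) \<in> SP ==> a : CK ==> Z0 A B a \<in> hom_set 0"
 "p : pW 3 ==> P1 p \<in> hom_set 1" "q : pW 6 ==> P2 q \<in> hom_set 2"
 by (simp_all add: hom_set_def homog.intros SP_lin)

lemma hom_setE: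
 assumes "X \<in> hom_set d"
 obtains u where "d = -2" "X = N2 u" "u : pV 6"
 | m where "d = -1" "X = N1 m" "m : pV 3"
 | A B a where "d = 0" "X = Z0 A B a" "(A, B) \<in> SP" "A : LV" "B : LW" "a : CK"
 | p where "d = 1" "X = P1 p" "p : pW 3"
 | q where "d = 2" "X = P2 q" "q : pW 6"
 using assms[unfolded hom_set_def mem_Collect_eq] by (cases rule: homog.cases) metis+

lemma hom_set_closed: "X \<in> hom_set d ==> X : CL"
 by (erule hom_setE) (simp_all add: hom_closed)

text \<open>Sorting and the bound on the total degree leave the cases proved above, some of them
  permuted, together with cases of total degree above 2, where every term is zero.\<close>

lemma jac_half:
 assumes X: "X \<in> hom_set i" and Y: "Y \<in> hom_set j" and U: "U \<in> hom_set k" and le: "i \<le> j" "j \<le> k" "0 \<le> i + j + k"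
 shows "jac X Y U"
proof -
 have SS: "jac (Z0 A B a) (N1 m) (P1 p) ==> (A, B) \<in> SP ==> a : CK ==> m : pV 3 ==> p : pW 3 ==> jac (N1 m) (Z0 A B a) (P1 p)"
  "jac (Z0 A B a) (N1 m) (P2 q) ==> (A, B) \<in> SP ==> a : CK ==> m : pV 3 ==> q : pW 6 ==> jac (N1 m) (Z0 A B a) (P2 q)"
  "jac (Z0 A B a) (N2 u) (P2 q) ==> (A, B) \<in> SP ==> a : CK ==> u : pV 6 ==> q : pW 6 ==> jac (N2 u) (Z0 A B a) (P2 q)"
  "jac (P2 q) (N1 m) (N1 m') ==> m : pV 3 ==> m' : pV 3 ==> q : pW 6 ==> jac (N1 m) (N1 m') (P2 q)"
  for A B a m m' p q u
  by (auto intro: jac_swap12 jac_swap23 hom_closed)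
 note J = jac_SSS jac_S_act(1,2) jac_S_act(3)[OF _ _ SP_zero V.R.zero_closed] SS(1)[OF jac_S_m_p]
  SS(2)[OF jac_S_act(4)[OF _ _ SP_zero V.R.zero_closed]] SS(3)[OF jac_S_u_q] SS(4)[OF jac_q_m_m]
  jac_m_p_p jac_u_p_p jac_m_p_q jac_u_p_q jac_u_q_q
 note triv = jac_def br_simps br_hom_zero hom_closed mult33 cW36 aP_rules(2)
 show ?thesis using le
  by (cases rule: hom_setE[OF X]; cases rule: hom_setE[OF Y]; cases rule: hom_setE[OF U])
   (simp_all add: J, simp_all add: triv)
qed

lemma hom_set_flip:
 assumes "X \<in> hom_set d"
 obtains X' where "X' \<in> lie.hom_set K W V (\<lambda>w v. h v w) (- d)" "X = flip_elem X'"
proof -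
 interpret t: lie K W V "\<lambda>w v. h v w" n c b by (rule lie_swap)
 have fl: "flip_elem (t.P2 u) = N2 u" "flip_elem (t.P1 m) = N1 m" "flip_elem (t.N1 p) = P1 p" "flip_elem (t.N2 q) = P2 q"
  "a : CK ==> flip_elem (t.Z0 B A (\<ominus> a)) = Z0 A B a" for u m p q A B a
  by (intro lie_elem_eqI; simp add: flip_elem_def tilde_zero_def)+
 show thesis
 proof (cases rule: hom_setE[OF assms])
  case (1 u) then show ?thesis using that[of "t.P2 u"] t.hom_setI(5) fl by simp
 next
  case (2 m) then show ?thesis using that[of "t.P1 m"] t.hom_setI(4) fl by simp
 next
  case (3 A B a)
  then have "t.Z0 B A (\<ominus> a) \<in> t.hom_set 0" by (intro t.hom_setI) (simp_all add: SP_swap)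
  with 3 show ?thesis using that[of "t.Z0 B A (\<ominus> a)"] fl by simp
 next
  case (4 p) then show ?thesis using that[of "t.N1 p"] t.hom_setI(2) fl by simp
 next
  case (5 q) then show ?thesis using that[of "t.N2 q"] t.hom_setI(1) fl by simp
 qed
qed

lemma jac_sorted:
 assumes X: "X \<in> hom_set i" and Y: "Y \<in> hom_set j" and U: "U \<in> hom_set k" and le: "i \<le> j" "j \<le> k"
 shows "jac X Y U"
proof (cases "0 \<le> i + j + k")
 case True with jac_half assms show ?thesis by blast
next
 case False
 interpret t: lie K W V "\<lambda>w v. h v w" n c b by (rule lie_swap)
 obtain X' where X': "X' \<in> t.hom_set (- i)" "X = flip_elem X'" using hom_set_flip[OF X] .
 obtain Y' where Y': "Y' \<in> t.hom_set (- j)" "Y = flip_elem Y'" using hom_set_flip[OF Y] .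
 obtain U' where U': "U' \<in> t.hom_set (- k)" "U = flip_elem U'" using hom_set_flip[OF U] .
 have c: "X' \<in> carrier t.L" "Y' \<in> carrier t.L" "U' \<in> carrier t.L" using X' Y' U' t.hom_set_closed by auto
 \<comment> \<open>The reversed triple has sorted degrees for the interchanged modules, and its
   total degree is positive.\<close>
 have "t.jac U' Y' X'" by (rule t.jac_half[OF U'(1) Y'(1) X'(1)]) (use le False in auto)
 then have "t.jac X' Y' U'" using c t.jac_swap12 t.jac_swap23 by blast
 then show ?thesis using flip_jac[OF c] X' Y' U' by simp
qed

lemma jac_hom:
 assumes "X \<in> hom_set i" "Y \<in> hom_set j" "U \<in> hom_set k" shows "jac X Y U"
proof -
 note c = assms[THEN hom_set_closed]
 \<comment> \<open>The largest degree stands last; the first two arguments may be exchanged.\<close>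
 have *: "jac A B C" if "A \<in> hom_set i" "B \<in> hom_set j" "C \<in> hom_set k" "i \<le> k" "j \<le> k" for A B C i j k
  using jac_sorted[OF that(1,2,3)] jac_sorted[OF that(2,1,3)] that jac_swap12[OF that(2,1,3)[THEN hom_set_closed]] by force
 consider "i \<le> k \<and> j \<le> k" | "i \<le> j \<and> k \<le> j" | "j \<le> i \<and> k \<le> i" by linarith
 then show ?thesis
 proof cases
  case 1 with * assms show ?thesis by blast
 next
  case 2 then show ?thesis using *[OF assms(1,3,2)] c jac_swap23 by blast
 next
  case 3 then show ?thesis using *[OF assms(2,3,1)] c jac_swap23 jac_swap12 by blast
 qed
qed

lemma L_hom_induct:
 assumes "X : CL" and hom: "!!Y d. Y \<in> hom_set d ==> Q Y"
  and add: "!!Y Y'. Y : CL ==> Y' : CL ==> Q Y ==> Q Y' ==> Q (Y \<oplus>L Y')"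
 shows "Q X"
proof -
 note f = L_fields[OF assms(1)]
 note m = hom_setI(1)[OF f(1)] hom_setI(2)[OF f(2)] hom_setI(3)[OF f(12,5)] hom_setI(4)[OF f(6)] hom_setI(5)[OF f(7)]
 show ?thesis
  by (subst hom_decomp[OF assms(1)]) (intro add m[THEN hom] m[THEN hom_set_closed] L.add.m_closed)
qed

text \<open>Homogeneity is given up one argument at a time. As \<open>jac_add\<close> concerns the
  first argument, each argument is moved there by the permutation rules.\<close>

lemma jac_all:
 assumes c: "X : CL" "Y : CL" "U : CL" shows "jac X Y U"
proof -
 have 1: "jac X Y U" if X: "X : CL" and Y: "Y \<in> hom_set j" and U: "U \<in> hom_set k" for X Y U j k
  by (rule L_hom_induct[where Q = "\<lambda>X. jac X Y U", OF X])
   (erule jac_hom[OF _ Y U], erule (1) jac_add[OF _ _ hom_set_closed[OF Y] hom_set_closed[OF U]])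
 have 2: "jac X Y U" if X: "X : CL" and Y: "Y : CL" and U: "U \<in> hom_set k" for X Y U k
 proof -
  note Uc = hom_set_closed[OF U]
  have "jac Y X U"
  proof (rule L_hom_induct[where Q = "\<lambda>Y. jac Y X U", OF Y])
   fix Y d assume Y: "Y \<in> hom_set d"
   show "jac Y X U" by (rule jac_swap12[OF X hom_set_closed[OF Y] Uc 1[OF X Y U]])
  qed (erule (1) jac_add[OF _ _ X Uc])
  then show ?thesis by (rule jac_swap12[OF Y X Uc])
 qed
 have "jac U X Y"
 proof (rule L_hom_induct[where Q = "\<lambda>U. jac U X Y", OF c(3)])
  fix U d assume U: "U \<in> hom_set d"
  note Uc = hom_set_closed[OF U]
  show "jac U X Y" by (rule jac_swap12[OF c(1) Uc c(2) jac_swap23[OF c(1,2) Uc 2[OF c(1,2) U]]])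
 qed (erule (1) jac_add[OF _ _ c(1,2)])
 then have "jac X U Y" by (rule jac_swap12[OF c(3,1,2)])
 then show ?thesis by (rule jac_swap23[OF c(1,3,2)])
qed

lemma jacobi:
 assumes c: "X : CL" "Y : CL" "U : CL"
 shows "br X (br Y U) \<oplus>L br Y (br U X) \<oplus>L br U (br X Y) = Z"
proof -
 have "br X (br Y U) = br (br X Y) U \<oplus>L br Y (br X U)" using jac_all[OF c] by (simp add: jac_def)
 moreover have "br Y (br U X) = \<ominus>L br Y (br X U)" using c by (simp add: br_skew[of X U] br_neg_r br_closed)
 moreover have "br U (br X Y) = \<ominus>L br (br X Y) U" using c by (simp add: br_skew[of "br X Y" U] br_closed)
 ultimately show ?thesis using c L_simps(2) by (simp add: br_closed L.a_assoc L.r_neg1 L.r_neg2 L.r_neg br_hom_zero)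
qed

end

section \<open>The ideal given by the trace condition\<close>

context lie
begin

abbreviation "LE \<equiv> lie_E K V W h"
abbreviation (input) plus_LE (infixl "\<oplus>LE" 65) where "x \<oplus>LE y \<equiv> x \<oplus>\<^bsub>LE\<^esub> y"
abbreviation (input) minus_LE (infixl "\<ominus>LE" 65) where "x \<ominus>LE y \<equiv> x \<ominus>\<^bsub>LE\<^esub> y"
abbreviation (input) times_LE (infixl "\<otimes>LE" 70) where "x \<otimes>LE y \<equiv> x \<otimes>\<^bsub>LE\<^esub> y"
abbreviation (input) scale_LE (infixl "\<odot>LE" 70) where "x \<odot>LE y \<equiv> x \<odot>\<^bsub>LE\<^esub> y"
abbreviation (input) neg_LE ("\<ominus>LE _" [81] 80) where "\<ominus>LE x \<equiv> \<ominus>\<^bsub>LE\<^esub> x"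
abbreviation (input) zero_LE ("\<zero>LE") where "\<zero>LE \<equiv> \<zero>\<^bsub>LE\<^esub>"
abbreviation (input) one_LE ("\<one>LE") where "\<one>LE \<equiv> \<one>\<^bsub>LE\<^esub>"
abbreviation (input) "CLE \<equiv> carrier LE"

lemma LE_iff: "X \<in> CLE \<longleftrightarrow> X : CL \<and> tr (endp X) \<oplus> [(3::int)] \<cdot>\<^bsub>K\<^esub> hcoef X = \<zero>"
 by (simp add: lie_E_def)

lemma LE_simps: "mult LE = br" "zero LE = Z" "add LE = add L" "smult LE = smult L"
 by (simp_all add: lie_E_def L_simps)

lemma LE_submodule: "submodule (CLE) K L"
proof (rule L.submoduleI')
 show "\<zero>L \<in> CLE"
  using L.zero_closed by (simp add: LE_iff L_simps(2) zero_fields trace_zero int_scale_ops(5)[OF V.R.zero_closed V.R.zero_closed])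
next
 fix X Y assume "X \<in> CLE" "Y \<in> CLE"
 then have XY: "X : CL" "Y : CL" and t: "tr (endp X) \<oplus> [(3::int)] \<cdot>\<^bsub>K\<^esub> hcoef X = \<zero>" "tr (endp Y) \<oplus> [(3::int)] \<cdot>\<^bsub>K\<^esub> hcoef Y = \<zero>"
  by (auto simp: LE_iff)
 note f = L_fields[OF XY(1)] L_fields[OF XY(2)]
 have "tr (endp X \<oplus>EW endp Y) \<oplus> [(3::int)] \<cdot>\<^bsub>K\<^esub> (hcoef X \<oplus> hcoef Y) =
   (tr (endp X) \<oplus> [(3::int)] \<cdot>\<^bsub>K\<^esub> hcoef X) \<oplus> (tr (endp Y) \<oplus> [(3::int)] \<cdot>\<^bsub>K\<^esub> hcoef Y)"
  using f by (simp add: trace_add int_scale_ops(1) V.R.a_ac)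
 then show "X \<oplus>L Y \<in> CLE" using XY t by (simp add: LE_iff add_fields)
next
 fix a X assume a: "a : CK" and "X \<in> CLE"
 then have X: "X : CL" and t: "tr (endp X) \<oplus> [(3::int)] \<cdot>\<^bsub>K\<^esub> hcoef X = \<zero>" by (auto simp: LE_iff)
 note f = L_fields[OF X]
 have "tr (a \<odot>EW endp X) \<oplus> [(3::int)] \<cdot>\<^bsub>K\<^esub> (a \<otimes> hcoef X) = a \<otimes> (tr (endp X) \<oplus> [(3::int)] \<cdot>\<^bsub>K\<^esub> hcoef X)"
  using f a by (simp add: trace_smult int_scale_ops(2) V.R.r_distr)
 then show "a \<odot>L X \<in> CLE" using X t a by (simp add: LE_iff smult_fields)
qed (auto simp: LE_iff)

lemma LE_module: "module K LE"
proof -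
 have "LE = L\<lparr>carrier := CLE\<rparr>" by (simp add: lie_E_def)
 then show ?thesis using submodule.submodule_is_module[OF LE_submodule L_module] by simp
qed

text \<open>Every bracket of the larger algebra satisfies the trace condition: commutators are
  traceless, \<open>E\<close> has trace three times the pairing in front of \<open>h_0\<close>, and
  the scalar part has trace 6 against the coefficient 2 of \<open>h_0\<close>.\<close>

lemma br_LE:
 assumes X: "X : CL" and Y: "Y : CL" shows "br X Y \<in> CLE"
proof -
 note f = L_fields[OF X] L_fields[OF Y]
 note e = E3(1,3)[OF f(2) f(20)] E3(1,3)[OF f(16) f(6)]
 define r where "r = pr (neg2 X) (pos2 Y) \<ominus> pr (neg2 Y) (pos2 X)"
 let ?a = "pr (neg1 X) (pos1 Y)" and ?b = "pr (neg1 Y) (pos1 X)"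
 have rc: "r : CK" "?a : CK" "?b : CK" using f by (simp_all add: r_def)
 have o: "r \<odot>EW \<one>EW \<in> LW" using rc by (simp add: W.End_closed)
 have cm: "endp X \<otimes>EW endp Y \<ominus>EW endp Y \<otimes>EW endp X : LW" using f by (simp add: W.End_closed)
 have t0: "tr (endp X \<otimes>EW endp Y \<ominus>EW endp Y \<otimes>EW endp X) = \<zero>"
  using f by (simp add: trace_minus W.End_closed trace_comm[of "endp X" "endp Y"] V.R.minus_eq V.R.r_neg)
 have six': "r \<otimes> [(6::int)] \<cdot>\<^bsub>K\<^esub> \<one> = [(3::int)] \<cdot>\<^bsub>K\<^esub> (r \<oplus> r)"
  using int_scale_ops(2)[of \<one> r 6] rc six[OF rc(1)] int_scale_ops(8)[of "r \<oplus> r"] by simp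
 have z: "\<ominus> a \<oplus> d \<ominus> s \<oplus> (a \<ominus> d \<oplus> s) = \<zero>" if "a : CK" "d : CK" "s : CK" for a d s
 proof -
  have "\<ominus> a \<oplus> d \<ominus> s \<oplus> (a \<ominus> d \<oplus> s) = (a \<oplus> \<ominus> a) \<oplus> ((d \<oplus> \<ominus> d) \<oplus> (s \<oplus> \<ominus> s))" using that by (simp add: V.R.minus_eq V.R.a_ac)
  then show ?thesis using that by (simp add: V.R.r_neg)
 qed
 have "tr (endp (br X Y)) = \<ominus> ([(3::int)] \<cdot>\<^bsub>K\<^esub> ?a) \<oplus> [(3::int)] \<cdot>\<^bsub>K\<^esub> ?b \<ominus> [(3::int)] \<cdot>\<^bsub>K\<^esub> (r \<oplus> r)"
  unfolding br_fields[OF X Y] r_def[symmetric] using f e o cm rc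
  by (simp add: trace_minus trace_add W.End_closed t0 E_trace trace_smult tr_id_W six' V.R.minus_eq)
 moreover have "[(3::int)] \<cdot>\<^bsub>K\<^esub> hcoef (br X Y) = [(3::int)] \<cdot>\<^bsub>K\<^esub> ?a \<ominus> [(3::int)] \<cdot>\<^bsub>K\<^esub> ?b \<oplus> [(3::int)] \<cdot>\<^bsub>K\<^esub> (r \<oplus> r)"
  unfolding br_fields[OF X Y] r_def[symmetric] using rc by (simp add: V.R.minus_eq int_scale_ops(1,3))
 ultimately show ?thesis using br_closed[OF X Y] z rc by (simp add: LE_iff)
qed

lemma LE_lie_algebra: "lie_algebra K LE"
 unfolding lie_algebra_def LE_simps
 using LE_module br_LE br_add_l br_add_r br_smult_l br_smult_r br_alternating jacobi by (simp add: LE_iff)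

end

section \<open>Weights relative to the pair of vectors e\<close>

locale lie_pair = lie K V W h n b c for K (structure) and V and W and h :: "'c => 'e => 'a" and n b c +
 fixes em ep
 assumes em: "em : CV" and ep: "ep : CW" and h_e: "h em ep = \<one>"
begin

lemma lie_pair_swap: "lie_pair K W V (\<lambda>w v. h v w) n c b ep em"
 by (intro lie_pair.intro lie_swap lie_pair_axioms.intro em ep h_e)

abbreviation "P \<equiv> rk em ep"
abbreviation "e1 \<equiv> gW ep"
abbreviation "de \<equiv> dW em"

text \<open>The grading elements: \<open>wt j x\<close> says that \<open>x\<close> is homogeneous of degree \<open>j\<close> with respect to the number
 of factors \<open>ep\<close>, and \<open>sw d B\<close> that \<open>B\<close> raises this degree by \<open>d\<close>; \<open>P\<close> is the projection onto \<open>K ep\<close>.\<close>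

definition wt :: "int => ('a, 'e) ext => bool" where
 "wt j x \<longleftrightarrow> (if j = 0 then de x = \<zero>AW else if j = 1 then e1 \<otimes>AW x = \<zero>AW else x = \<zero>AW)"

definition sw :: "int => ('e => 'e) => bool" where
 "sw d B \<longleftrightarrow> (if d = 0 then P \<otimes>EW B = B \<otimes>EW P
  else if d = 1 then P \<otimes>EW B = B \<and> B \<otimes>EW P = \<zero>EW
  else if d = -1 then P \<otimes>EW B = \<zero>EW \<and> B \<otimes>EW P = B else B = \<zero>EW)"

lemma P_lin: "P : LW" and P_closed: "P : YW"
 using rank1_lin[OF em ep] by (simp_all add: W.End_simps(1))

lemma P_idem: "P \<otimes>EW P = P"
 by (rule W.End_eqI) (use em ep h_e in \<open>simp_all add: P_lin W.End_closed W.End_simps h_smult_r\<close>)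

lemma e1_closed [simp]: "e1 : XW" using ep by simp

lemma de_e1: "x : XW ==> de (e1 \<otimes>AW x) = x \<ominus>AW e1 \<otimes>AW de x"
 using dW_gen_mult[OF em ep] h_e by simp

lemma e1_e1: "x : XW ==> e1 \<otimes>AW (e1 \<otimes>AW x) = \<zero>AW"
 using W.gen_square[OF ep] by (simp flip: W.A.A.m_assoc)

lemma de_closed [simp]: "x : XW ==> de x : XW"
 using dW_closed em by simp

text \<open>Contraction by \<open>em\<close> and multiplication by \<open>ep\<close> satisfy
  \<open>de e1 + e1 de = 1\<close>, so \<open>e1 de\<close> and \<open>de e1\<close> are
  complementary idempotents, the first being the derivation of \<open>P\<close>. The weights 0 and 1
  are their kernels.\<close>

lemma wt_D:
 assumes "x : XW"
 shows "wt 0 x \<longleftrightarrow> W.D P x = \<zero>AW" "wt 1 x \<longleftrightarrow> W.D P x = x"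
proof -
 have D: "W.D P x = e1 \<otimes>AW de x" using D_rank1[of x em ep] em ep assms by simp
 have "de (e1 \<otimes>AW de x) = de x" using assms em by (simp add: de_e1 dW_square dW_linear W.A.A.minus_eq)
 then show "wt 0 x \<longleftrightarrow> W.D P x = \<zero>AW" using assms em D by (auto simp: wt_def dW_linear)
 have "x \<ominus>AW e1 \<otimes>AW de x = \<zero>AW" if "wt 1 x" using de_e1[OF assms] that em by (simp add: wt_def dW_linear)
 then have "wt 1 x ==> x = W.D P x" using W.A.A.minus_zero_iff assms D by simp
 moreover have "W.D P x = x ==> wt 1 x" using assms D e1_e1[of "de x"] by (simp add: wt_def)
 ultimately show "wt 1 x \<longleftrightarrow> W.D P x = x" by auto
qed

lemma wt_1_factor: "x : XW ==> wt 1 x ==> x = e1 \<otimes>AW de x"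
 using wt_D(2)[of x] D_rank1[of x em ep] em ep by simp

lemma wt_zero [simp]: "wt j \<zero>AW"
 by (simp add: wt_def em dW_linear)

lemma wt_neg: "x : XW ==> wt j x ==> wt j (\<ominus>AW x)"
 by (auto simp: wt_def em dW_linear W.A.A.r_minus)

lemma wt_add: "x : XW ==> y : XW ==> wt j x ==> wt j y ==> wt j (x \<oplus>AW y)"
 by (auto simp: wt_def em dW_linear W.A.A.r_distr)

lemma wt_smult: "x : XW ==> a : CK ==> wt j x ==> wt j (a \<odot>AW x)"
 by (auto simp: wt_def em dW_linear W.A.smult_mult_r)

lemma wt_minus: "x : XW ==> y : XW ==> wt j x ==> wt j y ==> wt j (x \<ominus>AW y)"
 unfolding W.A.A.minus_eq by (simp add: wt_add wt_neg)

text \<open>Multiplication by \<open>ep\<close> would lead to degree seven. This places first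
  degrees 2 and -2 in second degrees 1 and -1.\<close>

lemma wt_top: "q : pW 6 ==> wt 1 q"
 by (simp add: wt_def top_gen_W ep)

lemma wt_top_iff: "q : pW 6 ==> wt j q \<longleftrightarrow> j = 1 \<or> q = \<zero>AW"
 using wt_top[of q] wt_D[OF W.ext_pow_closed[of q 6]] by (cases "j = 0") (auto simp: wt_def dW_linear em)

lemma sw_zero [simp]: "sw d \<zero>EW"
 using P_closed by (simp add: sw_def)

lemma sw_ops:
 assumes "B : YW" "sw d B"
 shows sw_neg: "sw d (\<ominus>EW B)" and sw_smult: "a : CK ==> sw d (a \<odot>EW B)"
  and sw_add: "B' : YW ==> sw d B' ==> sw d (B \<oplus>EW B')"
 using assms P_closed by (auto simp: sw_def W.End.A.l_minus W.End.A.r_minus W.End.smult_mult_l W.End.smult_mult_r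
   W.End.A.l_distr W.End.A.r_distr)

lemma sw_minus: "B : YW ==> B' : YW ==> sw d B ==> sw d B' ==> sw d (B \<ominus>EW B')"
 unfolding W.End.A.minus_eq by (simp add: sw_add sw_neg)

lemma sw_one: "sw 0 \<one>EW"
 using P_closed by (simp add: sw_def)

text \<open>Already the associative product adds degrees. When the inner sides of two factors do not
  match, as for two factors of degree 1, inserting \<open>P\<close> between them shows that their
  product is zero.\<close>

lemma sw_comm:
 assumes l: "B : YW" "B' : YW" and s: "sw d B" "sw d' B'"
 shows "sw (d + d') (B \<otimes>EW B' \<ominus>EW B' \<otimes>EW B)"
proof -
 note c = l P_closed and ds = W.End.A.minus_eq W.End.A.l_distr W.End.A.r_distr W.End.A.l_minus W.End.A.r_minus
 have mult: "sw (d + d') (B \<otimes>EW B')" if l: "B : YW" "B' : YW" and s: "sw d B" "sw d' B'" for d d' B B'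
 proof -
  note c = l P_closed
  have a: "P \<otimes>EW (B \<otimes>EW B') = (P \<otimes>EW B) \<otimes>EW B'" "(B \<otimes>EW B') \<otimes>EW P = B \<otimes>EW (B' \<otimes>EW P)"
   "(B \<otimes>EW P) \<otimes>EW B' = B \<otimes>EW (P \<otimes>EW B')" using c by (simp_all add: W.End.A.m_assoc)
  have dd: "d = 0 \<or> d = 1 \<or> d = -1 \<or> B = \<zero>EW" "d' = 0 \<or> d' = 1 \<or> d' = -1 \<or> B' = \<zero>EW"
   using s by (auto simp: sw_def split: if_splits)
  have z: "B \<otimes>EW B' = \<zero>EW" if "B \<otimes>EW P = \<zero>EW \<and> P \<otimes>EW B' = B' \<or> B \<otimes>EW P = B \<and> P \<otimes>EW B' = \<zero>EW"
   using that a(3) c by auto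
  show ?thesis
  proof (cases "B = \<zero>EW \<or> B' = \<zero>EW")
   case True
   then show ?thesis using c by auto
  next
   case False
   with dd have "d = 0 \<or> d = 1 \<or> d = -1" "d' = 0 \<or> d' = 1 \<or> d' = -1" by auto
   then show ?thesis using s z c a by (elim disjE; simp add: sw_def)
  qed
 qed
 show ?thesis using mult[OF l s] mult[OF l(2,1) s(2,1)] l by (intro sw_minus) (simp_all add: add.commute)
qed

end

context lie_pair
begin

abbreviation "wtV \<equiv> lie_pair.wt K V (\<lambda>w v. h v w) ep em"
abbreviation "swV \<equiv> lie_pair.sw K V (\<lambda>w v. h v w) ep em"

text \<open>A map into the line of \<open>ep\<close> is determined by the functional
  \<open>h em (B w)\<close>, which is the pairing with \<open>- A em\<close>. This functional
  vanishes at \<open>ep\<close> because \<open>B\<close> kills the line.\<close>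

lemma sw_1_form:
 assumes S: "(A, B) \<in> SP" and s: "sw 1 B"
 shows "B = rk (\<ominus>V A em) ep" "h (\<ominus>V A em) ep = \<zero>"
proof -
 note l = SP_lin[OF S] and cl = SP_lin[OF S, THEN lin_maps_closed]
 have 1: "P \<otimes>EW B = B" "B \<otimes>EW P = \<zero>EW" using s by (simp_all add: sw_def)
 have h: "h (\<ominus>V A em) w = h em (B w)" if "w : CW" for w
  using SP_adj[OF S em that] em that cl by (simp add: h_neg_l)
 show "B = rk (\<ominus>V A em) ep"
 proof (rule W.End_eqI[OF l(2) rank1_lin])
  fix w assume w: "w : CW"
  have "B w = (P \<otimes>EW B) w" using 1 by simp
  then show "B w = rk (\<ominus>V A em) ep w" using w cl h by (simp add: W.End_simps)
 qed (use em ep cl in simp_all)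
 have "(B \<otimes>EW P) ep = B ep" using ep em h_e cl by (simp add: W.End_simps)
 then have "B ep = \<zero>W" using 1 ep by (simp add: W.End_simps)
 then show "h (\<ominus>V A em) ep = \<zero>" using h[OF ep] em by simp
qed

lemma sw_m1_form:
 assumes l: "B : LW" and s: "sw (-1) B"
 shows "B = rk em (B ep)" "h em (B ep) = \<zero>"
proof -
 note cl = lin_maps_closed[OF l]
 have 1: "P \<otimes>EW B = \<zero>EW" "B \<otimes>EW P = B" using s by (simp_all add: sw_def)
 show "B = rk em (B ep)"
 proof (rule W.End_eqI[OF l rank1_lin])
  fix w assume w: "w : CW"
  have "B w = (B \<otimes>EW P) w" using 1 by simp
  then show "B w = rk em (B ep) w" using w cl em ep lin_maps_smult[OF l] by (simp add: W.End_simps)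
 qed (use em ep cl in simp_all)
 have "(P \<otimes>EW B) ep = h em (B ep) \<odot>W ep" using ep em cl by (simp add: W.End_simps)
 then have "h em (B ep) \<odot>W ep = \<zero>W" using 1 ep by (simp add: W.End_simps)
 then have "h em (h em (B ep) \<odot>W ep) = \<zero>" using em by simp
 then show "h em (B ep) = \<zero>" using em ep cl h_e by (simp add: h_smult_r)
qed

text \<open>In degree 0 the derivations of \<open>P\<close> and \<open>B\<close> commute. In degrees
  1 and -1 the map \<open>B\<close> has rank one, with vector \<open>ep\<close> or with functional
  \<open>h em\<close>; \<open>D_rank1\<close> then exhibits a factor \<open>e1\<close> or a
  contraction \<open>de\<close>, which fixes the weight of the result.\<close>

lemma D_wt:
 assumes S: "(A, B) \<in> SP" and s: "sw d B" and x: "x : XW" and w: "wt j x"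
 shows "wt (d + j) (W.D B x)"
proof -
 note l = SP_lin[OF S] and cl = SP_lin[OF S, THEN lin_maps_closed]
 consider "x = \<zero>AW" | "B = \<zero>EW" | "j \<in> {0, 1}" "d = 0" | "j \<in> {0, 1}" "d = 1" | "j \<in> {0, 1}" "d = -1"
  using s w by (auto simp: sw_def wt_def split: if_splits)
 then show ?thesis
 proof cases
  case 1 then show ?thesis using W.D_linear[OF l(2)] by simp
 next
  case 2 then show ?thesis using W.D_End_zero[OF x W.End_closed(7) W.End_closed(7)] by simp
 next
  case 3
  have "W.D (P \<otimes>EW B \<ominus>EW B \<otimes>EW P) x = \<zero>AW"
   using s 3 l P_closed W.D_End_zero[OF x W.End_closed(7) W.End_closed(7)] by (simp add: sw_def W.End.A.minus_eq W.End.A.r_neg W.End_simps(1) W.End_closed)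
  then have "W.D P (W.D B x) = W.D B (W.D P x)"
   using W.D_End_comm[OF x P_lin l(2)] W.A.A.minus_zero_iff P_lin l x by simp
  then show ?thesis using 3 w wt_D[OF x] wt_D[of "W.D B x"] W.D_linear[OF l(2)] l x by auto
 next
  case 4
  have D: "W.D B x = e1 \<otimes>AW dW (\<ominus>V A em) x" using s 4 by (subst sw_1_form(1)[OF S]) (use x em ep cl in \<open>simp_all add: D_rank1\<close>)
  have "wt 1 (W.D B x)" unfolding D using x em cl by (simp add: wt_def e1_e1)
  moreover have "W.D B x = \<zero>AW" if "wt 1 x"
  proof -
   \<comment> \<open>The functional vanishes at \<open>ep\<close>, so contracting
     \<open>e1 x = 0\<close> leaves only \<open>e1\<close> times the contraction of
     \<open>x\<close>, which is \<open>D B x\<close>.\<close>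
   have "h (\<ominus>V A em) ep \<odot>AW x \<ominus>AW e1 \<otimes>AW dW (\<ominus>V A em) x = \<zero>AW"
    using dW_gen_mult[of "\<ominus>V A em" ep x] that em ep x cl by (simp add: wt_def dW_linear)
   then show ?thesis unfolding D using sw_1_form(2)[OF S] s 4 x em cl W.A.A.minus_zero_iff by simp
  qed
  ultimately show ?thesis using 4 w by auto
 next
  case 5
  have D: "W.D B x = gW (B ep) \<otimes>AW de x" using s 5 by (subst sw_m1_form(1)[OF l(2)]) (use x em ep cl in \<open>simp_all add: D_rank1\<close>)
  have "wt 0 (W.D B x)" unfolding D using x em ep cl sw_m1_form(2)[OF l(2)] s 5
   by (simp add: wt_def dW_gen_mult dW_square W.A.A.minus_eq)
  moreover have "W.D B x = \<zero>AW" if "wt 0 x" unfolding D using that ep cl by (simp add: wt_def)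
  ultimately show ?thesis using 5 w by auto
 qed
qed

text \<open>Two factors of weight 0 have a product of weight 0, which in degree six has weight 1 as
  well and is zero. Two factors of weight 1 both contain \<open>ep\<close>.\<close>

lemma mult_wt:
 assumes x: "x : pW 3" "y : pW 3" and w: "wt j x" "wt k y"
 shows "wt (j + k) (x \<otimes>AW y)"
proof -
 note c = x[THEN W.ext_pow_closed]
 have "x \<otimes>AW y = \<zero>AW" if "j = 0" "k = 0"
 proof -
  have "de (x \<otimes>AW y) = \<zero>AW" using that w c em by (simp add: dW_mult wt_def)
  then have "wt 0 (x \<otimes>AW y)" by (simp add: wt_def)
  then show ?thesis using wt_top_iff[OF mult33[OF x]] by simp
 qed
 moreover have "x \<otimes>AW y = \<zero>AW" if "j = 1" "k = 1"
 proof -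
  have "x \<otimes>AW y = (e1 \<otimes>AW de x) \<otimes>AW y" using wt_1_factor[OF c(1)] w that by simp
  also have "\<dots> = W.alpha (de x) \<otimes>AW (e1 \<otimes>AW y)" using c ep by (simp add: W.gen_commute W.A.A.m_assoc)
  finally show ?thesis using w that c by (simp add: wt_def)
 qed
 moreover have "x = \<zero>AW \<or> j = 0 \<or> j = 1" "y = \<zero>AW \<or> k = 0 \<or> k = 1" using w by (auto simp: wt_def split: if_splits)
 ultimately show ?thesis using wt_top_iff[OF mult33[OF x]] c by (elim disjE) auto
qed

text \<open>If \<open>m\<close> has weight 0, multiplication by \<open>ep\<close> passes through the
  contraction up to sign and kills the top element. If \<open>m\<close> has weight 1, a further
  contraction by \<open>em\<close> amounts to contracting by \<open>em m = 0\<close>.\<close>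

lemma contract_wt:
 assumes m: "m : pV 3" and q: "q : pW 6" and w: "wtV j m"
 shows "wt (1 - j) (cW m q)"
proof -
 interpret t: lie_pair K W V "\<lambda>w v. h v w" n c b ep em by (rule lie_pair_swap)
 note cl = V.ext_pow_closed[OF m] W.ext_pow_closed[OF q]
 consider "m = \<zero>AV" | "j = 0" | "j = 1" using w by (auto simp: t.wt_def split: if_splits)
 then show ?thesis
 proof cases
  case 1 then show ?thesis using cl by (simp add: cW_linear_l)
 next
  case 2
  then have "cW (dV ep m) q = \<zero>AW" using w cl by (simp add: t.wt_def cW_linear_l)
  then show ?thesis using contract_contract1[OF cl(1) ep cl(2)] top_gen_W[OF q ep] 2 cl
   by (simp add: wt_def cW_linear_r W.A.A.minus_eq)
 next
  case 3
  then have "cW (gV em \<otimes>AV m) q = \<zero>AW" using w cl by (simp add: t.wt_def cW_linear_l)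
  then show ?thesis using 3 cl em by (simp add: wt_def cW_linear_l)
 qed
qed

text \<open>The factor \<open>em\<close> of \<open>m\<close> is moved to the right, where it
  contracts \<open>p\<close> before the others do.\<close>

lemma contract_zero:
 assumes m: "m : XV" and p: "p : XW" and w: "wtV 1 m" "wt 0 p"
 shows "cW m p = \<zero>AW"
proof -
 interpret t: lie_pair K W V "\<lambda>w v. h v w" n c b ep em by (rule lie_pair_swap)
 have "m = gV em \<otimes>AV dV ep m" using t.wt_1_factor[OF m w(1)] .
 then have "cW m p = cW (V.alpha (dV ep m) \<otimes>AV gV em) p" using m em by (simp add: V.gen_commute)
 also have "\<dots> = cW (V.alpha (dV ep m)) (de p)" using m p em ep by (simp add: cW_linear_l)
 finally show ?thesis using w m by (simp add: wt_def cW_linear_r)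
qed

lemma pr_wt:
 assumes m: "m : pV l" and p: "p : pW l" and w: "wtV j m" "wt k p" and ne: "j \<noteq> k"
 shows "pr m p = \<zero>"
proof -
 interpret t: lie_pair K W V "\<lambda>w v. h v w" n c b ep em by (rule lie_pair_swap)
 note cl = V.ext_pow_closed[OF m] W.ext_pow_closed[OF p]
 consider "m = \<zero>AV" | "p = \<zero>AW" | "j = 1" "k = 0" | "j = 0" "k = 1"
  using w ne by (auto simp: t.wt_def wt_def split: if_splits)
 then show ?thesis
 proof cases
  case 3 then show ?thesis using contract_zero[OF cl] w by simp
 next
  case 4
  then have "cV p m = \<zero>AV" using t.contract_zero[OF cl(2,1)] w by simp
  then show ?thesis using pairing_sym[OF m p] by simp
 qed (use cl in \<open>simp_all add: cW_linear_l cW_linear_r\<close>)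
qed

text \<open>Adjoints reverse products: multiplying \<open>B\<close> by \<open>P\<close> on one side
  corresponds to multiplying \<open>A\<close> by the projection of \<open>V\<close> on the other
  side. Degree \<open>d\<close> thus turns into \<open>- d\<close>.\<close>

lemma sw_adj:
 assumes S: "(A, B) \<in> SP"
 shows "(A \<otimes>EV s.rk ep em, P \<otimes>EW B) \<in> SP" "(s.rk ep em \<otimes>EV A, B \<otimes>EW P) \<in> SP"
  "sw d B \<longleftrightarrow> swV (- d) A"
proof -
 interpret t: lie_pair K W V "\<lambda>w v. h v w" n c b ep em by (rule lie_pair_swap)
 note l = SP_lin[OF S] and cl = SP_lin[OF S, THEN lin_maps_closed]
 show 1: "(A \<otimes>EV s.rk ep em, P \<otimes>EW B) \<in> SP"
  by (rule SPI) (use l cl em ep P_lin t.P_lin SP_adj[OF S] in \<open>simp_all add: V.End_closed W.End_closed V.End_simps W.End_simps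
   h_smult_l h_smult_r lin_maps_smult[OF l(1)] V.R.m_comm V.R.r_minus V.R.l_minus\<close>)
 show 2: "(s.rk ep em \<otimes>EV A, B \<otimes>EW P) \<in> SP"
  by (rule SPI) (use l cl em ep P_lin t.P_lin SP_adj[OF S] in \<open>simp_all add: V.End_closed W.End_closed V.End_simps W.End_simps
   h_smult_l h_smult_r lin_maps_smult[OF l(2)] V.R.m_comm V.R.r_minus V.R.l_minus\<close>)
 have eq: "X = X' \<longleftrightarrow> Y = Y'" if "(X, Y) \<in> SP" "(X', Y') \<in> SP" for X X' Y Y'
  using that SP_unique t.SP_unique SP_swap by metis
 note E = eq[OF 1 2] eq[OF 1 S] eq[OF 2 S] eq[OF 1 SP_zero] eq[OF 2 SP_zero] eq[OF S SP_zero]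
 show "sw d B \<longleftrightarrow> swV (- d) A"
  unfolding sw_def t.sw_def E[symmetric] by auto
qed

text \<open>For equal weights, equivariance under \<open>P\<close> and minus its adjoint makes
  \<open>E\<close> commute with \<open>P\<close>. For \<open>m\<close> of weight 0 and
  \<open>p\<close> of weight 1, the image lies in the line of \<open>ep\<close>, and
  \<open>ep\<close> is killed. For the opposite weights, the image has no component along
  \<open>ep\<close>, and all vectors orthogonal to \<open>em\<close> are killed.\<close>

lemma E_wt:
 assumes m: "m : pV 3" and p: "p : pW 3" and w: "wtV j m" "wt k p"
 shows "sw (k - j) (E p m)"
proof -
 interpret t: lie_pair K W V "\<lambda>w v. h v w" n c b ep em by (rule lie_pair_swap)
 note cl = V.ext_pow_closed[OF m] W.ext_pow_closed[OF p] and l = E3(1)[OF m p]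
 have Eg: "E p m w : CW" "gW (E p m w) = cW (dV w m) p" if "w : CW" for w
  using E_closed[of m 2 p w] E_gen[of m 2 p w] m p that by simp_all
 consider "m = \<zero>AV \<or> p = \<zero>AW" | "j = k" "j \<in> {0, 1}" | "j = 0" "k = 1" | "j = 1" "k = 0"
  using w by (auto simp: t.wt_def wt_def split: if_splits)
 then show ?thesis
 proof cases
  case 1
  then have "E p m = \<zero>EW" using E3_zero m p by metis
  then show ?thesis by simp
 next
  case 2
  have S: "(\<ominus>EV s.rk ep em, P) \<in> SP"
   by (rule SPI) (use em ep t.P_lin P_lin in \<open>simp_all add: V.End_neg V.End_closed h_smult_l h_smult_r h_neg_l V.R.m_comm\<close>)
  have a0: "V.D (\<ominus>EV s.rk ep em) m = \<ominus>AV V.D (s.rk ep em) m" using V.D_End_neg[OF cl(1) t.P_lin t.P_lin] .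
  have "aP P \<zero> p = (if k = 0 then \<zero>AW else p)" using 2 w wt_D[OF cl(2)] P_lin cl by (cases "k = 0") (simp_all add: aP_def)
  moreover have "aM (\<ominus>EV s.rk ep em) \<zero> m = (if k = 0 then \<zero>AV else \<ominus>AV m)"
   using 2 w t.wt_D[OF cl(1)] t.P_lin cl by (cases "k = 0") (simp_all add: aM_def a0 V.A.A.minus_eq)
  moreover have "E p (\<ominus>AV m) = \<ominus>EW E p m" using E3(10)[OF m p, of "\<ominus> \<one>"] cl E3(3)[OF m p]
   by (simp add: V.A.smult_l_minus W.End.smult_l_minus)
  ultimately have "P \<otimes>EW E p m \<ominus>EW E p m \<otimes>EW P = \<zero>EW"
   using E_act[OF S V.R.zero_closed p m] E3_zero m p E3(3)[OF m p] by (cases "k = 0") (simp_all add: W.End.A.r_neg)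
  then have "P \<otimes>EW E p m = E p m \<otimes>EW P" using P_closed E3(3)[OF m p] W.End.A.minus_zero_iff by simp
  then show ?thesis using 2 by (simp add: sw_def)
 next
  case 3
  then have dm: "dV ep m = \<zero>AV" and ex: "e1 \<otimes>AW p = \<zero>AW" using w by (simp_all add: t.wt_def wt_def)
  have "gW (E p m ep) = gW \<zero>W" using Eg[OF ep] dm cl by (simp add: cW_linear_l W.gen_zero)
  then have E0: "E p m ep = \<zero>W" using gen_inj Eg(1)[OF ep] by (metis W.zero_closed)
  \<comment> \<open>Multiplication by \<open>ep\<close> annihilates \<open>E p m w\<close>, so this
    vector has weight 1, and in degree 1 this means a multiple of \<open>ep\<close>.\<close>
  have "h em (E p m w) \<odot>W ep = E p m w" if w: "w : CW" for w
  proof -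
   have "dV ep (dV w m) = \<zero>AV" using s.dW_anticomm[of m ep w] dm cl ep w by (simp add: s.dW_linear)
   then have "e1 \<otimes>AW gW (E p m w) = \<zero>AW"
    using contract_contract1[of "dV w m" ep p] Eg[OF w] cl w ep ex by (simp add: cW_linear_l cW_linear_r W.A.A.minus_eq)
   then have "gW (E p m w) = e1 \<otimes>AW de (gW (E p m w))" using wt_1_factor[of "gW (E p m w)"] Eg[OF w] cl w by (simp add: wt_def)
   also have "\<dots> = gW (h em (E p m w) \<odot>W ep)" using Eg(1)[OF w] em ep by (simp add: dW_gen W.gen_smult W.A.smult_mult_r)
   finally show ?thesis using gen_inj Eg(1)[OF w] em ep by (metis W.smult_closed h_closed)
  qed
  then have "P \<otimes>EW E p m = E p m" by (intro W.End_eqI) (use l P_lin Eg in \<open>simp_all add: W.End_closed W.End_simps\<close>)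
  moreover have "E p m \<otimes>EW P = \<zero>EW"
   by (rule W.End_eqI[OF W.End_closed(2)[OF l P_lin] W.End_closed(7)]) (use l P_lin E0 em ep lin_maps_smult[OF l] in \<open>simp_all add: W.End_closed W.End_simps\<close>)
  ultimately show ?thesis using 3 by (simp add: sw_def)
 next
  case 4
  then have em0: "gV em \<otimes>AV m = \<zero>AV" and de0: "de p = \<zero>AW" and w01: "wtV 1 m" "wt 0 p" using w by (simp_all add: t.wt_def wt_def)
  have mp: "cW m p = \<zero>AW" using contract_zero[OF cl w01] .
  \<comment> \<open>The relation \<open>em m = 0\<close> contracted by \<open>w\<close>.\<close>
  have gm: "gV em \<otimes>AV dV w m = h em w \<odot>AV m" if w: "w : CW" for w
  proof -
   have "h em w \<odot>AV m \<ominus>AV gV em \<otimes>AV dV w m = \<zero>AV" using s.dW_gen_mult[OF w em cl(1)] em0 w by (simp add: s.dW_linear)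
   then show ?thesis using V.A.A.minus_zero_iff cl em w by simp
  qed
  have PE: "h em (E p m w) = \<zero>" if w: "w : CW" for w
  proof -
   have "h em (E p m w) \<odot>AW \<one>AW = cW (gV em \<otimes>AV dV w m) p"
    using Eg[OF w] em w cl dW_gen[OF em Eg(1)[OF w]] by (simp add: cW_linear_l)
   also have "\<dots> = \<zero>AW" using gm[OF w] mp cl em w by (simp add: cW_linear_l)
   finally have "W.counit (h em (E p m w) \<odot>AW \<one>AW) = W.counit \<zero>AW" by (rule arg_cong)
   then show ?thesis using Eg[OF w] em by simp
  qed
  have EU: "E p m w = \<zero>W" if w: "w : CW" and hw: "h em w = \<zero>" for w
  proof -
   have "wtV 1 (dV w m)" using gm[OF w] hw cl by (simp add: t.wt_def)
   then have "gW (E p m w) = gW \<zero>W" using contract_zero[of "dV w m" p] Eg[OF w] w cl w01 by (simp add: W.gen_zero)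
   then show ?thesis using gen_inj Eg(1)[OF w] by (metis W.zero_closed)
  qed
  have "E p m (h em w \<odot>W ep) = E p m w" if w: "w : CW" for w
  proof -
   have k: "h em w \<odot>W ep : CW" using w em ep by simp
   have "E p m (w \<ominus>W h em w \<odot>W ep) = \<zero>W"
    by (rule EU) (use w em ep h_e in \<open>simp_all add: W.M.minus_eq h_add_r h_neg_r h_smult_r V.R.r_neg\<close>)
   then have "E p m w \<ominus>W E p m (h em w \<odot>W ep) = \<zero>W" using w k by (simp add: lin_maps_minus[OF W.abelian_group_axioms W.abelian_group_axioms l])
   then show ?thesis using W.M.minus_zero_iff Eg(1) w k by metis
  qed
  then have "E p m \<otimes>EW P = E p m" by (intro W.End_eqI) (use l P_lin Eg in \<open>simp_all add: W.End_closed W.End_simps\<close>)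
  moreover have "P \<otimes>EW E p m = \<zero>EW"
   by (rule W.End_eqI[OF W.End_closed(2)[OF P_lin l] W.End_closed(7)]) (use l P_lin Eg PE ep in \<open>simp_all add: W.End_closed W.End_simps\<close>)
  ultimately show ?thesis using 4 by (simp add: sw_def)
 qed
qed

end

context abelian_group
begin

text \<open>Additive projections that fix their own set, kill the others and sum to the identity
  yield a decomposition; applied to any other decomposition they recover its members, which gives
  uniqueness.\<close>

lemma ex1_family:
 fixes C :: "'i => 'a set" and p :: "'i => 'a => 'a"
 assumes C: "!!i. C i \<subseteq> carrier G" "!!i. \<zero> \<in> C i" and p: "!!i x. x \<in> carrier G ==> p i x \<in> C i"
  and add: "!!i x y. x \<in> carrier G ==> y \<in> carrier G ==> p i (x \<oplus> y) = p i x \<oplus> p i y"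
  and same: "!!i x. x \<in> C i ==> p i x = x" and other: "!!i k x. x \<in> C k ==> i \<noteq> k ==> p i x = \<zero>"
  and I: "finite I" "!!i. i \<notin> I ==> C i = {\<zero>}" and sum: "(\<Oplus>i\<in>I. p i x) = x" and x: "x \<in> carrier G"
 shows "\<exists>!f. (\<forall>i. f i \<in> C i) \<and> finite {i. f i \<noteq> \<zero>} \<and> x = (\<Oplus>i\<in>{i. f i \<noteq> \<zero>}. f i)"
proof (rule ex1I[of _ "\<lambda>i. p i x"])
 have cl: "p i x \<in> carrier G" for i using p[OF x] C(1) by blast
 have sub: "{i. p i x \<noteq> \<zero>} \<subseteq> I" using p[OF x] I(2) by blast
 have "(\<Oplus>i\<in>{i. p i x \<noteq> \<zero>}. p i x) = (\<Oplus>i\<in>I. p i x)"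
  by (rule add.finprod_mono_neutral_cong_left[OF I(1) sub]) (use cl in auto)
 then show "(\<forall>i. p i x \<in> C i) \<and> finite {i. p i x \<noteq> \<zero>} \<and> x = (\<Oplus>i\<in>{i. p i x \<noteq> \<zero>}. p i x)"
  using sum p[OF x] finite_subset[OF sub I(1)] by simp
next
 fix f assume f: "(\<forall>i. f i \<in> C i) \<and> finite {i. f i \<noteq> \<zero>} \<and> x = (\<Oplus>i\<in>{i. f i \<noteq> \<zero>}. f i)"
 then have fc: "f i \<in> carrier G" for i using C(1) by blast
 have S: "p i (\<Oplus>k\<in>S. f k) = (if i \<in> S then f i else \<zero>)" if "finite S" for i S
  using that
 proof (induction S)
  case empty
  show ?case using same[OF C(2)] by simp
 next
  case (insert k S)
  have "p i (f k) = (if i = k then f k else \<zero>)" using f same[of "f k" k] other[of "f k" k i] by auto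
  with insert show ?case using fc by (auto simp: add)
 qed
 show "f = (\<lambda>i. p i x)"
 proof
  fix i
  have "p i (\<Oplus>k\<in>{i. f i \<noteq> \<zero>}. f k) = f i" using S[of "{i. f i \<noteq> \<zero>}" i] f by simp
  then show "f i = p i x" using f by simp
 qed
qed

end

section \<open>Bidegrees and their behaviour under the bracket\<close>

context lie_pair
begin

text \<open>The flag tells whether a field may be nonzero in the given first degree. In use it is an
  equation such as \<open>i = 1\<close>, so the flags of a product follow from arithmetic with
  degrees.\<close>

definition gw :: "bool => int => ('a, 'e) ext => bool" where
 "gw q j x \<longleftrightarrow> (if q then wt j x else x = \<zero>AW)"

definition gs :: "bool => int => ('e => 'e) => bool" where
 "gs q j B \<longleftrightarrow> (if q then sw j B else B = \<zero>EW)"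

abbreviation "gwV \<equiv> lie_pair.gw K V (\<lambda>w v. h v w) ep em"
abbreviation "gsV \<equiv> lie_pair.gs K V (\<lambda>w v. h v w) ep em"

lemma gw_ops:
 assumes "x : XW" "gw q j x"
 shows gw_smult: "a : CK ==> gw q j (a \<odot>AW x)"
  and gw_add: "y : XW ==> gw q j y ==> gw q j (x \<oplus>AW y)"
  and gw_minus: "y : XW ==> gw q j y ==> gw q j (x \<ominus>AW y)"
 using assms wt_smult wt_add wt_minus by (auto simp: gw_def W.A.A.minus_eq)

lemma gs_ops:
 assumes "B : YW" "gs q j B"
 shows gs_smult: "a : CK ==> gs q j (a \<odot>EW B)"
  and gs_add: "B' : YW ==> gs q j B' ==> gs q j (B \<oplus>EW B')"
  and gs_minus: "B' : YW ==> gs q j B' ==> gs q j (B \<ominus>EW B')"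
 using assms sw_smult sw_add sw_minus by (auto simp: gs_def W.End.A.minus_eq)

lemma gw_zero [simp]: "gw q j \<zero>AW" and gs_zero [simp]: "gs q j \<zero>EW"
 by (simp_all add: gw_def gs_def)

lemma gs_adj:
 fixes i :: int
 assumes S: "(A, B) \<in> SP" shows "gs (i = 0) j B \<longleftrightarrow> gsV (- i = 0) (- j) A"
proof -
 interpret t: lie_pair K W V "\<lambda>w v. h v w" n c b ep em by (rule lie_pair_swap)
 have "A = \<zero>EV \<longleftrightarrow> B = \<zero>EW" using S SP_zero SP_unique t.SP_unique SP_swap by metis
 then show ?thesis using sw_adj(3)[OF S] by (simp add: gs_def t.gs_def)
qed

text \<open>Unless both flags hold, the result is zero. If they do, \<open>D_wt\<close> treats the
  endomorphism, and a nonzero \<open>a\<close> occurs only in bidegree (0, 0), where its multiple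
  causes no shift.\<close>

lemma gw_act:
 fixes i k :: int
 assumes S: "(A, B) \<in> SP" "a : CK" and B: "gs (i = 0) j B" "(i = 0 \<and> j = 0) \<or> a = \<zero>"
  and x: "x : XW" "gw (k = s) l x"
 shows "gw (i + k = s) (j + l) (aP B a x)"
proof -
 note r = SP_lin(2)[OF S(1)]
 consider "i = 0" "k = s" | "x = \<zero>AW" | "B = \<zero>EW" "a = \<zero>"
  using B x(2) by (auto simp: gs_def gw_def split: if_splits)
 then show ?thesis
 proof cases
  case 1
  then have w: "wt l x" "sw j B" using B x by (simp_all add: gs_def gw_def)
  have "wt (j + l) (a \<odot>AW x)" using B(2) w x S by (auto simp: wt_smult)
  then show ?thesis using 1 D_wt[OF S(1) w(2) x(1) w(1)] S x r by (simp add: gw_def aP_def wt_add)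
 next
  case 2 then show ?thesis using aP_rules(7)[OF r S(2)] by simp
 next
  case 3 then show ?thesis using aP_rules(8)[OF r S(2) x(1)] by simp
 qed
qed

lemma gw_mult:
 fixes i k :: int
 assumes x: "x : pW 3" "y : pW 3" and w: "gw (i = 1) j x" "gw (k = 1) l y"
 shows "gw (i + k = 2) (j + l) (x \<otimes>AW y)"
 using mult_wt[OF x] w x[THEN W.ext_pow_closed] by (cases "i = 1"; cases "k = 1") (simp_all add: gw_def)

lemma gw_contract:
 fixes i k :: int
 assumes m: "m : pV 3" and q: "q : pW 6" and w: "gwV (- i = 1) (- j) m" "gw (k = 2) l q"
 shows "gw (i + k = 1) (j + l) (cW m q)"
proof -
 interpret t: lie_pair K W V "\<lambda>w v. h v w" n c b ep em by (rule lie_pair_swap)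
 note cl = V.ext_pow_closed[OF m] W.ext_pow_closed[OF q]
 consider "m = \<zero>AV \<or> q = \<zero>AW" | "i = -1" "k = 2" "l = 1"
  using w wt_top_iff[OF q] by (auto simp: gw_def t.gw_def split: if_splits)
 then show ?thesis
 proof cases
  case 1
  then have "cW m q = \<zero>AW" using cl by (elim disjE) (simp_all add: cW_linear_l cW_linear_r)
  then show ?thesis by simp
 next
  case 2 then show ?thesis using contract_wt[OF m q, of "- j"] w by (simp add: gw_def t.gw_def add.commute)
 qed
qed

lemma gs_comm:
 fixes i k :: int
 assumes B: "B : YW" "B' : YW" and s: "gs (i = 0) j B" "gs (k = 0) l B'"
 shows "gs (i + k = 0) (j + l) (B \<otimes>EW B' \<ominus>EW B' \<otimes>EW B)"
 using sw_comm[OF B] s B by (cases "i = 0"; cases "k = 0") (simp_all add: gs_def W.End.A.minus_eq)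

lemma gs_E:
 fixes i k :: int
 assumes m: "m : pV 3" and p: "p : pW 3" and w: "gwV (- i = 1) (- j) m" "gw (k = 1) l p"
 shows "gs (i + k = 0) (j + l) (E p m)"
proof -
 interpret t: lie_pair K W V "\<lambda>w v. h v w" n c b ep em by (rule lie_pair_swap)
 consider "m = \<zero>AV \<or> p = \<zero>AW" | "i = -1" "k = 1"
  using w by (auto simp: gw_def t.gw_def split: if_splits)
 then show ?thesis
 proof cases
  case 1
  then have "E p m = \<zero>EW" using E3_zero m p by metis
  then show ?thesis by simp
 next
  case 2 then show ?thesis using E_wt[OF m p, of "- j" l] w by (simp add: gw_def t.gw_def gs_def add.commute)
 qed
qed

lemma pr_zero:
 fixes i k j l :: int
 assumes m: "m : pV r" and p: "p : pW r" and w: "gwV (- i = s) (- j) m" "gw (k = s) l p"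
 shows "(i + k = 0 \<and> j + l = 0) \<or> pr m p = \<zero>"
proof -
 interpret t: lie_pair K W V "\<lambda>w v. h v w" n c b ep em by (rule lie_pair_swap)
 note cl = V.ext_pow_closed[OF m] W.ext_pow_closed[OF p]
 consider "m = \<zero>AV \<or> p = \<zero>AW" | "- i = s" "k = s"
  using w by (auto simp: gw_def t.gw_def split: if_splits)
 then show ?thesis
 proof cases
  case 1
  then have "cW m p = \<zero>AW" using cl by (elim disjE) (simp_all add: cW_linear_l cW_linear_r)
  then show ?thesis by simp
 next
  case 2
  then have "- j \<noteq> l ==> pr m p = \<zero>" using pr_wt[OF m p, of "- j" l] w by (simp add: gw_def t.gw_def)
  then show ?thesis using 2 by (cases "- j = l") simp_all
 qed
qed

text \<open>Homogeneity of bidegree \<open>(i, j)\<close>, field by field. Fields of negative degree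
  carry \<open>- i\<close> and \<open>- j\<close>, matching the interchanged modules;
  \<open>endm\<close> is governed by \<open>endp\<close> through \<open>gs_adj\<close>.\<close>

definition inG :: "int => int => ('a, 'c, 'e) lie_elem => bool" where
 "inG i j X \<longleftrightarrow> X \<in> CLE \<and> gwV (- i = 2) (- j) (neg2 X) \<and> gwV (- i = 1) (- j) (neg1 X) \<and>
  gs (i = 0) j (endp X) \<and> ((i = 0 \<and> j = 0) \<or> hcoef X = \<zero>) \<and> gw (i = 1) j (pos1 X) \<and> gw (i = 2) j (pos2 X)"

text \<open>Each component of the bracket is a sum of terms covered by the rules for actions,
  products, contractions and \<open>E\<close>. Negative degrees use the same rules for the
  interchanged modules, after \<open>aM\<close> is rewritten as an action with coefficient
  \<open>- a\<close>.\<close>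

lemma inG_br:
 assumes "inG i j X" "inG k l Y"
 shows "inG (i + k) (j + l) (br X Y)"
proof -
 interpret t: lie_pair K W V "\<lambda>w v. h v w" n c b ep em by (rule lie_pair_swap)
 have X: "X : CL" and Y: "Y : CL" using assms by (auto simp: inG_def LE_iff)
 note f = L_fields[OF X] L_fields[OF Y]
 have g: "gwV (- i = 2) (- j) (neg2 X)" "gwV (- i = 1) (- j) (neg1 X)" "gs (i = 0) j (endp X)" "(i = 0 \<and> j = 0) \<or> hcoef X = \<zero>"
  "gw (i = 1) j (pos1 X)" "gw (i = 2) j (pos2 X)" "gwV (- k = 2) (- l) (neg2 Y)" "gwV (- k = 1) (- l) (neg1 Y)"
  "gs (k = 0) l (endp Y)" "(k = 0 \<and> l = 0) \<or> hcoef Y = \<zero>" "gw (k = 1) l (pos1 Y)" "gw (k = 2) l (pos2 Y)"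
  using assms by (auto simp: inG_def)
 have g': "gsV (- i = 0) (- j) (endm X)" "gsV (- k = 0) (- l) (endm Y)"
  "(- i = 0 \<and> - j = 0) \<or> \<ominus> hcoef X = \<zero>" "(- k = 0 \<and> - l = 0) \<or> \<ominus> hcoef Y = \<zero>"
  using gs_adj[OF f(12)] gs_adj[OF f(26)] g by auto
 have h2: "(i = 0 \<and> j = 0) \<or> hcoef X \<oplus> hcoef X = \<zero>" "(k = 0 \<and> l = 0) \<or> hcoef Y \<oplus> hcoef Y = \<zero>"
  "(- i = 0 \<and> - j = 0) \<or> \<ominus> (hcoef X \<oplus> hcoef X) = \<zero>" "(- k = 0 \<and> - l = 0) \<or> \<ominus> (hcoef Y \<oplus> hcoef Y) = \<zero>"
  using g(4,10) by auto
 have hc: "hcoef X \<oplus> hcoef X : CK" "hcoef Y \<oplus> hcoef Y : CK" "\<ominus> hcoef X : CK" "\<ominus> hcoef Y : CK"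
  "\<ominus> (hcoef X \<oplus> hcoef X) : CK" "\<ominus> (hcoef Y \<oplus> hcoef Y) : CK" using f by simp_all
 have swp: "(endp X, endm X) \<in> S_pairs K W V (\<lambda>w v. h v w)" "(endp Y, endm Y) \<in> S_pairs K W V (\<lambda>w v. h v w)"
  using f by (simp_all add: SP_swap)
 have aM: "aM B a x = t.aP B (\<ominus> a) x" if "a : CK" "x : XV" for B a x
  using that by (simp add: aM_def t.aP_def V.A.A.minus_eq V.A.smult_l_minus)
 note com = add.commute[of k i] add.commute[of l j] add.commute[of "- k" "- i"] add.commute[of "- l" "- j"]
 note aPc = aP_rules(1) aM_rules(1) f hc
 have p1: "gw (i + k = 1) (j + l) (pos1 (br X Y))"
  unfolding br_fields[OF X Y]
  using gw_act[OF f(12,5) g(3,4) f(24) g(11)] gw_act[OF f(26,19) g(9,10) f(10) g(5)] gw_contract[OF f(2,21) g(2,12)]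
   gw_contract[OF f(16,7) g(8,6)] f unfolding com
  by (intro gw_minus gw_add) (simp_all add: aP_rules(1) W.A.A.minus_eq)
 have p2: "gw (i + k = 2) (j + l) (pos2 (br X Y))"
  unfolding br_fields[OF X Y]
  using gw_act[OF f(12) hc(1) g(3) h2(1) f(25) g(12)] gw_act[OF f(26) hc(2) g(9) h2(2) f(11) g(6)] gw_mult[OF f(6,20) g(5,11)] f unfolding com
  by (intro gw_minus gw_add) (simp_all add: aP_rules(1) W.A.A.minus_eq)
 have n1: "gwV (- (i + k) = 1) (- (j + l)) (neg1 (br X Y))"
  unfolding br_fields[OF X Y] minus_add_distrib aM[OF f(5) f(23)] aM[OF f(19) f(9)]
  using t.gw_act[OF swp(1) hc(3) g'(1,3) f(23) g(8)] t.gw_act[OF swp(2) hc(4) g'(2,4) f(9) g(2)]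
   t.gw_contract[of "pos1 X" "neg2 Y" "- i" "- j" "- k" "- l"] t.gw_contract[of "pos1 Y" "neg2 X" "- k" "- l" "- i" "- j"] g f hc unfolding com
  by (intro t.gw_minus t.gw_add) (simp_all add: t.aP_rules(1) V.A.A.minus_eq)
 have n2: "gwV (- (i + k) = 2) (- (j + l)) (neg2 (br X Y))"
  unfolding br_fields[OF X Y] minus_add_distrib aM[OF hc(1) f(22)] aM[OF hc(2) f(8)]
  using t.gw_act[OF swp(1) hc(5) g'(1) h2(3) f(22) g(7)] t.gw_act[OF swp(2) hc(6) g'(2) h2(4) f(8) g(1)] t.gw_mult[OF f(2,16) g(2,8)] f hc unfolding com
  by (intro t.gw_minus t.gw_add) (simp_all add: t.aP_rules(1) V.A.A.minus_eq)
 note z = pr_zero[OF f(2,20) g(2,11)] pr_zero[OF f(16,6) g(8,5)] pr_zero[OF f(1,21) g(1,12)] pr_zero[OF f(15,7) g(7,6)]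
 define r where "r = pr (neg2 X) (pos2 Y) \<ominus> pr (neg2 Y) (pos2 X)"
 have rz: "(i + k = 0 \<and> j + l = 0) \<or> r = \<zero>" using z unfolding com r_def by (auto simp: V.R.minus_eq)
 have rc: "r : CK" using f by (simp add: r_def)
 have r1: "gs (i + k = 0) (j + l) (r \<odot>EW \<one>EW)" using rz rc sw_one sw_smult by (auto simp: gs_def)
 have h0: "(i + k = 0 \<and> j + l = 0) \<or> hcoef (br X Y) = \<zero>"
  unfolding br_fields[OF X Y] r_def[symmetric] using z rz unfolding com by (auto simp: V.R.minus_eq)
 note e = E3(3)[OF f(2) f(20)] E3(3)[OF f(16) f(6)]
 define C where "C = endp X \<otimes>EW endp Y \<ominus>EW endp Y \<otimes>EW endp X"
 have C: "C : YW" "gs (i + k = 0) (j + l) C" using gs_comm[OF f(14,28) g(3,9)] f by (simp_all add: C_def)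
 have s0: "gs (i + k = 0) (j + l) (endp (br X Y))"
  unfolding br_fields[OF X Y] r_def[symmetric] C_def[symmetric]
  using C gs_E[OF f(2,20) g(2,11)] gs_E[OF f(16,6) g(8,5)] r1 rc e unfolding com
  by (intro gs_minus gs_add) (simp_all add: W.End.A.minus_eq)
 show ?thesis using br_LE[OF X Y] p1 p2 n1 n2 h0 s0 by (simp add: inG_def)
qed

definition prj :: "int => ('a, 'e) ext => ('a, 'e) ext" where
 "prj j x = (if j = 0 then x \<ominus>AW W.D P x else if j = 1 then W.D P x else \<zero>AW)"

text \<open>The off-diagonal Peirce components are \<open>P B (1 - P)\<close> and
  \<open>(1 - P) B P\<close>; degree 0 is what they leave of \<open>B\<close>.\<close>

definition prS :: "int => ('e => 'e) => ('e => 'e)" where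
 "prS d B = (if d = 1 then P \<otimes>EW B \<ominus>EW P \<otimes>EW (B \<otimes>EW P)
  else if d = -1 then B \<otimes>EW P \<ominus>EW P \<otimes>EW (B \<otimes>EW P)
  else if d = 0 then B \<ominus>EW ((P \<otimes>EW B \<ominus>EW P \<otimes>EW (B \<otimes>EW P)) \<oplus>EW (B \<otimes>EW P \<ominus>EW P \<otimes>EW (B \<otimes>EW P)))
  else \<zero>EW)"

lemma prj_rules:
 assumes x: "x : XW"
 shows "prj j x : XW" "x : pW k ==> prj j x : pW k" "wt j (prj j x)"
  "y : XW ==> prj j (x \<oplus>AW y) = prj j x \<oplus>AW prj j y" "wt l x ==> prj j x = (if j = l then x else \<zero>AW)"
  "prj 0 x \<oplus>AW prj 1 x = x" "prj j \<zero>AW = \<zero>AW"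
proof -
 note D = W.D_linear[OF P_lin]
 have c: "W.D P x : XW" using x P_lin by simp
 have i: "W.D P (W.D P x) = W.D P x"
  using x em ep by (simp add: D_rank1 dW_gen_mult h_e dW_square W.A.A.minus_eq)
 show "prj j x : XW" using x P_lin by (simp add: prj_def)
 show "x : pW k ==> prj j x : pW k" using W.D_pow[OF _ P_lin] by (simp add: prj_def)
 show "wt j (prj j x)"
  using x c i wt_D(1)[of "x \<ominus>AW W.D P x"] wt_D(2)[of "W.D P x"] by (simp add: prj_def D W.A.A.minus_eq W.A.A.r_neg)
 show "y : XW ==> prj j (x \<oplus>AW y) = prj j x \<oplus>AW prj j y"
  using x c P_lin by (simp add: prj_def D W.A.A.minus_eq W.A.A.minus_add W.A.A.a_ac)
 show "prj j x = (if j = l then x else \<zero>AW)" if "wt l x"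
 proof -
  consider "l = 0" | "l = 1" | "x = \<zero>AW" using \<open>wt l x\<close> by (auto simp: wt_def split: if_splits)
  then show ?thesis using that wt_D[OF x] x by cases (simp_all add: prj_def W.A.A.minus_eq W.A.A.r_neg D)
 qed
 show "prj 0 x \<oplus>AW prj 1 x = x" using x c by (simp add: prj_def W.A.A.minus_eq W.A.A.a_assoc W.A.A.l_neg)
 show "prj j \<zero>AW = \<zero>AW" by (simp add: prj_def D W.A.A.minus_eq)
qed

lemma prS_rules:
 assumes B: "B : YW"
 shows "prS d B : YW" "sw d (prS d B)" "B' : YW ==> prS d (B \<oplus>EW B') = prS d B \<oplus>EW prS d B'"
  "sw k B ==> prS d B = (if d = k then B else \<zero>EW)" "prS 0 B \<oplus>EW (prS 1 B \<oplus>EW prS (-1) B) = B" "prS d \<zero>EW = \<zero>EW"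
proof -
 note c = B P_closed
 note ds = W.End.A.minus_eq W.End.A.l_distr W.End.A.r_distr W.End.A.l_minus W.End.A.r_minus W.End.A.minus_add
 have PP: "P \<otimes>EW (P \<otimes>EW X) = P \<otimes>EW X" if "X : YW" for X
  using that P_closed P_idem by (simp flip: W.End.A.m_assoc)
 show "prS d B : YW" using c by (simp add: prS_def)
 show "sw d (prS d B)" using c
  by (simp add: prS_def sw_def ds PP P_idem W.End.A.m_assoc W.End.A.r_neg W.End.A.l_neg W.End.A.a_ac W.End.A.r_neg1 W.End.A.r_neg2)
 show "B' : YW ==> prS d (B \<oplus>EW B') = prS d B \<oplus>EW prS d B'"
  using c by (simp add: prS_def ds W.End.A.a_ac)
 show "prS d B = (if d = k then B else \<zero>EW)" if s: "sw k B"
 proof -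
  consider "k = 0" "P \<otimes>EW B = B \<otimes>EW P" | "k = 1" "P \<otimes>EW B = B" "B \<otimes>EW P = \<zero>EW"
   | "k = -1" "P \<otimes>EW B = \<zero>EW" "B \<otimes>EW P = B" | "B = \<zero>EW"
   using s by (auto simp: sw_def split: if_splits)
  then show ?thesis
  proof cases
   case 1
   then have "P \<otimes>EW (B \<otimes>EW P) = B \<otimes>EW P" using PP[OF B] by simp
   with 1 show ?thesis using c by (simp add: prS_def W.End.A.minus_eq W.End.A.r_neg)
  qed (use c in \<open>simp_all add: prS_def W.End.A.minus_eq W.End.A.r_neg\<close>)
 qed
 show "prS 0 B \<oplus>EW (prS 1 B \<oplus>EW prS (-1) B) = B" using c by (simp add: prS_def W.End.A.minus_eq W.End.A.a_assoc W.End.A.l_neg)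
 show "prS d \<zero>EW = \<zero>EW" using c by (simp add: prS_def W.End.A.minus_eq)
qed

abbreviation "prjV \<equiv> lie_pair.prj K V (\<lambda>w v. h v w) ep em"
abbreviation "prSV \<equiv> lie_pair.prS K V (\<lambda>w v. h v w) ep em"

lemma SP_prS:
 assumes S: "(A, B) \<in> SP" shows "(prSV (- d) A, prS d B) \<in> SP"
proof -
 interpret t: lie_pair K W V "\<lambda>w v. h v w" n c b ep em by (rule lie_pair_swap)
 note a = sw_adj(1)[OF S] sw_adj(2)[OF S]
 have l: "A : YV" "B : YW" using SP_lin[OF S] by (simp_all add: V.End_simps(1) W.End_simps(1))
 have p: "(t.P \<otimes>EV (A \<otimes>EV t.P), P \<otimes>EW (B \<otimes>EW P)) \<in> SP"
  using sw_adj(2)[OF a(1)] l P_closed t.P_closed by (simp add: W.End.A.m_assoc)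
 have c: "(t.P \<otimes>EV A \<ominus>EV t.P \<otimes>EV (A \<otimes>EV t.P)) \<oplus>EV (A \<otimes>EV t.P \<ominus>EV t.P \<otimes>EV (A \<otimes>EV t.P)) =
  (A \<otimes>EV t.P \<ominus>EV t.P \<otimes>EV (A \<otimes>EV t.P)) \<oplus>EV (t.P \<otimes>EV A \<ominus>EV t.P \<otimes>EV (A \<otimes>EV t.P))"
  using l t.P_closed by (intro V.End.A.a_comm) simp_all
 show ?thesis unfolding prS_def t.prS_def c
  by (simp add: SP_minus SP_add S a p SP_zero)
qed

text \<open>The trace sees only the diagonal blocks. Hence projecting to a bidegree preserves the
  trace condition and stays in the ideal.\<close>

lemma tr_prS: "B : YW ==> tr (prS d B) = (if d = 0 then tr B else \<zero>)"
proof -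
 assume B: "B : YW"
 have l: "B : LW" "P : LW" using B P_lin by (simp_all add: W.End_simps(1))
 have 1: "tr (P \<otimes>EW B) = tr (B \<otimes>EW P)" by (rule trace_comm[OF l(2,1)])
 have 2: "tr (P \<otimes>EW (B \<otimes>EW P)) = tr (B \<otimes>EW P)"
  using trace_comm[OF l(2) W.End_closed(2)[OF l]] B P_closed P_idem by (simp add: W.End.A.m_assoc)
 show ?thesis using l by (simp add: prS_def trace_minus trace_add W.End_closed 1 2 V.R.minus_eq V.R.r_neg trace_zero)
qed

end

context lie_pair
begin

definition cmp :: "int => int => ('a, 'c, 'e) lie_elem => ('a, 'c, 'e) lie_elem" where
 "cmp i j X = \<lparr>neg2 = if - i = 2 then prjV (- j) (neg2 X) else \<zero>AV, neg1 = if - i = 1 then prjV (- j) (neg1 X) else \<zero>AV,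
  endm = if i = 0 then prSV (- j) (endm X) else \<zero>EV, endp = if i = 0 then prS j (endp X) else \<zero>EW,
  hcoef = if i = 0 \<and> j = 0 then hcoef X else \<zero>,
  pos1 = if i = 1 then prj j (pos1 X) else \<zero>AW, pos2 = if i = 2 then prj j (pos2 X) else \<zero>AW\<rparr>"

lemma Z_LE: "Z \<in> CLE"
 using L.submodule_zero[OF LE_submodule] by (simp add: L_simps(2))

lemma inG_endm: "inG i j X ==> gsV (- i = 0) (- j) (endm X)"
 using gs_adj[of "endm X" "endp X" i j] by (auto simp: inG_def LE_iff L_iff)

lemma cmp_inG:
 assumes X: "X \<in> CLE" shows "inG i j (cmp i j X)"
proof -
 interpret t: lie_pair K W V "\<lambda>w v. h v w" n c b ep em by (rule lie_pair_swap)
 have XL: "X : CL" and tX: "tr (endp X) \<oplus> [(3::int)] \<cdot>\<^bsub>K\<^esub> hcoef X = \<zero>" using X by (auto simp: LE_iff)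
 note f = L_fields[OF XL]
 have "cmp i j X : CL"
  unfolding L_iff cmp_def using f SP_prS[OF f(12), of j] SP_zero
  by (cases "j = 0") (simp_all add: prj_rules(2)[OF f(10)] prj_rules(2)[OF f(11)] t.prj_rules(2)[OF f(9)] t.prj_rules(2)[OF f(8)])
 moreover have "tr (endp (cmp i j X)) \<oplus> [(3::int)] \<cdot>\<^bsub>K\<^esub> hcoef (cmp i j X) = \<zero>"
  using tX tr_prS[OF f(14)] by (simp add: cmp_def trace_zero int_scale_ops(5)[OF V.R.zero_closed V.R.zero_closed])
 ultimately show ?thesis
  by (simp add: inG_def LE_iff) (simp add: cmp_def gw_def gs_def t.gw_def prj_rules(3)[OF f(10)] prj_rules(3)[OF f(11)]
   t.prj_rules(3)[OF f(9)] t.prj_rules(3)[OF f(8)] prS_rules(2)[OF f(14)])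
qed

lemma cmp_hom:
 assumes X: "inG k l X" shows "cmp i j X = (if i = k \<and> j = l then X else Z)"
proof -
 interpret t: lie_pair K W V "\<lambda>w v. h v w" n c b ep em by (rule lie_pair_swap)
 have XL: "X : CL" using X by (auto simp: inG_def LE_iff)
 note f = L_fields[OF XL] and g = X[unfolded inG_def gw_def gs_def t.gw_def] inG_endm[OF X, unfolded t.gs_def]
 note z = prj_rules(7)[OF W.A.A.zero_closed] t.prj_rules(7)[OF V.A.A.zero_closed] prS_rules(6)[OF W.End.A.zero_closed] t.prS_rules(6)[OF V.End.A.zero_closed]
 show ?thesis
 proof (rule lie_elem_eqI)
  show "neg2 (cmp i j X) = neg2 (if i = k \<and> j = l then X else Z)"
   using g z t.prj_rules(5)[OF f(8), of "- l" "- j"] by (cases "k = -2") (auto simp: cmp_def zero_fields)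
  show "neg1 (cmp i j X) = neg1 (if i = k \<and> j = l then X else Z)"
   using g z t.prj_rules(5)[OF f(9), of "- l" "- j"] by (cases "k = -1") (auto simp: cmp_def zero_fields)
  show "endm (cmp i j X) = endm (if i = k \<and> j = l then X else Z)"
   using g z t.prS_rules(4)[OF f(13), of "- l" "- j"] by (cases "k = 0") (auto simp: cmp_def zero_fields)
  show "endp (cmp i j X) = endp (if i = k \<and> j = l then X else Z)"
   using g z prS_rules(4)[OF f(14), of l j] by (cases "k = 0") (auto simp: cmp_def zero_fields)
  show "hcoef (cmp i j X) = hcoef (if i = k \<and> j = l then X else Z)"
   using g by (auto simp: cmp_def zero_fields)
  show "pos1 (cmp i j X) = pos1 (if i = k \<and> j = l then X else Z)"
   using g z prj_rules(5)[OF f(10), of l j] by (cases "k = 1") (auto simp: cmp_def zero_fields)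
  show "pos2 (cmp i j X) = pos2 (if i = k \<and> j = l then X else Z)"
   using g z prj_rules(5)[OF f(11), of l j] by (cases "k = 2") (auto simp: cmp_def zero_fields)
 qed
qed

lemma cmp_add:
 assumes X: "X : CL" "Y : CL" shows "cmp i j (X \<oplus>L Y) = cmp i j X \<oplus>L cmp i j Y"
proof -
 interpret t: lie_pair K W V "\<lambda>w v. h v w" n c b ep em by (rule lie_pair_swap)
 note f = L_fields[OF X(1)] and g = L_fields[OF X(2)]
 show ?thesis
  by (rule lie_elem_eqI; simp add: cmp_def add_fields prj_rules(4)[OF f(10) g(10)] prj_rules(4)[OF f(11) g(11)]
   t.prj_rules(4)[OF f(8) g(8)] t.prj_rules(4)[OF f(9) g(9)] prS_rules(3)[OF f(14) g(14)] t.prS_rules(3)[OF f(13) g(13)])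
qed

definition idx :: "(int \<times> int) set" where
 "idx = {(0, 0), (0, 1), (0, -1), (1, 0), (1, 1), (-1, 0), (-1, -1), (2, 1), (-2, -1)}"

text \<open>First degrees 1 and -1 split by two weights and first degree 0 into three Peirce parts;
  in first degrees 2 and -2 a single term suffices, as top elements have weight 1.\<close>

lemma cmp_sum:
 assumes X: "X \<in> CLE"
 shows "(\<Oplus>\<^bsub>LE\<^esub>ij\<in>idx. cmp (fst ij) (snd ij) X) = X"
proof -
 interpret t: lie_pair K W V "\<lambda>w v. h v w" n c b ep em by (rule lie_pair_swap)
 interpret LE: module K LE by (rule LE_module)
 have XL: "X : CL" using X by (simp add: LE_iff)
 note f = L_fields[OF XL]
 have c: "cmp i j X \<in> CLE" for i j using cmp_inG[OF X] by (simp add: inG_def)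
 have af: "neg2 (Y \<oplus>LE Y') = neg2 Y \<oplus>AV neg2 Y'" "neg1 (Y \<oplus>LE Y') = neg1 Y \<oplus>AV neg1 Y'"
  "endm (Y \<oplus>LE Y') = endm Y \<oplus>EV endm Y'" "endp (Y \<oplus>LE Y') = endp Y \<oplus>EW endp Y'" "hcoef (Y \<oplus>LE Y') = hcoef Y \<oplus> hcoef Y'"
  "pos1 (Y \<oplus>LE Y') = pos1 Y \<oplus>AW pos1 Y'" "pos2 (Y \<oplus>LE Y') = pos2 Y \<oplus>AW pos2 Y'" for Y Y'
  by (simp_all add: LE_simps add_fields)
 note cl = prj_rules(1)[OF f(10)] t.prj_rules(1)[OF f(9)] prS_rules(1)[OF f(14)] t.prS_rules(1)[OF f(13)]
 have top: "prj 1 (pos2 X) = pos2 X" "prjV 1 (neg2 X) = neg2 X"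
  using prj_rules(5)[OF f(11) wt_top[OF f(7)], of 1] t.prj_rules(5)[OF f(8) t.wt_top[OF f(1)], of 1] by simp_all
 have m: "prSV 0 (endm X) \<oplus>EV (prSV (-1) (endm X) \<oplus>EV prSV 1 (endm X)) = endm X"
  using t.prS_rules(5)[OF f(13)] V.End.A.a_comm[OF cl(4)[of "-1"] cl(4)[of 1]] by simp
 have "(\<Oplus>\<^bsub>LE\<^esub>ij\<in>idx. cmp (fst ij) (snd ij) X) = cmp 0 0 X \<oplus>LE (cmp 0 1 X \<oplus>LE (cmp 0 (-1) X \<oplus>LE (cmp 1 0 X \<oplus>LE
   (cmp 1 1 X \<oplus>LE (cmp (-1) 0 X \<oplus>LE (cmp (-1) (-1) X \<oplus>LE (cmp 2 1 X \<oplus>LE cmp (-2) (-1) X)))))))"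
  by (simp add: idx_def c Pi_def)
 also have "\<dots> = X"
  by (rule lie_elem_eqI; simp only: af; simp add: cmp_def f cl top m prj_rules(6)[OF f(10)] t.prj_rules(6)[OF f(9)] prS_rules(5)[OF f(14)])
 finally show ?thesis .
qed

lemma inG_outside:
 assumes X: "inG i j X" and ij: "(i, j) \<notin> idx" shows "X = Z"
proof -
 interpret t: lie_pair K W V "\<lambda>w v. h v w" n c b ep em by (rule lie_pair_swap)
 have XL: "X : CL" using X by (auto simp: inG_def LE_iff)
 note f = L_fields[OF XL] and g = X[unfolded inG_def gw_def gs_def t.gw_def] inG_endm[OF X, unfolded t.gs_def]
 show ?thesis
 proof (rule lie_elem_eqI; unfold zero_fields)
  show "neg2 X = \<zero>AV" using g t.wt_top_iff[OF f(1), of "- j"] ij by (auto simp: idx_def split: if_splits)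
  show "neg1 X = \<zero>AV" using g ij by (auto simp: idx_def t.wt_def split: if_splits)
  show "endm X = \<zero>EV" using g ij by (auto simp: idx_def t.sw_def split: if_splits)
  show "endp X = \<zero>EW" using g ij by (auto simp: idx_def sw_def split: if_splits)
  show "hcoef X = \<zero>" using g ij by (auto simp: idx_def)
  show "pos1 X = \<zero>AW" using g ij by (auto simp: idx_def wt_def split: if_splits)
  show "pos2 X = \<zero>AW" using g wt_top_iff[OF f(7), of j] ij by (auto simp: idx_def split: if_splits)
 qed
qed

lemma inG_submodule: "submodule {X. inG i j X} K LE"
proof -
 interpret t: lie_pair K W V "\<lambda>w v. h v w" n c b ep em by (rule lie_pair_swap)
 interpret LE: module K LE by (rule LE_module)
 show ?thesis
 proof (rule LE.submoduleI')
  show "\<zero>LE \<in> {X. inG i j X}"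
   using Z_LE by (simp add: inG_def LE_simps zero_fields)
 next
  fix X Y assume "X \<in> {X. inG i j X}" "Y \<in> {X. inG i j X}"
  then have X: "inG i j X" and Y: "inG i j Y" by auto
  then have "X : CL" "Y : CL" and LE: "X \<in> CLE" "Y \<in> CLE" by (auto simp: inG_def LE_iff)
  note f = L_fields[OF this(1)] L_fields[OF this(2)]
  have "X \<oplus>L Y \<in> CLE" using LE.a_closed[OF LE] by (simp add: LE_simps)
  then show "X \<oplus>LE Y \<in> {X. inG i j X}"
   using X Y f by (auto simp: inG_def LE_simps add_fields gw_add t.gw_add gs_add)
 next
  fix a X assume a: "a : CK" and "X \<in> {X. inG i j X}"
  then have X: "inG i j X" by auto
  then have "X : CL" and LE: "X \<in> CLE" by (auto simp: inG_def LE_iff)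
  note f = L_fields[OF this(1)]
  have "a \<odot>L X \<in> CLE" using LE.smult_closed[OF a LE] by (simp add: LE_simps)
  then show "a \<odot>LE X \<in> {X. inG i j X}"
   using X f a by (auto simp: inG_def LE_simps smult_fields gw_smult t.gw_smult gs_smult)
 qed (auto simp: inG_def)
qed

text \<open>The projections \<open>cmp\<close> form a family as in \<open>ex1_family\<close>, with
  finite index set \<open>idx\<close>, outside of which the components are zero.\<close>

lemma inG_grading: "BC2_grading K LE (\<lambda>ij. {X. inG (fst ij) (snd ij) X})"
proof -
 interpret LE: module K LE by (rule LE_module)
 have Zin: "inG i j Z" for i j using LE.submodule_zero[OF inG_submodule[of i j]] by (simp add: LE_simps)
 have out: "{X. inG (fst ij) (snd ij) X} = {\<zero>LE}" if "ij \<notin> idx" for ij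
  using inG_outside[of "fst ij" "snd ij"] that Zin by (auto simp: LE_simps)
 have "\<exists>!f. (\<forall>i. f i \<in> {X. inG (fst i) (snd i) X}) \<and> finite {i. f i \<noteq> \<zero>LE} \<and> X = (\<Oplus>\<^bsub>LE\<^esub>i\<in>{i. f i \<noteq> \<zero>LE}. f i)"
  if X: "X \<in> CLE" for X
 proof (rule LE.ex1_family[where p = "\<lambda>ij. cmp (fst ij) (snd ij)" and I = idx])
  fix ij Y Y' assume "Y \<in> CLE" "Y' \<in> CLE"
  then show "cmp (fst ij) (snd ij) (Y \<oplus>LE Y') = cmp (fst ij) (snd ij) Y \<oplus>LE cmp (fst ij) (snd ij) Y'"
   by (simp add: LE_simps cmp_add LE_iff)
 next
  fix ij kl Y assume "Y \<in> {X. inG (fst kl) (snd kl) X}" "ij \<noteq> kl"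
  then show "cmp (fst ij) (snd ij) Y = \<zero>LE" by (auto simp: cmp_hom LE_simps prod_eq_iff)
 next
  show "finite idx" by (simp add: idx_def)
 next
  show "{X. inG (fst ij) (snd ij) X} \<subseteq> CLE" for ij
   by (auto simp: inG_def)
  show "\<zero>LE \<in> {X. inG (fst ij) (snd ij) X}" for ij
   using Zin by (simp add: LE_simps)
  show "cmp (fst ij) (snd ij) Y \<in> {X. inG (fst ij) (snd ij) X}" if "Y \<in> CLE" for ij Y
   using cmp_inG[OF that] by simp
  show "cmp (fst ij) (snd ij) Y = Y" if "Y \<in> {X. inG (fst ij) (snd ij) X}" for ij Y
   using that by (simp add: cmp_hom)
 qed (use X out cmp_sum in simp_all)
 then have "lie_grading K LE (\<lambda>ij. {X. inG (fst ij) (snd ij) X})"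
  unfolding lie_grading_def using LE_lie_algebra inG_submodule inG_br by (simp add: LE_simps)
 moreover have "{i. {X. inG (fst i) (snd i) X} \<noteq> {\<zero>LE}} \<subseteq> idx" using out by blast
 moreover have "idx \<subseteq> {(0, 0), (1, 0), (-1, 0), (0, 1), (0, -1), (1, 1), (-1, -1),
    (2, 0), (-2, 0), (2, 1), (-2, -1), (2, 2), (-2, -2)}" by (simp add: idx_def)
 ultimately show ?thesis unfolding BC2_grading_def by (intro conjI) (assumption, rule subset_trans)
qed

lemma finsum_submodule:
 assumes "module K M" "submodule N K M" "finite I" "!!i. i \<in> I ==> f i \<in> N" shows "(\<Oplus>\<^bsub>M\<^esub>i\<in>I. f i) \<in> N"
proof -
 interpret M: module K M by fact
 note N = M.submoduleE(1,5)[OF assms(2)] M.submodule_zero[OF assms(2)]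
 show ?thesis using assms(3,4)
 proof (induction I)
  case (insert i I)
  then have "f \<in> I \<rightarrow> carrier M" "f i \<in> carrier M" using N(1) by blast+
  with insert N show ?case by simp
 qed (use N in simp)
qed

text \<open>One inclusion is read off from the fields. Conversely, an element of the component is
  the sum of its projections, of which those of other first degrees are zero.\<close>

lemma inG_first_component:
 "first_component K LE (\<lambda>ij. {X. inG (fst ij) (snd ij) X}) i = lie_E_component K V W h i" (is "_ = ?C")
proof -
 interpret t: lie_pair K W V "\<lambda>w v. h v w" n c b ep em by (rule lie_pair_swap)
 interpret LE: module K LE by (rule LE_module)
 let ?S = "\<Union>j. {X. inG i j X}"
 have C: "submodule ?C K LE"
 proof (rule LE.submoduleI')
  show "\<zero>LE \<in> ?C" using Z_LE by (simp add: lie_E_component_def Let_def LE_simps)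
 next
  fix X Y assume "X \<in> ?C" "Y \<in> ?C"
  then show "X \<oplus>LE Y \<in> ?C" using LE.a_closed[of X Y]
   by (simp add: lie_E_component_def Let_def zero_fields) (simp add: LE_simps add_fields)
 next
  fix a X assume "a : CK" "X \<in> ?C"
  then show "a \<odot>LE X \<in> ?C" using LE.smult_closed[of a X]
   by (simp add: lie_E_component_def Let_def zero_fields) (simp add: LE_simps smult_fields)
 qed (auto simp: lie_E_component_def Let_def)
 have S: "?S \<subseteq> ?C"
  using inG_endm by (fastforce simp: lie_E_component_def Let_def zero_fields inG_def gw_def t.gw_def gs_def t.gs_def)
 have "X \<in> mspan K LE ?S" if X: "X \<in> ?C" for X
 proof -
  have XL: "X \<in> CLE" using X by (simp add: lie_E_component_def Let_def)
  have sp: "submodule (mspan K LE ?S) K LE" by (rule LE.mspan_submodule) (auto simp: inG_def)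
  note z = prj_rules(7)[OF W.A.A.zero_closed] t.prj_rules(7)[OF V.A.A.zero_closed] prS_rules(6)[OF W.End.A.zero_closed] t.prS_rules(6)[OF V.End.A.zero_closed]
  have "cmp k l X \<in> mspan K LE ?S" for k l
  proof (cases "k = i")
   case True
   then show ?thesis using cmp_inG[OF XL, of k l] LE.mspan_incl[of ?S] by blast
  next
   case False
   then have "cmp k l X = Z"
    using X z by (intro lie_elem_eqI) (auto simp: cmp_def zero_fields lie_E_component_def Let_def)
   then show ?thesis using LE.submodule_zero[OF sp] by (simp add: LE_simps)
  qed
  then have "(\<Oplus>\<^bsub>LE\<^esub>ij\<in>idx. cmp (fst ij) (snd ij) X) \<in> mspan K LE ?S"
   by (intro finsum_submodule[OF LE_module sp]) (simp_all add: idx_def)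
  then show ?thesis by (simp add: cmp_sum[OF XL])
 qed
 then show ?thesis using LE.mspan_least[OF C S] by (auto simp: first_component_def)
qed

section \<open>Exterior powers and endomorphism blocks along the decomposition by e\<close>

abbreviation "U \<equiv> perp K W h em"
abbreviation "Le \<equiv> line K W ep"

lemma U_sub: "U \<subseteq> CW"
 by (auto simp: perp_def)

lemma split_e:
 assumes w: "w : CW"
 shows "w \<ominus>W h em w \<odot>W ep \<in> U" "w = (w \<ominus>W h em w \<odot>W ep) \<oplus>W h em w \<odot>W ep" "h em w \<odot>W ep \<in> Le"
proof -
 have c: "h em w \<odot>W ep : CW" using w em ep by simp
 show "w \<ominus>W h em w \<odot>W ep \<in> U"
  using w em ep h_e by (simp add: perp_def W.M.minus_eq h_add_r h_neg_r h_smult_r V.R.r_neg)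
 show "w = (w \<ominus>W h em w \<odot>W ep) \<oplus>W h em w \<odot>W ep" using w c by (simp add: W.M.minus_eq W.M.a_assoc W.M.l_neg)
 show "h em w \<odot>W ep \<in> Le" using w em by (auto simp: line_def)
qed

lemma line_iff: "x \<in> Le \<longleftrightarrow> x : CW \<and> P x = x" and perp_iff: "x \<in> U \<longleftrightarrow> x : CW \<and> P x = \<zero>W"
proof -
 show "x \<in> Le \<longleftrightarrow> x : CW \<and> P x = x"
  using em ep h_e split_e(3)[of x] by (auto simp: line_def h_smult_r)
 have "h em x = \<zero>" if x: "x : CW" and "P x = \<zero>W"
 proof -
  have "h em (h em x \<odot>W ep) = \<zero>" using that em by simp
  then show ?thesis using x em ep h_e by (simp add: h_smult_r)
 qed
 then show "x \<in> U \<longleftrightarrow> x : CW \<and> P x = \<zero>W" using em ep by (auto simp: perp_def)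
qed

text \<open>Pairing with \<open>em\<close> determines the summand on the line, and hence the other
  one.\<close>

lemma line_perp_sum: "direct_sum2 K W Le U"
 unfolding direct_sum2_def
proof (intro conjI ballI)
 show "submodule Le K W"
 proof (rule W.submoduleI')
  fix a x assume "a : CK" "x \<in> Le"
  then show "a \<odot>W x \<in> Le" using lin_maps_smult[OF P_lin] by (simp add: line_iff del: rk_apply)
 qed (use em ep in \<open>auto simp: line_iff h_add_r W.smult_l_distr\<close>)
 show "submodule U K W"
  by (rule W.submoduleI') (use em in \<open>auto simp: perp_def h_add_r h_smult_r\<close>)
 fix v assume v: "v : CW"
 show "\<exists>!p. p \<in> Le \<times> U \<and> v = fst p \<oplus>W snd p"
 proof (rule ex1I[of _ "(h em v \<odot>W ep, v \<ominus>W h em v \<odot>W ep)"])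
  show "(h em v \<odot>W ep, v \<ominus>W h em v \<odot>W ep) \<in> Le \<times> U \<and>
   v = fst (h em v \<odot>W ep, v \<ominus>W h em v \<odot>W ep) \<oplus>W snd (h em v \<odot>W ep, v \<ominus>W h em v \<odot>W ep)"
   using split_e[OF v] U_sub v em ep W.M.a_comm[of "h em v \<odot>W ep" "v \<ominus>W h em v \<odot>W ep"] by auto
 next
  fix p assume p: "p \<in> Le \<times> U \<and> v = fst p \<oplus>W snd p"
  then obtain x y where xy: "p = (x, y)" "x : CW" "y : CW" "h em x \<odot>W ep = x" "h em y = \<zero>" "v = x \<oplus>W y"
   by (cases p) (auto simp: line_iff perp_def)
  have "h em v = h em x" using xy em by (simp add: h_add_r)
  then have "h em v \<odot>W ep = x" using xy by simp
  moreover have "v \<ominus>W x = y" using xy by (simp add: W.M.minus_eq W.M.a_comm[of x y] W.M.a_assoc W.M.r_neg)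
  ultimately show "p = (h em v \<odot>W ep, v \<ominus>W h em v \<odot>W ep)" using xy by simp
 qed
qed

lemma pow_split:
 assumes x: "x : pW k"
 obtains y z where "y \<in> ext_pow_of K W U k" "z \<in> ext_pow_of K W U (k - 1)" "k = 0 ==> z = \<zero>AW" "x = y \<oplus>AW z \<otimes>AW e1"
proof -
 have "\<exists>u\<in>U. \<exists>a\<in>CK. w = u \<oplus>W a \<odot>W ep" if "w : CW" for w
  using split_e[OF that] em that h_closed by blast
 then show ?thesis
  using W.pow_of_insert[OF x[unfolded ext_pow_def] order_refl U_sub ep] that by blast
qed

lemma pow_U_wt: "x \<in> ext_pow_of K W U k ==> wt 0 x"
proof (induction rule: W.ext_pow_of_induct[OF _ U_sub, consumes 1])
 case (2 vs)
 have "de (ext_prod K W vs) = \<zero>AW \<and> ext_prod K W vs : XW" if "set vs \<subseteq> U" for vs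
  using that
 proof (induction vs)
  case (Cons v vs)
  then have "v : CW" "h em v = \<zero>" by (auto simp: perp_def)
  with Cons show ?case using em by (simp add: W.ext_prod_Cons dW_gen_mult W.A.A.minus_eq)
 qed (use em in \<open>simp add: W.ext_prod_Nil dW_linear dW_one\<close>)
 with 2 show ?case by (simp add: wt_def)
qed (simp_all add: wt_add wt_smult)

lemma mult_e1_wt: "z \<in> ext_pow_of K W U k ==> z \<otimes>AW e1 : pW (Suc k) \<and> wt 1 (z \<otimes>AW e1)"
proof -
 assume z: "z \<in> ext_pow_of K W U k"
 have zk: "z : pW k" using W.ext_pow_of_sub[OF U_sub] z by blast
 have zc: "z : XW" using W.ext_pow_closed[OF zk] .
 have "z \<otimes>AW e1 : pW (Suc k)" using W.pow_mult[OF zk W.gen_in_pow[OF ep]] by simp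
 moreover have "e1 \<otimes>AW (z \<otimes>AW e1) = \<zero>AW"
  using W.gen_commute[OF zc ep] zc W.gen_square[OF ep] by (simp add: W.A.A.m_assoc flip: W.A.A.m_assoc[of e1 z e1])
 ultimately show ?thesis by (simp add: wt_def)
qed

lemma wt_0_1: "x : XW ==> wt 0 x ==> wt 1 x ==> x = \<zero>AW"
 using wt_D[of x] by simp

text \<open>Write \<open>x\<close> as \<open>y + z e1\<close> with \<open>y\<close> of weight 0 and
  \<open>z e1\<close> of weight 1. If \<open>x\<close> has one of the two weights, the summand of
  the other weight has both and is zero.\<close>

lemma pow_U: "ext_pow_of K W U k = {x \<in> pW k. wt 0 x}"
 and times_U: "ext_pow_times K W U l ep = {x \<in> pW (Suc l). wt 1 x}"
proof -
 note sub = subsetD[OF W.ext_pow_of_sub[OF U_sub]]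
 have split: "(wt 0 x \<longrightarrow> z \<otimes>AW e1 = \<zero>AW) \<and> (wt 1 x \<longrightarrow> y = \<zero>AW)"
  if y: "y \<in> ext_pow_of K W U k" and z: "z \<in> ext_pow_of K W U l" and x: "x = y \<oplus>AW z \<otimes>AW e1" for x y z k l
 proof -
  have c: "y : XW" "z \<otimes>AW e1 : XW" using sub[OF y] mult_e1_wt[OF z] W.ext_pow_closed by blast+
  have e: "z \<otimes>AW e1 = x \<ominus>AW y" "y = x \<ominus>AW z \<otimes>AW e1"
   unfolding x using c by (simp_all add: W.A.A.minus_eq W.A.A.a_ac W.A.A.r_neg1 W.A.A.r_neg2 W.A.A.r_neg)
  have xc: "x : XW" unfolding x using c by simp
  have "wt 0 (z \<otimes>AW e1)" if "wt 0 x" unfolding e(1) using wt_minus[OF xc c(1) that pow_U_wt[OF y]] .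
  moreover have "wt 1 y" if "wt 1 x" using wt_minus[OF xc c(2) that] mult_e1_wt[OF z] e(2) by simp
  ultimately show ?thesis using wt_0_1 c pow_U_wt[OF y] mult_e1_wt[OF z] by blast
 qed
 show "ext_pow_of K W U k = {x \<in> pW k. wt 0 x}"
 proof (intro subset_antisym subsetI)
  fix x assume x: "x \<in> {x \<in> pW k. wt 0 x}"
  then obtain y z where yz: "y \<in> ext_pow_of K W U k" "z \<in> ext_pow_of K W U (k - 1)" "x = y \<oplus>AW z \<otimes>AW e1"
   using pow_split by blast
  have "x = y" using split[OF yz] x yz(3) W.ext_pow_closed[OF sub[OF yz(1)]] by simp
  then show "x \<in> ext_pow_of K W U k" using yz by simp
 qed (use sub pow_U_wt in auto)
 show "ext_pow_times K W U l ep = {x \<in> pW (Suc l). wt 1 x}"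
 proof (intro subset_antisym subsetI)
  fix x assume x: "x \<in> {x \<in> pW (Suc l). wt 1 x}"
  then obtain y z where yz: "y \<in> ext_pow_of K W U (Suc l)" "z \<in> ext_pow_of K W U l" "x = y \<oplus>AW z \<otimes>AW e1"
   using pow_split[of x "Suc l"] by (metis (lifting) diff_Suc_1 mem_Collect_eq)
  have "z \<otimes>AW e1 : XW" by (rule W.ext_pow_closed[OF conjunct1[OF mult_e1_wt[OF yz(2)]]])
  then have "\<zero>AW \<oplus>AW z \<otimes>AW e1 = z \<otimes>AW e1" by (rule W.A.A.l_zero)
  moreover have "y = \<zero>AW" using split[OF yz] x by blast
  ultimately have "x = z \<otimes>AW e1" using yz(3) by metis
  with yz(2) show "x \<in> ext_pow_times K W U l ep" unfolding ext_pow_times_def by blast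
 next
  fix x assume "x \<in> ext_pow_times K W U l ep"
  then obtain z where "z \<in> ext_pow_of K W U l" "x = z \<otimes>AW e1" unfolding ext_pow_times_def by blast
  with mult_e1_wt show "x \<in> {x \<in> pW (Suc l). wt 1 x}" by simp
 qed
qed

end

context lie_pair
begin

lemma block_domain:
 assumes A: "A : LW"
 shows "(\<forall>x\<in>U. A x = \<zero>W) \<longleftrightarrow> A \<otimes>EW P = A" "(\<forall>x\<in>Le. A x = \<zero>W) \<longleftrightarrow> A \<otimes>EW P = \<zero>EW"
  and block_range: "(\<forall>x\<in>CW. A x \<in> Le) \<longleftrightarrow> P \<otimes>EW A = A" "(\<forall>x\<in>CW. A x \<in> U) \<longleftrightarrow> P \<otimes>EW A = \<zero>EW"
proof -
 note l = W.End_closed(2)[OF A P_lin] W.End_closed(2)[OF P_lin A] W.End_closed(7)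
 have Pc: "P w : CW" if "w : CW" for w using lin_maps_closed[OF P_lin that] .
 have ev: "(A \<otimes>EW P) w = A (P w)" "(P \<otimes>EW A) w = P (A w)" "\<zero>EW w = \<zero>W" if "w : CW" for w
  using that by (simp_all add: W.End_simps del: rk_apply)
 have sp: "A w = A (w \<ominus>W P w) \<oplus>W A (P w)" "w \<ominus>W P w \<in> U" "P w \<in> Le" if w: "w : CW" for w
 proof -
  have "w \<ominus>W P w : CW" using w Pc[OF w] by simp
  from lin_maps_add[OF A this Pc[OF w]] show "A w = A (w \<ominus>W P w) \<oplus>W A (P w)" using split_e(2)[OF w] w by simp
  show "w \<ominus>W P w \<in> U" "P w \<in> Le" using split_e[OF w] w by simp_all
 qed
 show "(\<forall>x\<in>U. A x = \<zero>W) \<longleftrightarrow> A \<otimes>EW P = A"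
 proof
  assume "\<forall>x\<in>U. A x = \<zero>W"
  then show "A \<otimes>EW P = A" by (intro W.End_eqI[OF l(1) A]) (use sp ev A Pc lin_maps_closed[OF A] in \<open>metis W.M.l_zero\<close>)
 next
  assume "A \<otimes>EW P = A"
  then show "\<forall>x\<in>U. A x = \<zero>W" using ev perp_iff lin_maps_zero[OF W.abelian_group_axioms W.abelian_group_axioms A] by metis
 qed
 show "(\<forall>x\<in>Le. A x = \<zero>W) \<longleftrightarrow> A \<otimes>EW P = \<zero>EW"
 proof
  assume "\<forall>x\<in>Le. A x = \<zero>W"
  then show "A \<otimes>EW P = \<zero>EW" by (intro W.End_eqI[OF l(1,3)]) (use sp ev in metis)
 next
  assume "A \<otimes>EW P = \<zero>EW"
  then show "\<forall>x\<in>Le. A x = \<zero>W" using ev line_iff by metis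
 qed
 show "(\<forall>x\<in>CW. A x \<in> Le) \<longleftrightarrow> P \<otimes>EW A = A"
 proof
  assume "\<forall>x\<in>CW. A x \<in> Le"
  then show "P \<otimes>EW A = A" by (intro W.End_eqI[OF l(2) A]) (use ev line_iff in metis)
 next
  assume "P \<otimes>EW A = A"
  then show "\<forall>x\<in>CW. A x \<in> Le" using ev line_iff lin_maps_closed[OF A] by metis
 qed
 show "(\<forall>x\<in>CW. A x \<in> U) \<longleftrightarrow> P \<otimes>EW A = \<zero>EW"
 proof
  assume "\<forall>x\<in>CW. A x \<in> U"
  then show "P \<otimes>EW A = \<zero>EW" by (intro W.End_eqI[OF l(2,3)]) (use ev perp_iff in metis)
 next
  assume "P \<otimes>EW A = \<zero>EW"
  then show "\<forall>x\<in>CW. A x \<in> U" using ev perp_iff lin_maps_closed[OF A] by metis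
 qed
qed

text \<open>A block prescribes the range on one summand only; as the other summand is sent to zero,
  the values on the whole module lie in \<open>Y\<close> too.\<close>

lemma hom_block_LU:
 assumes Y: "\<zero>W \<in> Y" "Y \<subseteq> CW"
 shows "A \<in> hom_block K W Le U Y \<longleftrightarrow> A : LW \<and> A \<otimes>EW P = A \<and> (\<forall>w\<in>CW. A w \<in> Y)"
  "A \<in> hom_block K W U Le Y \<longleftrightarrow> A : LW \<and> A \<otimes>EW P = \<zero>EW \<and> (\<forall>w\<in>CW. A w \<in> Y)"
proof -
 have Lc: "x : CW" if "x \<in> Le" for x using that by (simp add: line_iff)
 have Uc: "x : CW" if "x \<in> U" for x using that by (simp add: perp_def)
 have sp: "A w = A (w \<ominus>W h em w \<odot>W ep) \<oplus>W A (h em w \<odot>W ep)" if A: "A : LW" and w: "w : CW" for w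
  using lin_maps_add[OF A Uc[OF split_e(1)[OF w]] Lc[OF split_e(3)[OF w]]] by (simp only: split_e(2)[OF w, symmetric])
 have 1: "A w \<in> Y" if A: "A : LW" and a: "\<forall>x\<in>Le. A x \<in> Y" "\<forall>x\<in>U. A x = \<zero>W" and w: "w : CW" for w
 proof -
  note l = bspec[OF a(1) split_e(3)[OF w]]
  show ?thesis unfolding sp[OF A w] bspec[OF a(2) split_e(1)[OF w]] W.M.l_zero[OF subsetD[OF Y(2) l]] by (rule l)
 qed
 have 2: "A w \<in> Y" if A: "A : LW" and a: "\<forall>x\<in>U. A x \<in> Y" "\<forall>x\<in>Le. A x = \<zero>W" and w: "w : CW" for w
 proof -
  note l = bspec[OF a(1) split_e(1)[OF w]]
  show ?thesis unfolding sp[OF A w] bspec[OF a(2) split_e(3)[OF w]] W.M.r_zero[OF subsetD[OF Y(2) l]] by (rule l)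
 qed
 show "A \<in> hom_block K W Le U Y \<longleftrightarrow> A : LW \<and> A \<otimes>EW P = A \<and> (\<forall>w\<in>CW. A w \<in> Y)"
 proof
  assume "A \<in> hom_block K W Le U Y"
  note asm = this[unfolded hom_block_def mem_Collect_eq]
  note a = conjunct1[OF asm] conjunct1[OF conjunct2[OF asm]] conjunct2[OF conjunct2[OF asm]]
  show "A : LW \<and> A \<otimes>EW P = A \<and> (\<forall>w\<in>CW. A w \<in> Y)"
   by (intro conjI ballI a(1) iffD1[OF block_domain(1)[OF a(1)] a(3)] 1[OF a])
 next
  assume asm: "A : LW \<and> A \<otimes>EW P = A \<and> (\<forall>w\<in>CW. A w \<in> Y)"
  note a = conjunct1[OF asm] conjunct1[OF conjunct2[OF asm]] conjunct2[OF conjunct2[OF asm]]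
  show "A \<in> hom_block K W Le U Y"
   unfolding hom_block_def mem_Collect_eq by (intro conjI ballI a(1) bspec[OF a(3) Lc] bspec[OF iffD2[OF block_domain(1)[OF a(1)] a(2)]])
 qed
 show "A \<in> hom_block K W U Le Y \<longleftrightarrow> A : LW \<and> A \<otimes>EW P = \<zero>EW \<and> (\<forall>w\<in>CW. A w \<in> Y)"
 proof
  assume "A \<in> hom_block K W U Le Y"
  note asm = this[unfolded hom_block_def mem_Collect_eq]
  note a = conjunct1[OF asm] conjunct1[OF conjunct2[OF asm]] conjunct2[OF conjunct2[OF asm]]
  show "A : LW \<and> A \<otimes>EW P = \<zero>EW \<and> (\<forall>w\<in>CW. A w \<in> Y)"
   by (intro conjI ballI a(1) iffD1[OF block_domain(2)[OF a(1)] a(3)] 2[OF a])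
 next
  assume asm: "A : LW \<and> A \<otimes>EW P = \<zero>EW \<and> (\<forall>w\<in>CW. A w \<in> Y)"
  note a = conjunct1[OF asm] conjunct1[OF conjunct2[OF asm]] conjunct2[OF conjunct2[OF asm]]
  show "A \<in> hom_block K W U Le Y"
   unfolding hom_block_def mem_Collect_eq by (intro conjI ballI a(1) bspec[OF a(3) Uc] bspec[OF iffD2[OF block_domain(2)[OF a(1)] a(2)]])
 qed
qed

text \<open>The blocks are the Peirce components of \<open>P\<close>. This is how maps from
  \<open>U\<close> to the line acquire degree 1 and maps from the line to \<open>U\<close> degree
  -1.\<close>

lemma hom_blocks:
 "A \<in> hom_block K W Le U Le \<longleftrightarrow> A : LW \<and> A \<otimes>EW P = A \<and> P \<otimes>EW A = A"
 "A \<in> hom_block K W Le U U \<longleftrightarrow> A : LW \<and> A \<otimes>EW P = A \<and> P \<otimes>EW A = \<zero>EW"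
 "A \<in> hom_block K W U Le Le \<longleftrightarrow> A : LW \<and> A \<otimes>EW P = \<zero>EW \<and> P \<otimes>EW A = A"
 "A \<in> hom_block K W U Le U \<longleftrightarrow> A : LW \<and> A \<otimes>EW P = \<zero>EW \<and> P \<otimes>EW A = \<zero>EW"
proof -
 have Y: "\<zero>W \<in> Le" "Le \<subseteq> CW" "\<zero>W \<in> U"
  using line_iff perp_iff lin_maps_zero[OF W.abelian_group_axioms W.abelian_group_axioms P_lin] by auto
 show "A \<in> hom_block K W Le U Le \<longleftrightarrow> A : LW \<and> A \<otimes>EW P = A \<and> P \<otimes>EW A = A"
  "A \<in> hom_block K W Le U U \<longleftrightarrow> A : LW \<and> A \<otimes>EW P = A \<and> P \<otimes>EW A = \<zero>EW"
  "A \<in> hom_block K W U Le Le \<longleftrightarrow> A : LW \<and> A \<otimes>EW P = \<zero>EW \<and> P \<otimes>EW A = A"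
  "A \<in> hom_block K W U Le U \<longleftrightarrow> A : LW \<and> A \<otimes>EW P = \<zero>EW \<and> P \<otimes>EW A = \<zero>EW"
  unfolding hom_block_LU[OF Y(1,2)] hom_block_LU[OF Y(3) U_sub] using block_range[of A] by metis+
qed

lemma SP_exists:
 assumes T: "T : LW" obtains A where "(A, T) \<in> SP"
proof -
 obtain B where B: "B : LV" "\<forall>v\<in>CV. \<forall>w\<in>CW. h (B v) w = h v (T w)"
  using adjoint_exists[OF T] by metis
 have "(\<ominus>EV B, T) \<in> SP"
  by (rule SPI) (use B T lin_maps_closed[OF B(1)] lin_maps_closed[OF T] in \<open>simp_all add: V.End_closed V.End_neg h_neg_l\<close>)
 then show thesis by (rule that)
qed

text \<open>The definition yields minus the adjoint as first component, and so does any pair in S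
  with second component \<open>B\<close>.\<close>

lemma iota_SP:
 assumes S: "(A, B) \<in> SP" shows "iota_elem K V W h B a = Z0 A B a"
proof -
 note l = SP_lin[OF S] and cl = SP_lin(1)[OF S, THEN lin_maps_closed]
 have Ac: "A : YV" using l by (simp add: V.End_simps(1))
 have nA: "\<ominus>EV A : LV" and hA: "!!v w. v : CV ==> w : CW ==> h ((\<ominus>EV A) v) w = h v (B w)"
  using l cl by (simp_all add: V.End_closed V.End_neg h_neg_l SP_adj[OF S])
 have "adjoint K V W h B = \<ominus>EV A"
  unfolding adjoint_def
 proof (rule the_equality)
  fix T assume T: "T : LV \<and> (\<forall>v\<in>CV. \<forall>w\<in>CW. h (T v) w = h v (B w))"
  show "T = \<ominus>EV A"
   by (rule V.End_eqI[OF _ nA]) (use T hA nA lin_maps_closed[of T K V V] lin_maps_closed[OF nA] s.nondeg in auto)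
 qed (use nA hA in auto)
 then show ?thesis using Ac by (simp add: iota_elem_def iota_plus_def)
qed

lemma inG_sets:
 "{X. inG 1 j X} = {P1 x | x. x : pW 3 \<and> wt j x}"
 "{X. inG 2 j X} = {P2 x | x. x : pW 6 \<and> wt j x}"
 "{X. inG (-1) j X} = {N1 x | x. x : pV 3 \<and> wtV (- j) x}"
 "{X. inG (-2) j X} = {N2 x | x. x : pV 6 \<and> wtV (- j) x}"
 "{X. inG 0 j X} = {Z0 A B a | A B a. (A, B) \<in> SP \<and> sw j B \<and> a : CK \<and> (j = 0 \<or> a = \<zero>) \<and> tr B \<oplus> [(3::int)] \<cdot>\<^bsub>K\<^esub> a = \<zero>}"
proof -
 interpret t: lie_pair K W V "\<lambda>w v. h v w" n c b ep em by (rule lie_pair_swap)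
 have z3: "[(3::int)] \<cdot>\<^bsub>K\<^esub> \<zero> = \<zero>" by (rule int_scale_ops(5)[OF V.R.zero_closed V.R.zero_closed])
 have tz: "t.sw k \<zero>EV" "sw k \<zero>EW" for k by simp_all
 note d = inG_def LE_iff L_iff zero_fields gw_def t.gw_def gs_def t.gs_def trace_zero z3 SP_zero
 have f: "X : CL \<and> gsV (- i = 0) (- j) (endm X)" if "inG i j X" for i j X
  using inG_endm[OF that] that by (auto simp: inG_def LE_iff)
 show "{X. inG 1 j X} = {P1 x | x. x : pW 3 \<and> wt j x}"
 proof (intro subset_antisym subsetI)
  fix X assume "X \<in> {X. inG 1 j X}"
  then have "X = P1 (pos1 X)" "pos1 X : pW 3" "wt j (pos1 X)" using f[of 1 j X] by (auto simp: d intro!: lie_elem_eqI)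
  then show "X \<in> {P1 x | x. x : pW 3 \<and> wt j x}" by blast
 qed (auto simp: d)
 show "{X. inG 2 j X} = {P2 x | x. x : pW 6 \<and> wt j x}"
 proof (intro subset_antisym subsetI)
  fix X assume "X \<in> {X. inG 2 j X}"
  then have "X = P2 (pos2 X)" "pos2 X : pW 6" "wt j (pos2 X)" using f[of 2 j X] by (auto simp: d intro!: lie_elem_eqI)
  then show "X \<in> {P2 x | x. x : pW 6 \<and> wt j x}" by blast
 qed (auto simp: d)
 show "{X. inG (-1) j X} = {N1 x | x. x : pV 3 \<and> wtV (- j) x}"
 proof (intro subset_antisym subsetI)
  fix X assume "X \<in> {X. inG (-1) j X}"
  then have "X = N1 (neg1 X)" "neg1 X : pV 3" "wtV (- j) (neg1 X)" using f[of "-1" j X] by (auto simp: d intro!: lie_elem_eqI)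
  then show "X \<in> {N1 x | x. x : pV 3 \<and> wtV (- j) x}" by blast
 qed (auto simp: d)
 show "{X. inG (-2) j X} = {N2 x | x. x : pV 6 \<and> wtV (- j) x}"
 proof (intro subset_antisym subsetI)
  fix X assume "X \<in> {X. inG (-2) j X}"
  then have "X = N2 (neg2 X)" "neg2 X : pV 6" "wtV (- j) (neg2 X)" using f[of "-2" j X] by (auto simp: d intro!: lie_elem_eqI)
  then show "X \<in> {N2 x | x. x : pV 6 \<and> wtV (- j) x}" by blast
 qed (auto simp: d)
 show "{X. inG 0 j X} = {Z0 A B a | A B a. (A, B) \<in> SP \<and> sw j B \<and> a : CK \<and> (j = 0 \<or> a = \<zero>) \<and> tr B \<oplus> [(3::int)] \<cdot>\<^bsub>K\<^esub> a = \<zero>}"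
 proof (intro subset_antisym subsetI)
  fix X assume "X \<in> {X. inG 0 j X}"
  then have "X = Z0 (endm X) (endp X) (hcoef X)" "(endm X, endp X) \<in> SP" "sw j (endp X)" "hcoef X : CK" "j = 0 \<or> hcoef X = \<zero>"
   "tr (endp X) \<oplus> [(3::int)] \<cdot>\<^bsub>K\<^esub> hcoef X = \<zero>" by (auto simp: d intro!: lie_elem_eqI)
  then show "X \<in> {Z0 A B a | A B a. (A, B) \<in> SP \<and> sw j B \<and> a : CK \<and> (j = 0 \<or> a = \<zero>) \<and> tr B \<oplus> [(3::int)] \<cdot>\<^bsub>K\<^esub> a = \<zero>}" by blast
 next
  fix X assume "X \<in> {Z0 A B a | A B a. (A, B) \<in> SP \<and> sw j B \<and> a : CK \<and> (j = 0 \<or> a = \<zero>) \<and> tr B \<oplus> [(3::int)] \<cdot>\<^bsub>K\<^esub> a = \<zero>}"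
  then obtain A B a where "X = Z0 A B a" "(A, B) \<in> SP" "sw j B" "a : CK" "j = 0 \<or> a = \<zero>" "tr B \<oplus> [(3::int)] \<cdot>\<^bsub>K\<^esub> a = \<zero>"
   by blast
  then show "X \<in> {X. inG 0 j X}" by (simp add: d)
 qed
qed

text \<open>The products \<open>P B\<close> and \<open>B P\<close> have the same trace, and one of
  them is \<open>B\<close> while the other is zero. Off-diagonal maps therefore satisfy the trace
  condition with coefficient zero at \<open>h_0\<close>.\<close>

lemma tr_off_diagonal:
 assumes B: "B : LW" and s: "sw d B" "d = 1 \<or> d = -1"
 shows "tr B = \<zero>"
proof -
 have "tr (P \<otimes>EW B) = tr (B \<otimes>EW P)" by (rule trace_comm[OF P_lin B])
 then show ?thesis using s trace_zero by (auto simp: sw_def)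
qed

lemma E_bigraded_pos:
 "{P1 x | x. x \<in> ext_pow_of K W U 3} = {X. inG 1 0 X}"
 "{P1 x | x. x \<in> ext_pow_times K W U 2 ep} = {X. inG 1 1 X}"
 "{P2 x | x. x : pW 6} = {X. inG 2 1 X}"
proof -
 have "ext_pow_times K W U 2 ep = {x \<in> pW 3. wt 1 x}" using times_U[of 2] by (simp add: eval_nat_numeral)
 moreover have "x : pW 6 \<longleftrightarrow> x : pW 6 \<and> wt 1 x" for x using wt_top by blast
 ultimately show "{P1 x | x. x \<in> ext_pow_of K W U 3} = {X. inG 1 0 X}"
  "{P1 x | x. x \<in> ext_pow_times K W U 2 ep} = {X. inG 1 1 X}"
  "{P2 x | x. x : pW 6} = {X. inG 2 1 X}"
  unfolding inG_sets pow_U by simp_all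
qed

lemma E_bigraded_neg:
 "{N1 x | x. x \<in> ext_pow_of K V (perp K V (\<lambda>w v. h v w) ep) 3} = {X. inG (-1) 0 X}"
 "{N1 x | x. x \<in> ext_pow_times K V (perp K V (\<lambda>w v. h v w) ep) 2 em} = {X. inG (-1) (-1) X}"
 "{N2 x | x. x : pV 6} = {X. inG (-2) (-1) X}"
proof -
 interpret t: lie_pair K W V "\<lambda>w v. h v w" n c b ep em by (rule lie_pair_swap)
 have "ext_pow_times K V t.U 2 em = {x \<in> pV 3. t.wt 1 x}" using t.times_U[of 2] by (simp add: eval_nat_numeral)
 moreover have "x : pV 6 \<longleftrightarrow> x : pV 6 \<and> t.wt 1 x" for x using t.wt_top by blast
 ultimately show "{N1 x | x. x \<in> ext_pow_of K V t.U 3} = {X. inG (-1) 0 X}"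
  "{N1 x | x. x \<in> ext_pow_times K V t.U 2 em} = {X. inG (-1) (-1) X}"
  "{N2 x | x. x : pV 6} = {X. inG (-2) (-1) X}"
  unfolding inG_sets t.pow_U by simp_all
qed

lemma E_bigraded_off_diagonal:
 assumes d: "d = 1 \<or> d = -1" and H: "!!A. A \<in> H \<longleftrightarrow> A : LW \<and> sw d A"
 shows "{iota_elem K V W h A \<zero> | A. A \<in> H} = {X. inG 0 d X}"
proof -
 have z3: "[(3::int)] \<cdot>\<^bsub>K\<^esub> \<zero> = \<zero>" by (rule int_scale_ops(5)[OF V.R.zero_closed V.R.zero_closed])
 show ?thesis unfolding inG_sets
 proof (intro subset_antisym subsetI)
  fix X assume "X \<in> {iota_elem K V W h A \<zero> | A. A \<in> H}"
  then obtain T where T: "T : LW" "sw d T" "X = iota_elem K V W h T \<zero>" using H by blast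
  obtain A where A: "(A, T) \<in> SP" using SP_exists[OF T(1)] .
  have "tr T \<oplus> [(3::int)] \<cdot>\<^bsub>K\<^esub> \<zero> = \<zero>" using tr_off_diagonal[OF T(1,2) d] z3 by simp
  then show "X \<in> {Z0 A B a | A B a. (A, B) \<in> SP \<and> sw d B \<and> a : CK \<and> (d = 0 \<or> a = \<zero>) \<and> tr B \<oplus> [(3::int)] \<cdot>\<^bsub>K\<^esub> a = \<zero>}"
   using T A iota_SP[OF A] V.R.zero_closed by blast
 next
  fix X assume "X \<in> {Z0 A B a | A B a. (A, B) \<in> SP \<and> sw d B \<and> a : CK \<and> (d = 0 \<or> a = \<zero>) \<and> tr B \<oplus> [(3::int)] \<cdot>\<^bsub>K\<^esub> a = \<zero>}"
  then obtain A B a where X: "X = Z0 A B a" "(A, B) \<in> SP" "sw d B" "a = \<zero>" using d by fastforce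
  then have "X = iota_elem K V W h B \<zero>" "B \<in> H" using iota_SP[OF X(2), of \<zero>] SP_lin(2)[OF X(2)] H by simp_all
  then show "X \<in> {iota_elem K V W h A \<zero> | A. A \<in> H}" by blast
 qed
qed

lemma E_bigraded_diagonal:
 "lie_E_component K V W h 0 \<inter> {iota_elem K V W h (A \<oplus>EW B) a | A B a.
   A \<in> hom_block K W Le U Le \<and> B \<in> hom_block K W U Le U \<and> a : CK} = {X. inG 0 0 X}" (is "?C \<inter> ?D = _")
proof (intro subset_antisym subsetI)
 fix X assume "X \<in> ?C \<inter> ?D"
 then obtain A B a where X: "X \<in> ?C" "X = iota_elem K V W h (A \<oplus>EW B) a" "A \<in> hom_block K W Le U Le" "B \<in> hom_block K W U Le U" "a : CK"
  by blast
 then have AB: "A : YW" "A \<otimes>EW P = A" "P \<otimes>EW A = A" "B : YW" "B \<otimes>EW P = \<zero>EW" "P \<otimes>EW B = \<zero>EW"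
  by (simp_all add: hom_blocks W.End_simps(1))
 then have T: "A \<oplus>EW B : LW" "sw 0 (A \<oplus>EW B)"
  using P_closed by (simp_all add: sw_def W.End.A.l_distr W.End.A.r_distr flip: W.End_simps(1))
 obtain S where S: "(S, A \<oplus>EW B) \<in> SP" using SP_exists[OF T(1)] .
 have XZ: "X = Z0 S (A \<oplus>EW B) a" using X(2) iota_SP[OF S] by simp
 have "X \<in> CLE" using X(1) by (simp add: lie_E_component_def Let_def)
 then have "tr (A \<oplus>EW B) \<oplus> [(3::int)] \<cdot>\<^bsub>K\<^esub> a = \<zero>" using XZ by (simp add: LE_iff)
 then show "X \<in> {X. inG 0 0 X}" unfolding inG_sets using XZ S T X(5) by blast
next
 fix X assume X: "X \<in> {X. inG 0 0 X}"
 then have "X \<in> \<Union> (range (\<lambda>j. {X. inG 0 j X}))" by blast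
 \<comment> \<open>Membership in the component of first degree 0 is taken from the description of
   the first component grading.\<close>
 moreover have "(\<Union>j. {X. inG 0 j X}) \<subseteq> ?C"
  unfolding inG_first_component[symmetric, of 0] first_component_def using module.mspan_incl[OF LE_module] by simp
 ultimately have C: "X \<in> ?C" by blast
 obtain A B a where Z: "X = Z0 A B a" "(A, B) \<in> SP" "sw 0 B" "a : CK" using X unfolding inG_sets by blast
 have B: "B : YW" "P \<otimes>EW B = B \<otimes>EW P" using SP_lin(2)[OF Z(2)] Z(3) by (simp_all add: W.End_simps(1) sw_def)
 have PPB: "P \<otimes>EW (P \<otimes>EW B) = P \<otimes>EW B" "(P \<otimes>EW B) \<otimes>EW P = P \<otimes>EW B"
 proof -
  show 1: "P \<otimes>EW (P \<otimes>EW B) = P \<otimes>EW B" using W.End.A.m_assoc[OF P_closed P_closed B(1)] P_idem by simp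
  show "(P \<otimes>EW B) \<otimes>EW P = P \<otimes>EW B" using W.End.A.m_assoc[OF P_closed B(1) P_closed] 1 B(2) by simp
 qed
 have c: "P \<otimes>EW B : YW" using B P_closed by simp
 \<comment> \<open>The diagonal blocks of \<open>B\<close> are \<open>P B\<close> and
   \<open>B - P B\<close>, because \<open>B\<close> commutes with \<open>P\<close>.\<close>
 have 1: "P \<otimes>EW B \<in> hom_block K W Le U Le" using c PPB by (simp add: hom_blocks W.End_simps(1))
 have "(B \<ominus>EW P \<otimes>EW B) \<otimes>EW P = \<zero>EW" "P \<otimes>EW (B \<ominus>EW P \<otimes>EW B) = \<zero>EW"
  using B(1) c P_closed PPB B(2)[symmetric]
  by (simp_all add: W.End.A.minus_eq W.End.A.l_distr W.End.A.r_distr W.End.A.l_minus W.End.A.r_minus W.End.A.r_neg)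
 then have 2: "B \<ominus>EW P \<otimes>EW B \<in> hom_block K W U Le U" using B(1) c by (simp add: hom_blocks flip: W.End_simps(1))
 have "B = P \<otimes>EW B \<oplus>EW (B \<ominus>EW P \<otimes>EW B)" using B(1) c
  by (simp add: W.End.A.minus_eq W.End.A.a_comm[of B] W.End.A.r_neg2)
 then have "X = iota_elem K V W h (P \<otimes>EW B \<oplus>EW (B \<ominus>EW P \<otimes>EW B)) a" using iota_SP[OF Z(2)] Z(1) by simp
 then show "X \<in> ?C \<inter> ?D" using C 1 2 Z(4) by blast
qed

lemma E_bigraded_eq: "E_bigraded K V W h em ep = (\<lambda>ij. {X. inG (fst ij) (snd ij) X})"
proof
 fix ij :: "int \<times> int"
 note e = E_bigraded_pos E_bigraded_neg E_bigraded_diagonal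
  E_bigraded_off_diagonal[of 1 "hom_block K W U Le Le"] E_bigraded_off_diagonal[of "-1" "hom_block K W Le U U"]
 note d = E_bigraded_def Let_def
 interpret LE: module K LE by (rule LE_module)
 have off: "{iota_elem K V W h A \<zero> | A. A \<in> hom_block K W U Le Le} = {X. inG 0 1 X}"
  "{iota_elem K V W h A \<zero> | A. A \<in> hom_block K W Le U U} = {X. inG 0 (-1) X}"
  by (rule E_bigraded_off_diagonal; auto simp: hom_blocks sw_def)+
 have "ij \<in> {(0, 0), (0, 1), (0, -1), (1, 0), (1, 1), (-1, 0), (-1, -1), (2, 1), (-2, -1)} \<or> ij \<notin> idx" unfolding idx_def by blast
 then consider "ij = (0, 0)" | "ij = (0, 1)" | "ij = (0, -1)" | "ij = (1, 0)" | "ij = (1, 1)" | "ij = (-1, 0)" | "ij = (-1, -1)"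
  | "ij = (2, 1)" | "ij = (-2, -1)" | "ij \<notin> idx" by blast
 then show "E_bigraded K V W h em ep ij = {X. inG (fst ij) (snd ij) X}"
 proof cases
  case 1 then show ?thesis unfolding d by ((simp add: e(7); fail) | (simp add: e(7)[symmetric]; fail) | (simp; rule e(7)))
 next
  case 2 then show ?thesis unfolding d by ((simp add: off(1); fail) | (simp add: off(1)[symmetric]; fail) | (simp; rule off(1)))
 next
  case 3 then show ?thesis unfolding d by ((simp add: off(2); fail) | (simp add: off(2)[symmetric]; fail) | (simp; rule off(2)))
 next
  case 4 then show ?thesis unfolding d by ((simp add: e(1); fail) | (simp add: e(1)[symmetric]; fail) | (simp; rule e(1)))
 next
  case 5 then show ?thesis unfolding d by ((simp add: e(2); fail) | (simp add: e(2)[symmetric]; fail) | (simp; rule e(2)))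
 next
  case 6 then show ?thesis unfolding d by ((simp add: e(4); fail) | (simp add: e(4)[symmetric]; fail) | (simp; rule e(4)))
 next
  case 7 then show ?thesis unfolding d by ((simp add: e(5); fail) | (simp add: e(5)[symmetric]; fail) | (simp; rule e(5)))
 next
  case 8 then show ?thesis unfolding d by ((simp add: e(3); fail) | (simp add: e(3)[symmetric]; fail) | (simp; rule e(3)))
 next
  case 9 then show ?thesis unfolding d by ((simp add: e(6); fail) | (simp add: e(6)[symmetric]; fail) | (simp; rule e(6)))
 next
  case 10
  then have "inG (fst ij) (snd ij) X \<longleftrightarrow> X = Z" for X
   using inG_outside[of "fst ij" "snd ij" X] LE.submodule_zero[OF inG_submodule[of "fst ij" "snd ij"]] by (auto simp: LE_simps)
  moreover have "E_bigraded K V W h em ep ij = {Z}" unfolding d using 10 by (auto simp: idx_def)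
  ultimately show ?thesis by simp
 qed
qed

end

theorem proposition7p9p1:
 fixes K :: "'k ring"
  and Mm :: "('k, 'm) module" and Mp :: "('k, 'n) module"
  and g :: "'m => 'n => 'k" and em :: 'm and ep :: 'n
 assumes "cring K"
  and "fg_projective_of_rank K Mm 6" and "fg_projective_of_rank K Mp 6"
  and "bilinear_form K Mm Mp g" and "nonsingular K Mm Mp g"
  and "em \<in> carrier Mm" and "ep \<in> carrier Mp" and "g em ep = \<one>\<^bsub>K\<^esub>"
 shows "direct_sum2 K Mm (line K Mm em) (perp K Mm (\<lambda>w v. g v w) ep) \<and>
  direct_sum2 K Mp (line K Mp ep) (perp K Mp g em) \<and>
  BC2_grading K (lie_E K Mm Mp g) (E_bigraded K Mm Mp g em ep) \<and>
  (\<forall>i. first_component K (lie_E K Mm Mp g) (E_bigraded K Mm Mp g em ep) i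
     = lie_E_component K Mm Mp g i)"
proof -
 obtain l b c where "perfect K Mm Mp g l b c"
  using perfect_exists[OF assms(1-5)] .
 then interpret perfect K Mm Mp g l b c .
 interpret s: perfect K Mp Mm "\<lambda>w v. g v w" l c b by (rule perfect_swap)
 have rank: "free_of_rank (loc_ring K P) (loc_module K P Mm) 6" "free_of_rank (loc_ring K P) (loc_module K P Mp) 6"
  if "primeideal P K" for P
  using assms(2,3) that by (simp_all add: fg_projective_of_rank_def)
 \<comment> \<open>The obligations beyond the pairing are the consequences of rank six: degree seven
   is one above the rank, and the trace of the identity equals the rank.\<close>
 interpret lie_pair K Mm Mp g l b c em ep
 proof unfold_locales
  show "x = \<zero>\<^bsub>ext_alg K Mm\<^esub>" if "x \<in> ext_pow K Mm 7" for x
   using V.ext_pow_above_rank[of 6 x] rank(1) that by (simp add: eval_nat_numeral)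
  show "y = \<zero>\<^bsub>ext_alg K Mp\<^esub>" if "y \<in> ext_pow K Mp 7" for y
   using W.ext_pow_above_rank[of 6 y] rank(2) that by (simp add: eval_nat_numeral)
  show "mtrace K Mm \<one>\<^bsub>End_alg K Mm\<^esub> = [(6::int)] \<cdot>\<^bsub>K\<^esub> \<one>\<^bsub>K\<^esub>" using s.trace_id[of 6] rank(1) by simp
  show "mtrace K Mp \<one>\<^bsub>End_alg K Mp\<^esub> = [(6::int)] \<cdot>\<^bsub>K\<^esub> \<one>\<^bsub>K\<^esub>" using trace_id[of 6] rank(2) by simp
 qed (use assms in auto)
 interpret t: lie_pair K Mp Mm "\<lambda>w v. g v w" l c b ep em by (rule lie_pair_swap)
 show ?thesis
  unfolding E_bigraded_eq by (intro conjI allI t.line_perp_sum line_perp_sum inG_grading inG_first_component)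
qed

end
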